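(* (i) Under the hypotheses of Theorem 1 (with $\lambda:\partial\mathbb{D}\to\partial\mathbb{D}$ of class $\mathcal{CBV}(\partial\mathbb{D})$ and $\varphi:\partial\mathbb{D}\to\mathbb{R}$ measurable with respect to logarithmic capacity), the set of analytic functions $f:\mathbb{D}\to\mathbb{C}$ such that for all $\zeta\in\partial\mathbb{D}$ outside a set of logarithmic capacity zero $\mathrm{Re}\{\overline{\lambda(\zeta)} f(z)\}\to\varphi(\zeta)$ as $z\to\zeta$ along every nontangential path, is not contained in any finite-dimensional affine subspace of the space of analytic functions on $\mathbb{D}$ (i.e. the space of solutions is infinite-dimensional). (ii) The analogous statement holds for the multivalued solutions $f=F\circ g^{-1}$ in a bounded nondegenerate circular domain $\mathbb{D}_*$ under the hypotheses of Theorem 2: the set of analytic $F:\mathbb{D}\to\mathbb{C}$ for which $F\circ g^{-1}$ satisfies the boundary condition of Theorem 2 is infinite-dimensional.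
   Context: $\mathbb{D}=\{z\in\mathbb{C}:|z|<1\}$. $\mathcal{CBV}$ (countably bounded variation) on a finite union of circles: there are countably many pairwise disjoint open arcs on each of which the function has bounded variation (finite supremum of $\sum|\lambda(\zeta_{j+1})-\lambda(\zeta_j)|$ over monotonically ordered finite point collections in the arc), and the complement of their union is countable. A circular domain has boundary consisting of finitely many pairwise disjoint circles and points; nondegenerate means only circles. $g:\mathbb{D}\to\mathbb{D}_*$ is a holomorphic universal covering map, and the boundary condition of Theorem 2 is: for all $\zeta\in\partial\mathbb{D}_*$ outside a set of logarithmic capacity zero, along every nontangential path in $\mathbb{D}_*$ to $\zeta$ and every branch of $f=F\circ g^{-1}$ continued along it, $\mathrm{Re}\{\overline{\lambda(\zeta)} f(z)\}\to\varphi(\zeta)$. Nontangential paths end at $\zeta$ inside a sector with vertex $\zeta$ of opening less than $\pi$ symmetric about the normal. Measurability with respect to logarithmic capacity: a set $E$ is measurable if for every $\varepsilon>0$ there are closed $C\subset E\subset U$ open with outer logarithmic capacity of $U\setminus C$ less than $\varepsilon$; a function is measurable if preimages of open sets are. *)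

theory Defs
  imports "HOL-Analysis.Analysis"
begin

text \<open>Logarithmic energy of a (probability) Borel measure on the plane:
  the double integral of log(1/|z-w|), split into positive and negative parts
  (the diagonal contributes +infinity).\<close>
definition log_energy :: "complex measure \<Rightarrow> ereal" where
  "log_energy \<mu> =
     enn2ereal (\<integral>\<^sup>+ p. (if fst p = snd p then \<infinity>
                          else ennreal (max 0 (- ln (cmod (fst p - snd p))))) \<partial>(\<mu> \<Otimes>\<^sub>M \<mu>))
   - enn2ereal (\<integral>\<^sup>+ p. (if fst p = snd p then 0
                          else ennreal (max 0 (ln (cmod (fst p - snd p))))) \<partial>(\<mu> \<Otimes>\<^sub>M \<mu>))"

definition prob_measures_on :: "complex set \<Rightarrow> complex measure set" where
  "prob_measures_on K = {\<mu>. sets \<mu> = sets borel \<and> emeasure \<mu> UNIV = 1 \<and> emeasure \<mu> K = 1}"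

definition robin_const :: "complex set \<Rightarrow> ereal" where
  "robin_const K = (INF \<mu> \<in> prob_measures_on K. log_energy \<mu>)"

definition log_cap_compact :: "complex set \<Rightarrow> ereal" where
  "log_cap_compact K =
     (if robin_const K = \<infinity> then 0 else ereal (exp (- real_of_ereal (robin_const K))))"

definition inner_log_cap :: "complex set \<Rightarrow> ereal" where
  "inner_log_cap A = (SUP K \<in> {K. compact K \<and> K \<subseteq> A}. log_cap_compact K)"

definition outer_log_cap :: "complex set \<Rightarrow> ereal" where
  "outer_log_cap E = (INF U \<in> {U. open U \<and> E \<subseteq> U}. inner_log_cap U)"

definition log_cap_zero :: "complex set \<Rightarrow> bool" where
  "log_cap_zero E \<longleftrightarrow> outer_log_cap E = 0"

definition cap_measurable_set :: "complex set \<Rightarrow> complex set \<Rightarrow> bool" where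
  "cap_measurable_set S E \<longleftrightarrow> E \<subseteq> S \<and>
     (\<forall>\<epsilon>>0. \<exists>C U. closedin (top_of_set S) C \<and> openin (top_of_set S) U \<and>
                   C \<subseteq> E \<and> E \<subseteq> U \<and> outer_log_cap (U - C) < ereal \<epsilon>)"

definition cap_measurable_fun :: "complex set \<Rightarrow> (complex \<Rightarrow> real) \<Rightarrow> bool" where
  "cap_measurable_fun S \<phi> \<longleftrightarrow> (\<forall>V. open V \<longrightarrow> cap_measurable_set S (\<phi> -` V \<inter> S))"

text \<open>Open arc of the circle of centre c, radius r: parameters a < b <= a + 2 pi.\<close>
definition circ_arc :: "complex \<Rightarrow> real \<Rightarrow> real \<Rightarrow> real \<Rightarrow> complex set" where
  "circ_arc c r a b = {c + of_real r * cis \<theta> | \<theta>. a < \<theta> \<and> \<theta> < b}"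

definition bv_on_arc :: "(complex \<Rightarrow> complex) \<Rightarrow> complex \<Rightarrow> real \<Rightarrow> real \<Rightarrow> real \<Rightarrow> bool" where
  "bv_on_arc lam c r a b \<longleftrightarrow>
     (\<exists>M. \<forall>(n::nat) (\<theta>::nat \<Rightarrow> real).
        (\<forall>j\<le>n. a < \<theta> j \<and> \<theta> j < b) \<and> (\<forall>j<n. \<theta> j \<le> \<theta> (Suc j)) \<longrightarrow>
        (\<Sum>j<n. cmod (lam (c + of_real r * cis (\<theta> (Suc j))) - lam (c + of_real r * cis (\<theta> j)))) \<le> M)"

definition CBV :: "(complex \<times> real) set \<Rightarrow> (complex \<Rightarrow> complex) \<Rightarrow> bool" where
  "CBV Cs lam \<longleftrightarrow>
     (\<exists>A :: (complex \<times> real \<times> real \<times> real) set.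
        countable A \<and>
        (\<forall>(c, r, a, b) \<in> A. (c, r) \<in> Cs \<and> a < b \<and> b \<le> a + 2 * pi \<and> bv_on_arc lam c r a b) \<and>
        (\<forall>x\<in>A. \<forall>y\<in>A. x \<noteq> y \<longrightarrow>
            (case x of (c, r, a, b) \<Rightarrow> circ_arc c r a b) \<inter>
            (case y of (c, r, a, b) \<Rightarrow> circ_arc c r a b) = {}) \<and>
        countable ((\<Union>(c, r) \<in> Cs. sphere c r) - (\<Union>(c, r, a, b) \<in> A. circ_arc c r a b)))"

definition nondeg_circular_domain :: "complex set \<Rightarrow> (complex \<times> real) set \<Rightarrow> bool" where
  "nondeg_circular_domain \<Omega> Cs \<longleftrightarrow>
     open \<Omega> \<and> connected \<Omega> \<and> \<Omega> \<noteq> {} \<and> bounded \<Omega> \<and> finite Cs \<and>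
     (\<forall>(c, r) \<in> Cs. r > 0) \<and>
     (\<forall>x\<in>Cs. \<forall>y\<in>Cs. x \<noteq> y \<longrightarrow> sphere (fst x) (snd x) \<inter> sphere (fst y) (snd y) = {}) \<and>
     frontier \<Omega> = (\<Union>(c, r) \<in> Cs. sphere c r)"

text \<open>Open sector with vertex \<zeta>, axis direction n (unit), half-opening \<alpha>.\<close>
definition sector :: "complex \<Rightarrow> complex \<Rightarrow> real \<Rightarrow> complex set" where
  "sector \<zeta> n \<alpha> = {z. z \<noteq> \<zeta> \<and> Re ((z - \<zeta>) * cnj n) > cos \<alpha> * cmod (z - \<zeta>)}"

text \<open>A nontangential path in \<Omega> to the boundary point \<zeta> (on the circle (c,r) of Cs):
  a continuous path on [0,1) in \<Omega> tending to \<zeta>, which eventually lies in a sector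
  with vertex \<zeta>, opening 2\<alpha> < pi, symmetric about the inward normal n.\<close>
definition nontangential_path ::
  "complex set \<Rightarrow> (complex \<times> real) set \<Rightarrow> complex \<Rightarrow> (real \<Rightarrow> complex) \<Rightarrow> bool" where
  "nontangential_path \<Omega> Cs \<zeta> \<gamma> \<longleftrightarrow>
     continuous_on {0..<1} \<gamma> \<and> \<gamma> ` {0..<1} \<subseteq> \<Omega> \<and> (\<gamma> \<longlongrightarrow> \<zeta>) (at_left 1) \<and>
     (\<exists>c r n \<alpha>. (c, r) \<in> Cs \<and> \<zeta> \<in> sphere c r \<and>
        (n = (\<zeta> - c) / of_real r \<or> n = (c - \<zeta>) / of_real r) \<and>
        (\<exists>\<delta>>0. \<forall>s. 0 < s \<and> s < \<delta> \<longrightarrow> \<zeta> + of_real s * n \<in> \<Omega>) \<and>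
        0 < \<alpha> \<and> \<alpha> < pi / 2 \<and>
        (\<forall>\<^sub>F t in at_left 1. \<gamma> t \<in> sector \<zeta> n \<alpha>))"

definition infinite_dimensional_on :: "complex set \<Rightarrow> (complex \<Rightarrow> complex) set \<Rightarrow> bool" where
  "infinite_dimensional_on D S \<longleftrightarrow>
     \<not> (\<exists>f0 B. finite B \<and>
          S \<subseteq> {f. \<exists>a. \<forall>z\<in>D. f z = f0 z + (\<Sum>b\<in>B. a b * b z)})"

end

theory Submission
  imports Defs "HOL-Complex_Analysis.Complex_Analysis"
begin

text \<open>On the disk, write \<open>\<lambda> = exp (\<i> \<alpha>)\<close> and let \<open>A\<close> be the Schwarz integral of \<open>\<alpha>\<close>. Because \<open>\<alpha>\<close> is locally
  of bounded variation, the tails of the logarithmic potentials of the variation measures are small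
  off sets of small capacity; there \<open>A\<close> has an angular limit with real part \<open>\<alpha>\<close>, attained faster than
  \<open>1 / ln (1 / (1 - \<bar>z\<bar>))\<close>. A theorem of Gehring type gives an analytic \<open>G\<close> whose real part has the
  angular limits \<open>\<phi> exp (Im A)\<close> and which grows at most logarithmically at quasi-every boundary point;
  then \<open>f = exp (\<i> A) G\<close> solves the problem.

  In a circular domain, the solutions \<open>f\<^sub>j\<close> obtained for the single circles are added. The disturbance
  that the other summands cause on a circle is analytic across it, and it can be removed by a
  contraction: on each circle there is a function cancelling it up to \<open>exp (\<i> A)\<close> times a function
  with vanishing real part, and which is much smaller near the other circles.

  Adding the kernel \<open>(x + w) / (x - w)\<close>, imaginary on the circle, to \<open>G\<close> produces a solution with a
  pole-like singularity at an arbitrary boundary point \<open>x\<close>. Solutions with different singularities are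
  affinely independent.\<close>

section \<open>Logarithmic capacity\<close>

text \<open>Sets of capacity zero are much smaller than null sets, so theorems on almost everywhere
  boundary values do not suffice: every limit is proved outside open sets of small capacity, and
  these are handled through lower bounds for energies alone, without equilibrium measures. The rate
  demanded of \<open>A\<close> comes from the identity behind the product:
  \<open>Re (cnj \<lambda> exp (\<i> A) G)\<close> is, up to the factor \<open>exp (- Im A)\<close>,
  equal to \<open>cos \<delta> Re G - sin \<delta> Im G\<close> with
  \<open>\<delta> = Re A - \<alpha>\<close>. Prescribing \<open>Re G\<close> gives no bound for
  \<open>Im G\<close>, so the decay of \<open>\<delta>\<close> has to beat the growth of
  \<open>Im G\<close>; the logarithm is the growth of the conjugate of a bounded function. Terms
  with purely imaginary angular limits can be added to \<open>G\<close> without changing the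
  boundary condition. This one freedom serves three purposes: the poles in the Gehring construction,
  the cancellation between circles, and the infinite family at the end. In a circular domain the
  solutions are single valued, and \<open>F\<close> is their composition with
  \<open>g\<close>.\<close>

definition log_kernel :: "complex \<Rightarrow> complex \<Rightarrow> ennreal" where
  "log_kernel x y = (if x = y then \<infinity> else ennreal (max 0 (- ln (cmod (x - y)))))"

definition log_pot :: "complex measure \<Rightarrow> complex \<Rightarrow> ennreal" where
  "log_pot \<mu> x = (\<integral>\<^sup>+ y. log_kernel x y \<partial>\<mu>)"

text \<open>For \<open>T \<ge> 0\<close> this is the share of the potential that comes from points
  closer than \<open>exp (- T)\<close>. Its uniform smallness off a thin set replaces continuity of
  the potential.\<close>

definition tail_pot :: "real \<Rightarrow> complex measure \<Rightarrow> complex \<Rightarrow> ennreal" where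
  "tail_pot T \<mu> x = (\<integral>\<^sup>+ y. log_kernel x y * indicator {y. ennreal T < log_kernel x y} y \<partial>\<mu>)"

definition pos_energy :: "complex measure \<Rightarrow> ennreal" where
  "pos_energy \<mu> = (\<integral>\<^sup>+ x. log_pot \<mu> x \<partial>\<mu>)"

text \<open>A quantitative form of outer capacity at most about \<open>exp (- V)\<close>. The open
  superset makes it an outer notion from the start. Only the positive part of the energy is used, so
  all integrals are nonnegative and Tonelli applies freely.\<close>

definition thin :: "real \<Rightarrow> complex set \<Rightarrow> bool" where
  "thin V E \<longleftrightarrow> (\<exists>U. open U \<and> E \<subseteq> U \<and>
     (\<forall>K \<nu>. compact K \<and> K \<subseteq> U \<and> \<nu> \<in> prob_measures_on K \<longrightarrow> ennreal V \<le> pos_energy \<nu>))"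

section \<open>Kernel estimates, measurability of potentials and symmetry of the mutual
  energy\<close>

lemma log_kernel_sym: "log_kernel x y = log_kernel y x"
  by (simp add: log_kernel_def norm_minus_commute)

lemma log_kernel_ge: "ennreal (- ln (cmod (x - y))) \<le> log_kernel x y"
  by (auto simp: log_kernel_def intro: ennreal_leI)

text \<open>A factor 2 in the distance shifts the logarithm by \<open>ln 2\<close>, and truncation
  at 0 does not enlarge the shift. This is the estimate behind the nearest-point maximum
  principle.\<close>

lemma log_kernel_halve:
  assumes "cmod (x' - t) \<le> 2 * cmod (x - t)"
  shows "log_kernel x t \<le> log_kernel x' t + ennreal (ln 2)"
proof (cases "x = t \<or> x' = t")
  case True
  then have "x' = t" using assms by auto
  then show ?thesis by (simp add: log_kernel_def)
next
  case False
  then have "- ln (cmod (x - t)) \<le> - ln (cmod (x' - t)) + ln 2"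
    using assms ln_mono[of "cmod (x' - t)" "2 * cmod (x - t)"] by (simp add: ln_mult)
  then have "ennreal (max 0 (- ln (cmod (x - t)))) \<le> ennreal (max 0 (- ln (cmod (x' - t))) + ln 2)"
    by (intro ennreal_leI) auto
  also have "\<dots> = ennreal (max 0 (- ln (cmod (x' - t)))) + ennreal (ln 2)"
    by (subst ennreal_plus) auto
  finally show ?thesis using False by (simp add: log_kernel_def)
qed

lemma measurable_log_kernel_pair [measurable]:
  "(\<lambda>p. log_kernel (fst p) (snd p)) \<in> borel_measurable (borel \<Otimes>\<^sub>M borel)"
proof -
  have "Measurable.pred (borel \<Otimes>\<^sub>M borel) (\<lambda>p::complex \<times> complex. fst p = snd p)"
    by measurable
  then show ?thesis unfolding log_kernel_def by measurable
qed

lemma measurable_log_kernel [measurable]: "log_kernel x \<in> borel_measurable borel"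
proof -
  have "(\<lambda>y. (\<lambda>p. log_kernel (fst p) (snd p)) (x, y)) \<in> borel_measurable borel"
    by measurable
  then show ?thesis by simp
qed

lemma measurable_log_kernel_tail [measurable]:
  "{y. ennreal T < log_kernel x y} \<in> sets borel"
proof -
  have "{y \<in> space borel. ennreal T < log_kernel x y} \<in> sets borel" by measurable
  then show ?thesis by simp
qed

lemma measurable_log_pot:
  assumes "sets \<mu> = sets borel" "finite_measure \<mu>"
  shows "log_pot \<mu> \<in> borel_measurable borel"
proof -
  interpret finite_measure \<mu> by fact
  have "sets (borel \<Otimes>\<^sub>M \<mu>) = sets (borel \<Otimes>\<^sub>M borel :: (complex \<times> complex) measure)"
    using assms(1) by (intro sets_pair_measure_cong) auto
  then have "(\<lambda>p. log_kernel (fst p) (snd p)) \<in> borel_measurable (borel \<Otimes>\<^sub>M \<mu>)"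
    using measurable_log_kernel_pair by (simp cong: measurable_cong_sets)
  from borel_measurable_nn_integral_fst[OF this] show ?thesis
    unfolding log_pot_def by simp
qed

lemma measurable_tail_pot:
  assumes "sets \<mu> = sets borel" "finite_measure \<mu>"
  shows "tail_pot T \<mu> \<in> borel_measurable borel"
proof -
  interpret finite_measure \<mu> by fact
  have eq: "sets (borel \<Otimes>\<^sub>M \<mu>) = sets (borel \<Otimes>\<^sub>M borel :: (complex \<times> complex) measure)"
    using assms(1) by (intro sets_pair_measure_cong) auto
  have "(\<lambda>p. if ennreal T < log_kernel (fst p) (snd p) then log_kernel (fst p) (snd p) else 0)
      \<in> borel_measurable (borel \<Otimes>\<^sub>M borel)"
    by measurable
  then have "(\<lambda>p. if ennreal T < log_kernel (fst p) (snd p) then log_kernel (fst p) (snd p) else 0)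
      \<in> borel_measurable (borel \<Otimes>\<^sub>M \<mu>)"
    using eq by (simp cong: measurable_cong_sets)
  from borel_measurable_nn_integral_fst[OF this] show ?thesis
    unfolding tail_pot_def by (simp add: indicator_def if_distrib of_bool_def cong: if_cong)
qed

lemma log_pot_swap:
  assumes "sets \<mu> = sets borel" "finite_measure \<mu>" "sets \<nu> = sets borel" "finite_measure \<nu>"
  shows "(\<integral>\<^sup>+ x. log_pot \<mu> x \<partial>\<nu>) = (\<integral>\<^sup>+ x. log_pot \<nu> x \<partial>\<mu>)"
proof -
  interpret M: finite_measure \<mu> by fact
  interpret N: finite_measure \<nu> by fact
  interpret pair_sigma_finite \<nu> \<mu> ..
  have eq: "sets (\<nu> \<Otimes>\<^sub>M \<mu>) = sets (borel \<Otimes>\<^sub>M borel :: (complex \<times> complex) measure)"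
    using assms by (intro sets_pair_measure_cong) auto
  have m: "(\<lambda>p. log_kernel (fst p) (snd p)) \<in> borel_measurable (\<nu> \<Otimes>\<^sub>M \<mu>)"
    using eq measurable_log_kernel_pair by (simp cong: measurable_cong_sets)
  then have m': "(\<lambda>(x, y). log_kernel x y) \<in> borel_measurable (\<nu> \<Otimes>\<^sub>M \<mu>)"
    by (simp add: case_prod_beta')
  show ?thesis unfolding log_pot_def
    using Fubini'[OF m'] by (simp add: log_kernel_sym)
qed

lemma prob_measures_onD:
  assumes "\<nu> \<in> prob_measures_on K"
  shows "sets \<nu> = sets borel" "space \<nu> = UNIV" "finite_measure \<nu>" "emeasure \<nu> UNIV = 1"
    "emeasure \<nu> K = 1"
proof -
  show 1: "sets \<nu> = sets borel" "emeasure \<nu> UNIV = 1" "emeasure \<nu> K = 1"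
    using assms by (auto simp: prob_measures_on_def)
  show 2: "space \<nu> = UNIV" using sets_eq_imp_space_eq[OF 1(1)] by simp
  show "finite_measure \<nu>" using 1 2 by (intro finite_measureI) auto
qed

lemma prob_measures_on_uniform:
  assumes s: "sets \<nu> = sets borel" and f: "finite_measure \<nu>" and K: "compact K" and "0 < emeasure \<nu> K"
  shows "uniform_measure \<nu> K \<in> prob_measures_on K"
proof -
  interpret finite_measure \<nu> by fact
  have [simp]: "space \<nu> = UNIV" using sets_eq_imp_space_eq[OF s] by simp
  have K': "K \<in> sets \<nu>" using K s by (simp add: borel_closed compact_imp_closed)
  have "emeasure \<nu> K \<noteq> 0" "emeasure \<nu> K \<noteq> \<infinity>" using assms(4) by auto
  then have 1: "emeasure (uniform_measure \<nu> K) K = 1"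
    by (rule emeasure_uniform_measure_1)
  have "emeasure (uniform_measure \<nu> K) UNIV = 1"
    using K' \<open>emeasure \<nu> K \<noteq> 0\<close> \<open>emeasure \<nu> K \<noteq> \<infinity>\<close> s
    by (simp add: less_top[symmetric] ennreal_divide_self)
  then show ?thesis using 1 s by (simp add: prob_measures_on_def)
qed

lemma nn_integral_uniform_le:
  assumes "f \<in> borel_measurable \<nu>" "K \<in> sets \<nu>"
  shows "(\<integral>\<^sup>+x. f x \<partial>uniform_measure \<nu> K) \<le> (\<integral>\<^sup>+x. f x \<partial>\<nu>) / emeasure \<nu> K"
  unfolding nn_integral_uniform_measure[OF assms]
  by (intro divide_right_mono_ennreal nn_integral_mono) (auto simp: indicator_def)

text \<open>Each of the two integrations in the energy costs one division by the mass of
  \<open>K\<close>.\<close>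

lemma pos_energy_uniform_le:
  assumes s: "sets \<nu> = sets borel" and f: "finite_measure \<nu>" and K: "compact K"
  shows "pos_energy (uniform_measure \<nu> K) \<le> pos_energy \<nu> / emeasure \<nu> K / emeasure \<nu> K"
proof -
  have K': "K \<in> sets \<nu>" using K s by (simp add: borel_closed compact_imp_closed)
  have m: "log_kernel x \<in> borel_measurable \<nu>" for x
    using s measurable_log_kernel by (simp cong: measurable_cong_sets)
  have p: "log_pot (uniform_measure \<nu> K) x \<le> log_pot \<nu> x / emeasure \<nu> K" for x
    unfolding log_pot_def by (rule nn_integral_uniform_le[OF m K'])
  have m2: "log_pot \<nu> \<in> borel_measurable \<nu>"
    using measurable_log_pot[OF s f] s by (simp cong: measurable_cong_sets)
  have "pos_energy (uniform_measure \<nu> K) \<le> (\<integral>\<^sup>+ x. log_pot \<nu> x / emeasure \<nu> K \<partial>uniform_measure \<nu> K)"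
    unfolding pos_energy_def by (intro nn_integral_mono p)
  also have "\<dots> \<le> (\<integral>\<^sup>+ x. log_pot \<nu> x / emeasure \<nu> K \<partial>\<nu>) / emeasure \<nu> K"
    by (intro nn_integral_uniform_le K') (use m2 in measurable)
  also have "(\<integral>\<^sup>+ x. log_pot \<nu> x / emeasure \<nu> K \<partial>\<nu>) = pos_energy \<nu> / emeasure \<nu> K"
    unfolding pos_energy_def by (rule nn_integral_divide[OF m2])
  finally show ?thesis .
qed

section \<open>Thin sets and their countable subadditivity\<close>

lemma thin_mono: "thin V E \<Longrightarrow> E' \<subseteq> E \<Longrightarrow> V' \<le> V \<Longrightarrow> thin V' E'"
  unfolding thin_def by (meson ennreal_leI order_trans subset_trans)

lemma thin_open_superset:
  assumes "thin V E" obtains U where "open U" "E \<subseteq> U" "thin V U"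
  using assms unfolding thin_def by blast

lemma thin_empty [simp]: "thin V {}"
  unfolding thin_def by (intro exI[of _ "{}"]) (auto simp: prob_measures_on_def)

lemma compact_approx:
  fixes \<nu> :: "complex measure"
  assumes s: "sets \<nu> = sets borel" and f: "finite_measure \<nu>" and B: "B \<in> sets borel"
    and c: "c < emeasure \<nu> B"
  obtains K where "compact K" "K \<subseteq> B" "c < emeasure \<nu> K"
proof -
  interpret finite_measure \<nu> by fact
  have "emeasure \<nu> B = (SUP K \<in> {K. K \<subseteq> B \<and> compact K}. emeasure \<nu> K)"
    by (rule inner_regular[OF s _ B]) simp
  then show ?thesis using c that by (auto simp: less_SUP_iff)
qed

text \<open>Inner regularity gives a compact part of \<open>U\<close> of mass above
  \<open>m\<close>. After normalisation it has energy at least \<open>V\<close>, and energy is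
  homogeneous of degree two in the measure.\<close>

lemma pos_energy_mass:
  assumes s: "sets \<nu> = sets borel" and f: "finite_measure \<nu>" and U: "U \<in> sets borel"
    and m: "ennreal m < emeasure \<nu> U" "0 < m" and V: "0 \<le> V"
    and thin: "\<And>K \<nu>. compact K \<Longrightarrow> K \<subseteq> U \<Longrightarrow> \<nu> \<in> prob_measures_on K \<Longrightarrow> ennreal V \<le> pos_energy \<nu>"
  shows "ennreal (V * m\<^sup>2) \<le> pos_energy \<nu>"
proof -
  interpret finite_measure \<nu> by fact
  obtain K where K: "compact K" "K \<subseteq> U" "ennreal m < emeasure \<nu> K"
    using compact_approx[OF s f U m(1)] .
  define k where "k = measure \<nu> K"
  have k: "emeasure \<nu> K = ennreal k" unfolding k_def by (rule emeasure_eq_measure)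
  have km: "m < k" using K(3) m(2) unfolding k by (simp add: ennreal_less_iff)
  have "ennreal V \<le> pos_energy \<nu> / ennreal k / ennreal k"
    using pos_energy_uniform_le[OF s f K(1)] thin[OF K(1,2) prob_measures_on_uniform[OF s f K(1)]]
      K(3) unfolding k by (meson order_trans le_less_trans zero_le)
  then have "ennreal V * ennreal k * ennreal k \<le> pos_energy \<nu>"
    using km m(2) by (cases "pos_energy \<nu>")
      (auto simp: divide_ennreal ennreal_mult[symmetric] V field_simps)
  moreover have "ennreal (V * m\<^sup>2) \<le> ennreal V * ennreal k * ennreal k"
    using km m(2) V by (auto simp: ennreal_mult[symmetric] power2_eq_square mult.assoc
        intro!: ennreal_leI mult_left_mono mult_mono)
  ultimately show ?thesis by simp
qed

text \<open>The numbers \<open>(1/2) ^ (n + 2)\<close> add up to \<open>1/2\<close>, so a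
  probability measure on the union must exceed one of them on the corresponding \<open>U n\<close>.
  The weight \<open>4 ^ (n + 2)\<close> is exactly what the squared mass takes away in
  \<open>pos_energy_mass\<close>.\<close>

lemma thin_UN:
  fixes E :: "nat \<Rightarrow> complex set"
  assumes E: "\<And>n. thin (4 ^ (n + 2) * V) (E n)" and V: "0 \<le> V"
  shows "thin V (\<Union>n. E n)"
proof -
  have "\<forall>n. \<exists>U. open U \<and> E n \<subseteq> U \<and>
     (\<forall>K \<nu>. compact K \<and> K \<subseteq> U \<and> \<nu> \<in> prob_measures_on K \<longrightarrow> ennreal (4 ^ (n + 2) * V) \<le> pos_energy \<nu>)"
    using E unfolding thin_def by blast
  then obtain U where U: "\<And>n. open (U n)" "\<And>n. E n \<subseteq> U n"
    "\<And>n K \<nu>. compact K \<Longrightarrow> K \<subseteq> U n \<Longrightarrow> \<nu> \<in> prob_measures_on K \<Longrightarrow> ennreal (4 ^ (n + 2) * V) \<le> pos_energy \<nu>"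
    by metis
  show ?thesis unfolding thin_def
  proof (intro exI[of _ "\<Union>n. U n"] conjI allI impI)
    fix K \<nu> assume *: "compact K \<and> K \<subseteq> (\<Union>n. U n) \<and> \<nu> \<in> prob_measures_on K"
    note \<nu> = prob_measures_onD[of \<nu> K]
    interpret finite_measure \<nu> using * \<nu>(3) by simp
    have s: "sets \<nu> = sets borel" using * \<nu> by simp
    have "\<exists>n. ennreal ((1/2) ^ (n + 2)) < emeasure \<nu> (U n)"
    proof (rule ccontr)
      assume neg: "\<not> ?thesis"
      have "1 = emeasure \<nu> K" using * \<nu> by simp
      also have "\<dots> \<le> emeasure \<nu> (\<Union>n. U n)"
        using * s U(1) by (intro emeasure_mono) auto
      also have "\<dots> \<le> (\<Sum>n. emeasure \<nu> (U n))"
        by (intro emeasure_subadditive_countably) (use s U(1) in auto)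
      also have "\<dots> \<le> (\<Sum>n. ennreal ((1/2) ^ (n + 2)))"
        using neg by (intro suminf_le) (auto simp: not_less)
      also have "\<dots> = ennreal (\<Sum>n. (1/2) ^ (n + 2))"
        by (intro suminf_ennreal2) (auto intro!: summable_mult simp: power_add summable_geometric)
      also have "(\<Sum>n. (1/2) ^ (n + 2) :: real) = 1/2"
        using suminf_mult[of "\<lambda>n. (1/2::real)^n" "1/4"] suminf_geometric[of "1/2::real"]
        by (simp add: power_add summable_geometric mult.commute power2_eq_square)
      finally show False by (simp add: ennreal_1[symmetric] ennreal_le_iff del: ennreal_1 ennreal_half)
    qed
    then obtain n where n: "ennreal ((1/2) ^ (n + 2)) < emeasure \<nu> (U n)" by blast
    have "ennreal (4 ^ (n + 2) * V * ((1/2) ^ (n + 2))\<^sup>2) \<le> pos_energy \<nu>"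
      by (rule pos_energy_mass[OF s finite_measure_axioms _ n _ _ U(3)]) (use U(1) V in auto)
    also have "4 ^ (n + 2) * V * ((1/2) ^ (n + 2))\<^sup>2 = V"
    proof -
      have "((1/2::real) ^ (n + 2))\<^sup>2 = ((1/2)\<^sup>2) ^ (n + 2)"
        by (simp only: power_mult[symmetric] mult.commute)
      moreover have "(4::real) ^ (n + 2) * ((1/2)\<^sup>2) ^ (n + 2) = (4 * (1/2)\<^sup>2) ^ (n + 2)"
        by (rule power_mult_distrib[symmetric])
      ultimately have "(4::real) ^ (n + 2) * ((1/2) ^ (n + 2))\<^sup>2 = 1"
        by (simp add: power2_eq_square del: power_Suc power_add)
      then show ?thesis by (metis mult.assoc mult.commute mult_1)
    qed
    finally show "ennreal V \<le> pos_energy \<nu>" .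
  qed (use U in auto)
qed

text \<open>The factor 64 is the weight \<open>4 ^ (1 + 2)\<close> of the second set in
  \<open>thin_UN\<close>; the first would need only 16.\<close>

lemma thin_Un:
  assumes "thin (64 * V) A" "thin (64 * V) B" "0 \<le> V" shows "thin V (A \<union> B)"
proof -
  define f where "f = (\<lambda>n::nat. if n = 0 then A else if n = 1 then B else {})"
  have "thin V (\<Union>n. f n)"
  proof (rule thin_UN)
    show "thin (4 ^ (n + 2) * V) (f n)" for n
      using assms by (auto simp: f_def intro: thin_mono)
  qed fact
  moreover have "A \<union> B \<subseteq> (\<Union>n. f n)"
    using UN_upper[of 0 UNIV f] UN_upper[of 1 UNIV f] by (auto simp: f_def)
  ultimately show ?thesis by (rule thin_mono) simp
qed

lemma thin_point: "thin V {a}"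
  unfolding thin_def
\<comment> \<open>Two points of this ball are closer than \<open>exp (- \<bar>V\<bar>)\<close>, so
  the kernel is at least \<open>V\<close> throughout.\<close>
proof (intro exI[of _ "ball a (exp (- \<bar>V\<bar>) / 2)"] conjI allI impI)
  fix K \<nu> assume *: "compact K \<and> K \<subseteq> ball a (exp (- \<bar>V\<bar>) / 2) \<and> \<nu> \<in> prob_measures_on K"
  note \<nu> = prob_measures_onD[of \<nu> K]
  interpret finite_measure \<nu> using * \<nu>(3) by simp
  have s: "sets \<nu> = sets borel" using * \<nu> by simp
  have K: "K \<in> sets \<nu>" using * s by (simp add: borel_closed compact_imp_closed)
  have k: "ennreal V \<le> log_kernel x y" if "x \<in> K" "y \<in> K" for x y
  proof (cases "x = y")
    case False
    have "dist x y < exp (- \<bar>V\<bar>)"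
      using that * by (intro dist_triangle_half_r[of a x "exp (- \<bar>V\<bar>)" y]) auto
    then have "ln (cmod (x - y)) \<le> - \<bar>V\<bar>"
      using False ln_mono[of "cmod (x - y)" "exp (- \<bar>V\<bar>)"] by (simp add: dist_norm less_imp_le)
    then have "V \<le> - ln (cmod (x - y))" by simp
    then show ?thesis using log_kernel_ge ennreal_leI order_trans by meson
  qed (simp add: log_kernel_def)
  have "(\<integral>\<^sup>+x. (\<integral>\<^sup>+y. ennreal V * indicator K y \<partial>\<nu>) * indicator K x \<partial>\<nu>) \<le> pos_energy \<nu>"
    unfolding pos_energy_def log_pot_def
    by (intro nn_integral_mono) (auto simp: indicator_def k intro!: nn_integral_mono)
  then show "ennreal V \<le> pos_energy \<nu>"
    using K * \<nu> by (simp add: nn_integral_cmult_indicator)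
qed auto

lemma thin_countable:
  assumes "countable N" shows "thin V N"
proof (cases "N = {}")
  case False
  have "thin \<bar>V\<bar> (\<Union>n. {from_nat_into N n})"
    by (rule thin_UN) (auto intro: thin_point)
  then show ?thesis
    by (rule thin_mono) (use assms False in \<open>auto simp: subset_range_from_nat_into\<close>,
      metis from_nat_into_surj)
qed auto

text \<open>The truncated measure \<open>\<nu>'\<close> below plays the role of an equilibrium measure: its potential is
  bounded on the whole plane by the nearest-point form of the maximum principle.\<close>

lemma nearest_point_kernel:
  assumes "compact K" "K \<noteq> {}"
  obtains x' where "x' \<in> K" "\<And>t. t \<in> K \<Longrightarrow> cmod (x' - t) \<le> 2 * cmod (x - t)"
proof -
  obtain x' where x': "x' \<in> K" "\<And>t. t \<in> K \<Longrightarrow> dist x x' \<le> dist x t"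
    using distance_attains_inf[of K x] assms compact_imp_closed by blast
  have "cmod (x' - t) \<le> 2 * cmod (x - t)" if "t \<in> K" for t
    using x'(2)[OF that] norm_triangle_ineq4[of "x - t" "x - x'"] by (simp add: dist_norm)
  then show ?thesis using that x'(1) by blast
qed

text \<open>The mutual energy is computed in two ways. Integrating the potential of
  \<open>\<mu>\<close> against a part \<open>\<nu>'\<close> of \<open>\<nu>\<close> of mass above
  \<open>1/4\<close> gives at least \<open>T / 4\<close>; integrating the potential of
  \<open>\<nu>'\<close> against \<open>\<mu>\<close> gives at most \<open>(2 J + 2) m\<close>, where
  \<open>J\<close> is the energy of \<open>\<nu>\<close>.\<close>

lemma pos_energy_ge_of_pot_ge:
  assumes m: "sets \<mu> = sets borel" "finite_measure \<mu>" and mass: "emeasure \<mu> UNIV \<le> ennreal m" "0 < m"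
    and K: "compact K" and \<nu>K: "\<nu> \<in> prob_measures_on K" and T: "0 \<le> T"
    and pot: "\<And>x. x \<in> K \<Longrightarrow> ennreal T \<le> log_pot \<mu> x"
  shows "ennreal (T / (8 * m) - 1) \<le> pos_energy \<nu>"
proof (cases "pos_energy \<nu>")
  case (real J)
  note \<nu> = prob_measures_onD[OF \<nu>K]
  interpret M: finite_measure \<mu> by fact
  interpret N: finite_measure \<nu> by fact
  have [simp]: "space \<mu> = UNIV" using sets_eq_imp_space_eq[OF m(1)] by simp
  note sn [measurable_cong] = \<nu>(1)
  have Kb: "K \<in> sets borel" using K by (simp add: borel_closed compact_imp_closed)
  have pm: "log_pot \<nu> \<in> borel_measurable borel" by (rule measurable_log_pot[OF \<nu>(1,3)])
  \<comment> \<open>By Markov the potential of \<open>\<nu>\<close> exceeds \<open>2 J + 1\<close>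
    on mass at most \<open>J / (2 J + 1) \<le> 1/2\<close>; the summand 1 keeps the threshold
    positive when \<open>J = 0\<close>. Mass at least \<open>1/2\<close> remains, which leaves room
    for a compact subset of mass above \<open>1/4\<close>.\<close>
  define B where "B = {x. log_pot \<nu> x < ennreal (2 * J + 1)}"
  have B: "B \<in> sets borel"
    using measurable_sets[OF pm, of "{..<ennreal (2 * J + 1)}"] by (auto simp: B_def vimage_def)
  have "ennreal (2 * J + 1) * emeasure \<nu> (- B) = (\<integral>\<^sup>+x. ennreal (2 * J + 1) * indicator (- B) x \<partial>\<nu>)"
    using B \<nu>(1) by (subst nn_integral_cmult_indicator) auto
  also have "\<dots> \<le> pos_energy \<nu>"
    unfolding pos_energy_def by (intro nn_integral_mono) (auto simp: B_def indicator_def)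
  finally have le: "ennreal (2 * J + 1) * emeasure \<nu> (- B) \<le> ennreal J" using real by simp
  have half: "measure \<nu> (- B) \<le> 1/2"
  proof -
    have "(2 * J + 1) * measure \<nu> (- B) \<le> J"
      using le real by (simp add: N.emeasure_eq_measure ennreal_mult[symmetric] del: ennreal_plus)
    then have "(2 * J + 1) * measure \<nu> (- B) \<le> (2 * J + 1) * (1/2)" by simp
    then show ?thesis using real by (subst (asm) mult_le_cancel_left_pos) auto
  qed
  have "1 = measure \<nu> K" using \<nu>(5) by (simp add: measure_def)
  also have "\<dots> \<le> measure \<nu> (K \<inter> B \<union> - B)"
    using Kb B \<nu>(1) by (intro N.finite_measure_mono) auto
  also have "\<dots> \<le> measure \<nu> (K \<inter> B) + measure \<nu> (- B)"
    using Kb B \<nu>(1) by (intro measure_Un_le) auto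
  finally have "ennreal (1/4) < emeasure \<nu> (K \<inter> B)"
    using half by (simp add: N.emeasure_eq_measure ennreal_less_iff)
  then obtain K' where K': "compact K'" "K' \<subseteq> K \<inter> B" "ennreal (1/4) < emeasure \<nu> K'"
    using compact_approx[OF \<nu>(1,3), of "K \<inter> B"] Kb B by blast
  have K'b: "K' \<in> sets borel" using K'(1) by (simp add: borel_closed compact_imp_closed)
  have "K' \<noteq> {}" using K'(3) by auto
  define \<nu>' where "\<nu>' = density \<nu> (indicator K')"
  have s': "sets \<nu>' = sets borel" by (simp add: \<nu>'_def \<nu>(1))
  have mk: "log_kernel x \<in> borel_measurable \<nu>" for x
    using \<nu>(1) measurable_log_kernel by (simp cong: measurable_cong_sets)
  have pot': "log_pot \<nu>' x = (\<integral>\<^sup>+y. indicator K' y * log_kernel x y \<partial>\<nu>)" for x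
    unfolding log_pot_def \<nu>'_def using K'b mk \<nu>(1) by (intro nn_integral_density borel_measurable_indicator) auto
  have mk': "(\<lambda>y. indicator K' y * log_kernel x y) \<in> borel_measurable \<nu>" for x
    using mk[of x] K'b \<nu>(1) by measurable
  have em': "emeasure \<nu>' UNIV = emeasure \<nu> K'"
    unfolding \<nu>'_def using K'b \<nu>(1) by (subst emeasure_density) (auto simp: borel_measurable_indicator_iff)
  have f': "finite_measure \<nu>'"
    using em' sets_eq_imp_space_eq[OF s'] by (intro finite_measureI) simp
  have bound: "log_pot \<nu>' x \<le> ennreal (2 * J + 2)" for x
  proof -
    obtain x' where x': "x' \<in> K'" "\<And>t. t \<in> K' \<Longrightarrow> cmod (x' - t) \<le> 2 * cmod (x - t)"
      using nearest_point_kernel[OF K'(1) \<open>K' \<noteq> {}\<close>, of x] by blast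
    have "log_pot \<nu>' x \<le> (\<integral>\<^sup>+y. indicator K' y * log_kernel x' y + ennreal (ln 2) \<partial>\<nu>)"
      unfolding pot' by (intro nn_integral_mono) (auto simp: indicator_def log_kernel_halve x')
    also have "\<dots> = log_pot \<nu>' x' + ennreal (ln 2)"
      unfolding pot' by (subst nn_integral_add) (use mk' \<nu>(2,4) in auto)
    also have "log_pot \<nu>' x' \<le> log_pot \<nu> x'"
      unfolding pot' unfolding log_pot_def by (intro nn_integral_mono) (auto simp: indicator_def)
    also have "\<dots> \<le> ennreal (2 * J + 1)" using x'(1) K'(2) by (auto simp: B_def)
    also have "ennreal (2 * J + 1) + ennreal (ln 2) = ennreal (2 * J + 1 + ln 2)"
      using real by (intro ennreal_plus[symmetric]) auto
    also have "\<dots> \<le> ennreal (2 * J + 2)"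
      using ln_le_minus_one[of "2::real"] by (intro ennreal_leI) auto
    finally show ?thesis by (simp add: add_right_mono)
  qed
  have "ennreal T * ennreal (1/4) \<le> ennreal T * emeasure \<nu> K'"
    using K'(3) by (intro mult_left_mono) auto
  also have "\<dots> = (\<integral>\<^sup>+x. ennreal T * indicator K' x \<partial>\<nu>)"
    using K'b \<nu>(1) by (simp add: nn_integral_cmult_indicator)
  also have "\<dots> \<le> (\<integral>\<^sup>+x. indicator K' x * log_pot \<mu> x \<partial>\<nu>)"
    using pot K'(2) by (intro nn_integral_mono) (auto simp: indicator_def)
  also have "\<dots> = (\<integral>\<^sup>+x. log_pot \<mu> x \<partial>\<nu>')"
    unfolding \<nu>'_def using measurable_log_pot[OF m] K'b \<nu>(1)
    by (intro nn_integral_density[symmetric]) (auto cong: measurable_cong_sets)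
  also have "\<dots> = (\<integral>\<^sup>+x. log_pot \<nu>' x \<partial>\<mu>)"
    by (rule log_pot_swap[OF m s' f'])
  also have "\<dots> \<le> (\<integral>\<^sup>+x. ennreal (2 * J + 2) \<partial>\<mu>)"
    by (intro nn_integral_mono bound)
  also have "\<dots> \<le> ennreal (2 * J + 2) * ennreal m"
    using mass by (simp add: mult_left_mono)
  finally have "T * (1/4) \<le> (2 * J + 2) * m"
    using T real mass(2) by (simp add: ennreal_mult[symmetric] del: ennreal_1 divide_ennreal ennreal_plus)
  then have "T / (8 * m) - 1 \<le> J" using mass(2) by (simp add: field_simps)
  then show ?thesis using real by (simp add: ennreal_leI)
qed simp

section \<open>Lower semicontinuity and superlevel sets of potentials\<close>

lemma log_pot_liminf:
  assumes "sets \<mu> = sets borel" "X \<longlonglongrightarrow> x" "\<And>n. log_pot \<mu> (X n) \<le> c"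
  shows "log_pot \<mu> x \<le> c"
proof -
  have m: "log_kernel x \<in> borel_measurable \<mu>" for x
    using assms(1) measurable_log_kernel by (simp cong: measurable_cong_sets)
  \<comment> \<open>The kernel is lower semicontinuous in its first argument: continuous off the
    diagonal and tending to infinity at it. Fatou then carries this over to the potential.\<close>
  have "log_kernel x y \<le> liminf (\<lambda>n. log_kernel (X n) y)" for y
  proof (cases "x = y")
    case False
    have "\<forall>\<^sub>F n in sequentially. X n \<noteq> y"
      using False assms(2) by (rule t1_space_class.tendsto_imp_eventually_ne[rotated])
    then have ev: "\<forall>\<^sub>F n in sequentially. ennreal (max 0 (- ln (cmod (X n - y)))) = log_kernel (X n) y"
      by eventually_elim (simp add: log_kernel_def)
    have "(\<lambda>n. ennreal (max 0 (- ln (cmod (X n - y))))) \<longlonglongrightarrow> ennreal (max 0 (- ln (cmod (x - y))))"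
      using False by (intro tendsto_intros assms(2)) auto
    then have "(\<lambda>n. log_kernel (X n) y) \<longlonglongrightarrow> log_kernel x y"
      using False Lim_transform_eventually[OF _ ev] by (simp add: log_kernel_def)
    then show ?thesis by (simp add: lim_imp_Liminf)
  next
    case True
    have "ennreal (real N) \<le> liminf (\<lambda>n. log_kernel (X n) y)" for N :: nat
    proof (rule Liminf_bounded)
      have "\<forall>\<^sub>F n in sequentially. dist (X n) x < exp (- real N)"
        using assms(2) by (rule tendstoD) simp
      then show "\<forall>\<^sub>F n in sequentially. ennreal (real N) \<le> log_kernel (X n) y"
      proof eventually_elim
        case (elim n)
        show ?case
        proof (cases "X n = y")
          case False
          then have "ln (cmod (X n - y)) \<le> - real N"
            using elim True ln_mono[of "cmod (X n - y)" "exp (- real N)"] by (simp add: dist_norm less_imp_le)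
          then have "ennreal (real N) \<le> ennreal (- ln (cmod (X n - y)))" by (intro ennreal_leI) auto
          then show ?thesis using log_kernel_ge order_trans by meson
        qed (simp add: log_kernel_def)
      qed
    qed
    then have "liminf (\<lambda>n. log_kernel (X n) y) = top"
      by (metis ennreal_of_nat_eq_real_of_nat ennreal_SUP_of_nat_eq_top SUP_least top.extremum_uniqueI)
    then show ?thesis by simp
  qed
  then have "log_pot \<mu> x \<le> (\<integral>\<^sup>+y. liminf (\<lambda>n. log_kernel (X n) y) \<partial>\<mu>)"
    unfolding log_pot_def by (intro nn_integral_mono)
  also have "\<dots> \<le> liminf (\<lambda>n. log_pot \<mu> (X n))"
    unfolding log_pot_def by (intro nn_integral_liminf m)
  also have "\<dots> \<le> c"
    using Liminf_mono[of "\<lambda>n. log_pot \<mu> (X n)" "\<lambda>_. c" sequentially] assms(3)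
    by (simp add: Liminf_const)
  finally show ?thesis .
qed

lemma open_log_pot_greater:
  assumes "sets \<mu> = sets borel"
  shows "open {x. c < log_pot \<mu> x}"
proof -
  have "closed {x. log_pot \<mu> x \<le> c}"
    unfolding closed_sequential_limits using log_pot_liminf[OF assms] by blast
  then show ?thesis by (simp add: closed_def Compl_eq not_le)
qed

text \<open>By lower semicontinuity the superlevel set is open, so it is itself a witness for
  \<open>thin\<close>.\<close>

lemma thin_log_pot_greater:
  assumes m: "sets \<mu> = sets borel" "finite_measure \<mu>" and mass: "emeasure \<mu> UNIV \<le> ennreal m" "0 < m"
    and T: "0 \<le> T"
  shows "thin (T / (8 * m) - 1) {x. ennreal T < log_pot \<mu> x}"
  unfolding thin_def
proof (intro exI[of _ "{x. ennreal T < log_pot \<mu> x}"] conjI allI impI)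
  fix K \<nu> assume *: "compact K \<and> K \<subseteq> {x. ennreal T < log_pot \<mu> x} \<and> \<nu> \<in> prob_measures_on K"
  show "ennreal (T / (8 * m) - 1) \<le> pos_energy \<nu>"
    by (rule pos_energy_ge_of_pot_ge[OF m mass _ _ T, of K]) (use * in auto)
qed (use open_log_pot_greater[OF m(1)] in auto)


section \<open>Uniform smallness of potential tails off a thin set\<close>

lemma tail_pot_tendsto_0:
  assumes m: "sets \<mu> = sets borel" and fin: "log_pot \<mu> x < \<infinity>"
  shows "(\<lambda>n. tail_pot (real n) \<mu> x) \<longlonglongrightarrow> 0"
proof -
  note [measurable_cong] = m
  have mk [measurable]: "log_kernel x \<in> borel_measurable \<mu>"
    using m measurable_log_kernel by (simp cong: measurable_cong_sets)
  have meas [measurable]: "{y. ennreal (real n) < log_kernel x y} \<in> sets \<mu>" for n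
    using m by simp
  have "(\<lambda>n. tail_pot (real n) \<mu> x) \<longlonglongrightarrow> (\<integral>\<^sup>+y. 0 \<partial>\<mu>)"
    unfolding tail_pot_def
  proof (rule nn_integral_dominated_convergence[where w = "log_kernel x"])
    show "AE y in \<mu>. (\<lambda>n. log_kernel x y * indicator {y. ennreal (real n) < log_kernel x y} y) \<longlonglongrightarrow> 0"
    proof -
      have "AE y in \<mu>. log_kernel x y \<noteq> \<infinity>"
        using fin by (intro nn_integral_PInf_AE) (auto simp: log_pot_def)
      then show ?thesis
      proof eventually_elim
        case (elim y)
        then obtain r where r: "log_kernel x y = ennreal r" "0 \<le> r" by (cases "log_kernel x y") auto
        have "\<forall>\<^sub>F n in sequentially. log_kernel x y * indicator {y. ennreal (real n) < log_kernel x y} y = 0"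
          using eventually_ge_at_top[of "nat \<lceil>r\<rceil>"]
        proof eventually_elim
          case (elim n)
          then have "r \<le> real n" by linarith
          then show ?case using r by (simp add: indicator_def not_less ennreal_leI)
        qed
        then show ?case by (rule tendsto_eventually)
      qed
    qed
    show "(\<integral>\<^sup>+ y. log_kernel x y \<partial>\<mu>) < \<infinity>" using fin by (simp add: log_pot_def)
  qed (auto simp: indicator_def)
  then show ?thesis by simp
qed

text \<open>The bound \<open>n + 1 \<le> T\<close> makes the threshold \<open>T\<close> at
  \<open>x\<close> force the threshold \<open>n\<close> at \<open>x'\<close>, as
  \<open>ln 2 \<le> 1\<close>. The bound \<open>1 \<le> n\<close> makes the kernel at
  \<open>x'\<close> at least 1, so that the additive error is absorbed by the factor 2.\<close>

lemma tail_pot_nearest: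
  assumes "cmod (x' - t) \<le> 2 * cmod (x - t)" "1 \<le> n" "n + 1 \<le> T"
  shows "log_kernel x t * indicator {y. ennreal T < log_kernel x y} t
    \<le> 2 * (log_kernel x' t * indicator {y. ennreal n < log_kernel x' y} t)"
proof (cases "ennreal T < log_kernel x t")
  case True
  have le: "log_kernel x t \<le> log_kernel x' t + ennreal 1"
    using log_kernel_halve[OF assms(1)] ln_le_minus_one[of "2::real"]
    by (elim order_trans) (intro add_left_mono ennreal_leI, simp)
  have lt: "ennreal n < log_kernel x' t"
  proof (rule ccontr)
    assume "\<not> ?thesis"
    then have "log_kernel x t \<le> ennreal n + ennreal 1"
      using le by (meson add_right_mono not_less order_trans)
    also have "\<dots> = ennreal (n + 1)" using assms by (intro ennreal_plus[symmetric]) auto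
    also have "\<dots> \<le> ennreal T" using assms by (intro ennreal_leI)
    finally show False using True by simp
  qed
  have "ennreal 1 \<le> log_kernel x' t"
    using lt assms(2) by (meson ennreal_leI less_imp_le order_trans)
  then have "log_kernel x t \<le> 2 * log_kernel x' t"
    using le by (metis add_left_mono mult_2 order_trans)
  then show ?thesis using lt by (simp add: indicator_def)
qed (simp add: indicator_def)

text \<open>The measure is cut into three parts. On the compact \<open>K1\<close> the tails at level
  \<open>n\<close> are small, and the nearest-point comparison extends this to all \<open>x\<close>.
  On the compact \<open>K2\<close> the potential is infinite, so \<open>K2\<close> lies inside an
  open thin set and is invisible in the tail at points outside it. The remainder \<open>R\<close>
  has so little mass that its whole potential is small off a thin set.\<close>

lemma tail_pot_quasi_small:
  assumes m: "sets \<mu> = sets borel" "finite_measure \<mu>" and s: "0 < s" and V: "0 \<le> V"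
  obtains T G where "0 \<le> T" "open G" "thin V G" "\<And>x. x \<notin> G \<Longrightarrow> tail_pot T \<mu> x \<le> ennreal s"
proof -
  interpret finite_measure \<mu> by fact
  have [simp]: "space \<mu> = UNIV" using sets_eq_imp_space_eq[OF m(1)] by simp
  \<comment> \<open>\<open>K1\<close> contributes at most \<open>2 s'\<close> and \<open>R\<close>
    at most \<open>s'\<close>, so a quarter of \<open>s\<close> is enough.\<close>
  define s' where "s' = s / 4"
  have s': "0 < s'" using s by (simp add: s'_def)
  \<comment> \<open>Chosen so that \<open>s' / (8 \<eta>) - 1 = 64 V\<close>: this is the bound of
    \<open>thin_log_pot_greater\<close> for a measure of mass at most \<open>\<eta>\<close>, and 64
    is the loss in \<open>thin_Un\<close>. The level \<open>T2\<close> below is adjusted to the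
    total mass of \<open>\<mu>\<close> in the same way.\<close>
  define \<eta> where "\<eta> = s' / (8 * (64 * V + 1))"
  have \<eta>: "0 < \<eta>" using s' V by (simp add: \<eta>_def)
  have pm: "log_pot \<mu> \<in> borel_measurable borel" by (rule measurable_log_pot[OF m])
  have tm: "tail_pot T \<mu> \<in> borel_measurable borel" for T by (rule measurable_tail_pot[OF m])
  define E where "E = (\<lambda>n::nat. {x. log_pot \<mu> x < \<infinity> \<and> ennreal s' < tail_pot (real n) \<mu> x})"
  have Eb: "E n \<in> sets borel" for n
  proof -
    have "{x \<in> space borel. log_pot \<mu> x < \<infinity> \<and> ennreal s' < tail_pot (real n) \<mu> x} \<in> sets borel"
      using pm tm by measurable
    then show ?thesis by (simp add: E_def)
  qed
  have tail_mono: "tail_pot T' \<mu> x \<le> tail_pot T \<mu> x" if "T \<le> T'" for T T' x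
    unfolding tail_pot_def
    by (intro nn_integral_mono) (use that in \<open>auto simp: indicator_def dest: le_less_trans[OF ennreal_leI]\<close>)
  have "decseq E"
    unfolding decseq_def
  proof (intro allI impI subsetI)
    fix i j x assume "i \<le> j" "x \<in> E j"
    then show "x \<in> E i"
      using less_le_trans[OF _ tail_mono[of "real i" "real j" x]] by (auto simp: E_def)
  qed
  have "(\<Inter>n. E n) = {}"
  proof safe
    fix x assume x: "x \<in> (\<Inter>n. E n)"
    then have "log_pot \<mu> x < \<infinity>" by (auto simp: E_def)
    from tail_pot_tendsto_0[OF m(1) this] have "\<forall>\<^sub>F n in sequentially. tail_pot (real n) \<mu> x < ennreal s'"
      using s' by (auto intro: order_tendstoD)
    then obtain n where "tail_pot (real n) \<mu> x < ennreal s'" by (auto dest: eventually_happens)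
    moreover have "x \<in> E n" using x by blast
    ultimately have "tail_pot (real n) \<mu> x < tail_pot (real n) \<mu> x" by (auto simp: E_def intro: less_trans)
    then show "x \<in> {}" by simp
  qed
  then have "(\<lambda>n. measure \<mu> (E n)) \<longlonglongrightarrow> 0"
    using finite_Lim_measure_decseq[of E] Eb m(1) \<open>decseq E\<close> by (auto simp: image_subset_iff)
  from order_tendstoD(2)[OF this, of "\<eta> / 4"] have "\<forall>\<^sub>F n in sequentially. measure \<mu> (E n) < \<eta> / 4"
    using \<eta> by simp
  then have "\<forall>\<^sub>F n in sequentially. measure \<mu> (E n) < \<eta> / 4 \<and> 1 \<le> n"
    using eventually_ge_at_top[of 1] by eventually_elim auto
  then obtain n where n: "measure \<mu> (E n) < \<eta> / 4" "1 \<le> n" by (auto dest: eventually_happens)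
  define N where "N = {x. log_pot \<mu> x = \<infinity>}"
  define A where "A = - E n - N"
  have Nb: "N \<in> sets borel" using measurable_sets[OF pm, of "{\<infinity>}"] by (simp add: N_def vimage_def)
  have Ab: "A \<in> sets borel" unfolding A_def using Eb[of n] Nb by (intro sets.Diff) auto
  have approx: "\<exists>K. compact K \<and> K \<subseteq> B \<and> measure \<mu> (B - K) < \<eta> / 4" if B: "B \<in> sets borel" for B
  proof (cases "measure \<mu> B = 0")
    case True then show ?thesis using \<eta> by (intro exI[of _ "{}"]) auto
  next
    case False
    then have pos: "0 < measure \<mu> B" by (simp add: less_le)
    have "ennreal (max 0 (measure \<mu> B - \<eta> / 4)) < emeasure \<mu> B"
      using pos \<eta> by (simp add: emeasure_eq_measure ennreal_less_iff)
    then obtain K where K: "compact K" "K \<subseteq> B" "ennreal (max 0 (measure \<mu> B - \<eta> / 4)) < emeasure \<mu> K"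
      using compact_approx[OF m B] by blast
    then have "measure \<mu> B - \<eta> / 4 < measure \<mu> K"
      by (simp add: emeasure_eq_measure ennreal_less_iff)
    moreover have "measure \<mu> (B - K) = measure \<mu> B - measure \<mu> K"
      using K B m(1) by (intro finite_measure_Diff) (auto simp: borel_closed compact_imp_closed)
    ultimately show ?thesis using K by (intro exI[of _ K]) auto
  qed
  obtain K1 where K1: "compact K1" "K1 \<subseteq> A" "measure \<mu> (A - K1) < \<eta> / 4" using approx[OF Ab] by blast
  obtain K2 where K2: "compact K2" "K2 \<subseteq> N" "measure \<mu> (N - K2) < \<eta> / 4" using approx[OF Nb] by blast
  have K1b: "K1 \<in> sets borel" and K2b: "K2 \<in> sets borel"
    using K1 K2 by (auto simp: borel_closed compact_imp_closed)
  define R where "R = - K1 - K2"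
  have Rb: "R \<in> sets borel" unfolding R_def using K1b K2b by (intro sets.Diff) auto
  have "measure \<mu> R \<le> measure \<mu> (E n \<union> ((A - K1) \<union> (N - K2)))"
    using Eb[of n] Ab Nb K1b K2b m(1) by (intro finite_measure_mono) (auto simp: R_def A_def)
  also have "\<dots> \<le> measure \<mu> (E n) + (measure \<mu> (A - K1) + measure \<mu> (N - K2))"
    using Eb[of n] Ab Nb K1b K2b m(1)
    by (intro order_trans[OF measure_Un_le] add_left_mono measure_Un_le sets.Un sets.Diff) auto
  finally have R\<eta>: "measure \<mu> R \<le> \<eta>" using n(1) K1(3) K2(3) \<eta> by linarith
  define \<rho> where "\<rho> = density \<mu> (indicator R)"
  have s\<rho>: "sets \<rho> = sets borel" by (simp add: \<rho>_def m(1))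
  have em\<rho>: "emeasure \<rho> UNIV = emeasure \<mu> R"
    unfolding \<rho>_def using Rb m(1) by (subst emeasure_density) (auto simp: borel_measurable_indicator_iff)
  have f\<rho>: "finite_measure \<rho>"
    using em\<rho> sets_eq_imp_space_eq[OF s\<rho>] by (intro finite_measureI) simp
  have mk: "log_kernel x \<in> borel_measurable \<mu>" for x
    using m(1) measurable_log_kernel by (simp cong: measurable_cong_sets)
  have pot\<rho>: "log_pot \<rho> x = (\<integral>\<^sup>+y. indicator R y * log_kernel x y \<partial>\<mu>)" for x
    unfolding log_pot_def \<rho>_def using Rb mk m(1) by (intro nn_integral_density borel_measurable_indicator) auto
  have thin1: "thin (s' / (8 * \<eta>) - 1) {x. ennreal s' < log_pot \<rho> x}"
    using R\<eta> s' \<eta> by (intro thin_log_pot_greater[OF s\<rho> f\<rho>]) (auto simp: em\<rho> emeasure_eq_measure ennreal_leI)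
  have "s' / (8 * \<eta>) - 1 = 64 * V" using s' V by (simp add: \<eta>_def field_simps)
  with thin1 have thin1: "thin (64 * V) {x. ennreal s' < log_pot \<rho> x}" by simp
  define M where "M = measure \<mu> UNIV + 1"
  have M: "0 < M" using measure_nonneg[of \<mu> UNIV] unfolding M_def by linarith
  define T2 where "T2 = 8 * M * (64 * V + 1)"
  have T2: "0 \<le> T2" using M V by (simp add: T2_def)
  have thin2: "thin (T2 / (8 * M) - 1) {x. ennreal T2 < log_pot \<mu> x}"
    using M T2 by (intro thin_log_pot_greater[OF m]) (auto simp: M_def emeasure_eq_measure intro!: ennreal_leI)
  have "T2 / (8 * M) - 1 = 64 * V" using M by (simp add: T2_def)
  with thin2 have thin2: "thin (64 * V) {x. ennreal T2 < log_pot \<mu> x}" by simp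
  \<comment> \<open>\<open>O2\<close> is open and contains the compact \<open>K2\<close>, so points
    outside \<open>O2\<close> have a positive distance \<open>d\<close> from \<open>K2\<close>. Once
    \<open>T \<ge> - ln d\<close>, the kernel from such a point to \<open>K2\<close> never exceeds
    \<open>T\<close>.\<close>
  define O2 where "O2 = {x. ennreal T2 < log_pot \<mu> x}"
  have O2: "open O2" unfolding O2_def by (rule open_log_pot_greater[OF m(1)])
  have "K2 \<inter> - O2 = {}" using K2(2) by (auto simp: N_def O2_def)
  then have "\<exists>d>0. \<forall>x\<in>K2. \<forall>y\<in>- O2. d \<le> dist x y"
    using K2(1) O2 by (intro separate_compact_closed) (auto simp: closed_Compl)
  then obtain d where d: "0 < d" "\<And>x y. x \<in> K2 \<Longrightarrow> y \<notin> O2 \<Longrightarrow> d \<le> dist x y" by blast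
  define T where "T = max (real n + 1) (- ln d)"
  have T: "real n + 1 \<le> T" "- ln d \<le> T" "0 \<le> T" by (auto simp: T_def)
  have "tail_pot T \<mu> x \<le> ennreal s" if x1: "x \<notin> O2" and x2: "log_pot \<rho> x \<le> ennreal s'" for x
  proof -
    let ?f = "\<lambda>y. log_kernel x y * indicator {y. ennreal T < log_kernel x y} y"
    have fm: "?f \<in> borel_measurable \<mu>"
      using mk[of x] measurable_log_kernel_tail[of T x] m(1) by (intro borel_measurable_times_ennreal) auto
    have p1: "(\<integral>\<^sup>+y. indicator K1 y * ?f y \<partial>\<mu>) \<le> ennreal (2 * s')"
    proof (cases "K1 = {}")
      case False
      obtain x' where x': "x' \<in> K1" "\<And>t. t \<in> K1 \<Longrightarrow> cmod (x' - t) \<le> 2 * cmod (x - t)"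
        using nearest_point_kernel[OF K1(1) False, of x] by blast
      have "(\<integral>\<^sup>+y. indicator K1 y * ?f y \<partial>\<mu>)
        \<le> (\<integral>\<^sup>+y. 2 * (log_kernel x' y * indicator {y. ennreal (real n) < log_kernel x' y} y) \<partial>\<mu>)"
      proof (rule nn_integral_mono)
        fix y show "indicator K1 y * ?f y \<le> 2 * (log_kernel x' y * indicator {y. ennreal (real n) < log_kernel x' y} y)"
        proof (cases "y \<in> K1")
          case True
          then show ?thesis using tail_pot_nearest[OF x'(2)[OF True], of "real n" T] n(2) T(1) by simp
        qed simp
      qed
      also have "\<dots> = 2 * tail_pot (real n) \<mu> x'"
        unfolding tail_pot_def using mk[of x'] measurable_log_kernel_tail[of "real n" x'] m(1)
        by (intro nn_integral_cmult borel_measurable_times_ennreal) auto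
      also have "tail_pot (real n) \<mu> x' \<le> ennreal s'"
        using x'(1) K1(2) by (auto simp: A_def E_def N_def less_top[symmetric] not_less)
      finally show ?thesis using s' by (simp add: ennreal_mult mult_left_mono)
    qed (use s' in simp)
    have p2: "indicator K2 y * ?f y = 0" for y
    proof (cases "y \<in> K2")
      case True
      then have "d \<le> cmod (x - y)" using d(2)[OF True x1] by (simp add: dist_norm norm_minus_commute)
      then have "x \<noteq> y" "- ln (cmod (x - y)) \<le> T" using d(1) T(2) ln_mono[of d "cmod (x - y)"] by auto
      then have "log_kernel x y \<le> ennreal T" using T(3) by (auto simp: log_kernel_def intro!: ennreal_leI)
      then show ?thesis by (simp add: indicator_def not_less)
    qed simp
    have "tail_pot T \<mu> x \<le> (\<integral>\<^sup>+y. indicator K1 y * ?f y + indicator R y * log_kernel x y \<partial>\<mu>)"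
      unfolding tail_pot_def
    proof (rule nn_integral_mono)
      fix y show "?f y \<le> indicator K1 y * ?f y + indicator R y * log_kernel x y"
        using p2[of y] by (auto simp: R_def indicator_def split: if_splits)
    qed
    also have "\<dots> = (\<integral>\<^sup>+y. indicator K1 y * ?f y \<partial>\<mu>) + log_pot \<rho> x"
      unfolding pot\<rho> using fm mk[of x] K1b Rb m(1)
      by (intro nn_integral_add borel_measurable_times_ennreal) auto
    also have "\<dots> \<le> ennreal (2 * s') + ennreal s'" by (intro add_mono p1 x2)
    also have "\<dots> \<le> ennreal s" using s' by (subst ennreal_plus[symmetric]) (auto simp: s'_def intro!: ennreal_leI)
    finally show ?thesis .
  qed
  then have "tail_pot T \<mu> x \<le> ennreal s" if "x \<notin> O2 \<union> {x. ennreal s' < log_pot \<rho> x}" for x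
    using that by (auto simp: not_less)
  moreover have "thin V (O2 \<union> {x. ennreal s' < log_pot \<rho> x})"
    using thin2 thin1 V unfolding O2_def by (rule thin_Un)
  moreover have "open (O2 \<union> {x. ennreal s' < log_pot \<rho> x})"
    using O2 open_log_pot_greater[OF s\<rho>] by auto
  ultimately show ?thesis using that T(3) by blast
qed

text \<open>A measure on the image is pulled back by the inverse \<open>S\<close>. As
  \<open>T\<close> stretches distances by at most \<open>L\<close>, the kernel of the pulled-back
  points grows by at most \<open>ln L\<close>, and so does the energy of a probability measure.
  Continuity of \<open>S\<close> keeps images of open sets open and pulls compact sets back to
  compact ones.\<close>

lemma thin_image:
  assumes E: "thin V E" and ST: "\<And>x. S (T x) = x" "\<And>x. T (S x) = x"
    and S: "continuous_on UNIV S"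
    and L: "\<And>a b. cmod (T a - T b) \<le> L * cmod (a - b)" "1 \<le> L"
  shows "thin (V - ln L) (T ` E)"
proof -
  obtain U where U: "open U" "E \<subseteq> U"
    "\<And>K \<nu>. compact K \<Longrightarrow> K \<subseteq> U \<Longrightarrow> \<nu> \<in> prob_measures_on K \<Longrightarrow> ennreal V \<le> pos_energy \<nu>"
    using E unfolding thin_def by blast
  have TU: "T ` U = S -` U" using ST by (auto simp: image_iff) (metis)
  show ?thesis unfolding thin_def
  proof (intro exI[of _ "T ` U"] conjI allI impI)
    show "open (T ` U)" unfolding TU using S U(1) by (simp add: continuous_on_open_vimage)
    fix K \<nu> assume *: "compact K \<and> K \<subseteq> T ` U \<and> \<nu> \<in> prob_measures_on K"
    note \<nu> = prob_measures_onD[of \<nu> K]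
    have s: "sets \<nu> = sets borel" "finite_measure \<nu>" "space \<nu> = UNIV" using * \<nu> by auto
    have Sm: "S \<in> borel_measurable \<nu>"
      using borel_measurable_continuous_onI[OF S] s(1) by (simp cong: measurable_cong_sets)
    define \<nu>' where "\<nu>' = distr \<nu> borel S"
    have cSK: "compact (S ` K)" using * S by (auto intro: compact_continuous_image continuous_on_subset)
    have "emeasure \<nu>' (S ` K) = emeasure \<nu> (S -` S ` K \<inter> space \<nu>)"
      unfolding \<nu>'_def using Sm cSK by (intro emeasure_distr) (auto simp: borel_closed compact_imp_closed)
    also have "S -` S ` K \<inter> space \<nu> = K" using s(3) ST(2) by (auto simp: image_iff) metis
    finally have "emeasure \<nu>' (S ` K) = 1" using * \<nu> by simp
    moreover have "emeasure \<nu>' UNIV = 1"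
      unfolding \<nu>'_def using Sm s * \<nu>(4) by (subst emeasure_distr) auto
    ultimately have p: "\<nu>' \<in> prob_measures_on (S ` K)" by (simp add: prob_measures_on_def \<nu>'_def)
    have le: "log_kernel (S x) (S y) \<le> log_kernel x y + ennreal (ln L)" for x y
    proof (cases "x = y \<or> S x = S y")
      case True
      then have "x = y" using ST(2) by metis
      then show ?thesis by (simp add: log_kernel_def)
    next
      case False
      have "ln (cmod (x - y)) \<le> ln (L * cmod (S x - S y))"
        using L(1)[of "S x" "S y"] False ST(2) by (intro ln_mono) auto
      then have "- ln (cmod (S x - S y)) \<le> - ln (cmod (x - y)) + ln L"
        using False L(2) by (simp add: ln_mult)
      then have "ennreal (max 0 (- ln (cmod (S x - S y)))) \<le> ennreal (max 0 (- ln (cmod (x - y))) + ln L)"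
        using L(2) by (intro ennreal_leI) auto
      also have "\<dots> = ennreal (max 0 (- ln (cmod (x - y)))) + ennreal (ln L)"
        using L(2) by (subst ennreal_plus) auto
      finally show ?thesis using False by (simp add: log_kernel_def)
    qed
    have mk: "log_kernel x \<in> borel_measurable \<nu>" for x
      using s(1) measurable_log_kernel by (simp cong: measurable_cong_sets)
    have pm: "log_pot \<nu> \<in> borel_measurable \<nu>"
      using measurable_log_pot[OF s(1,2)] s(1) by (simp cong: measurable_cong_sets)
    have potle: "log_pot \<nu>' (S x) \<le> log_pot \<nu> x + ennreal (ln L)" for x
    proof -
      have "log_pot \<nu>' (S x) = (\<integral>\<^sup>+y. log_kernel (S x) (S y) \<partial>\<nu>)"
        unfolding log_pot_def \<nu>'_def using Sm by (intro nn_integral_distr) auto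
      also have "\<dots> \<le> (\<integral>\<^sup>+y. log_kernel x y + ennreal (ln L) \<partial>\<nu>)" by (intro nn_integral_mono le)
      also have "\<dots> = log_pot \<nu> x + ennreal (ln L)"
        unfolding log_pot_def using mk * \<nu>(4) s(3) by (subst nn_integral_add) auto
      finally show ?thesis .
    qed
    have s': "sets \<nu>' = sets borel" "finite_measure \<nu>'" using prob_measures_onD[OF p] by auto
    have "ennreal V \<le> pos_energy \<nu>'"
      using * cSK p ST by (intro U(3)[OF cSK _ p]) auto
    also have "\<dots> = (\<integral>\<^sup>+x. log_pot \<nu>' (S x) \<partial>\<nu>)"
      unfolding pos_energy_def using measurable_log_pot[OF s'] Sm
      by (subst \<nu>'_def, intro nn_integral_distr) (auto simp: \<nu>'_def)
    also have "\<dots> \<le> (\<integral>\<^sup>+x. log_pot \<nu> x + ennreal (ln L) \<partial>\<nu>)" by (intro nn_integral_mono potle)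
    also have "\<dots> = pos_energy \<nu> + ennreal (ln L)"
      unfolding pos_energy_def using pm * \<nu>(4) s(3) by (subst nn_integral_add) auto
    finally have "ennreal V \<le> pos_energy \<nu> + ennreal (ln L)" .
    then show "ennreal (V - ln L) \<le> pos_energy \<nu>"
    proof (cases "pos_energy \<nu>")
      case (real J)
      then have "ennreal V \<le> ennreal (J + ln L)"
        using \<open>ennreal V \<le> pos_energy \<nu> + ennreal (ln L)\<close> L(2) by (simp add: ennreal_plus)
      moreover have "0 \<le> J + ln L" using real L(2) by simp
      ultimately have "V \<le> J + ln L" by (simp add: ennreal_le_iff del: ennreal_plus)
      then show ?thesis using real by (auto intro!: ennreal_leI)
    qed simp
  qed (use U in auto)
qed

section \<open>Comparison of thinness with logarithmic capacity\<close>

lemma log_energy_eq: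
  assumes K: "compact K" "K \<subseteq> ball 0 R" and R: "1 \<le> R" and \<nu>K: "\<nu> \<in> prob_measures_on K"
  shows "\<exists>c. 0 \<le> c \<and> c \<le> ln (2 * R) \<and> log_energy \<nu> = enn2ereal (pos_energy \<nu>) - ereal c"
proof -
  note \<nu> = prob_measures_onD[OF \<nu>K]
  interpret finite_measure \<nu> by (rule \<nu>(3))
  have Kb: "K \<in> sets \<nu>" using K(1) \<nu>(1) by (simp add: borel_closed compact_imp_closed)
  have eq: "sets (\<nu> \<Otimes>\<^sub>M \<nu>) = sets (borel \<Otimes>\<^sub>M borel :: (complex \<times> complex) measure)"
    using \<nu>(1) by (intro sets_pair_measure_cong) auto
  have m1: "(\<lambda>p. log_kernel (fst p) (snd p)) \<in> borel_measurable (\<nu> \<Otimes>\<^sub>M \<nu>)"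
    using eq measurable_log_kernel_pair by (simp cong: measurable_cong_sets)
  define n where "n = (\<lambda>p::complex \<times> complex. if fst p = snd p then 0 else ennreal (max 0 (ln (cmod (fst p - snd p)))))"
  have "n \<in> borel_measurable (borel \<Otimes>\<^sub>M borel)"
  proof -
    have "Measurable.pred (borel \<Otimes>\<^sub>M borel) (\<lambda>p::complex \<times> complex. fst p = snd p)"
      by measurable
    then show ?thesis unfolding n_def by measurable
  qed
  then have m2: "n \<in> borel_measurable (\<nu> \<Otimes>\<^sub>M \<nu>)"
    using eq by (simp cong: measurable_cong_sets)
  have pos: "(\<integral>\<^sup>+ p. (if fst p = snd p then \<infinity> else ennreal (max 0 (- ln (cmod (fst p - snd p))))) \<partial>(\<nu> \<Otimes>\<^sub>M \<nu>))
      = pos_energy \<nu>"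
    unfolding pos_energy_def log_pot_def using nn_integral_fst[OF m1] by (simp add: log_kernel_def[abs_def])
  have AEK: "AE x in \<nu>. x \<in> K"
  proof -
    have "emeasure \<nu> (space \<nu> - K) = 0"
      using emeasure_compl[OF Kb] \<nu>(2,4,5) by simp
    then show ?thesis using sets.compl_sets[OF Kb] \<nu>(2) by (intro AE_I[of _ _ "space \<nu> - K"]) auto
  qed
  \<comment> \<open>Points of a ball of radius \<open>R\<close> are less than \<open>2 R\<close>
    apart, so the negative part of the kernel is bounded. The subtrahend in
    \<open>log_energy\<close> is therefore a finite constant and no difference of infinities
    occurs.\<close>
  have nK: "n (x, y) \<le> ennreal (ln (2 * R))" if "x \<in> K" "y \<in> K" for x y
  proof (cases "x = y")
    case False
    have "cmod x < R" "cmod y < R" using that K(2) by auto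
    then have "cmod (x - y) \<le> 2 * R" using norm_triangle_ineq4[of x y] by linarith
    then have "ln (cmod (x - y)) \<le> ln (2 * R)" using False by (intro ln_mono) auto
    then show ?thesis using False R by (auto simp: n_def intro!: ennreal_leI)
  qed (simp add: n_def)
  have "integral\<^sup>N (\<nu> \<Otimes>\<^sub>M \<nu>) n = (\<integral>\<^sup>+x. \<integral>\<^sup>+y. n (x, y) \<partial>\<nu> \<partial>\<nu>)"
    using nn_integral_fst[OF m2] by simp
  also have "\<dots> \<le> (\<integral>\<^sup>+x. \<integral>\<^sup>+y. ennreal (ln (2 * R)) \<partial>\<nu> \<partial>\<nu>)"
    using AEK
  proof (intro nn_integral_mono_AE, eventually_elim)
    case (elim x)
    show ?case using AEK by (intro nn_integral_mono_AE, eventually_elim) (rule nK[OF elim(2)])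
  qed
  also have "\<dots> = ennreal (ln (2 * R))" using \<nu>(2,4) by simp
  finally have le: "integral\<^sup>N (\<nu> \<Otimes>\<^sub>M \<nu>) n \<le> ennreal (ln (2 * R))" .
  then obtain c where c: "integral\<^sup>N (\<nu> \<Otimes>\<^sub>M \<nu>) n = ennreal c" "0 \<le> c"
    by (cases "integral\<^sup>N (\<nu> \<Otimes>\<^sub>M \<nu>) n") (auto simp: top_unique)
  have "log_energy \<nu> = enn2ereal (pos_energy \<nu>) - ereal c"
    using pos c unfolding log_energy_def n_def by (simp add: enn2ereal_ennreal)
  moreover have "c \<le> ln (2 * R)" using le c R by (simp add: ennreal_le_iff)
  ultimately show ?thesis using c(2) by blast
qed

lemma bounded_ball_1:
  assumes "bounded (E::complex set)" obtains R where "1 \<le> R" "E \<subseteq> ball 0 R"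
proof -
  obtain r where "E \<subseteq> ball 0 r" using bounded_subset_ballD[OF assms, of 0] by blast
  then have "E \<subseteq> ball 0 (max 1 r)" by auto
  then show ?thesis using that[of "max 1 r"] by simp
qed

text \<open>The subtracted part can only lower the logarithmic energy. Hence a measure with positive
  energy \<open>J < V\<close> forces the Robin constant down to \<open>J\<close> and the capacity up
  to more than \<open>exp (- V)\<close>.\<close>

lemma thin_of_outer_log_cap:
  assumes "outer_log_cap E < ereal (exp (- V))"
  shows "thin V E"
proof -
  obtain U where U: "open U" "E \<subseteq> U" "inner_log_cap U < ereal (exp (- V))"
    using assms unfolding outer_log_cap_def by (auto simp: INF_less_iff)
  show ?thesis unfolding thin_def
  proof (intro exI[of _ U] conjI allI impI)
    fix K \<nu> assume *: "compact K \<and> K \<subseteq> U \<and> \<nu> \<in> prob_measures_on K"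
    have cap: "log_cap_compact K < ereal (exp (- V))"
    proof -
      have "log_cap_compact K \<le> inner_log_cap U"
        unfolding inner_log_cap_def using * by (intro SUP_upper) auto
      then show ?thesis using U(3) by simp
    qed
    obtain R where R: "1 \<le> R" "K \<subseteq> ball 0 R"
      using bounded_ball_1 * compact_imp_bounded by blast
    \<comment> \<open>This excludes the value minus infinity, at which \<open>real_of_ereal\<close>
      would return the default 0.\<close>
    have low: "ereal (- ln (2 * R)) \<le> robin_const K"
      unfolding robin_const_def
    proof (rule INF_greatest)
      fix \<mu> assume "\<mu> \<in> prob_measures_on K"
      then obtain c where c: "0 \<le> c" "c \<le> ln (2 * R)" "log_energy \<mu> = enn2ereal (pos_energy \<mu>) - ereal c"
        using log_energy_eq[OF _ R(2,1), of \<mu>] * by blast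
      show "ereal (- ln (2 * R)) \<le> log_energy \<mu>"
        unfolding c(3) using c(1,2) enn2ereal_nonneg[of "pos_energy \<mu>"]
        by (cases "enn2ereal (pos_energy \<mu>)") auto
    qed
    show "ennreal V \<le> pos_energy \<nu>"
    proof (rule ccontr)
      assume neg: "\<not> ?thesis"
      then obtain J where J: "pos_energy \<nu> = ennreal J" "0 \<le> J" by (cases "pos_energy \<nu>") (auto simp: top_unique)
      then have JV: "J < V" using neg by (simp add: not_le ennreal_less_iff)
      obtain c where c: "0 \<le> c" "log_energy \<nu> = enn2ereal (pos_energy \<nu>) - ereal c"
        using log_energy_eq[OF _ R(2,1), of \<nu>] * by blast
      have "robin_const K \<le> log_energy \<nu>" unfolding robin_const_def using * by (intro INF_lower) auto
      also have "\<dots> \<le> ereal J" unfolding c(2) using J c(1) by (simp add: enn2ereal_ennreal)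
      finally obtain r where r: "robin_const K = ereal r" "r \<le> J"
        using low by (cases "robin_const K") auto
      then show False using cap JV by (simp add: log_cap_compact_def)
    qed
  qed (use U in auto)
qed

text \<open>Inside a ball of radius \<open>R\<close> the logarithmic energy is below the positive
  energy by at most \<open>ln (2 R)\<close>, so thinness \<open>V\<close> gives capacity at most
  \<open>2 R exp (- V)\<close>. Boundedness of \<open>E\<close> is what makes this constant
  available.\<close>

lemma log_cap_zero_of_thin:
  assumes "bounded E" "\<And>V. thin V E"
  shows "log_cap_zero E"
proof -
  obtain R where R: "1 \<le> R" "E \<subseteq> ball 0 R" using bounded_ball_1[OF assms(1)] by blast
  \<comment> \<open>With no probability measure on the empty set the infimum is infinite. The empty
    compact set later supplies the lower bound 0 for the outer capacity.\<close>
  have cap0: "log_cap_compact {} = 0"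
    by (simp add: log_cap_compact_def robin_const_def prob_measures_on_def top_ereal_def)
  have "outer_log_cap E \<le> ereal (2 * R * exp (- V))" if V0: "0 \<le> V" for V
  proof -
    obtain U where U: "open U" "E \<subseteq> U"
      "\<And>K \<nu>. compact K \<Longrightarrow> K \<subseteq> U \<Longrightarrow> \<nu> \<in> prob_measures_on K \<Longrightarrow> ennreal V \<le> pos_energy \<nu>"
      using assms(2)[of V] unfolding thin_def by blast
    have "outer_log_cap E \<le> inner_log_cap (U \<inter> ball 0 R)"
      unfolding outer_log_cap_def using U R by (intro INF_lower) auto
    also have "\<dots> \<le> ereal (2 * R * exp (- V))"
      unfolding inner_log_cap_def
    proof (rule SUP_least)
      fix K assume "K \<in> {K. compact K \<and> K \<subseteq> U \<inter> ball 0 R}"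
      then have K: "compact K" "K \<subseteq> U" "K \<subseteq> ball 0 R" by auto
      have low: "ereal (V - ln (2 * R)) \<le> robin_const K"
        unfolding robin_const_def
      proof (rule INF_greatest)
        fix \<mu> assume \<mu>: "\<mu> \<in> prob_measures_on K"
        then obtain c where c: "c \<le> ln (2 * R)" "log_energy \<mu> = enn2ereal (pos_energy \<mu>) - ereal c"
          using log_energy_eq[OF K(1,3) R(1) \<mu>] by blast
        have "ennreal V \<le> pos_energy \<mu>" by (rule U(3)[OF K(1,2) \<mu>])
        then have "ereal V \<le> enn2ereal (pos_energy \<mu>)"
          using V0 by (metis enn2ereal_ennreal less_eq_ennreal.rep_eq)
        then show "ereal (V - ln (2 * R)) \<le> log_energy \<mu>"
          unfolding c(2) using c(1) by (cases "enn2ereal (pos_energy \<mu>)") auto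
      qed
      show "log_cap_compact K \<le> ereal (2 * R * exp (- V))"
      proof (cases "robin_const K")
        case (real r)
        then have "exp (- r) \<le> exp (ln (2 * R) - V)" using low by simp
        also have "\<dots> = 2 * R * exp (- V)" using R(1) by (simp add: exp_diff exp_minus divide_inverse)
        finally show ?thesis using real by (simp add: log_cap_compact_def)
      qed (use low R in \<open>auto simp: log_cap_compact_def\<close>)
    qed
    finally show ?thesis .
  qed
  then have le: "outer_log_cap E \<le> ereal \<epsilon>" if "0 < \<epsilon>" for \<epsilon>
  proof -
    define V where "V = max 0 (ln (2 * R / \<epsilon>))"
    have "exp (- V) \<le> exp (- ln (2 * R / \<epsilon>))" by (simp add: V_def)
    also have "\<dots> = \<epsilon> / (2 * R)" using R(1) that by (simp add: exp_minus)
    finally have "2 * R * exp (- V) \<le> \<epsilon>" using R(1) by (simp add: field_simps)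
    then show ?thesis using \<open>\<And>V. 0 \<le> V \<Longrightarrow> outer_log_cap E \<le> ereal (2 * R * exp (- V))\<close>[of V]
      by (simp add: V_def) (meson ereal_less_eq(3) order_trans)
  qed
  have "outer_log_cap E \<le> 0"
    by (rule ereal_le_epsilon2) (use le in \<open>auto simp: zero_ereal_def\<close>)
  moreover have "0 \<le> outer_log_cap E"
    unfolding outer_log_cap_def
  proof (rule INF_greatest)
    fix U assume "U \<in> {U. open U \<and> E \<subseteq> U}"
    have "log_cap_compact {} \<le> inner_log_cap U"
      unfolding inner_log_cap_def by (intro SUP_upper) auto
    then show "0 \<le> inner_log_cap U" by (simp add: cap0)
  qed
  ultimately show ?thesis by (simp add: log_cap_zero_def)
qed

section \<open>Quasicontinuity of functions measurable with respect to capacity\<close>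

lemma cap_measurable_quasicontinuous:
  assumes \<phi>: "cap_measurable_fun S \<phi>" and V: "0 \<le> V"
  obtains G where "open G" "thin V G" "continuous_on (S - G) \<phi>"
proof -
  obtain B :: "real set set" where B: "countable B" "topological_basis B"
    using ex_countable_basis by blast
  define b where "b = (\<lambda>i. if B = {} then {} else from_nat_into B i)"
  have bo: "open (b i)" for i
    using B by (auto simp: b_def from_nat_into topological_basis_open)
  have bsurj: "\<exists>i. W = b i" if "W \<in> B" for W
    using that B(1) from_nat_into_surj[of B W] by (auto simp: b_def)
  \<comment> \<open>Lusin's argument, one basic open set at a time. Capacity below
    \<open>exp (- 4 ^ (i + 2) V)\<close> is thinness with the weight that \<open>thin_UN\<close>
    asks for, and replacing \<open>U - C\<close> by an open superset makes the union of all
    exceptional sets open.\<close>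
  have "\<exists>C U Q. openin (top_of_set S) U \<and> C \<subseteq> \<phi> -` b i \<inter> S \<and> \<phi> -` b i \<inter> S \<subseteq> U
      \<and> open Q \<and> U - C \<subseteq> Q \<and> thin (4 ^ (i + 2) * V) Q" for i
  proof -
    have "cap_measurable_set S (\<phi> -` b i \<inter> S)" using \<phi> bo by (auto simp: cap_measurable_fun_def)
    then obtain C U where "openin (top_of_set S) U" "C \<subseteq> \<phi> -` b i \<inter> S" "\<phi> -` b i \<inter> S \<subseteq> U"
      "outer_log_cap (U - C) < ereal (exp (- (4 ^ (i + 2) * V)))"
      unfolding cap_measurable_set_def by (metis exp_gt_zero)
    moreover obtain Q where "open Q" "U - C \<subseteq> Q" "thin (4 ^ (i + 2) * V) Q"
      using thin_of_outer_log_cap[OF calculation(4)] by (rule thin_open_superset)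
    ultimately show ?thesis by blast
  qed
  then obtain C U Q where CU: "\<And>i. openin (top_of_set S) (U i)" "\<And>i. C i \<subseteq> \<phi> -` b i \<inter> S"
    "\<And>i. \<phi> -` b i \<inter> S \<subseteq> U i" "\<And>i. open (Q i)" "\<And>i. U i - C i \<subseteq> Q i" "\<And>i. thin (4 ^ (i + 2) * V) (Q i)"
    by metis
  define G where "G = (\<Union>i. Q i)"
  \<comment> \<open>A point of \<open>U i\<close> outside the preimage lies in
    \<open>U i - C i\<close> and hence in \<open>G\<close>. Off \<open>G\<close> the preimage is
    thus cut out by a relatively open set.\<close>
  have pre: "(S - G) \<inter> \<phi> -` b i = (S - G) \<inter> U i" for i
    using CU(2,3,5)[of i] by (auto simp: G_def)
  have opre: "openin (top_of_set (S - G)) ((S - G) \<inter> \<phi> -` b i)" for i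
  proof -
    obtain W where "open W" "U i = S \<inter> W" using CU(1)[of i] by (auto simp: openin_open)
    then have "(S - G) \<inter> \<phi> -` b i = (S - G) \<inter> W" unfolding pre by auto
    then show ?thesis using \<open>open W\<close> by (auto simp: openin_open)
  qed
  have "continuous_on (S - G) \<phi>"
    unfolding continuous_openin_preimage_eq
  proof (intro allI impI)
    fix W :: "real set" assume "open W"
    then obtain B' where B': "B' \<subseteq> B" "\<Union>B' = W" using B(2) by (auto simp: topological_basis_def)
    have "(S - G) \<inter> \<phi> -` W = (\<Union>w\<in>B'. (S - G) \<inter> \<phi> -` w)" using B'(2) by auto
    also have "openin (top_of_set (S - G)) \<dots>"
    proof (rule openin_Union)
      fix X assume "X \<in> (\<lambda>w. (S - G) \<inter> \<phi> -` w) ` B'"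
      then obtain w where w: "w \<in> B" "X = (S - G) \<inter> \<phi> -` w" using B'(1) by auto
      then obtain i where "w = b i" using bsurj by blast
      then show "openin (top_of_set (S - G)) X" using w opre by simp
    qed
    finally show "openin (top_of_set (S - G)) ((S - G) \<inter> \<phi> -` W)" .
  qed
  moreover have "open G" "thin V G" using CU(4) thin_UN[OF CU(6) V] by (auto simp: G_def)
  ultimately show ?thesis using that by blast
qed

section \<open>The Schwarz integral\<close>

text \<open>Normalised arc length, taken as a Borel measure on the whole plane so that integrands
  need no restriction to the circle; \<open>AE_circ\<close> recovers the support.\<close>

definition circ :: "complex measure" where
  "circ = distr (density lborel (\<lambda>\<theta>. ennreal (indicator {-pi..pi} \<theta> / (2 * pi)))) borel cis"

lemma sets_circ [simp, measurable_cong]: "sets circ = sets borel"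
  and space_circ [simp]: "space circ = UNIV"
  by (auto simp: circ_def)

lemma cis_measurable [measurable]: "cis \<in> borel_measurable borel"
  by (intro borel_measurable_continuous_onI continuous_intros)

lemma emeasure_circ:
  assumes "A \<in> sets borel"
  shows "emeasure circ A = ennreal (1 / (2 * pi)) * emeasure lborel ({-pi..pi} \<inter> cis -` A)"
proof -
  have cA: "cis -` A \<in> sets borel"
    using measurable_sets[OF cis_measurable assms] by simp
  have "emeasure circ A = (\<integral>\<^sup>+ \<theta>. ennreal (indicator {-pi..pi} \<theta> / (2 * pi)) * indicator (cis -` A) \<theta> \<partial>lborel)"
    unfolding circ_def using assms cA by (subst emeasure_distr) (auto simp: emeasure_density)
  also have "\<dots> = (\<integral>\<^sup>+ \<theta>. ennreal (1 / (2 * pi)) * indicator ({-pi..pi} \<inter> cis -` A) \<theta> \<partial>lborel)"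
    by (intro nn_integral_cong) (auto simp: indicator_def)
  also have "\<dots> = ennreal (1 / (2 * pi)) * emeasure lborel ({-pi..pi} \<inter> cis -` A)"
    using cA by (subst nn_integral_cmult_indicator) auto
  finally show ?thesis .
qed

lemma emeasure_circ_UNIV: "emeasure circ UNIV = 1"
  using emeasure_circ[of UNIV] by (simp add: ennreal_mult[symmetric] del: ennreal_1 flip: ennreal_1)

interpretation circ: finite_measure circ
  by (rule finite_measureI) (simp add: emeasure_circ_UNIV)

lemma measure_circ_UNIV [simp]: "measure circ UNIV = 1"
  by (simp add: measure_def emeasure_circ_UNIV)

lemma AE_circ: "AE \<zeta> in circ. cmod \<zeta> = 1"
proof -
  have "{\<zeta>. cmod \<zeta> = 1} \<in> sets borel" by measurable
  then have "(AE \<zeta> in circ. cmod \<zeta> = 1) \<longleftrightarrow>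
      (AE \<theta> in density lborel (\<lambda>\<theta>. ennreal (indicator {-pi..pi} \<theta> / (2 * pi))). cmod (cis \<theta>) = 1)"
    unfolding circ_def by (intro AE_distr_iff) auto
  then show ?thesis by simp
qed

lemma circ_integral:
  fixes f :: "complex \<Rightarrow> complex"
  assumes "f \<in> borel_measurable borel"
  shows "(\<integral>\<zeta>. f \<zeta> \<partial>circ) = (\<integral>\<theta>. indicator {-pi..pi} \<theta> *\<^sub>R (f (cis \<theta>) / (2 * pi)) \<partial>lborel)"
proof -
  have "(\<integral>\<zeta>. f \<zeta> \<partial>circ) = (\<integral>\<theta>. f (cis \<theta>) \<partial>density lborel (\<lambda>\<theta>. ennreal (indicator {-pi..pi} \<theta> / (2 * pi))))"
    unfolding circ_def using assms by (intro integral_distr) auto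
  also have "\<dots> = (\<integral>\<theta>. (indicator {-pi..pi} \<theta> / (2 * pi)) *\<^sub>R f (cis \<theta>) \<partial>lborel)"
    using assms by (intro integral_density) auto
  also have "\<dots> = (\<integral>\<theta>. indicator {-pi..pi} \<theta> *\<^sub>R (f (cis \<theta>) / (2 * pi)) \<partial>lborel)"
    by (intro Bochner_Integration.integral_cong) (auto simp: scaleR_conv_of_real)
  finally show ?thesis .
qed

lemma circ_bounded:
  fixes f :: "complex \<Rightarrow> 'b::{banach,second_countable_topology}"
  assumes "f \<in> borel_measurable borel" "\<And>\<zeta>. cmod \<zeta> = 1 \<Longrightarrow> norm (f \<zeta>) \<le> B"
  shows "integrable circ f" "norm (\<integral>\<zeta>. f \<zeta> \<partial>circ) \<le> B"
proof -
  have AE: "AE \<zeta> in circ. norm (f \<zeta>) \<le> B" using AE_circ by eventually_elim (rule assms(2))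
  show i: "integrable circ f"
    using assms(1) AE by (intro circ.integrable_const_bound[of _ B]) (auto cong: measurable_cong_sets)
  have "norm (\<integral>\<zeta>. f \<zeta> \<partial>circ) \<le> (\<integral>\<zeta>. norm (f \<zeta>) \<partial>circ)" by (rule integral_norm_bound)
  also have "\<dots> \<le> (\<integral>\<zeta>. B \<partial>circ)"
    using AE i by (intro integral_mono_AE) auto
  also have "\<dots> = B" by simp
  finally show "norm (\<integral>\<zeta>. f \<zeta> \<partial>circ) \<le> B" .
qed

lemma circ_mono:
  fixes f g :: "complex \<Rightarrow> real"
  assumes "integrable circ f" "integrable circ g" "\<And>\<zeta>. cmod \<zeta> = 1 \<Longrightarrow> f \<zeta> \<le> g \<zeta>"
  shows "(\<integral>\<zeta>. f \<zeta> \<partial>circ) \<le> (\<integral>\<zeta>. g \<zeta> \<partial>circ)"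
  using assms AE_circ by (intro integral_mono_AE) (auto elim!: eventually_mono)

section \<open>Chords, small arcs and the integral of the reciprocal distance\<close>

lemma sin_ge_half: assumes "0 \<le> v" "v \<le> pi / 2" shows "v / 2 \<le> sin v"
\<comment> \<open>At \<open>pi / 3\<close> the cosine equals \<open>1/2\<close>, so
  \<open>sin v - v / 2\<close> increases up to there. Beyond it
  \<open>sin v \<ge> sqrt 3 / 2\<close>, which exceeds \<open>pi / 4\<close>.\<close>
proof (cases "v \<le> pi / 3")
  case True
  have "sin 0 - 0 / 2 \<le> sin v - v / 2"
  proof (rule DERIV_nonneg_imp_nondecreasing[OF assms(1)])
    fix x assume x: "0 \<le> x" "x \<le> v"
    have "cos (pi / 3) \<le> cos x" using x True by (intro cos_monotone_0_pi_le) auto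
    then have "0 \<le> cos x - 1/2" by (simp add: cos_60)
    moreover have "((\<lambda>v. sin v - v / 2) has_real_derivative cos x - 1/2) (at x)"
      by (auto intro!: derivative_eq_intros)
    ultimately show "\<exists>y. ((\<lambda>v. sin v - v / 2) has_real_derivative y) (at x) \<and> 0 \<le> y" by blast
  qed
  then show ?thesis by simp
next
  case False
  have "sin (pi / 3) \<le> sin v" using False assms pi_gt_zero by (intro sin_monotone_2pi_le) auto
  then have "sqrt 3 / 2 \<le> sin v" by (simp add: sin_60)
  moreover have "1.7 \<le> sqrt 3" by (rule real_le_rsqrt) (simp add: power2_eq_square)
  moreover have "pi < 3.2" using pi_approx by simp
  ultimately show ?thesis using assms(2) by simp
qed

lemma cmod_cis_diff: "cmod (cis a - cis b) = 2 * \<bar>sin ((a - b) / 2)\<bar>"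
proof -
  have "cis a - cis b = cis b * (cis (a - b) - 1)" by (simp add: cis_mult algebra_simps)
  then have "cmod (cis a - cis b) = cmod (cis (a - b) - 1)" by (simp add: norm_mult)
  then show ?thesis using dist_exp_i_1[of "a - b"] by (simp add: cis_conv_exp)
qed

lemma cmod_cis_diff_ge:
  assumes "\<bar>a - b\<bar> \<le> pi" shows "\<bar>a - b\<bar> / 2 \<le> cmod (cis a - cis b)"
proof -
  have "\<bar>a - b\<bar> / 2 / 2 \<le> sin (\<bar>a - b\<bar> / 2)" using assms by (intro sin_ge_half) auto
  also have "\<dots> \<le> \<bar>sin ((a - b) / 2)\<bar>"
  proof (cases "0 \<le> a - b")
    case False
    have "sin ((b - a) / 2) = - sin ((a - b) / 2)" by (metis minus_diff_eq minus_divide_left sin_minus)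
    then show ?thesis using False by (simp add: abs_if)
  qed simp
  finally show ?thesis by (simp add: cmod_cis_diff)
qed

text \<open>A chord of length at most \<open>r\<close> means an angle of at most \<open>2 r\<close>.
  Because angles wrap around, three intervals of length \<open>4 r\<close> are needed, and
  \<open>12 r / (2 pi) \<le> 2 r\<close> as \<open>pi > 3\<close>.\<close>

lemma circ_cball:
  assumes x: "cmod x = 1" and r: "0 \<le> r"
  shows "measure circ (cball x r) \<le> 2 * r"
proof -
  define a where "a = Arg x"
  have a: "cis a = x" "-pi < a" "a \<le> pi"
    using x by (auto simp: a_def mpi_less_Arg Arg_le_pi cis_Arg sgn_div_norm)
       (metis cis_Arg norm_zero scaleR_one sgn_div_norm inverse_1 zero_neq_one)
  define I where "I = (\<lambda>c. {c - 2 * r .. c + 2 * r})"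
  have sub: "{-pi..pi} \<inter> cis -` cball x r \<subseteq> I a \<union> I (a + 2 * pi) \<union> I (a - 2 * pi)"
  proof
    fix \<theta> assume "\<theta> \<in> {-pi..pi} \<inter> cis -` cball x r"
    then have \<theta>: "-pi \<le> \<theta>" "\<theta> \<le> pi" "cmod (cis \<theta> - cis a) \<le> r"
      by (auto simp: a(1) dist_norm norm_minus_commute)
    consider "\<bar>\<theta> - a\<bar> \<le> pi" | "\<bar>\<theta> - (a + 2 * pi)\<bar> \<le> pi" | "\<bar>\<theta> - (a - 2 * pi)\<bar> \<le> pi"
      using a \<theta> by linarith
    then show "\<theta> \<in> I a \<union> I (a + 2 * pi) \<union> I (a - 2 * pi)"
    proof cases
      case 1 then show ?thesis using cmod_cis_diff_ge[OF 1] \<theta>(3) by (auto simp: I_def abs_if split: if_splits)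
    next
      case 2
      have "cis (a + 2 * pi) = cis a" by (simp add: cis_mult[symmetric])
      then show ?thesis using cmod_cis_diff_ge[OF 2] \<theta>(3) by (auto simp: I_def abs_if split: if_splits)
    next
      case 3
      have "cis (a - 2 * pi) = cis a" by (simp add: cis_divide[symmetric])
      then show ?thesis using cmod_cis_diff_ge[OF 3] \<theta>(3) by (auto simp: I_def abs_if split: if_splits)
    qed
  qed
  have eI: "emeasure lborel (I c) = ennreal (4 * r)" for c using r by (simp add: I_def)
  have "emeasure lborel ({-pi..pi} \<inter> cis -` cball x r) \<le> emeasure lborel (I a \<union> I (a + 2 * pi) \<union> I (a - 2 * pi))"
    by (intro emeasure_mono sub) (auto simp: I_def)
  also have "\<dots> \<le> emeasure lborel (I a) + emeasure lborel (I (a + 2 * pi)) + emeasure lborel (I (a - 2 * pi))"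
    by (intro order_trans[OF emeasure_subadditive] add_mono emeasure_subadditive) (auto simp: I_def)
  also have "\<dots> = ennreal (12 * r)" unfolding eI using r by (simp flip: ennreal_plus)
  finally have "emeasure circ (cball x r) \<le> ennreal (1 / (2 * pi)) * ennreal (12 * r)"
    by (subst emeasure_circ) (auto intro!: mult_left_mono)
  also have "\<dots> = ennreal (12 * r / (2 * pi))" using r by (simp flip: ennreal_mult)
  also have "\<dots> \<le> ennreal (2 * r)"
    using pi_ge_two r pi_gt3 by (intro ennreal_leI) (auto simp: divide_simps mult_right_mono)
  finally show ?thesis using r by (simp add: circ.emeasure_eq_measure)
qed

text \<open>One summand suffices: the last index \<open>m \<le> N\<close> with
  \<open>\<rho> \<le> 2 / 2 ^ m\<close>. Either \<open>m = N\<close> and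
  \<open>d \<ge> \<tau>\<close> bounds \<open>1 / d\<close>, or the next scale fails and
  \<open>\<rho> \<le> 2 d\<close> does.\<close>

lemma dyadic_kernel_bound:
  fixes \<rho> \<tau> :: real
  assumes "0 < \<tau>" "1 / \<tau> \<le> 2 ^ N" "0 \<le> \<rho>" "\<rho> \<le> 2" "\<tau> \<le> d" "\<rho> \<le> 2 * d"
  shows "1 / d \<le> (\<Sum>n\<le>N. 2 ^ (n + 1) * indicator {t. t \<le> 2 / 2 ^ n} \<rho>)"
proof -
  define P where "P = (\<lambda>n. n \<le> N \<and> \<rho> \<le> 2 / 2 ^ n)"
  have P0: "P 0" using assms by (simp add: P_def)
  define m where "m = (GREATEST n. P n)"
  have m: "P m" "\<And>n. P n \<Longrightarrow> n \<le> m"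
  proof -
    have b: "\<And>n. P n \<Longrightarrow> n \<le> N" by (simp add: P_def)
    show "P m" unfolding m_def by (rule GreatestI_nat[of P 0 N, OF P0 b])
    show "n \<le> m" if "P n" for n unfolding m_def by (rule Greatest_le_nat[of P n N, OF that b])
  qed
  have "1 / d \<le> 2 ^ (m + 1)"
  proof (cases "m = N")
    case True
    have "1 / d \<le> 1 / \<tau>" using assms by (intro divide_left_mono) auto
    then have "1 / d \<le> 2 ^ N" using assms(2) by linarith
    moreover have "(2::real) ^ N \<le> 2 ^ (N + 1)" by simp
    ultimately show ?thesis unfolding True by linarith
  next
    case False
    then have "2 / 2 ^ Suc m < \<rho>" using m(1) m(2)[of "Suc m"] by (intro not_le_imp_less notI) (auto simp: P_def)
    then have "1 / 2 ^ m < 2 * d" using assms by simp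
    then have "1 / d < 2 * 2 ^ m" using assms(1,5) by (simp add: field_simps)
    then show ?thesis by simp
  qed
  also have "\<dots> = (2 ^ (m + 1) * indicator {t. t \<le> 2 / 2 ^ m} \<rho> :: real)" using m(1) by (simp add: P_def)
  also have "\<dots> \<le> (\<Sum>n\<le>N. 2 ^ (n + 1) * indicator {t. t \<le> 2 / 2 ^ n} \<rho>)"
    using m(1) by (intro member_le_sum[where f = "\<lambda>n. 2 ^ (n + 1) * indicator {t. t \<le> 2 / 2 ^ n} \<rho>"]) (auto simp: P_def)
  finally show ?thesis .
qed

lemma circle_dist_ge: "cmod \<zeta> = 1 \<Longrightarrow> 1 - cmod z \<le> cmod (\<zeta> - z)"
  using norm_triangle_ineq2[of \<zeta> z] by simp

text \<open>With \<open>x\<close> the boundary point nearest to \<open>z\<close>, the distance to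
  \<open>x\<close> is at most twice the distance to \<open>z\<close>. Every dyadic scale around
  \<open>x\<close> contributes at most 8 to the integral, and about
  \<open>ln (1 / \<tau>) / ln 2\<close> scales lie between 1 and
  \<open>\<tau> = 1 - \<bar>z\<bar>\<close>. This is where the logarithm comes from.\<close>

lemma circ_inverse_dist:
  assumes z: "cmod z < 1"
  shows "(\<integral>\<zeta>. 1 / cmod (\<zeta> - z) \<partial>circ) \<le> 16 + 16 * ln (1 / (1 - cmod z))"
proof -
  define \<tau> where "\<tau> = 1 - cmod z"
  have \<tau>: "0 < \<tau>" "\<tau> \<le> 1" using z by (auto simp: \<tau>_def)
  define x where "x = (if z = 0 then 1 else sgn z)"
  have x: "cmod x = 1" by (auto simp: x_def norm_sgn)
  have zx: "cmod (z - x) = \<tau>"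
  proof (cases "z = 0")
    case False
    have "z - x = (cmod z - 1) *\<^sub>R sgn z"
      using False by (simp add: x_def algebra_simps) (simp add: sgn_div_norm)
    then show ?thesis using z False by (simp add: \<tau>_def norm_sgn)
  qed (simp add: x_def \<tau>_def)
  define N where "N = nat \<lceil>log 2 (1 / \<tau>)\<rceil>"
  have l0: "0 \<le> log 2 (1 / \<tau>)" using \<tau> by (simp add: zero_le_log_cancel_iff)
  have "1 / \<tau> = 2 powr log 2 (1 / \<tau>)" using \<tau> by simp
  also have "\<dots> \<le> 2 powr real N" by (intro powr_mono) (use l0 in \<open>auto simp: N_def\<close>)
  also have "\<dots> = 2 ^ N" by (simp add: powr_realpow)
  finally have N1: "1 / \<tau> \<le> 2 ^ N" .
  have "real N \<le> log 2 (1 / \<tau>) + 1" using l0 unfolding N_def by linarith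
  also have "log 2 (1 / \<tau>) = ln (1 / \<tau>) / ln 2" by (simp add: log_def)
  also have "\<dots> \<le> ln (1 / \<tau>) / (1/2)"
  proof -
    have "(1/2::real) \<le> ln 2" using ln_ge_iff exp_bound_half by (metis exp_half_le2 zero_less_numeral)
    then show ?thesis using \<tau> by (intro divide_left_mono) auto
  qed
  finally have N2: "real N \<le> 2 * ln (1 / \<tau>) + 1" by simp
  define f where "f = (\<lambda>\<zeta>. \<Sum>n\<le>N. 2 ^ (n + 1) * indicator (cball x (2 / 2 ^ n)) \<zeta> :: real)"
  have le: "1 / cmod (\<zeta> - z) \<le> f \<zeta>" if \<zeta>: "cmod \<zeta> = 1" for \<zeta>
  proof -
    have d: "\<tau> \<le> cmod (\<zeta> - z)" using circle_dist_ge[OF \<zeta>] by (simp add: \<tau>_def)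
    have "cmod (\<zeta> - x) \<le> cmod (\<zeta> - z) + cmod (z - x)" using norm_triangle_ineq[of "\<zeta> - z" "z - x"] by simp
    then have "cmod (\<zeta> - x) \<le> 2 * cmod (\<zeta> - z)" using d zx by simp
    moreover have "cmod (\<zeta> - x) \<le> 2" using norm_triangle_ineq4[of \<zeta> x] \<zeta> x by simp
    ultimately have "1 / cmod (\<zeta> - z) \<le> (\<Sum>n\<le>N. 2 ^ (n + 1) * indicator {t. t \<le> 2 / 2 ^ n} (cmod (\<zeta> - x)))"
      using \<tau> N1 d by (intro dyadic_kernel_bound) auto
    also have "\<dots> = f \<zeta>"
      unfolding f_def by (intro sum.cong) (auto simp: indicator_def dist_norm norm_minus_commute)
    finally show ?thesis .
  qed
  have ci: "integrable circ (indicator (cball x r) :: complex \<Rightarrow> real)" for r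
    by (intro integrable_real_indicator) (auto simp: less_top[symmetric])
  have fi: "integrable circ f" unfolding f_def by (intro Bochner_Integration.integrable_sum integrable_mult_right ci)
  have "(\<integral>\<zeta>. 1 / cmod (\<zeta> - z) \<partial>circ) \<le> (\<integral>\<zeta>. f \<zeta> \<partial>circ)"
  proof (rule circ_mono[OF _ fi le])
    show "integrable circ (\<lambda>\<zeta>. 1 / cmod (\<zeta> - z))"
    proof (rule circ_bounded(1)[where B = "1 / \<tau>"])
      show "norm (1 / cmod (\<zeta> - z)) \<le> 1 / \<tau>" if "cmod \<zeta> = 1" for \<zeta>
        using circle_dist_ge[OF that, of z] \<tau> by (auto simp: \<tau>_def intro!: frac_le)
    qed measurable
  qed
  also have "\<dots> = (\<Sum>n\<le>N. 2 ^ (n + 1) * measure circ (cball x (2 / 2 ^ n)))"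
    unfolding f_def using ci by (subst Bochner_Integration.integral_sum) auto
  also have "\<dots> \<le> (\<Sum>n\<le>N. 2 ^ (n + 1) * (2 * (2 / 2 ^ n)))"
    by (intro sum_mono mult_left_mono circ_cball x) auto
  also have "\<dots> = 8 * (real N + 1)" by (simp add: field_simps)
  also have "\<dots> \<le> 16 + 16 * ln (1 / \<tau>)" using N2 by simp
  finally show ?thesis by (simp add: \<tau>_def)
qed

section \<open>Schwarz integrals of bounded densities\<close>

definition schwarz :: "(complex \<Rightarrow> real) \<Rightarrow> complex \<Rightarrow> complex" where
  "schwarz a z = (\<integral>\<zeta>. of_real (a \<zeta>) * ((\<zeta> + z) / (\<zeta> - z)) \<partial>circ)"

lemma Re_schwarz_kernel:
  assumes "cmod \<zeta> = 1" "cmod z < 1"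
  shows "Re ((\<zeta> + z) / (\<zeta> - z)) = (1 - (cmod z)\<^sup>2) / (cmod (\<zeta> - z))\<^sup>2"
proof -
  have "Re ((\<zeta> + z) / (\<zeta> - z)) = Re ((\<zeta> + z) * cnj (\<zeta> - z)) / (cmod (\<zeta> - z))\<^sup>2"
    by (subst complex_div_cnj) (simp only: Re_divide_of_real flip: of_real_power)
  also have "Re ((\<zeta> + z) * cnj (\<zeta> - z)) = (cmod \<zeta>)\<^sup>2 - (cmod z)\<^sup>2"
    unfolding cmod_power2 by (simp add: power2_eq_square algebra_simps)
  finally show ?thesis using assms by simp
qed

lemma schwarz_kernel_norm:
  assumes "cmod \<zeta> = 1" "cmod z < 1"
  shows "cmod ((\<zeta> + z) / (\<zeta> - z)) \<le> 2 / cmod (\<zeta> - z)"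
  using assms norm_triangle_ineq[of \<zeta> z] by (simp add: norm_divide divide_right_mono)

lemma schwarz_kernel_norm':
  assumes "cmod \<zeta> = 1" "cmod z < 1"
  shows "cmod ((\<zeta> + z) / (\<zeta> - z)) \<le> 2 / (1 - cmod z)"
proof -
  have "2 / cmod (\<zeta> - z) \<le> 2 / (1 - cmod z)"
    using circle_dist_ge[OF assms(1), of z] assms(2) by (intro frac_le) auto
  then show ?thesis using schwarz_kernel_norm[OF assms] by linarith
qed

text \<open>An explicit primitive in the angle is available. The principal logarithm is admissible
  because \<open>1 - z cis (- \<theta>)\<close> stays in the right half plane; it takes equal values
  at \<open>- pi\<close> and \<open>pi\<close>, so only the linear term contributes.\<close>

lemma schwarz_1:
  assumes z: "cmod z < 1" shows "(\<integral>\<zeta>. (\<zeta> + z) / (\<zeta> - z) \<partial>circ) = 1"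
proof -
  define F where "F = (\<lambda>\<theta>::real. (of_real \<theta> - 2 * \<i> * Ln (1 - z * cis (- \<theta>))) / (2 * pi))"
  have re: "0 < Re (1 - z * cis (- \<theta>))" for \<theta>
    using complex_Re_le_cmod[of "z * cis (- \<theta>)"] z by (simp add: norm_mult)
  have ne: "cis \<theta> \<noteq> z" for \<theta> using z by auto
  have cc: "cis \<theta> * cis (- \<theta>) = 1" for \<theta> by (simp add: cis_mult)
  have der: "(F has_vector_derivative ((cis \<theta> + z) / (cis \<theta> - z)) / (2 * pi)) (at \<theta> within {-pi..pi})" for \<theta>
  proof -
    have nz: "1 - z * cis (- \<theta>) \<noteq> 0" using re[of \<theta>] by (metis less_irrefl zero_complex.simps(1))
    have npos: "1 - z * cis (- \<theta>) \<notin> \<real>\<^sub>\<le>\<^sub>0" using re[of \<theta>] by (auto simp: complex_nonpos_Reals_iff)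
    have c: "((\<lambda>\<theta>. cis (- \<theta>)) has_vector_derivative - \<i> * cis (- \<theta>)) (at \<theta> within {-pi..pi})"
    proof -
      have "((\<lambda>w. exp (- (\<i> * w))) has_field_derivative - \<i> * cis (- \<theta>)) (at (of_real \<theta>))"
        by (auto intro!: derivative_eq_intros simp: cis_conv_exp)
      from has_vector_derivative_real_field[OF this] show ?thesis by (simp add: cis_conv_exp)
    qed
    have "((\<lambda>\<theta>. Ln (1 - z * cis (- \<theta>))) has_vector_derivative
        (- (z * (- \<i> * cis (- \<theta>)))) * (1 / (1 - z * cis (- \<theta>)))) (at \<theta> within {-pi..pi})"
    proof -
      have "((\<lambda>\<theta>. 1 - z * cis (- \<theta>)) has_vector_derivative 0 - z * (- \<i> * cis (- \<theta>))) (at \<theta> within {-pi..pi})"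
        by (intro has_vector_derivative_diff has_vector_derivative_const has_vector_derivative_mult_right c)
      then have A: "((\<lambda>\<theta>. 1 - z * cis (- \<theta>)) has_vector_derivative - (z * (- \<i> * cis (- \<theta>)))) (at \<theta> within {-pi..pi})"
        by (simp only: diff_0)
      have B: "(Ln has_field_derivative 1 / (1 - z * cis (- \<theta>)))
          (at (1 - z * cis (- \<theta>)) within (\<lambda>\<theta>. 1 - z * cis (- \<theta>)) ` {-pi..pi})"
        by (rule has_field_derivative_at_within[OF has_field_derivative_Ln[OF npos, unfolded inverse_eq_divide]])
      note field_vector_diff_chain_within[of "\<lambda>\<theta>. 1 - z * cis (- \<theta>)" "- (z * (- \<i> * cis (- \<theta>)))" \<theta>
          "{-pi..pi}" Ln "1 / (1 - z * cis (- \<theta>))", OF A B]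
      then show ?thesis by (simp only: o_def)
    qed
    then have "(F has_vector_derivative
        (1 - 2 * \<i> * ((- (z * (- \<i> * cis (- \<theta>)))) * (1 / (1 - z * cis (- \<theta>))))) / (2 * pi)) (at \<theta> within {-pi..pi})"
      unfolding F_def by (auto intro!: derivative_eq_intros has_vector_derivative_of_real)
    also have "1 - 2 * \<i> * ((- (z * (- \<i> * cis (- \<theta>)))) * (1 / (1 - z * cis (- \<theta>)))) =
       (1 + z * cis (- \<theta>)) / (1 - z * cis (- \<theta>))"
      using nz by (simp add: field_simps)
    also have "\<dots> = (cis \<theta> * (1 + z * cis (- \<theta>))) / (cis \<theta> * (1 - z * cis (- \<theta>)))" by simp
    also have "\<dots> = (cis \<theta> + z) / (cis \<theta> - z)" by (simp add: algebra_simps cis_mult)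
    finally show ?thesis .
  qed
  have "(\<integral>\<zeta>. (\<zeta> + z) / (\<zeta> - z) \<partial>circ) =
     (\<integral>\<theta>. indicator {-pi..pi} \<theta> *\<^sub>R (((cis \<theta> + z) / (cis \<theta> - z)) / (2 * pi)) \<partial>lborel)"
    by (rule circ_integral) measurable
  also have "\<dots> = F pi - F (- pi)"
    using ne by (intro integral_FTC_atLeastAtMost der) (auto intro!: continuous_intros)
  also have "\<dots> = 1"
  proof -
    have c: "cis (- pi) = -1" "cis (- (- pi)) = -1" by (simp_all add: complex_eq_iff)
    show ?thesis unfolding F_def c by (simp add: field_simps)
  qed
  finally show ?thesis .
qed

context
  fixes a :: "complex \<Rightarrow> real" and B :: real
  assumes am [measurable]: "a \<in> borel_measurable borel"
    and aB: "\<And>\<zeta>. cmod \<zeta> = 1 \<Longrightarrow> \<bar>a \<zeta>\<bar> \<le> B"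
begin

lemma B_nonneg: "0 \<le> B" using aB[of 1] by simp

lemma schwarz_integrable:
  assumes "cmod z < 1"
  shows "integrable circ (\<lambda>\<zeta>. of_real (a \<zeta>) * ((\<zeta> + z) / (\<zeta> - z)))"
  using assms aB schwarz_kernel_norm' B_nonneg
  by (intro circ_bounded(1)[where B = "B * (2 / (1 - cmod z))"])
     (auto simp del: times_divide_eq_right simp: norm_mult intro!: mult_mono)

lemma Re_schwarz_bound:
  assumes z: "cmod z < 1" shows "\<bar>Re (schwarz a z)\<bar> \<le> B"
proof -
  have k: "integrable circ (\<lambda>\<zeta>. (\<zeta> + z) / (\<zeta> - z))"
    using z schwarz_kernel_norm' by (intro circ_bounded(1)[where B = "2 / (1 - cmod z)"]) auto
  have nn: "0 \<le> Re ((\<zeta> + z) / (\<zeta> - z))" if "cmod \<zeta> = 1" for \<zeta>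
    using Re_schwarz_kernel[OF that z] z by (simp add: abs_square_le_1)
  have eq: "Re (schwarz a z) = (\<integral>\<zeta>. a \<zeta> * Re ((\<zeta> + z) / (\<zeta> - z)) \<partial>circ)"
  proof -
    have "Re (schwarz a z) = (\<integral>\<zeta>. Re (of_real (a \<zeta>) * ((\<zeta> + z) / (\<zeta> - z))) \<partial>circ)"
      unfolding schwarz_def by (rule integral_Re[OF schwarz_integrable[OF z], symmetric])
    also have "\<dots> = (\<integral>\<zeta>. a \<zeta> * Re ((\<zeta> + z) / (\<zeta> - z)) \<partial>circ)"
      by (simp only: Re_complex_of_real Im_complex_of_real times_complex.simps mult_zero_left diff_0_right)
    finally show ?thesis .
  qed
  have i: "integrable circ (\<lambda>\<zeta>. a \<zeta> * Re ((\<zeta> + z) / (\<zeta> - z)))"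
    using integrable_Re[OF schwarz_integrable[OF z]]
    by (simp only: Re_complex_of_real Im_complex_of_real times_complex.simps mult_zero_left diff_0_right)
  have "\<bar>Re (schwarz a z)\<bar> \<le> (\<integral>\<zeta>. \<bar>a \<zeta> * Re ((\<zeta> + z) / (\<zeta> - z))\<bar> \<partial>circ)"
    unfolding eq using integral_norm_bound[of circ "\<lambda>\<zeta>. a \<zeta> * Re ((\<zeta> + z) / (\<zeta> - z))"] by simp
  also have "\<dots> \<le> (\<integral>\<zeta>. B * Re ((\<zeta> + z) / (\<zeta> - z)) \<partial>circ)"
    using i k nn aB by (intro circ_mono integrable_abs integrable_mult_right integrable_Re)
      (auto simp: abs_mult intro!: mult_right_mono)
  also have "\<dots> = B * Re (\<integral>\<zeta>. (\<zeta> + z) / (\<zeta> - z) \<partial>circ)" using k by (simp add: integral_Re)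
  finally show ?thesis by (simp add: schwarz_1[OF z])
qed

lemma schwarz_log_bound:
  assumes z: "cmod z < 1"
  shows "cmod (schwarz a z) \<le> 32 * B * (1 + ln (1 / (1 - cmod z)))"
proof -
  have i: "integrable circ (\<lambda>\<zeta>. 1 / cmod (\<zeta> - z))"
  proof (rule circ_bounded(1)[where B = "1 / (1 - cmod z)"])
    show "norm (1 / cmod (\<zeta> - z)) \<le> 1 / (1 - cmod z)" if "cmod \<zeta> = 1" for \<zeta>
      using circle_dist_ge[OF that, of z] z by (auto intro!: frac_le)
  qed measurable
  have "cmod (schwarz a z) \<le> (\<integral>\<zeta>. cmod (of_real (a \<zeta>) * ((\<zeta> + z) / (\<zeta> - z))) \<partial>circ)"
    unfolding schwarz_def by (rule integral_norm_bound)
  also have "\<dots> \<le> (\<integral>\<zeta>. 2 * B * (1 / cmod (\<zeta> - z)) \<partial>circ)"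
  proof (intro circ_mono integrable_norm schwarz_integrable z integrable_mult_right i)
    fix \<zeta> assume \<zeta>: "cmod \<zeta> = 1"
    have "\<bar>a \<zeta>\<bar> * cmod ((\<zeta> + z) / (\<zeta> - z)) \<le> B * (2 / cmod (\<zeta> - z))"
      using aB[OF \<zeta>] schwarz_kernel_norm[OF \<zeta> z] B_nonneg by (intro mult_mono) auto
    also have "B * (2 / cmod (\<zeta> - z)) = 2 * B * (1 / cmod (\<zeta> - z))" by simp
    finally show "cmod (of_real (a \<zeta>) * ((\<zeta> + z) / (\<zeta> - z))) \<le> 2 * B * (1 / cmod (\<zeta> - z))"
      by (simp add: norm_mult del: times_divide_eq_right times_divide_eq_left)
  qed
  also have "\<dots> = 2 * B * (\<integral>\<zeta>. 1 / cmod (\<zeta> - z) \<partial>circ)" by (rule integral_mult_right_zero)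
  also have "\<dots> \<le> 2 * B * (16 + 16 * ln (1 / (1 - cmod z)))"
    using B_nonneg circ_inverse_dist[OF z] by (intro mult_left_mono) auto
  finally show ?thesis by (simp add: algebra_simps)
qed

text \<open>The error of the difference quotient of the kernel is exactly
  \<open>2 \<zeta> h / ((\<zeta> - z - h) (\<zeta> - z)^2)\<close>. For
  \<open>\<bar>h\<bar> < d / 2\<close> it is of order \<open>\<bar>h\<bar> / d ^ 3\<close> uniformly
  in \<open>\<zeta>\<close>, so differentiation passes under the integral.\<close>

lemma schwarz_holomorphic: "schwarz a holomorphic_on ball 0 1"
proof -
  have "(schwarz a has_field_derivative (\<integral>\<zeta>. of_real (a \<zeta>) * (2 * \<zeta> / (\<zeta> - z)\<^sup>2) \<partial>circ)) (at z)"
    if z: "cmod z < 1" for z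
  proof -
    define d where "d = 1 - cmod z"
    have d: "0 < d" using z by (simp add: d_def)
    let ?D = "\<integral>\<zeta>. of_real (a \<zeta>) * (2 * \<zeta> / (\<zeta> - z)\<^sup>2) \<partial>circ"
    have iD: "integrable circ (\<lambda>\<zeta>. of_real (a \<zeta>) * (2 * \<zeta> / (\<zeta> - z)\<^sup>2))"
    proof (rule circ_bounded(1)[where B = "B * (2 / d\<^sup>2)"])
      fix \<zeta> assume \<zeta>: "cmod \<zeta> = 1"
      have "d \<le> cmod (\<zeta> - z)" using circle_dist_ge[OF \<zeta>, of z] by (simp add: d_def)
      then have "2 / (cmod (\<zeta> - z))\<^sup>2 \<le> 2 / d\<^sup>2" using d by (intro frac_le power_mono) auto
      then show "norm (of_real (a \<zeta>) * (2 * \<zeta> / (\<zeta> - z)\<^sup>2)) \<le> B * (2 / d\<^sup>2)"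
        using aB[OF \<zeta>] \<zeta> B_nonneg by (auto simp: norm_mult norm_divide norm_power simp del: times_divide_eq_right intro!: mult_mono)
    qed measurable
    have "\<forall>\<^sub>F h in at (0::complex). norm ((schwarz a (z + h) - schwarz a z) / h - ?D) \<le> (4 * B / d ^ 3) * norm h"
    proof (rule eventually_mono[OF eventually_at_ball'[of "d / 2" 0 UNIV]])
      fix h :: complex assume h: "h \<in> ball 0 (d / 2) \<and> h \<noteq> 0 \<and> h \<in> UNIV"
      then have h': "h \<noteq> 0" "cmod h < d / 2" by auto
      have zh: "cmod (z + h) < 1" using norm_triangle_ineq[of z h] h' d by (simp add: d_def)
      have "(schwarz a (z + h) - schwarz a z) / h - ?D =
         (\<integral>\<zeta>. (of_real (a \<zeta>) * ((\<zeta> + (z + h)) / (\<zeta> - (z + h))) - of_real (a \<zeta>) * ((\<zeta> + z) / (\<zeta> - z))) / h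
            - of_real (a \<zeta>) * (2 * \<zeta> / (\<zeta> - z)\<^sup>2) \<partial>circ)"
        unfolding schwarz_def using schwarz_integrable[OF zh] schwarz_integrable[OF z] iD
        by (subst Bochner_Integration.integral_diff integral_divide_zero | simp)+
      also have "norm \<dots> \<le> (4 * B / d ^ 3) * norm h"
      proof (rule circ_bounded(2))
        fix \<zeta> assume \<zeta>: "cmod \<zeta> = 1"
        have d1: "d \<le> cmod (\<zeta> - z)" using circle_dist_ge[OF \<zeta>, of z] by (simp add: d_def)
        have d2: "d / 2 \<le> cmod (\<zeta> - z - h)" using norm_triangle_ineq2[of "\<zeta> - z" h] d1 h' by simp
        have nz: "\<zeta> - z \<noteq> 0" "\<zeta> - z - h \<noteq> 0" using d1 d2 d by auto
        have "(of_real (a \<zeta>) * ((\<zeta> + (z + h)) / (\<zeta> - (z + h))) - of_real (a \<zeta>) * ((\<zeta> + z) / (\<zeta> - z))) / h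
            - of_real (a \<zeta>) * (2 * \<zeta> / (\<zeta> - z)\<^sup>2) =
            of_real (a \<zeta>) * (((\<zeta> + (z + h)) / (\<zeta> - z - h) - (\<zeta> + z) / (\<zeta> - z)) / h - 2 * \<zeta> / (\<zeta> - z)\<^sup>2)"
          by (simp add: algebra_simps diff_divide_distrib)
        also have "((\<zeta> + (z + h)) / (\<zeta> - z - h) - (\<zeta> + z) / (\<zeta> - z)) / h - 2 * \<zeta> / (\<zeta> - z)\<^sup>2
           = 2 * \<zeta> * h / ((\<zeta> - z - h) * (\<zeta> - z)\<^sup>2)"
          using nz h'(1) by (simp add: divide_simps) (simp add: power2_eq_square algebra_simps)
        also have "norm (of_real (a \<zeta>) * (2 * \<zeta> * h / ((\<zeta> - z - h) * (\<zeta> - z)\<^sup>2)))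
            = \<bar>a \<zeta>\<bar> * (2 * cmod h / (cmod (\<zeta> - z - h) * (cmod (\<zeta> - z))\<^sup>2))"
          using \<zeta> by (simp add: norm_mult norm_divide norm_power)
        also have "\<dots> \<le> B * (2 * cmod h / ((d / 2) * d\<^sup>2))"
          using aB[OF \<zeta>] B_nonneg d1 d2 d nz
          by (intro mult_mono divide_left_mono power_mono mult_pos_pos) auto
        also have "\<dots> = (4 * B / d ^ 3) * norm h" by (simp add: power2_eq_square power3_eq_cube mult.assoc)
        finally show "norm ((of_real (a \<zeta>) * ((\<zeta> + (z + h)) / (\<zeta> - (z + h))) - of_real (a \<zeta>) * ((\<zeta> + z) / (\<zeta> - z))) / h
            - of_real (a \<zeta>) * (2 * \<zeta> / (\<zeta> - z)\<^sup>2)) \<le> (4 * B / d ^ 3) * norm h" .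
      qed measurable
      finally show "norm ((schwarz a (z + h) - schwarz a z) / h - ?D) \<le> (4 * B / d ^ 3) * norm h" .
    qed (use d in auto)
    moreover have "((\<lambda>h::complex. (4 * B / d ^ 3) * norm h) \<longlongrightarrow> 0) (at 0)"
      using d by (auto intro!: tendsto_eq_intros)
    ultimately have "((\<lambda>h. (schwarz a (z + h) - schwarz a z) / h - ?D) \<longlongrightarrow> 0) (at 0)"
      by (rule Lim_null_comparison)
    then show ?thesis by (simp add: DERIV_def Lim_null[symmetric])
  qed
  then show ?thesis unfolding holomorphic_on_open[OF open_ball] by (metis mem_ball_0)
qed


lemma schwarz_Poisson_tendsto:
  assumes x: "cmod x = 1" and c: "isCont a x"
  shows "((\<lambda>z. Re (schwarz a z)) \<longlongrightarrow> a x) (at x within ball 0 1)"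
proof (rule tendstoI)
  fix e :: real assume e: "0 < e"
  define P where "P = (\<lambda>\<zeta> z. Re ((\<zeta> + z) / (\<zeta> - z)))"
  obtain d where d: "0 < d" "\<And>\<zeta>. dist \<zeta> x < d \<Longrightarrow> \<bar>a \<zeta> - a x\<bar> < e / 2"
    using c e unfolding continuous_at_eps_delta by (metis dist_real_def half_gt_zero)
  have "\<forall>\<^sub>F z in at x within ball 0 1. z \<in> ball 0 1 \<and> dist z x < d / 2"
    using d by (auto simp: eventually_at intro!: exI[of _ "d / 2"])
  moreover have "((\<lambda>z. 2 * B * (1 - (cmod z)\<^sup>2) * (4 / d\<^sup>2)) \<longlongrightarrow> 2 * B * (1 - (cmod x)\<^sup>2) * (4 / d\<^sup>2)) (at x within ball 0 1)"
    by (intro tendsto_intros)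
  from order_tendstoD(2)[OF this, of "e / 2"]
  have "\<forall>\<^sub>F z in at x within ball 0 1. 2 * B * (1 - (cmod z)\<^sup>2) * (4 / d\<^sup>2) < e / 2"
    using e x by simp
  ultimately show "\<forall>\<^sub>F z in at x within ball 0 1. dist (Re (schwarz a z)) (a x) < e"
  proof eventually_elim
    case (elim z)
    then have z: "cmod z < 1" by simp
    have ik: "integrable circ (\<lambda>\<zeta>. (\<zeta> + z) / (\<zeta> - z))"
      using z schwarz_kernel_norm' by (intro circ_bounded(1)[where B = "2 / (1 - cmod z)"]) auto
    have iP: "integrable circ (\<lambda>\<zeta>. P \<zeta> z)" unfolding P_def by (intro integrable_Re ik)
    have ieP: "integrable circ (\<lambda>\<zeta>. e / 2 * P \<zeta> z)" using iP by (intro integrable_mult_right)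
    have P1: "(\<integral>\<zeta>. P \<zeta> z \<partial>circ) = 1" unfolding P_def by (subst integral_Re[OF ik]) (simp add: schwarz_1[OF z])
    have Pnn: "0 \<le> P \<zeta> z" if "cmod \<zeta> = 1" for \<zeta>
      using Re_schwarz_kernel[OF that z] z by (simp add: P_def abs_square_le_1)
    have iaP: "integrable circ (\<lambda>\<zeta>. a \<zeta> * P \<zeta> z)"
      using integrable_Re[OF schwarz_integrable[OF z]]
      by (simp only: P_def Re_complex_of_real Im_complex_of_real times_complex.simps mult_zero_left diff_0_right)
    have "Re (schwarz a z) = (\<integral>\<zeta>. Re (of_real (a \<zeta>) * ((\<zeta> + z) / (\<zeta> - z))) \<partial>circ)"
      unfolding schwarz_def by (rule integral_Re[OF schwarz_integrable[OF z], symmetric])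
    also have "\<dots> = (\<integral>\<zeta>. a \<zeta> * P \<zeta> z \<partial>circ)"
      by (simp only: P_def Re_complex_of_real Im_complex_of_real times_complex.simps mult_zero_left diff_0_right)
    finally have "Re (schwarz a z) - a x = (\<integral>\<zeta>. a \<zeta> * P \<zeta> z \<partial>circ) - (\<integral>\<zeta>. a x * P \<zeta> z \<partial>circ)"
      by (simp add: P1)
    also have "\<dots> = (\<integral>\<zeta>. (a \<zeta> - a x) * P \<zeta> z \<partial>circ)"
      using iaP iP by (subst Bochner_Integration.integral_diff[symmetric]) (auto simp: left_diff_distrib)
    finally have "\<bar>Re (schwarz a z) - a x\<bar> \<le> (\<integral>\<zeta>. \<bar>(a \<zeta> - a x) * P \<zeta> z\<bar> \<partial>circ)"
      using integral_norm_bound[of circ "\<lambda>\<zeta>. (a \<zeta> - a x) * P \<zeta> z"] by simp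
    also have "\<dots> \<le> (\<integral>\<zeta>. e / 2 * P \<zeta> z + 2 * B * (1 - (cmod z)\<^sup>2) * (4 / d\<^sup>2) \<partial>circ)"
    proof (rule circ_mono)
      have "integrable circ (\<lambda>\<zeta>. (a \<zeta> - a x) * P \<zeta> z)"
        using iaP iP by (simp add: left_diff_distrib)
      then show "integrable circ (\<lambda>\<zeta>. \<bar>(a \<zeta> - a x) * P \<zeta> z\<bar>)" by (rule integrable_abs)
      show "integrable circ (\<lambda>\<zeta>. e / 2 * P \<zeta> z + 2 * B * (1 - (cmod z)\<^sup>2) * (4 / d\<^sup>2))"
        by (intro Bochner_Integration.integrable_add ieP circ.integrable_const)
      fix \<zeta> assume \<zeta>: "cmod \<zeta> = 1"
      have z2: "0 \<le> 1 - (cmod z)\<^sup>2" using z by (simp add: abs_square_le_1)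
      show "\<bar>(a \<zeta> - a x) * P \<zeta> z\<bar> \<le> e / 2 * P \<zeta> z + 2 * B * (1 - (cmod z)\<^sup>2) * (4 / d\<^sup>2)"
      proof (cases "dist \<zeta> x < d")
        case True
        then have "\<bar>a \<zeta> - a x\<bar> * P \<zeta> z \<le> e / 2 * P \<zeta> z"
          using d(2)[OF True] Pnn[OF \<zeta>] by (intro mult_right_mono) auto
        moreover have "0 \<le> 2 * B * (1 - (cmod z)\<^sup>2) * (4 / d\<^sup>2)" using z2 B_nonneg by simp
        ultimately show ?thesis using Pnn[OF \<zeta>] by (simp only: abs_mult abs_of_nonneg)
      next
        case False
        \<comment> \<open>Away from \<open>x\<close> the Poisson kernel is bounded by a multiple of
          \<open>1 - \<bar>z\<bar>^2\<close> and tends to 0; only the arc where \<open>a\<close> is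
          close to \<open>a x\<close> keeps its mass.\<close>
        have "d / 2 \<le> cmod (\<zeta> - z)"
          using False elim norm_triangle_ineq[of "\<zeta> - z" "z - x"] by (simp add: dist_norm)
        then have "(d / 2)\<^sup>2 \<le> (cmod (\<zeta> - z))\<^sup>2" using d(1) by (intro power_mono) auto
        then have "P \<zeta> z \<le> (1 - (cmod z)\<^sup>2) / (d / 2)\<^sup>2"
          unfolding P_def Re_schwarz_kernel[OF \<zeta> z] using z2 d(1) \<open>d / 2 \<le> cmod (\<zeta> - z)\<close>
          by (intro divide_left_mono mult_pos_pos) auto
        also have "\<dots> = (1 - (cmod z)\<^sup>2) * (4 / d\<^sup>2)" by (simp add: power2_eq_square)
        finally have P: "P \<zeta> z \<le> (1 - (cmod z)\<^sup>2) * (4 / d\<^sup>2)" .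
        have "\<bar>a \<zeta> - a x\<bar> \<le> 2 * B" using aB[OF \<zeta>] aB[OF x] by linarith
        then have "\<bar>a \<zeta> - a x\<bar> * P \<zeta> z \<le> 2 * B * ((1 - (cmod z)\<^sup>2) * (4 / d\<^sup>2))"
          using P Pnn[OF \<zeta>] B_nonneg by (intro mult_mono) auto
        moreover have "0 \<le> e / 2 * P \<zeta> z" using e Pnn[OF \<zeta>] by simp
        ultimately show ?thesis using Pnn[OF \<zeta>] by (simp only: abs_mult abs_of_nonneg mult.assoc)
      qed
    qed
    also have "\<dots> = e / 2 + 2 * B * (1 - (cmod z)\<^sup>2) * (4 / d\<^sup>2)"
      by (simp only: Bochner_Integration.integral_add[OF ieP circ.integrable_const] integral_mult_right_zero P1) simp
    also have "\<dots> < e" using elim by simp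
    finally show ?case by (simp add: dist_real_def)
  qed
qed

end

text \<open>Riemann sums: on the set where the kernel is uniformly continuous, the Schwarz integral of a
  compactly supported density is uniformly close to a finite sum of point masses, whose real part
  vanishes on the circle off the poles.\<close>

lemma schwarz_Riemann_sum:
  fixes a :: "complex \<Rightarrow> real"
  assumes am: "a \<in> borel_measurable borel" and aB: "\<And>\<zeta>. cmod \<zeta> = 1 \<Longrightarrow> \<bar>a \<zeta>\<bar> \<le> B"
    and d: "0 < d" and e: "0 < e"
  obtains C :: "complex set" and m :: "complex \<Rightarrow> real"
  where "finite C" "C \<subseteq> sphere 0 1"
    "\<And>z. cmod z < 1 \<Longrightarrow> (\<And>\<zeta>. cmod \<zeta> = 1 \<Longrightarrow> a \<zeta> \<noteq> 0 \<Longrightarrow> d \<le> cmod (\<zeta> - z)) \<Longrightarrow>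
       cmod (schwarz a z - (\<Sum>c\<in>C. of_real (m c) * ((c + z) / (c - z)))) \<le> e"
proof -
  have B: "0 \<le> B" using aB[of 1] by simp
  \<comment> \<open>The bound \<open>d / 2\<close> keeps a node at distance \<open>d / 2\<close>
    from \<open>z\<close> whenever its cell is at distance \<open>d\<close>. The other bound makes
    the change of the kernel across a cell, at most \<open>4 \<delta> / d^2\<close>, no larger than
    \<open>e / (B + 1)\<close>; the summand 1 covers \<open>B = 0\<close>.\<close>
  define \<delta> where "\<delta> = min (d / 2) (e * d\<^sup>2 / (4 * (B + 1)))"
  have \<delta>: "0 < \<delta>" "\<delta> \<le> d / 2" "\<delta> \<le> e * d\<^sup>2 / (4 * (B + 1))"
    using d e B unfolding \<delta>_def by (simp_all only: min.cobounded1 min.cobounded2) (simp add: add_nonneg_pos)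
  have "sphere 0 1 \<subseteq> (\<Union>c\<in>sphere 0 1. ball (c::complex) \<delta>)" using \<delta>(1) by auto
  then obtain C where C: "C \<subseteq> sphere (0::complex) 1" "finite C" "sphere 0 1 \<subseteq> (\<Union>c\<in>C. ball c \<delta>)"
    by (rule compactE_image[OF compact_sphere, rotated]) auto
  obtain xs where xs: "set xs = C" "distinct xs" using C(2) finite_distinct_list by blast
  define N where "N = length xs"
  have cov: "\<exists>i<N. dist (xs ! i) \<zeta> < \<delta>" if "cmod \<zeta> = 1" for \<zeta>
  proof -
    have "\<zeta> \<in> (\<Union>c\<in>C. ball c \<delta>)" by (rule subsetD[OF C(3)]) (simp add: that)
    then show ?thesis using xs(1) by (auto simp: N_def in_set_conv_nth)
  qed
  \<comment> \<open>The balls are made disjoint by assigning each point to the first ball that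
    contains it. Points with \<open>a \<zeta> = 0\<close> are dropped, so that every cell used
    contains points at distance at least \<open>d\<close> from \<open>z\<close>.\<close>
  define Q where "Q = (\<lambda>i. {\<zeta>. a \<zeta> \<noteq> 0 \<and> dist (xs ! i) \<zeta> < \<delta> \<and> (\<forall>j<i. \<delta> \<le> dist (xs ! j) \<zeta>)})"
  have Qm [measurable]: "Q i \<in> sets borel" for i
  proof -
    have "{\<zeta> \<in> space borel. a \<zeta> \<noteq> 0 \<and> dist (xs ! i) \<zeta> < \<delta> \<and> (\<forall>j\<in>{..<i}. \<delta> \<le> dist (xs ! j) \<zeta>)} \<in> sets borel"
      using am by measurable
    then show ?thesis by (simp add: Q_def Ball_def)
  qed
  have Qsum: "(\<Sum>i<N. indicator (Q i) \<zeta> * y i) = (if a \<zeta> \<noteq> 0 then y (LEAST i. dist (xs ! i) \<zeta> < \<delta>) else 0)"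
    if \<zeta>: "cmod \<zeta> = 1" for \<zeta> and y :: "nat \<Rightarrow> complex"
  proof -
    define k where "k = (LEAST i. dist (xs ! i) \<zeta> < \<delta>)"
    obtain i0 where i0: "i0 < N" "dist (xs ! i0) \<zeta> < \<delta>" using cov[OF \<zeta>] by blast
    have k: "dist (xs ! k) \<zeta> < \<delta>" "k \<le> i0" unfolding k_def using i0(2) by (auto intro: LeastI Least_le)
    have kmin: "\<delta> \<le> dist (xs ! j) \<zeta>" if "j < k" for j using not_less_Least[of j "\<lambda>i. dist (xs ! i) \<zeta> < \<delta>"] that by (auto simp: k_def)
    have "indicator (Q i) \<zeta> * y i = (if i = k then (if a \<zeta> \<noteq> 0 then y k else 0) else 0)" for i
    proof (cases "i = k")
      case True
      have "\<zeta> \<in> Q k \<longleftrightarrow> a \<zeta> \<noteq> 0" using k(1) kmin by (auto simp: Q_def)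
      then show ?thesis using True by (simp add: indicator_def)
    next
      case False
      then have "\<zeta> \<notin> Q i" using k(1) kmin[of i] by (cases i k rule: linorder_cases) (auto simp: Q_def)
      then show ?thesis using False by simp
    qed
    then have "(\<Sum>i<N. indicator (Q i) \<zeta> * y i) = (\<Sum>i<N. if i = k then (if a \<zeta> \<noteq> 0 then y k else 0) else 0)" by simp
    then show ?thesis using k(2) i0(1) by (simp add: k_def[symmetric])
  qed
  define m where "m = (\<lambda>i. \<integral>\<zeta>. indicator (Q i) \<zeta> * a \<zeta> \<partial>circ)"
  have im: "integrable circ (\<lambda>\<zeta>. indicator (Q i) \<zeta> * a \<zeta>)" for i
    using am aB B by (intro circ_bounded(1)[where B = B]) (auto simp: indicator_def)
  have main: "cmod (schwarz a z - (\<Sum>i<N. of_real (m i) * ((xs ! i + z) / (xs ! i - z)))) \<le> e"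
    if z: "cmod z < 1" and far: "\<And>\<zeta>. cmod \<zeta> = 1 \<Longrightarrow> a \<zeta> \<noteq> 0 \<Longrightarrow> d \<le> cmod (\<zeta> - z)" for z
  proof -
    define S where "S = (\<lambda>\<zeta>. (\<zeta> + z) / (\<zeta> - z))"
    have "(\<Sum>i<N. of_real (m i) * S (xs ! i)) = (\<Sum>i<N. (\<integral>\<zeta>. of_real (indicator (Q i) \<zeta> * a \<zeta>) * S (xs ! i) \<partial>circ))"
      unfolding m_def by (intro sum.cong refl) (simp only: integral_mult_left_zero integral_complex_of_real)
    also have "\<dots> = (\<integral>\<zeta>. (\<Sum>i<N. of_real (indicator (Q i) \<zeta> * a \<zeta>) * S (xs ! i)) \<partial>circ)"
      by (intro Bochner_Integration.integral_sum[symmetric] integrable_mult_left integrable_of_real im)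
    finally have eq: "(\<Sum>i<N. of_real (m i) * S (xs ! i)) = (\<integral>\<zeta>. (\<Sum>i<N. of_real (indicator (Q i) \<zeta> * a \<zeta>) * S (xs ! i)) \<partial>circ)" .
    have i2: "integrable circ (\<lambda>\<zeta>. (\<Sum>i<N. of_real (indicator (Q i) \<zeta> * a \<zeta>) * S (xs ! i)))"
      by (intro Bochner_Integration.integrable_sum integrable_mult_left integrable_of_real im)
    have "schwarz a z - (\<Sum>i<N. of_real (m i) * S (xs ! i)) =
       (\<integral>\<zeta>. of_real (a \<zeta>) * S \<zeta> - (\<Sum>i<N. of_real (indicator (Q i) \<zeta> * a \<zeta>) * S (xs ! i)) \<partial>circ)"
      unfolding eq using schwarz_integrable[OF am aB z] i2
      by (simp add: schwarz_def S_def)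
    also have "cmod \<dots> \<le> e"
    proof (rule circ_bounded(2))
      fix \<zeta> assume \<zeta>: "cmod \<zeta> = 1"
      show "cmod (of_real (a \<zeta>) * S \<zeta> - (\<Sum>i<N. of_real (indicator (Q i) \<zeta> * a \<zeta>) * S (xs ! i))) \<le> e"
      proof (cases "a \<zeta> = 0")
        case False
        define k where "k = (LEAST i. dist (xs ! i) \<zeta> < \<delta>)"
        define c where "c = xs ! k"
        have k: "dist c \<zeta> < \<delta>" unfolding c_def k_def using cov[OF \<zeta>] by (metis LeastI)
        have "(\<Sum>i<N. of_real (indicator (Q i) \<zeta> * a \<zeta>) * S (xs ! i)) = (\<Sum>i<N. indicator (Q i) \<zeta> * (of_real (a \<zeta>) * S (xs ! i)))"
          by (intro sum.cong) (auto simp: indicator_def)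
        also have "\<dots> = of_real (a \<zeta>) * S c" using Qsum[OF \<zeta>] False by (simp add: c_def k_def)
        finally have eq2: "of_real (a \<zeta>) * S \<zeta> - (\<Sum>i<N. of_real (indicator (Q i) \<zeta> * a \<zeta>) * S (xs ! i)) = of_real (a \<zeta>) * (S \<zeta> - S c)"
          by (simp add: algebra_simps)
        have d1: "d \<le> cmod (\<zeta> - z)" using far[OF \<zeta> False] .
        have d2: "d / 2 \<le> cmod (c - z)"
          using norm_triangle_ineq[of "\<zeta> - c" "c - z"] d1 k \<delta>(2) by (simp add: dist_norm norm_minus_commute)
        have nz: "\<zeta> - z \<noteq> 0" "c - z \<noteq> 0" using d1 d2 d by auto
        have "S \<zeta> - S c = 2 * z * (c - \<zeta>) / ((\<zeta> - z) * (c - z))"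
          unfolding S_def using nz by (simp add: divide_simps) (simp add: algebra_simps)
        then have "cmod (S \<zeta> - S c) = 2 * cmod z * cmod (c - \<zeta>) / (cmod (\<zeta> - z) * cmod (c - z))"
          by (simp add: norm_mult norm_divide)
        also have "\<dots> \<le> 2 * 1 * \<delta> / (d * (d / 2))"
          using z k d1 d2 d \<delta>(1) by (intro frac_le mult_mono) (auto simp: dist_norm)
        also have "\<dots> = 4 * \<delta> / d\<^sup>2" by (simp add: power2_eq_square)
        also have "\<dots> \<le> e / (B + 1)" using \<delta>(3) d B by (simp add: field_simps)
        finally have "cmod (S \<zeta> - S c) \<le> e / (B + 1)" .
        then have "\<bar>a \<zeta>\<bar> * cmod (S \<zeta> - S c) \<le> B * (e / (B + 1))"
          using aB[OF \<zeta>] B by (intro mult_mono) auto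
        also have "\<dots> \<le> e" using B e by (simp add: field_simps)
        finally show ?thesis unfolding eq2 by (simp add: norm_mult)
      next
        case True
        then show ?thesis using e by simp
      qed
    next
      have [measurable]: "S \<in> borel_measurable borel" unfolding S_def by measurable
      show "(\<lambda>\<zeta>. of_real (a \<zeta>) * S \<zeta> - (\<Sum>i<N. of_real (indicator (Q i) \<zeta> * a \<zeta>) * S (xs ! i))) \<in> borel_measurable borel"
        using am by measurable
    qed
    finally show ?thesis by (simp add: S_def)
  qed
  \<comment> \<open>Masses are moved from list indices to points, which is unambiguous because the
    list is distinct.\<close>
  define m' where "m' = (\<lambda>c. m (THE i. i < N \<and> xs ! i = c))"
  have m': "m' (xs ! i) = m i" if "i < N" for i
  proof -
    have "(THE j. j < N \<and> xs ! j = xs ! i) = i"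
      using that xs(2) by (intro the_equality) (auto simp: N_def nth_eq_iff_index_eq)
    then show ?thesis by (simp add: m'_def)
  qed
  have "(\<Sum>c\<in>C. of_real (m' c) * ((c + z) / (c - z))) = (\<Sum>i<N. of_real (m i) * ((xs ! i + z) / (xs ! i - z)))" for z
  proof -
    have "bij_betw (\<lambda>i. xs ! i) {..<N} C" using bij_betw_nth[OF xs(2)] xs(1) by (simp add: N_def)
    from sum.reindex_bij_betw[OF this, of "\<lambda>c. of_real (m' c) * ((c + z) / (c - z))"]
    show ?thesis using m' by simp
  qed
  then show ?thesis using that[of C m'] C(1,2) main by simp
qed

section \<open>Harmonic functions with prescribed angular limits\<close>

text \<open>Nontangential approach as a comparison of distances instead of a sector. This form
  enters kernel estimates directly and is carried over by the coordinates of all boundary circles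
  without loss.\<close>

definition stolz :: "real \<Rightarrow> complex \<Rightarrow> complex set" where
  "stolz M x = {z. cmod z < 1 \<and> cmod (z - x) \<le> M * (1 - cmod z)}"

lemma stolz_subset: "stolz M x \<subseteq> ball 0 1"
  by (auto simp: stolz_def)

lemma ln_growth_nonneg: "cmod z < 1 \<Longrightarrow> 0 \<le> ln (1 / (1 - cmod z))"
  by simp

lemma schwarz_diff:
  assumes am: "a \<in> borel_measurable borel" "\<And>\<zeta>. cmod \<zeta> = 1 \<Longrightarrow> \<bar>a \<zeta>\<bar> \<le> B"
    and bm: "b \<in> borel_measurable borel" "\<And>\<zeta>. cmod \<zeta> = 1 \<Longrightarrow> \<bar>b \<zeta>\<bar> \<le> B'" and z: "cmod z < 1"
  shows "schwarz (\<lambda>\<zeta>. a \<zeta> - b \<zeta>) z = schwarz a z - schwarz b z"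
proof -
  have "schwarz (\<lambda>\<zeta>. a \<zeta> - b \<zeta>) z =
      (\<integral>\<zeta>. of_real (a \<zeta>) * ((\<zeta> + z) / (\<zeta> - z)) - of_real (b \<zeta>) * ((\<zeta> + z) / (\<zeta> - z)) \<partial>circ)"
    unfolding schwarz_def by (intro Bochner_Integration.integral_cong) (auto simp: algebra_simps diff_divide_distrib)
  also have "\<dots> = schwarz a z - schwarz b z"
    unfolding schwarz_def
    by (rule Bochner_Integration.integral_diff[OF schwarz_integrable[OF am z] schwarz_integrable[OF bm z]])
  finally show ?thesis .
qed

text \<open>The Schwarz integral of a finite real combination of point masses. The masses are real
  so that the real part vanishes on the circle away from \<open>C\<close>.\<close>

definition pole_sum :: "complex set \<Rightarrow> (complex \<Rightarrow> real) \<Rightarrow> complex \<Rightarrow> complex" where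
  "pole_sum C m z = (\<Sum>c\<in>C. of_real (m c) * ((c + z) / (c - z)))"

lemma pole_sum_holomorphic:
  assumes "C \<subseteq> sphere 0 1" shows "pole_sum C m holomorphic_on ball 0 1"
proof -
  have "c \<noteq> z" if "c \<in> C" "z \<in> ball 0 1" for c z using that assms by auto
  then show ?thesis unfolding pole_sum_def by (intro holomorphic_intros) auto
qed

lemma pole_sum_tendsto:
  assumes "C \<subseteq> sphere 0 1" "x \<in> sphere 0 1" "x \<notin> C"
  shows "(pole_sum C m \<longlongrightarrow> pole_sum C m x) (at x within S)" "Re (pole_sum C m x) = 0"
proof -
  have "c \<noteq> x" if "c \<in> C" for c using that assms by auto
  then show "(pole_sum C m \<longlongrightarrow> pole_sum C m x) (at x within S)"
    unfolding pole_sum_def by (intro tendsto_intros) auto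
  have "Re ((c + x) / (c - x)) = 0" if "c \<in> C" for c
  proof -
    have cx: "cmod c = 1" "cmod x = 1" using that assms by auto
    have "Re ((c + x) / (c - x)) = Re ((c + x) * cnj (c - x)) / (cmod (c - x))\<^sup>2"
      by (subst complex_div_cnj) (simp only: Re_divide_of_real flip: of_real_power)
    also have "Re ((c + x) * cnj (c - x)) = (cmod c)\<^sup>2 - (cmod x)\<^sup>2"
      unfolding cmod_power2 by (simp add: power2_eq_square algebra_simps)
    finally show ?thesis using cx by simp
  qed
  then have "Re (of_real (m c) * ((c + x) / (c - x))) = 0" if "c \<in> C" for c
    using that by (simp only: times_complex.simps Re_complex_of_real Im_complex_of_real)
  then show "Re (pole_sum C m x) = 0"
    unfolding pole_sum_def Re_sum by (intro sum.neutral) blast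
qed

text \<open>The function \<open>p\<close> is cut at height \<open>\<epsilon>\<close>. The bounded
  part has real part at most \<open>\<epsilon>\<close> and growth \<open>32 \<epsilon>\<close>. The
  rest \<open>q\<close> lives where \<open>\<bar>p\<bar> \<ge> \<epsilon>\<close>, a compact set off
  \<open>F\<close>, hence far from the Stolz regions at \<open>F\<close> and from the smaller disk,
  and there poles imitate it up to \<open>\<epsilon>\<close>. However large \<open>p\<close> is,
  what remains is small without any change of boundary values on \<open>F\<close>.\<close>

lemma gehring_step:
  fixes p :: "complex \<Rightarrow> real" and F :: "complex set"
  assumes p: "continuous_on UNIV p" and F: "closed F" "\<And>x. x \<in> F \<Longrightarrow> p x = 0" and \<epsilon>: "0 < \<epsilon>"
  obtains C m where "finite C" "C \<subseteq> sphere 0 1"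
    "\<And>z. cmod z < 1 \<Longrightarrow> cmod z \<le> 1 - 1 / real (Suc n) \<or> (\<exists>x\<in>F. z \<in> stolz (real n) x) \<Longrightarrow>
       \<bar>Re (schwarz p z - pole_sum C m z)\<bar> \<le> 2 * \<epsilon> \<and>
       cmod (schwarz p z - pole_sum C m z) \<le> 33 * \<epsilon> * (1 + ln (1 / (1 - cmod z)))"
proof -
  define q where "q = (\<lambda>\<zeta>. p \<zeta> - max (- \<epsilon>) (min \<epsilon> (p \<zeta>)))"
  have qc: "continuous_on UNIV q" unfolding q_def by (intro continuous_intros p)
  have q0: "\<epsilon> \<le> \<bar>p \<zeta>\<bar>" if "q \<zeta> \<noteq> 0" for \<zeta> using that by (auto simp: q_def max_def min_def split: if_splits)
  have pq: "\<bar>p \<zeta> - q \<zeta>\<bar> \<le> \<epsilon>" for \<zeta> using \<epsilon> by (auto simp: q_def)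
  have "compact (p ` sphere 0 1)" by (intro compact_continuous_image continuous_on_subset[OF p]) auto
  then obtain B where B: "\<And>\<zeta>. cmod \<zeta> = 1 \<Longrightarrow> \<bar>p \<zeta>\<bar> \<le> B"
    using compact_imp_bounded[of "p ` sphere 0 1"] by (auto simp: bounded_iff) (metis mem_sphere_0)
  have qB: "\<bar>q \<zeta>\<bar> \<le> B + \<epsilon>" if "cmod \<zeta> = 1" for \<zeta> using pq[of \<zeta>] B[OF that] by linarith
  have pm: "p \<in> borel_measurable borel" and qm: "q \<in> borel_measurable borel"
    using p qc by (auto intro: borel_measurable_continuous_onI)
  define K where "K = {\<zeta> \<in> sphere 0 1. \<epsilon> \<le> \<bar>p \<zeta>\<bar>}"
  have "closed {\<zeta>. \<epsilon> \<le> \<bar>p \<zeta>\<bar>}" using p by (intro closed_Collect_le continuous_intros) 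
  moreover have "K = sphere 0 1 \<inter> {\<zeta>. \<epsilon> \<le> \<bar>p \<zeta>\<bar>}" by (auto simp: K_def)
  ultimately have K: "compact K" by (simp add: compact_Int_closed)
  have "K \<inter> F = {}" using F(2) \<epsilon> by (auto simp: K_def)
  then have "\<exists>d>0. \<forall>x\<in>K. \<forall>y\<in>F. d \<le> dist x y" by (rule separate_compact_closed[OF K F(1)])
  then obtain d where d: "0 < d" "\<And>x y. x \<in> K \<Longrightarrow> y \<in> F \<Longrightarrow> d \<le> dist x y" by blast
  \<comment> \<open>In a Stolz region of aperture \<open>n\<close> at a point of \<open>F\<close>
    one has \<open>d \<le> (1 + n) \<bar>\<zeta> - z\<bar>\<close>; in the disk of radius
    \<open>1 - 1 / (n + 1)\<close> the distance to the circle is at least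
    \<open>1 / (n + 1)\<close>.\<close>
  define e where "e = min (d / (1 + real n)) (1 / real (Suc n))"
  have e: "0 < e" "e \<le> d / (1 + real n)" "e \<le> 1 / real (Suc n)" using d(1) by (auto simp: e_def)
  obtain C m where C: "finite C" "C \<subseteq> sphere 0 1"
    and Cm: "\<And>z. cmod z < 1 \<Longrightarrow> (\<And>\<zeta>. cmod \<zeta> = 1 \<Longrightarrow> q \<zeta> \<noteq> 0 \<Longrightarrow> e \<le> cmod (\<zeta> - z)) \<Longrightarrow>
       cmod (schwarz q z - pole_sum C m z) \<le> \<epsilon>"
    unfolding pole_sum_def by (rule schwarz_Riemann_sum[OF qm qB e(1) \<epsilon>]) (assumption, blast)
  have far: "e \<le> cmod (\<zeta> - z)"
    if z: "cmod z < 1" "cmod z \<le> 1 - 1 / real (Suc n) \<or> (\<exists>x\<in>F. z \<in> stolz (real n) x)"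
      and \<zeta>: "cmod \<zeta> = 1" "q \<zeta> \<noteq> 0" for \<zeta> z
    using z(2)
  proof
    assume "cmod z \<le> 1 - 1 / real (Suc n)"
    then show ?thesis using circle_dist_ge[OF \<zeta>(1), of z] e(3) by linarith
  next
    assume "\<exists>x\<in>F. z \<in> stolz (real n) x"
    then obtain x where x: "x \<in> F" "cmod (z - x) \<le> real n * (1 - cmod z)" by (auto simp: stolz_def)
    have "\<zeta> \<in> K" using \<zeta> q0 by (auto simp: K_def)
    then have "d \<le> cmod (\<zeta> - x)" using d(2) x(1) by (simp add: dist_norm)
    also have "\<dots> \<le> cmod (\<zeta> - z) + cmod (z - x)" using norm_triangle_ineq[of "\<zeta> - z" "z - x"] by simp
    also have "cmod (z - x) \<le> real n * cmod (\<zeta> - z)"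
      using x(2) circle_dist_ge[OF \<zeta>(1), of z] by (elim order_trans) (intro mult_left_mono, auto)
    finally have "d \<le> (1 + real n) * cmod (\<zeta> - z)" by (simp add: algebra_simps)
    then have "d / (1 + real n) \<le> cmod (\<zeta> - z)" by (simp add: field_simps)
    then show ?thesis using e(2) by simp
  qed
  have "\<bar>Re (schwarz p z - pole_sum C m z)\<bar> \<le> 2 * \<epsilon> \<and>
       cmod (schwarz p z - pole_sum C m z) \<le> 33 * \<epsilon> * (1 + ln (1 / (1 - cmod z)))"
    if z: "cmod z < 1" "cmod z \<le> 1 - 1 / real (Suc n) \<or> (\<exists>x\<in>F. z \<in> stolz (real n) x)" for z
  proof -
    have rm: "(\<lambda>\<zeta>. p \<zeta> - q \<zeta>) \<in> borel_measurable borel" using pm qm by measurable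
    have s: "schwarz p z - pole_sum C m z = schwarz (\<lambda>\<zeta>. p \<zeta> - q \<zeta>) z + (schwarz q z - pole_sum C m z)"
      using schwarz_diff[OF pm B qm qB z(1)] by simp
    have 1: "cmod (schwarz q z - pole_sum C m z) \<le> \<epsilon>" using Cm[OF z(1)] far[OF z] by blast
    have 2: "\<bar>Re (schwarz (\<lambda>\<zeta>. p \<zeta> - q \<zeta>) z)\<bar> \<le> \<epsilon>" using Re_schwarz_bound[OF rm pq z(1)] .
    have 3: "cmod (schwarz (\<lambda>\<zeta>. p \<zeta> - q \<zeta>) z) \<le> 32 * \<epsilon> * (1 + ln (1 / (1 - cmod z)))"
      using schwarz_log_bound[OF rm pq z(1)] .
    have "\<epsilon> * 1 \<le> \<epsilon> * (1 + ln (1 / (1 - cmod z)))" using \<epsilon> ln_growth_nonneg[OF z(1)] by (intro mult_left_mono) auto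
    then have "cmod (schwarz p z - pole_sum C m z) \<le> 33 * \<epsilon> * (1 + ln (1 / (1 - cmod z)))"
      unfolding s using norm_triangle_ineq[of "schwarz (\<lambda>\<zeta>. p \<zeta> - q \<zeta>) z" "schwarz q z - pole_sum C m z"] 1 3 by linarith
    moreover have "\<bar>Re (schwarz p z - pole_sum C m z)\<bar> \<le> 2 * \<epsilon>"
      unfolding s using 2 1 abs_Re_le_cmod[of "schwarz q z - pole_sum C m z"] by simp
    ultimately show ?thesis by blast
  qed
  then show ?thesis using that C by blast
qed

lemma summable_half_powers: "summable (\<lambda>n. c * (1/2::real) ^ n)"
  by (intro summable_mult summable_geometric) simp

text \<open>Continuous extensions \<open>g n\<close> of \<open>\<psi>\<close> from
  \<open>F n\<close> agree on smaller sets, so consecutive differences vanish on the previous set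
  and \<open>gehring_step\<close> applies with error \<open>(1/2) ^ n\<close>. At a point of
  \<open>F n\<close> the finite partial sums have boundary value \<open>g k x = \<psi> x\<close>,
  while the tail is uniformly small on the Stolz region. The exceptional set consists of the poles
  and is countable.\<close>

theorem gehring:
  fixes F :: "nat \<Rightarrow> complex set" and \<psi> :: "complex \<Rightarrow> real"
  assumes F: "\<And>n. closed (F n)" "\<And>n. F n \<subseteq> sphere 0 1" "incseq F" and \<psi>: "\<And>n. continuous_on (F n) \<psi>"
  obtains G N where "G holomorphic_on ball 0 1" "countable N"
    "\<And>n x M. x \<in> F n \<Longrightarrow> x \<notin> N \<Longrightarrow> ((\<lambda>z. Re (G z)) \<longlongrightarrow> \<psi> x) (at x within stolz M x)"
    "\<And>n x M. x \<in> F n \<Longrightarrow> x \<notin> N \<Longrightarrow>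
       \<exists>C. \<forall>\<^sub>F z in at x within stolz M x. cmod (G z) \<le> C * (1 + ln (1 / (1 - cmod z)))"
proof -
  have "\<exists>g. continuous_on UNIV g \<and> (\<forall>x\<in>F n. g x = \<psi> x)" for n
    using Tietze_unbounded[OF \<psi>[of n], of UNIV] F(1)[of n] by (metis closed_closedin subtopology_UNIV)
  then obtain g where g: "\<And>n. continuous_on UNIV (g n)" "\<And>n x. x \<in> F n \<Longrightarrow> g n x = \<psi> x" by metis
  \<comment> \<open>The \<open>p n\<close> telescope to \<open>g n\<close>. \<open>Fp n\<close> is
    the set on which \<open>p n\<close> vanishes, one index behind \<open>F\<close>; for
    \<open>n = 0\<close> nothing is known and it is empty.\<close>
  define p where "p = (\<lambda>n x. case n of 0 \<Rightarrow> g 0 x | Suc k \<Rightarrow> g (Suc k) x - g k x)"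
  define Fp where "Fp = (\<lambda>n. case n of 0 \<Rightarrow> {} | Suc k \<Rightarrow> F k)"
  have pc: "continuous_on UNIV (p n)" for n
    unfolding p_def using g(1) by (cases n) (auto intro!: continuous_intros)
  have Fp: "closed (Fp n)" for n using F(1) by (cases n) (auto simp: Fp_def)
  have p0: "p n x = 0" if "x \<in> Fp n" for n x
    using that g(2) F(3) by (cases n) (auto simp: Fp_def p_def incseq_Suc_iff)
  have psum: "(\<Sum>k\<le>n. p k x) = g n x" for n x by (induction n) (auto simp: p_def)
  define \<epsilon> where "\<epsilon> = (\<lambda>n::nat. (1/2::real) ^ n)"
  have \<epsilon>: "0 < \<epsilon> n" for n by (simp add: \<epsilon>_def)
  have "\<exists>C m. finite C \<and> C \<subseteq> sphere 0 1 \<and>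
    (\<forall>z. cmod z < 1 \<longrightarrow> cmod z \<le> 1 - 1 / real (Suc n) \<or> (\<exists>x\<in>Fp n. z \<in> stolz (real n) x) \<longrightarrow>
       \<bar>Re (schwarz (p n) z - pole_sum C m z)\<bar> \<le> 2 * \<epsilon> n \<and>
       cmod (schwarz (p n) z - pole_sum C m z) \<le> 33 * \<epsilon> n * (1 + ln (1 / (1 - cmod z))))" for n
    using gehring_step[OF pc Fp p0 \<epsilon>, of n n n n] by metis
  then obtain C m where C: "\<And>n. finite (C n)" "\<And>n. C n \<subseteq> sphere 0 1"
    and Cm: "\<And>n z. cmod z < 1 \<Longrightarrow> cmod z \<le> 1 - 1 / real (Suc n) \<or> (\<exists>x\<in>Fp n. z \<in> stolz (real n) x) \<Longrightarrow>
       \<bar>Re (schwarz (p n) z - pole_sum (C n) (m n) z)\<bar> \<le> 2 * \<epsilon> n \<and>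
       cmod (schwarz (p n) z - pole_sum (C n) (m n) z) \<le> 33 * \<epsilon> n * (1 + ln (1 / (1 - cmod z)))"
    by metis
  have pm: "p n \<in> borel_measurable borel" for n using pc by (rule borel_measurable_continuous_onI)
  have "\<exists>B. \<forall>\<zeta>. cmod \<zeta> = 1 \<longrightarrow> \<bar>p n \<zeta>\<bar> \<le> B" for n
  proof -
    have "compact (p n ` sphere 0 1)" by (intro compact_continuous_image continuous_on_subset[OF pc]) auto
    from compact_imp_bounded[OF this] show ?thesis by (auto simp: bounded_iff) (metis mem_sphere_0)
  qed
  then obtain B where B: "\<And>n \<zeta>. cmod \<zeta> = 1 \<Longrightarrow> \<bar>p n \<zeta>\<bar> \<le> B n" by metis
  define H where "H = (\<lambda>n z. schwarz (p n) z - pole_sum (C n) (m n) z)"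
  have Hhol: "H n holomorphic_on ball 0 1" for n
    unfolding H_def using schwarz_holomorphic[OF pm B] pole_sum_holomorphic[OF C(2)] by (intro holomorphic_intros)
  have sm: "summable (\<lambda>n. c * \<epsilon> n)" for c unfolding \<epsilon>_def by (rule summable_half_powers)
  define G where "G = (\<lambda>z. \<Sum>n. H n z)"
  \<comment> \<open>A fixed disk is covered by the estimates only once
    \<open>1 - 1 / (n + 1)\<close> has passed its radius, hence the eventual form of the Weierstrass
    test.\<close>
  have Hbound: "\<forall>\<^sub>F n in sequentially. \<forall>z\<in>cball 0 r. norm (H n z) \<le> 33 * (1 + ln (1 / (1 - r))) * \<epsilon> n"
    if r: "0 \<le> r" "r < 1" for r
  proof -
    obtain n0 :: nat where n0: "1 / (1 - r) < real n0" using reals_Archimedean2 by blast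
    show ?thesis using eventually_ge_at_top[of n0]
    proof eventually_elim
      case (elim n)
      show ?case
      proof
        fix z :: complex assume z: "z \<in> cball 0 r"
        then have z1: "cmod z < 1" using r by simp
        have "1 / (1 - r) < real (Suc n)" using n0 elim by simp
        then have "1 / real (Suc n) < 1 - r" using r by (simp add: field_simps)
        then have "cmod z \<le> 1 - 1 / real (Suc n)" using z by simp
        then have "norm (H n z) \<le> 33 * \<epsilon> n * (1 + ln (1 / (1 - cmod z)))" using Cm[OF z1, of n] by (simp add: H_def)
        also have "\<dots> \<le> 33 * \<epsilon> n * (1 + ln (1 / (1 - r)))"
          using \<epsilon>[of n] r z by (intro mult_left_mono add_left_mono ln_mono frac_le) auto
        finally show "norm (H n z) \<le> 33 * (1 + ln (1 / (1 - r))) * \<epsilon> n" by (simp add: mult.commute mult.left_commute)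
      qed
    qed
  qed
  have ul: "uniform_limit (cball 0 r) (\<lambda>n z. \<Sum>i<n. H i z) G sequentially" if "0 \<le> r" "r < 1" for r
    unfolding G_def by (rule Weierstrass_m_test_ev[OF Hbound[OF that] sm])
  have Ghol: "G holomorphic_on ball 0 1"
  proof (rule holomorphic_uniform_sequence[where f = "\<lambda>n z. \<Sum>i<n. H i z"])
    show "(\<lambda>z. \<Sum>i<n. H i z) holomorphic_on ball 0 1" for n by (intro holomorphic_intros Hhol)
    fix x :: complex assume x: "x \<in> ball 0 1"
    define d where "d = (1 - cmod x) / 2"
    have "cball x d \<subseteq> cball 0 ((1 + cmod x) / 2)"
    proof
      fix y assume "y \<in> cball x d"
      then show "y \<in> cball 0 ((1 + cmod x) / 2)"
        using norm_triangle_ineq[of x "y - x"] by (simp add: d_def dist_norm norm_minus_commute field_simps)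
    qed
    moreover have "cball 0 ((1 + cmod x) / 2) \<subseteq> ball (0::complex) 1" using x by auto
    ultimately show "\<exists>d>0. cball x d \<subseteq> ball 0 1 \<and> uniform_limit (cball x d) (\<lambda>n z. \<Sum>i<n. H i z) G sequentially"
      using x ul[of "(1 + cmod x) / 2"] by (intro exI[of _ d]) (auto simp: d_def intro: uniform_limit_on_subset)
  qed auto
  have Hsummable: "summable (\<lambda>n. H n z)" if "cmod z < 1" for z
  proof (rule summable_comparison_test_ev[OF _ sm])
    show "\<forall>\<^sub>F n in sequentially. norm (H n z) \<le> 33 * (1 + ln (1 / (1 - cmod z))) * \<epsilon> n"
      using Hbound[of "cmod z"] that by (auto elim: eventually_mono)
  qed
  define N where "N = (\<Union>n. C n)"
  have N: "countable N" unfolding N_def using C(1) by (intro countable_UN) (auto intro: countable_finite)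
  \<comment> \<open>From index \<open>k\<close> on, the point \<open>x\<close> belongs to every
    \<open>Fp\<close> and the aperture is at least \<open>M\<close>, so all remaining terms obey
    both bounds on the whole region. The sum of \<open>2 \<epsilon>\<close> over this tail is
    \<open>4 (1/2) ^ k\<close>.\<close>
  have tail: "\<bar>Re (G z - (\<Sum>n<k. H n z))\<bar> \<le> 4 * (1/2) ^ k \<and> cmod (G z - (\<Sum>n<k. H n z)) \<le> 66 * (1 + ln (1 / (1 - cmod z)))"
    if x: "x \<in> F n0" and k: "Suc n0 \<le> k" "M \<le> real k" and z: "z \<in> stolz M x" for x n0 M k z
  proof -
    have z1: "cmod z < 1" using z by (simp add: stolz_def)
    have b: "\<bar>Re (H (n + k) z)\<bar> \<le> 2 * \<epsilon> (n + k) \<and> cmod (H (n + k) z) \<le> 33 * \<epsilon> (n + k) * (1 + ln (1 / (1 - cmod z)))" for n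
    proof -
      obtain j where j: "n + k = Suc j" "n0 \<le> j" using k(1) by (cases "n + k") auto
      have "x \<in> Fp (n + k)" using x F(3) j by (auto simp: Fp_def incseq_def)
      moreover have "z \<in> stolz (real (n + k)) x"
        using z k(2) order_trans[OF _ mult_right_mono[of M "real (n + k)" "1 - cmod z"]] by (auto simp: stolz_def)
      ultimately show ?thesis using Cm[OF z1, of "n + k"] unfolding H_def by blast
    qed
    have eq: "G z - (\<Sum>n<k. H n z) = (\<Sum>n. H (n + k) z)"
      unfolding G_def using suminf_split_initial_segment[OF Hsummable[OF z1], of k] by simp
    have sk: "summable (\<lambda>n. H (n + k) z)" using Hsummable[OF z1] by (rule summable_ignore_initial_segment)
    have se: "(\<lambda>n. \<epsilon> (n + k)) sums (2 * (1/2) ^ k)"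
    proof -
      have "(\<lambda>n. (1/2) ^ k * (1/2::real) ^ n) sums ((1/2) ^ k * 2)"
        using sums_mult[OF geometric_sums[of "1/2::real"], of "(1/2) ^ k"] by simp
      then show ?thesis by (simp add: \<epsilon>_def power_add mult.commute)
    qed
    have "\<bar>Re (\<Sum>n. H (n + k) z)\<bar> = norm (\<Sum>n. Re (H (n + k) z))"
      by (simp add: Re_suminf[OF sk])
    also have "\<dots> \<le> (\<Sum>n. 2 * \<epsilon> (n + k))"
      using b sums_summable[OF sums_mult[OF se, of 2]] by (intro norm_suminf_le) auto
    also have "\<dots> = 4 * (1/2) ^ k" using sums_unique[OF sums_mult[OF se, of 2]] by simp
    finally have 1: "\<bar>Re (G z - (\<Sum>n<k. H n z))\<bar> \<le> 4 * (1/2) ^ k" unfolding eq .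
    define L where "L = 1 + ln (1 / (1 - cmod z))"
    have L: "1 \<le> L" using ln_growth_nonneg[OF z1] by (simp add: L_def)
    have "cmod (\<Sum>n. H (n + k) z) \<le> (\<Sum>n. 33 * L * \<epsilon> (n + k))"
      using b sums_summable[OF sums_mult[OF se, of "33 * L"]] by (intro norm_suminf_le) (auto simp: L_def mult.commute mult.left_commute)
    also have "\<dots> = 33 * L * (2 * (1/2) ^ k)" using sums_unique[OF sums_mult[OF se, of "33 * L"]] by simp
    also have "\<dots> \<le> 33 * L * (2 * 1)" using L by (intro mult_left_mono power_le_one) auto
    finally show ?thesis using 1 unfolding eq L_def by simp
  qed
  have lim: "((\<lambda>z. Re (G z)) \<longlongrightarrow> \<psi> x) (at x within stolz M x)" if x: "x \<in> F n0" "x \<notin> N" for n0 x M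
  proof (rule tendstoI)
    fix e :: real assume e: "0 < e"
    have x1: "cmod x = 1" using subsetD[OF F(2) x(1)] by simp
    obtain k0 where "(1/2::real) ^ k0 < e / 8" using real_arch_pow_inv[of "e / 8" "1/2::real"] e by auto
    then have k0: "4 * (1/2::real) ^ k0 < e / 2" by simp
    define k where "k = k0 + (Suc n0 + nat \<lceil>M\<rceil>)"
    have k: "k0 \<le> k" "Suc n0 \<le> k" "M \<le> real k"
      using real_nat_ceiling_ge[of M] unfolding k_def by (simp_all only: of_nat_add)
    have "(1/2::real) ^ k \<le> (1/2) ^ k0" using k(1) by (intro power_decreasing) auto
    then have ke: "4 * (1/2::real) ^ k < e / 2" using k0 by linarith
    have "((\<lambda>z. \<Sum>n<k. Re (H n z)) \<longlongrightarrow> (\<Sum>n<k. p n x - 0)) (at x within stolz M x)"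
      unfolding H_def minus_complex.sel
    proof (intro tendsto_intros)
      fix n
      have "isCont (p n) x" using pc[of n] by (simp add: continuous_on_eq_continuous_at)
      from tendsto_within_subset[OF schwarz_Poisson_tendsto[OF pm B x1 this] stolz_subset]
      show "((\<lambda>z. Re (schwarz (p n) z)) \<longlongrightarrow> p n x) (at x within stolz M x)" .
      have xC: "x \<notin> C n" using x(2) by (auto simp: N_def)
      have xs: "x \<in> sphere 0 1" using x1 by simp
      from tendsto_Re[OF pole_sum_tendsto(1)[OF C(2) xs xC]] pole_sum_tendsto(2)[OF C(2) xs xC] show "((\<lambda>z. Re (pole_sum (C n) (m n) z)) \<longlongrightarrow> 0) (at x within stolz M x)" by simp
    qed
    moreover have "(\<Sum>n<k. p n x - 0) = \<psi> x"
    proof -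
      obtain j where j: "k = Suc j" "n0 \<le> j" using k(2) by (cases k) auto
      have "x \<in> F j" using x(1) F(3) j(2) by (auto simp: incseq_def)
      then show ?thesis using psum[of x j] g(2) j(1) by (simp add: lessThan_Suc_atMost)
    qed
    ultimately have "\<forall>\<^sub>F z in at x within stolz M x. dist (\<Sum>n<k. Re (H n z)) (\<psi> x) < e / 2"
      using e tendstoD[of _ "\<psi> x" _ "e / 2"] by simp
    moreover have "\<forall>\<^sub>F z in at x within stolz M x. z \<in> stolz M x" by (simp add: eventually_at_filter)
    ultimately show "\<forall>\<^sub>F z in at x within stolz M x. dist (Re (G z)) (\<psi> x) < e"
    proof eventually_elim
      case (elim z)
      have "\<bar>Re (G z) - (\<Sum>n<k. Re (H n z))\<bar> < e / 2"
        using tail[OF x(1) k(2,3) elim(2)] ke by simp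
      then show ?case using elim(1) unfolding dist_real_def by linarith
    qed
  qed
  have bd: "\<exists>K. \<forall>\<^sub>F z in at x within stolz M x. cmod (G z) \<le> K * (1 + ln (1 / (1 - cmod z)))"
    if x: "x \<in> F n0" "x \<notin> N" for n0 x M
  proof -
    have x1: "cmod x = 1" using subsetD[OF F(2) x(1)] by simp
    define k where "k = Suc n0 + nat \<lceil>M\<rceil>"
    have k: "Suc n0 \<le> k" "M \<le> real k"
      using real_nat_ceiling_ge[of M] unfolding k_def by (simp_all only: of_nat_add)
    define K where "K = (\<Sum>n<k. 32 * B n + cmod (pole_sum (C n) (m n) x) + 1)"
    have "\<forall>\<^sub>F z in at x within stolz M x. cmod (pole_sum (C n) (m n) z) < cmod (pole_sum (C n) (m n) x) + 1" for n
    proof (rule order_tendstoD(2))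
      have "x \<notin> C n" using x(2) by (auto simp: N_def)
      then show "((\<lambda>z. cmod (pole_sum (C n) (m n) z)) \<longlongrightarrow> cmod (pole_sum (C n) (m n) x)) (at x within stolz M x)"
        using pole_sum_tendsto(1)[OF C(2)[of n]] x1 by (intro tendsto_norm) auto
    qed simp
    then have "\<forall>\<^sub>F z in at x within stolz M x. \<forall>n\<in>{..<k}. cmod (pole_sum (C n) (m n) z) < cmod (pole_sum (C n) (m n) x) + 1"
      by (intro eventually_ball_finite) auto
    moreover have "\<forall>\<^sub>F z in at x within stolz M x. z \<in> stolz M x" by (simp add: eventually_at_filter)
    ultimately have "\<forall>\<^sub>F z in at x within stolz M x. cmod (G z) \<le> (K + 66) * (1 + ln (1 / (1 - cmod z)))"
    proof eventually_elim
      case (elim z)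
      have z1: "cmod z < 1" using elim(2) by (simp add: stolz_def)
      define L where "L = 1 + ln (1 / (1 - cmod z))"
      have L: "1 \<le> L" using ln_growth_nonneg[OF z1] by (simp add: L_def)
      have "cmod (\<Sum>n<k. H n z) \<le> (\<Sum>n<k. (32 * B n + cmod (pole_sum (C n) (m n) x) + 1) * L)"
      proof (rule order_trans[OF norm_sum sum_mono])
        fix n assume "n \<in> {..<k}"
        then have "cmod (pole_sum (C n) (m n) z) \<le> (cmod (pole_sum (C n) (m n) x) + 1) * 1" using elim(1) by (auto intro: less_imp_le)
        also have "\<dots> \<le> (cmod (pole_sum (C n) (m n) x) + 1) * L" using L by (intro mult_left_mono) auto
        finally have "cmod (pole_sum (C n) (m n) z) \<le> (cmod (pole_sum (C n) (m n) x) + 1) * L" .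
        moreover have "cmod (schwarz (p n) z) \<le> 32 * B n * L"
          using schwarz_log_bound[OF pm B z1] by (simp add: L_def)
        ultimately show "cmod (H n z) \<le> (32 * B n + cmod (pole_sum (C n) (m n) x) + 1) * L"
          unfolding H_def using norm_triangle_ineq4[of "schwarz (p n) z" "pole_sum (C n) (m n) z"] by (simp add: algebra_simps)
      qed
      also have "\<dots> = K * L" by (simp add: K_def sum_distrib_right)
      finally have "cmod (\<Sum>n<k. H n z) \<le> K * L" .
      moreover have "cmod (G z - (\<Sum>n<k. H n z)) \<le> 66 * L"
        using tail[OF x(1) k elim(2)] by (simp add: L_def)
      ultimately show ?case
        using norm_triangle_ineq[of "G z - (\<Sum>n<k. H n z)" "\<Sum>n<k. H n z"] by (simp add: L_def algebra_simps)
    qed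
    then show ?thesis by blast
  qed
  show ?thesis using that[OF Ghol N] lim bd by blast
qed

section \<open>Boundary behaviour of the Schwarz integral of a function of bounded variation\<close>

text \<open>A quantitative Dini condition at \<open>x\<close>; both parts are controlled by the tail of the
  logarithmic potential of the variation measure.\<close>

definition dini_tail :: "(complex \<Rightarrow> real) \<Rightarrow> complex \<Rightarrow> real \<Rightarrow> real \<Rightarrow> bool" where
  "dini_tail \<alpha> x \<delta> s \<longleftrightarrow> 0 < \<delta> \<and> \<delta> < 1 \<and>
     (\<forall>\<zeta>. cmod \<zeta> = 1 \<and> \<zeta> \<noteq> x \<and> cmod (\<zeta> - x) < \<delta> \<longrightarrow> \<bar>\<alpha> \<zeta> - \<alpha> x\<bar> * ln (1 / cmod (\<zeta> - x)) \<le> s) \<and>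
     (\<integral>\<^sup>+\<zeta>. ennreal (\<bar>\<alpha> \<zeta> - \<alpha> x\<bar> / cmod (\<zeta> - x)) * indicator (ball x \<delta>) \<zeta> \<partial>circ) \<le> ennreal s"

lemma dini_tail_mono:
  assumes "dini_tail \<alpha> x \<delta> s" "s \<le> s'" shows "dini_tail \<alpha> x \<delta> s'"
  using assms order_trans[OF _ ennreal_leI[OF assms(2)]] unfolding dini_tail_def
  by (auto intro: order_trans)

text \<open>For the pointwise part, on the disk of radius \<open>t\<close> the kernel is at least
  \<open>ln (1 / t) > T\<close>, so mass times logarithm is at most the tail. For the integral,
  dyadic disks of radius \<open>r j\<close> have arc length at most \<open>2 r j\<close>, which
  leaves four times the sum of their \<open>\<mu>\<close>-masses. A point \<open>y\<close> lies in
  at most \<open>ln (1 / \<bar>x - y\<bar>) / ln 2\<close> of them, so this sum is again a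
  logarithmic integral; \<open>ln 2 \<ge> 1/2\<close> turns 4 into 8.\<close>

lemma dini_tail_of_tail_pot:
  assumes \<alpha>: "\<alpha> \<in> borel_measurable borel"
    and m: "sets \<mu> = sets borel" "finite_measure \<mu>" and x: "cmod x = 1"
    and loc: "\<And>\<zeta>. cmod \<zeta> = 1 \<Longrightarrow> cmod (\<zeta> - x) < 1 / 2 ^ n0 \<Longrightarrow> \<bar>\<alpha> \<zeta> - \<alpha> x\<bar> \<le> measure \<mu> (cball x (cmod (\<zeta> - x)))"
    and n0: "1 \<le> n0" "0 \<le> T" "T < real n0 * ln 2" and s: "0 \<le> s" "tail_pot T \<mu> x \<le> ennreal s"
  shows "dini_tail \<alpha> x (1 / 2 ^ n0) (8 * s)"
proof -
  interpret M: finite_measure \<mu> by fact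
  note [measurable_cong] = m(1)
  note [measurable] = \<alpha>
  have mk [measurable]: "log_kernel x \<in> borel_measurable \<mu>"
    using m(1) measurable_log_kernel by (simp cong: measurable_cong_sets)
  have meas [measurable]: "{y. ennreal T < log_kernel x y} \<in> sets \<mu>"
    using m(1) by simp
  have cb [measurable]: "cball x r \<in> sets \<mu>" for r using m(1) by simp
  have small: "T < ln (1 / t)" if "0 < t" "t \<le> 1 / 2 ^ n0" for t :: real
  proof -
    have "real n0 * ln 2 = ln (2 ^ n0)" by (simp add: ln_realpow)
    also have "\<dots> \<le> ln (1 / t)" using that by (intro ln_mono) (auto simp: field_simps)
    finally show ?thesis using n0(3) by simp
  qed
  have part1: "\<bar>\<alpha> \<zeta> - \<alpha> x\<bar> * ln (1 / cmod (\<zeta> - x)) \<le> 8 * s"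
    if \<zeta>: "cmod \<zeta> = 1" "\<zeta> \<noteq> x" "cmod (\<zeta> - x) < 1 / 2 ^ n0" for \<zeta>
  proof -
    define t where "t = cmod (\<zeta> - x)"
    have t: "0 < t" "t \<le> 1 / 2 ^ n0" using \<zeta> by (auto simp: t_def)
    have l: "T < ln (1 / t)" by (rule small[OF t])
    have "ennreal (measure \<mu> (cball x t) * ln (1 / t)) = (\<integral>\<^sup>+y. ennreal (ln (1 / t)) * indicator (cball x t) y \<partial>\<mu>)"
      using l n0(2) by (subst nn_integral_cmult_indicator) (auto simp: M.emeasure_eq_measure ennreal_mult[symmetric] mult.commute)
    also have "\<dots> \<le> tail_pot T \<mu> x"
      unfolding tail_pot_def
    proof (rule nn_integral_mono)
      fix y
      show "ennreal (ln (1 / t)) * indicator (cball x t) y \<le> log_kernel x y * indicator {y. ennreal T < log_kernel x y} y"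
      proof (cases "y \<in> cball x t")
        case True
        have "ennreal (ln (1 / t)) \<le> log_kernel x y"
        proof (cases "x = y")
          case False
          have "ln (1 / t) \<le> - ln (cmod (x - y))"
            using True False t(1) by (simp add: dist_norm ln_div)
          then show ?thesis using log_kernel_ge[of x y] ennreal_leI order_trans by meson
        qed (simp add: log_kernel_def)
        moreover have "ennreal T < ennreal (ln (1 / t))" using l n0(2) by (simp add: ennreal_less_iff)
        ultimately show ?thesis using True by (auto simp: indicator_def dest: less_le_trans)
      qed simp
    qed
    also have "\<dots> \<le> ennreal s" by (rule s(2))
    finally have "measure \<mu> (cball x t) * ln (1 / t) \<le> s" using s(1) by simp
    moreover have "\<bar>\<alpha> \<zeta> - \<alpha> x\<bar> * ln (1 / t) \<le> measure \<mu> (cball x t) * ln (1 / t)"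
      using loc[OF \<zeta>(1,3)] l n0(2) by (intro mult_right_mono) (auto simp: t_def)
    ultimately show ?thesis using s(1) by (simp add: t_def)
  qed
  define r where "r = (\<lambda>j::nat. 1 / 2 ^ (n0 + j) :: real)"
  have r: "0 < r j" for j by (simp add: r_def)
  have point: "ennreal (\<bar>\<alpha> \<zeta> - \<alpha> x\<bar> / cmod (\<zeta> - x)) * indicator (ball x (1 / 2 ^ n0)) \<zeta>
      \<le> (\<Sum>j. ennreal (2 / r j * measure \<mu> (cball x (r j))) * indicator (cball x (r j)) \<zeta>)" if \<zeta>: "cmod \<zeta> = 1" for \<zeta>
  proof (cases "\<zeta> \<in> ball x (1 / 2 ^ n0) \<and> \<zeta> \<noteq> x")
    case True
    define t where "t = cmod (\<zeta> - x)"
    have t: "0 < t" "t < 1 / 2 ^ n0" using True by (auto simp: t_def dist_norm norm_minus_commute)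
    \<comment> \<open>The first \<open>j\<close> with \<open>r j < 2 t\<close> works: if its
      predecessor exists, it fails and has radius \<open>2 r j\<close>; for \<open>j = 0\<close> the
      bound \<open>t < 1 / 2 ^ n0\<close> is used.\<close>
    have "\<exists>j. t \<le> r j \<and> r j < 2 * t"
    proof -
      obtain k where k: "(1/2::real) ^ k < t" using real_arch_pow_inv[of t "1/2::real"] t(1) by auto
      define P where "P = (\<lambda>j. r j < 2 * t)"
      have "r k \<le> (1/2) ^ k" by (simp add: r_def power_add field_simps)
      then have "P k" using k t(1) by (simp add: P_def)
      define j where "j = (LEAST j. P j)"
      have Pj: "P j" unfolding j_def by (rule LeastI[of P k]) fact
      have "t \<le> r j"
      proof (cases j)
        case 0 then show ?thesis using t(2) by (simp add: r_def)
      next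
        case (Suc i)
        then have "\<not> P i" using not_less_Least[of i P] by (simp add: j_def)
        then have "2 * t \<le> r i" by (simp add: P_def)
        also have "r i = 2 * r j" by (simp add: Suc r_def)
        finally show ?thesis by simp
      qed
      then show ?thesis using Pj by (auto simp: P_def)
    qed
    then obtain j where j: "t \<le> r j" "r j < 2 * t" by blast
    have "\<bar>\<alpha> \<zeta> - \<alpha> x\<bar> \<le> measure \<mu> (cball x t)" using loc[OF \<zeta>] t(2) by (simp add: t_def)
    also have "\<dots> \<le> measure \<mu> (cball x (r j))" using j(1) by (intro M.finite_measure_mono) auto
    finally have "\<bar>\<alpha> \<zeta> - \<alpha> x\<bar> / t \<le> measure \<mu> (cball x (r j)) / (r j / 2)"
      using j(2) r[of j] by (intro frac_le) auto
    also have "\<dots> = 2 / r j * measure \<mu> (cball x (r j))" by simp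
    finally have "ennreal (\<bar>\<alpha> \<zeta> - \<alpha> x\<bar> / t) \<le> ennreal (2 / r j * measure \<mu> (cball x (r j))) * indicator (cball x (r j)) \<zeta>"
      using j(1) by (auto simp: t_def dist_norm norm_minus_commute intro: ennreal_leI)
    also have "\<dots> \<le> (\<Sum>j. ennreal (2 / r j * measure \<mu> (cball x (r j))) * indicator (cball x (r j)) \<zeta>)"
    proof -
      define h where "h = (\<lambda>j. ennreal (2 / r j * measure \<mu> (cball x (r j))) * indicator (cball x (r j)) \<zeta>)"
      have "h j \<le> suminf h" using sum_le_suminf[of h "{j}"] by simp
      then show ?thesis by (simp only: h_def)
    qed
    finally show ?thesis using True by (simp add: t_def)
  qed auto
  have "(\<integral>\<^sup>+\<zeta>. ennreal (\<bar>\<alpha> \<zeta> - \<alpha> x\<bar> / cmod (\<zeta> - x)) * indicator (ball x (1 / 2 ^ n0)) \<zeta> \<partial>circ)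
     \<le> (\<integral>\<^sup>+\<zeta>. (\<Sum>j. ennreal (2 / r j * measure \<mu> (cball x (r j))) * indicator (cball x (r j)) \<zeta>) \<partial>circ)"
  proof (rule nn_integral_mono_AE)
    show "AE \<zeta> in circ. ennreal (\<bar>\<alpha> \<zeta> - \<alpha> x\<bar> / cmod (\<zeta> - x)) * indicator (ball x (1 / 2 ^ n0)) \<zeta>
      \<le> (\<Sum>j. ennreal (2 / r j * measure \<mu> (cball x (r j))) * indicator (cball x (r j)) \<zeta>)"
      using AE_circ by eventually_elim (rule point)
  qed
  also have "\<dots> = (\<Sum>j. ennreal (2 / r j * measure \<mu> (cball x (r j))) * emeasure circ (cball x (r j)))"
    by (subst nn_integral_suminf) (auto simp: nn_integral_cmult_indicator)
  also have "\<dots> \<le> (\<Sum>j. ennreal 4 * emeasure \<mu> (cball x (r j)))"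
  proof (intro suminf_le allI)
    fix j
    have "ennreal (2 / r j * measure \<mu> (cball x (r j))) * emeasure circ (cball x (r j))
        = ennreal (2 / r j * measure \<mu> (cball x (r j)) * measure circ (cball x (r j)))"
      using r[of j] by (simp add: circ.emeasure_eq_measure ennreal_mult[symmetric] less_imp_le)
    also have "\<dots> \<le> ennreal (2 / r j * measure \<mu> (cball x (r j)) * (2 * r j))"
      using r[of j] circ_cball[OF x, of "r j"] by (intro ennreal_leI mult_left_mono) (auto simp: less_imp_le)
    also have "\<dots> = ennreal (4 * measure \<mu> (cball x (r j)))" using r[of j] by simp
    also have "\<dots> = ennreal 4 * emeasure \<mu> (cball x (r j))"
      by (simp add: M.emeasure_eq_measure ennreal_mult)
    finally show "ennreal (2 / r j * measure \<mu> (cball x (r j))) * emeasure circ (cball x (r j)) \<le> ennreal 4 * emeasure \<mu> (cball x (r j))" .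
  qed auto
  also have "\<dots> = (\<integral>\<^sup>+y. (\<Sum>j. ennreal 4 * indicator (cball x (r j)) y) \<partial>\<mu>)"
    by (subst nn_integral_suminf) (auto simp: nn_integral_cmult_indicator)
  also have "\<dots> \<le> (\<integral>\<^sup>+y. ennreal 8 * (log_kernel x y * indicator {y. ennreal T < log_kernel x y} y) \<partial>\<mu>)"
  proof (rule nn_integral_mono)
    fix y
    show "(\<Sum>j. ennreal 4 * indicator (cball x (r j)) y) \<le> ennreal 8 * (log_kernel x y * indicator {y. ennreal T < log_kernel x y} y)"
    proof (cases "x = y")
      case True
      then show ?thesis by (simp add: log_kernel_def indicator_def ennreal_mult_top)
    next
      case False
      define t where "t = cmod (x - y)"
      have t: "0 < t" using False by (simp add: t_def)
      show ?thesis
      proof (cases "t \<le> 1 / 2 ^ n0")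
        case True
        define l where "l = ln (1 / t)"
        have l: "T < l" unfolding l_def by (rule small[OF t True])
        \<comment> \<open>Membership of \<open>y\<close> in disk \<open>j\<close> means
          \<open>n0 + j \<le> l / ln 2\<close>. As \<open>n0 \<ge> 1\<close>, this gives the strict
          \<open>j < K\<close> that the range of summation needs.\<close>
        define K where "K = nat \<lfloor>l / ln 2\<rfloor>"
        have zero: "indicator (cball x (r j)) y = (0::ennreal)" if "j \<notin> {..<K}" for j
        proof (rule ccontr)
          assume "\<not> ?thesis"
          then have "t \<le> r j" by (auto simp: t_def dist_norm indicator_def split: if_splits)
          then have "2 ^ (n0 + j) \<le> 1 / t" using t by (simp add: r_def field_simps)
          then have "ln (2 ^ (n0 + j)) \<le> l" unfolding l_def using t by (intro ln_mono) auto
          then have "real (n0 + j) * ln 2 \<le> l" by (simp add: ln_realpow)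
          then have "real (n0 + j) \<le> l / ln 2" by (simp add: pos_le_divide_eq)
          then have "j < K" using n0(1) unfolding K_def by linarith
          then show False using that by simp
        qed
        have "(\<Sum>j. ennreal 4 * indicator (cball x (r j)) y) = (\<Sum>j<K. ennreal 4 * indicator (cball x (r j)) y)"
          by (rule suminf_finite) (use zero in auto)
        also have "\<dots> \<le> (\<Sum>j<K. ennreal 4)" by (intro sum_mono) (auto simp: indicator_def)
        also have "\<dots> = ennreal (4 * real K)" by (simp add: ennreal_of_nat_eq_real_of_nat ennreal_mult mult.commute)
        also have "\<dots> \<le> ennreal (8 * l)"
        proof (rule ennreal_leI)
          have "(1/2::real) \<le> ln 2" using ln_ge_iff exp_bound_half by (metis exp_half_le2 zero_less_numeral)
          then have "l / ln 2 \<le> l / (1/2)" using l n0(2) by (intro divide_left_mono) auto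
          moreover have "0 \<le> l / ln 2" using l n0(2) by simp
          moreover from this have "real K \<le> l / ln 2" by (simp add: K_def)
          ultimately show "4 * real K \<le> 8 * l" by simp
        qed
        also have "\<dots> = ennreal 8 * ennreal l" using l n0(2) by (simp add: ennreal_mult)
        also have "ennreal l = log_kernel x y"
        proof -
          have "l = - ln (cmod (x - y))" using t by (simp add: l_def t_def ln_div)
          moreover have "max 0 l = l" using l n0(2) by simp
          ultimately show ?thesis using False by (simp add: log_kernel_def)
        qed
        finally show ?thesis using l n0(2) \<open>ennreal l = log_kernel x y\<close>[symmetric]
          by (simp add: indicator_def ennreal_less_iff)
      next
        case False
        have "indicator (cball x (r j)) y = (0::ennreal)" for j
        proof -
          have "r j \<le> 1 / 2 ^ n0" by (simp add: r_def power_add field_simps)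
          then show ?thesis using False by (auto simp: t_def dist_norm indicator_def)
        qed
        then show ?thesis by simp
      qed
    qed
  qed
  also have "\<dots> = ennreal 8 * tail_pot T \<mu> x"
    unfolding tail_pot_def by (intro nn_integral_cmult) measurable
  also have "\<dots> \<le> ennreal 8 * ennreal s" by (intro mult_left_mono s(2)) auto
  also have "\<dots> = ennreal (8 * s)" using s(1) by (simp add: ennreal_mult)
  finally have part2: "(\<integral>\<^sup>+\<zeta>. ennreal (\<bar>\<alpha> \<zeta> - \<alpha> x\<bar> / cmod (\<zeta> - x)) * indicator (ball x (1 / 2 ^ n0)) \<zeta> \<partial>circ) \<le> ennreal (8 * s)" .
  have "(1::real) < 2 ^ n0" using n0(1) by (intro one_less_power) auto
  then show ?thesis unfolding dini_tail_def using part1 part2 by auto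
qed

text \<open>The Schwarz kernel is not integrable at \<open>\<zeta> = x\<close>. Subtracting the
  constant \<open>\<alpha> x\<close>, whose Schwarz integral is itself, leaves an integral that
  converges absolutely under the Dini condition.\<close>

definition schwarz_bdry :: "(complex \<Rightarrow> real) \<Rightarrow> complex \<Rightarrow> complex" where
  "schwarz_bdry \<alpha> x = of_real (\<alpha> x) + (\<integral>\<zeta>. of_real (\<alpha> \<zeta> - \<alpha> x) * ((\<zeta> + x) / (\<zeta> - x)) \<partial>circ)"

lemma sqrt_ln_tendsto: "((\<lambda>y::real. sqrt y * ln (1 / y)) \<longlongrightarrow> 0) (at_right 0)"
proof -
  have s: "filterlim sqrt (at_right 0) (at_right (0::real))"
    unfolding filterlim_at
  proof
    show "(sqrt \<longlongrightarrow> 0) (at_right 0)" by (auto intro!: tendsto_eq_intros)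
    show "\<forall>\<^sub>F x in at_right 0. sqrt x \<in> {0<..} \<and> sqrt x \<noteq> 0" by (auto simp: eventually_at_filter)
  qed
  have "((\<lambda>y::real. 2 * (ln (inverse (sqrt y)) / inverse (sqrt y))) \<longlongrightarrow> 2 * 0) (at_right 0)"
    by (intro tendsto_mult tendsto_const filterlim_compose[OF ln_x_over_x_tendsto_0]
        filterlim_compose[OF filterlim_inverse_at_top_right s])
  moreover have "\<forall>\<^sub>F y in at_right 0. 2 * (ln (inverse (sqrt y)) / inverse (sqrt y)) = sqrt y * ln (1 / y)"
    unfolding eventually_at_right_field
    by (intro exI[of _ 1]) (auto simp: ln_inverse ln_sqrt ln_div, simp add: field_simps)
  ultimately show ?thesis using Lim_transform_eventually by fastforce
qed

context
  fixes \<alpha> :: "complex \<Rightarrow> real" and B :: real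
  assumes am [measurable]: "\<alpha> \<in> borel_measurable borel"
    and aB: "\<And>\<zeta>. cmod \<zeta> = 1 \<Longrightarrow> \<bar>\<alpha> \<zeta>\<bar> \<le> B"
begin

lemma schwarz_minus_const:
  assumes z: "cmod z < 1"
  shows "integrable circ (\<lambda>\<zeta>. of_real (\<alpha> \<zeta> - c) * ((\<zeta> + z) / (\<zeta> - z)))"
    "schwarz \<alpha> z - of_real c = (\<integral>\<zeta>. of_real (\<alpha> \<zeta> - c) * ((\<zeta> + z) / (\<zeta> - z)) \<partial>circ)"
proof -
  have k: "integrable circ (\<lambda>\<zeta>. (\<zeta> + z) / (\<zeta> - z))"
    using z schwarz_kernel_norm' by (intro circ_bounded(1)[where B = "2 / (1 - cmod z)"]) auto
  have i: "integrable circ (\<lambda>\<zeta>. of_real (\<alpha> \<zeta>) * ((\<zeta> + z) / (\<zeta> - z)))"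
    by (rule schwarz_integrable[OF am aB z])
  have i2: "integrable circ (\<lambda>\<zeta>. of_real c * ((\<zeta> + z) / (\<zeta> - z)))" by (intro integrable_mult_right k)
  have eq: "of_real (\<alpha> \<zeta> - c) * ((\<zeta> + z) / (\<zeta> - z)) = of_real (\<alpha> \<zeta>) * ((\<zeta> + z) / (\<zeta> - z)) - of_real c * ((\<zeta> + z) / (\<zeta> - z))" for \<zeta>
    by (simp only: of_real_diff left_diff_distrib)
  show "integrable circ (\<lambda>\<zeta>. of_real (\<alpha> \<zeta> - c) * ((\<zeta> + z) / (\<zeta> - z)))"
    unfolding eq by (intro Bochner_Integration.integrable_diff i i2)
  show "schwarz \<alpha> z - of_real c = (\<integral>\<zeta>. of_real (\<alpha> \<zeta> - c) * ((\<zeta> + z) / (\<zeta> - z)) \<partial>circ)"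
    unfolding eq Bochner_Integration.integral_diff[OF i i2] schwarz_def integral_mult_right_zero schwarz_1[OF z] by simp
qed

lemma dini_integrable:
  assumes x: "cmod x = 1" and d: "dini_tail \<alpha> x \<delta> s"
  shows "integrable circ (\<lambda>\<zeta>. \<bar>\<alpha> \<zeta> - \<alpha> x\<bar> / cmod (\<zeta> - x))"
    "integrable circ (\<lambda>\<zeta>. \<bar>\<alpha> \<zeta> - \<alpha> x\<bar> / cmod (\<zeta> - x) * indicator (ball x \<delta>) \<zeta>)"
    "(\<integral>\<zeta>. \<bar>\<alpha> \<zeta> - \<alpha> x\<bar> / cmod (\<zeta> - x) * indicator (ball x \<delta>) \<zeta> \<partial>circ) \<le> max 0 s"
proof -
  let ?g = "\<lambda>\<zeta>. \<bar>\<alpha> \<zeta> - \<alpha> x\<bar> / cmod (\<zeta> - x)"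
  have \<delta>: "0 < \<delta>" and le: "(\<integral>\<^sup>+\<zeta>. ennreal (?g \<zeta>) * indicator (ball x \<delta>) \<zeta> \<partial>circ) \<le> ennreal s"
    using d by (auto simp: dini_tail_def)
  have eq: "ennreal (?g \<zeta>) * indicator (ball x \<delta>) \<zeta> = ennreal (?g \<zeta> * indicator (ball x \<delta>) \<zeta>)" for \<zeta>
    by (simp add: indicator_def)
  have [measurable]: "ball x \<delta> \<in> sets borel" by simp
  have mg: "(\<lambda>\<zeta>. ?g \<zeta> * indicator (ball x \<delta>) \<zeta>) \<in> borel_measurable circ" by measurable
  show i1: "integrable circ (\<lambda>\<zeta>. ?g \<zeta> * indicator (ball x \<delta>) \<zeta>)"
  proof (rule integrableI_bounded[OF mg])
    have "(\<integral>\<^sup>+\<zeta>. ennreal (norm (?g \<zeta> * indicator (ball x \<delta>) \<zeta>)) \<partial>circ) \<le> ennreal s"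
      using le unfolding eq by (simp add: indicator_def)
    then show "(\<integral>\<^sup>+\<zeta>. ennreal (norm (?g \<zeta> * indicator (ball x \<delta>) \<zeta>)) \<partial>circ) < \<infinity>"
      using ennreal_less_top le_less_trans by (metis infinity_ennreal_def)
  qed
  have "integrable circ (\<lambda>\<zeta>. ?g \<zeta> * indicator (- ball x \<delta>) \<zeta>)"
  proof (rule circ_bounded(1)[where B = "2 * B / \<delta>"])
    fix \<zeta> assume \<zeta>: "cmod \<zeta> = 1"
    have "\<bar>\<alpha> \<zeta> - \<alpha> x\<bar> \<le> 2 * B" using aB[OF \<zeta>] aB[OF x] by linarith
    moreover have "0 \<le> B" using aB[OF x] by simp
    ultimately show "norm (?g \<zeta> * indicator (- ball x \<delta>) \<zeta>) \<le> 2 * B / \<delta>"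
      using \<delta> by (auto simp: indicator_def dist_norm norm_minus_commute intro!: frac_le)
  qed measurable
  then have "integrable circ (\<lambda>\<zeta>. ?g \<zeta> * indicator (ball x \<delta>) \<zeta> + ?g \<zeta> * indicator (- ball x \<delta>) \<zeta>)"
    using i1 by (rule Bochner_Integration.integrable_add[rotated])
  also have "(\<lambda>\<zeta>. ?g \<zeta> * indicator (ball x \<delta>) \<zeta> + ?g \<zeta> * indicator (- ball x \<delta>) \<zeta>) = ?g"
    by (auto simp: indicator_def)
  finally show "integrable circ ?g" .
  have "ennreal (\<integral>\<zeta>. ?g \<zeta> * indicator (ball x \<delta>) \<zeta> \<partial>circ) = (\<integral>\<^sup>+\<zeta>. ennreal (?g \<zeta> * indicator (ball x \<delta>) \<zeta>) \<partial>circ)"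
    by (rule nn_integral_eq_integral[OF i1, symmetric]) (auto simp: indicator_def)
  also have "\<dots> \<le> ennreal (max 0 s)" using le unfolding eq by (elim order_trans) (intro ennreal_leI, simp)
  finally show "(\<integral>\<zeta>. ?g \<zeta> * indicator (ball x \<delta>) \<zeta> \<partial>circ) \<le> max 0 s" by (simp add: ennreal_le_iff)
qed

lemma bdry_kernel_bound:
  assumes "cmod \<zeta> = 1" "cmod x = 1"
  shows "cmod (of_real (\<alpha> \<zeta> - \<alpha> x) * ((\<zeta> + x) / (\<zeta> - x))) \<le> 2 * (\<bar>\<alpha> \<zeta> - \<alpha> x\<bar> / cmod (\<zeta> - x))"
proof -
  have "cmod (\<zeta> + x) \<le> 2" using norm_triangle_ineq[of \<zeta> x] assms by simp
  then have "\<bar>\<alpha> \<zeta> - \<alpha> x\<bar> * cmod (\<zeta> + x) / cmod (\<zeta> - x) \<le> \<bar>\<alpha> \<zeta> - \<alpha> x\<bar> * 2 / cmod (\<zeta> - x)"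
    by (intro divide_right_mono mult_left_mono) auto
  then show ?thesis by (simp add: norm_mult norm_divide mult.commute flip: of_real_diff)
qed

lemma stolz_dist:
  assumes "z \<in> stolz M x" "cmod \<zeta> = 1" "0 \<le> M"
  shows "cmod (\<zeta> - x) \<le> (1 + M) * cmod (\<zeta> - z)"
proof -
  have "cmod (\<zeta> - x) \<le> cmod (\<zeta> - z) + cmod (z - x)" using norm_triangle_ineq[of "\<zeta> - z" "z - x"] by simp
  also have "cmod (z - x) \<le> M * (1 - cmod z)" using assms by (simp add: stolz_def)
  also have "\<dots> \<le> M * cmod (\<zeta> - z)" using circle_dist_ge[OF assms(2)] assms(3) by (intro mult_left_mono) auto
  finally show ?thesis by (simp add: algebra_simps)
qed

text \<open>In a Stolz region the distance to \<open>z\<close> controls the distance to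
  \<open>x\<close>, so the Dini integrand is a dominating function. The real part is
  \<open>\<alpha> x\<close> because the boundary kernel is imaginary.\<close>

lemma schwarz_tendsto_bdry:
  assumes x: "cmod x = 1" and d: "dini_tail \<alpha> x \<delta> s"
  shows "(schwarz \<alpha> \<longlongrightarrow> schwarz_bdry \<alpha> x) (at x within stolz M x)" "Re (schwarz_bdry \<alpha> x) = \<alpha> x"
proof -
  define g where "g = (\<lambda>\<zeta>. \<bar>\<alpha> \<zeta> - \<alpha> x\<bar> / cmod (\<zeta> - x))"
  have ig: "integrable circ g" unfolding g_def by (rule dini_integrable(1)[OF x d])
  \<comment> \<open>A negative aperture gives an empty region; passing to \<open>max 0 M\<close>
    lets \<open>1 + M'\<close> be used as a positive factor.\<close>
  define M' where "M' = max 0 M"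
  have M': "0 \<le> M'" "stolz M x \<subseteq> stolz M' x"
    by (auto simp: M'_def stolz_def intro: order_trans[OF _ mult_right_mono])
  show "(schwarz \<alpha> \<longlongrightarrow> schwarz_bdry \<alpha> x) (at x within stolz M x)"
    unfolding tendsto_at_iff_sequentially
  proof (intro allI impI)
    fix X :: "nat \<Rightarrow> complex" assume X: "\<forall>i. X i \<in> stolz M x - {x}" "X \<longlonglongrightarrow> x"
    have X1: "cmod (X i) < 1" for i using X(1) by (auto simp: stolz_def)
    have X2: "X i \<in> stolz M' x" for i using X(1) M'(2) by auto
    have "(\<lambda>i. \<integral>\<zeta>. of_real (\<alpha> \<zeta> - \<alpha> x) * ((\<zeta> + X i) / (\<zeta> - X i)) \<partial>circ)
       \<longlonglongrightarrow> (\<integral>\<zeta>. of_real (\<alpha> \<zeta> - \<alpha> x) * ((\<zeta> + x) / (\<zeta> - x)) \<partial>circ)"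
    proof (rule integral_dominated_convergence[where w = "\<lambda>\<zeta>. 2 * (1 + M') * g \<zeta>"])
      show "integrable circ (\<lambda>\<zeta>. 2 * (1 + M') * g \<zeta>)" by (intro integrable_mult_right ig)
      show "AE \<zeta> in circ. (\<lambda>i. of_real (\<alpha> \<zeta> - \<alpha> x) * ((\<zeta> + X i) / (\<zeta> - X i))) \<longlonglongrightarrow> of_real (\<alpha> \<zeta> - \<alpha> x) * ((\<zeta> + x) / (\<zeta> - x))"
      proof (rule AE_I2)
        fix \<zeta>
        show "(\<lambda>i. of_real (\<alpha> \<zeta> - \<alpha> x) * ((\<zeta> + X i) / (\<zeta> - X i))) \<longlonglongrightarrow> of_real (\<alpha> \<zeta> - \<alpha> x) * ((\<zeta> + x) / (\<zeta> - x))"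
        proof (cases "\<zeta> = x")
          case False
          then show ?thesis using X(2) by (intro tendsto_intros) auto
        qed simp
      qed
      fix i
      show "AE \<zeta> in circ. norm (of_real (\<alpha> \<zeta> - \<alpha> x) * ((\<zeta> + X i) / (\<zeta> - X i))) \<le> 2 * (1 + M') * g \<zeta>"
        using AE_circ
      proof eventually_elim
        case (elim \<zeta>)
        have nz: "0 < cmod (\<zeta> - X i)" using circle_dist_ge[OF elim, of "X i"] X1[of i] by linarith
        show ?case
        proof (cases "\<zeta> = x")
          case False
          have "cmod ((\<zeta> + X i) / (\<zeta> - X i)) \<le> 2 / cmod (\<zeta> - X i)" by (rule schwarz_kernel_norm[OF elim X1])
          also have "\<dots> \<le> 2 * (1 + M') / cmod (\<zeta> - x)"
            using stolz_dist[OF X2 elim M'(1), of i] nz False by (simp add: field_simps)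
          finally have "\<bar>\<alpha> \<zeta> - \<alpha> x\<bar> * cmod ((\<zeta> + X i) / (\<zeta> - X i)) \<le> \<bar>\<alpha> \<zeta> - \<alpha> x\<bar> * (2 * (1 + M') / cmod (\<zeta> - x))"
            by (intro mult_left_mono) auto
          also have "\<dots> = 2 * (1 + M') * g \<zeta>" by (simp add: g_def)
          finally show ?thesis by (simp only: norm_mult norm_of_real)
        qed (simp add: g_def)
      qed
    qed (simp_all, measurable)
    then have "(\<lambda>i. schwarz \<alpha> (X i) - of_real (\<alpha> x)) \<longlonglongrightarrow> schwarz_bdry \<alpha> x - of_real (\<alpha> x)"
      using schwarz_minus_const(2)[OF X1, of _ "\<alpha> x"] by (simp add: schwarz_bdry_def)
    then show "(schwarz \<alpha> \<circ> X) \<longlonglongrightarrow> schwarz_bdry \<alpha> x"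
      using tendsto_add[OF _ tendsto_const[of "of_real (\<alpha> x)"], of "\<lambda>i. schwarz \<alpha> (X i) - of_real (\<alpha> x)"] by (fastforce simp: o_def)
  qed
  have "integrable circ (\<lambda>\<zeta>. of_real (\<alpha> \<zeta> - \<alpha> x) * ((\<zeta> + x) / (\<zeta> - x)))"
  proof (rule Bochner_Integration.integrable_bound[of _ "\<lambda>\<zeta>. 2 * g \<zeta>"])
    show "integrable circ (\<lambda>\<zeta>. 2 * g \<zeta>)" by (intro integrable_mult_right ig)
    show "AE \<zeta> in circ. norm (of_real (\<alpha> \<zeta> - \<alpha> x) * ((\<zeta> + x) / (\<zeta> - x))) \<le> norm (2 * g \<zeta>)"
      using AE_circ
    proof eventually_elim
      case (elim \<zeta>)
      show ?case using bdry_kernel_bound[OF elim x] by (simp add: g_def)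
    qed
  qed measurable
  from integral_Re[OF this]
  have "Re (\<integral>\<zeta>. of_real (\<alpha> \<zeta> - \<alpha> x) * ((\<zeta> + x) / (\<zeta> - x)) \<partial>circ) = (\<integral>\<zeta>. Re (of_real (\<alpha> \<zeta> - \<alpha> x) * ((\<zeta> + x) / (\<zeta> - x))) \<partial>circ)"
    by simp
  also have "\<dots> = (\<integral>\<zeta>. 0 \<partial>circ)"
  proof (rule integral_cong_AE)
    show "AE \<zeta> in circ. Re (of_real (\<alpha> \<zeta> - \<alpha> x) * ((\<zeta> + x) / (\<zeta> - x))) = 0"
      using AE_circ
    proof eventually_elim
      case (elim \<zeta>)
      have "Re ((\<zeta> + x) / (\<zeta> - x)) = Re ((\<zeta> + x) * cnj (\<zeta> - x)) / (cmod (\<zeta> - x))\<^sup>2"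
        by (subst complex_div_cnj) (simp only: Re_divide_of_real flip: of_real_power)
      also have "Re ((\<zeta> + x) * cnj (\<zeta> - x)) = (cmod \<zeta>)\<^sup>2 - (cmod x)\<^sup>2"
        unfolding cmod_power2 by (simp add: power2_eq_square algebra_simps)
      finally have "Re ((\<zeta> + x) / (\<zeta> - x)) = 0" using elim x by simp
      then show ?case by (simp only: times_complex.simps Re_complex_of_real Im_complex_of_real)
    qed
  qed measurable
  finally show "Re (schwarz_bdry \<alpha> x) = \<alpha> x" by (simp add: schwarz_bdry_def)
qed

text \<open>The circle is divided at distance \<open>sqrt y\<close> from \<open>x\<close>, where
  \<open>y = 1 - \<bar>z\<bar>\<close>. Inside, the logarithm in the Dini condition is at least half
  of \<open>L = ln (1 / y)\<close>, so the density is at most \<open>2 s / L\<close> and the Poisson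
  kernel has mass 1. Outside, the Poisson kernel at distance \<open>t\<close> is of order
  \<open>y / t^2 \<le> sqrt y / t\<close>, which is integrated against the Dini integrand;
  \<open>sqrt y * L\<close> tends to 0.\<close>

lemma Re_schwarz_log_tendsto:
  assumes x: "cmod x = 1" and d: "\<And>s. 0 < s \<Longrightarrow> \<exists>\<delta>. dini_tail \<alpha> x \<delta> s"
  shows "((\<lambda>z. (Re (schwarz \<alpha> z) - \<alpha> x) * ln (1 / (1 - cmod z))) \<longlongrightarrow> 0) (at x within stolz M x)"
proof (rule tendstoI)
  fix e :: real assume e: "0 < e"
  define s where "s = e / 4"
  have s: "0 < s" using e by (simp add: s_def)
  obtain \<delta> where \<delta>: "dini_tail \<alpha> x \<delta> s" using d[OF s] by blast
  then have \<delta>1: "0 < \<delta>" "\<delta> < 1"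
    and \<delta>2: "\<And>\<zeta>. cmod \<zeta> = 1 \<Longrightarrow> \<zeta> \<noteq> x \<Longrightarrow> cmod (\<zeta> - x) < \<delta> \<Longrightarrow> \<bar>\<alpha> \<zeta> - \<alpha> x\<bar> * ln (1 / cmod (\<zeta> - x)) \<le> s"
    by (auto simp: dini_tail_def)
  define g where "g = (\<lambda>\<zeta>. \<bar>\<alpha> \<zeta> - \<alpha> x\<bar> / cmod (\<zeta> - x))"
  have ig: "integrable circ g" unfolding g_def by (rule dini_integrable(1)[OF x \<delta>])
  define D where "D = (\<integral>\<zeta>. g \<zeta> \<partial>circ)"
  define M' where "M' = max 0 M"
  have M': "0 \<le> M'" "stolz M x \<subseteq> stolz M' x"
    by (auto simp: M'_def stolz_def intro: order_trans[OF _ mult_right_mono])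
  define Cc where "Cc = 2 * (1 + M')\<^sup>2 * D"
  have l1: "filterlim (\<lambda>z. 1 - cmod z) (at_right 0) (at x within stolz M x)"
    unfolding filterlim_at
  proof
    show "((\<lambda>z. 1 - cmod z) \<longlongrightarrow> 0) (at x within stolz M x)"
      using x by (auto intro!: tendsto_eq_intros)
    show "\<forall>\<^sub>F z in at x within stolz M x. 1 - cmod z \<in> {0<..} \<and> 1 - cmod z \<noteq> 0"
      by (auto simp: eventually_at_filter stolz_def)
  qed
  have "((\<lambda>z. Cc * (sqrt (1 - cmod z) * ln (1 / (1 - cmod z)))) \<longlongrightarrow> Cc * 0) (at x within stolz M x)"
    by (intro tendsto_mult tendsto_const filterlim_compose[OF sqrt_ln_tendsto l1])
  from order_tendstoD(2)[OF this, of "e / 4"] e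
  have "\<forall>\<^sub>F z in at x within stolz M x. Cc * (sqrt (1 - cmod z) * ln (1 / (1 - cmod z))) < e / 4" by simp
  moreover have "\<forall>\<^sub>F y in at_right 0. y < \<delta>\<^sup>2" unfolding eventually_at_right_field using \<delta>1 by (intro exI[of _ "\<delta>\<^sup>2"]) auto
  then have "\<forall>\<^sub>F z in at x within stolz M x. 1 - cmod z < \<delta>\<^sup>2"
    by (rule eventually_compose_filterlim[OF _ l1])
  moreover have "\<forall>\<^sub>F z in at x within stolz M x. z \<in> stolz M x" by (simp add: eventually_at_filter)
  ultimately show "\<forall>\<^sub>F z in at x within stolz M x. dist ((Re (schwarz \<alpha> z) - \<alpha> x) * ln (1 / (1 - cmod z))) 0 < e"
  proof eventually_elim
    case (elim z)
    have z: "cmod z < 1" using elim(3) by (simp add: stolz_def)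
    have zM: "z \<in> stolz M' x" using elim(3) M'(2) by auto
    define y where "y = 1 - cmod z"
    have y: "0 < y" "sqrt y < \<delta>" "y < 1"
      using z elim(2) \<delta>1 real_sqrt_less_mono[of y "\<delta>\<^sup>2"] power_le_one[of \<delta> 2] by (auto simp: y_def)
    have sy: "0 < sqrt y" "sqrt y < 1" using y \<delta>1 by auto
    define L where "L = ln (1 / y)"
    have L: "0 < L" using y by (simp add: L_def)
    have L2: "ln (1 / sqrt y) = L / 2" using y by (simp add: L_def ln_div ln_sqrt)
    define P where "P = (\<lambda>\<zeta>. Re ((\<zeta> + z) / (\<zeta> - z)))"
    have ik: "integrable circ (\<lambda>\<zeta>. (\<zeta> + z) / (\<zeta> - z))"
      using z schwarz_kernel_norm' by (intro circ_bounded(1)[where B = "2 / (1 - cmod z)"]) auto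
    have iP: "integrable circ P" unfolding P_def by (intro integrable_Re ik)
    have P1: "(\<integral>\<zeta>. P \<zeta> \<partial>circ) = 1" unfolding P_def by (subst integral_Re[OF ik]) (simp add: schwarz_1[OF z])
    have Re_eq: "Re (of_real c * ((\<zeta> + z) / (\<zeta> - z))) = c * P \<zeta>" for c \<zeta>
      by (simp only: P_def Re_complex_of_real Im_complex_of_real times_complex.simps mult_zero_left diff_0_right)
    have iaP: "integrable circ (\<lambda>\<zeta>. (\<alpha> \<zeta> - \<alpha> x) * P \<zeta>)"
      using integrable_Re[OF schwarz_minus_const(1)[OF z, of "\<alpha> x"]] by (simp only: Re_eq)
    have "Re (schwarz \<alpha> z) - \<alpha> x = Re (schwarz \<alpha> z - of_real (\<alpha> x))" by simp
    also have "\<dots> = (\<integral>\<zeta>. (\<alpha> \<zeta> - \<alpha> x) * P \<zeta> \<partial>circ)"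
      unfolding schwarz_minus_const(2)[OF z]
      by (subst integral_Re[OF schwarz_minus_const(1)[OF z], symmetric]) (simp only: Re_eq)
    finally have "\<bar>Re (schwarz \<alpha> z) - \<alpha> x\<bar> \<le> (\<integral>\<zeta>. \<bar>(\<alpha> \<zeta> - \<alpha> x) * P \<zeta>\<bar> \<partial>circ)"
      using integral_norm_bound[of circ "\<lambda>\<zeta>. (\<alpha> \<zeta> - \<alpha> x) * P \<zeta>"] by simp
    also have "\<dots> \<le> (\<integral>\<zeta>. 2 * s / L * P \<zeta> + 2 * (1 + M')\<^sup>2 * sqrt y * g \<zeta> \<partial>circ)"
    proof (rule circ_mono)
      show "integrable circ (\<lambda>\<zeta>. \<bar>(\<alpha> \<zeta> - \<alpha> x) * P \<zeta>\<bar>)" by (intro integrable_abs iaP)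
      show "integrable circ (\<lambda>\<zeta>. 2 * s / L * P \<zeta> + 2 * (1 + M')\<^sup>2 * sqrt y * g \<zeta>)"
        by (intro Bochner_Integration.integrable_add integrable_mult_right iP ig)
      fix \<zeta> assume \<zeta>: "cmod \<zeta> = 1"
      have Pnn: "0 \<le> P \<zeta>" using Re_schwarz_kernel[OF \<zeta> z] z by (simp add: P_def abs_square_le_1)
      have gnn: "0 \<le> g \<zeta>" by (simp add: g_def)
      show "\<bar>(\<alpha> \<zeta> - \<alpha> x) * P \<zeta>\<bar> \<le> 2 * s / L * P \<zeta> + 2 * (1 + M')\<^sup>2 * sqrt y * g \<zeta>"
      proof (cases "\<zeta> = x")
        case True then show ?thesis using Pnn gnn L s y(1) by simp
      next
        case False
        define t where "t = cmod (\<zeta> - x)"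
        have t: "0 < t" using False by (simp add: t_def)
        show ?thesis
        proof (cases "t < sqrt y")
          case True
          have "L / 2 \<le> ln (1 / t)" unfolding L2[symmetric] using True t sy by (intro ln_mono) (auto intro: frac_le)
          then have "\<bar>\<alpha> \<zeta> - \<alpha> x\<bar> * (L / 2) \<le> \<bar>\<alpha> \<zeta> - \<alpha> x\<bar> * ln (1 / t)" by (intro mult_left_mono) auto
          also have "\<dots> \<le> s" using \<delta>2[OF \<zeta> False] True y(2) by (simp add: t_def)
          finally have "\<bar>\<alpha> \<zeta> - \<alpha> x\<bar> \<le> 2 * s / L" using L by (simp add: field_simps)
          then have "\<bar>\<alpha> \<zeta> - \<alpha> x\<bar> * P \<zeta> \<le> 2 * s / L * P \<zeta>" using Pnn by (intro mult_right_mono)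
          moreover have "0 \<le> 2 * (1 + M')\<^sup>2 * sqrt y * g \<zeta>" using gnn y(1) by simp
          ultimately show ?thesis using Pnn by (simp only: abs_mult abs_of_nonneg)
        next
          case False
          have nz: "0 < cmod (\<zeta> - z)" using circle_dist_ge[OF \<zeta>, of z] z by linarith
          have td: "t \<le> (1 + M') * cmod (\<zeta> - z)" using stolz_dist[OF zM \<zeta> M'(1)] by (simp add: t_def)
          have "P \<zeta> = (1 - (cmod z)\<^sup>2) / (cmod (\<zeta> - z))\<^sup>2" unfolding P_def by (rule Re_schwarz_kernel[OF \<zeta> z])
          also have "\<dots> \<le> 2 * y / (t / (1 + M'))\<^sup>2"
          proof (rule frac_le)
            have "1 - (cmod z)\<^sup>2 = y * (1 + cmod z)" by (simp add: y_def power2_eq_square algebra_simps)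
            also have "\<dots> \<le> y * 2" using y z by (intro mult_left_mono) auto
            finally show "1 - (cmod z)\<^sup>2 \<le> 2 * y" by simp
            show "(t / (1 + M'))\<^sup>2 \<le> (cmod (\<zeta> - z))\<^sup>2"
              using td t M'(1) by (intro power_mono) (auto simp: field_simps)
          qed (use t M'(1) y in auto)
          also have "\<dots> = 2 * (1 + M')\<^sup>2 * (y / (t * t))" using t M'(1) by (simp add: power2_eq_square field_simps)
          also have "\<dots> \<le> 2 * (1 + M')\<^sup>2 * (sqrt y / t)"
          proof (rule mult_left_mono)
            have "y / (t * t) = (sqrt y / t) * (sqrt y / t)" using y(1) by simp
            also have "\<dots> \<le> (sqrt y / t) * 1"
            proof (rule mult_left_mono)
              show "sqrt y / t \<le> 1" using False t by (simp add: divide_le_eq_1_pos)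
              show "0 \<le> sqrt y / t" using t y(1) by simp
            qed
            finally show "y / (t * t) \<le> sqrt y / t" by simp
          qed simp
          finally have "P \<zeta> \<le> 2 * (1 + M')\<^sup>2 * (sqrt y / t)" .
          then have "\<bar>\<alpha> \<zeta> - \<alpha> x\<bar> * P \<zeta> \<le> \<bar>\<alpha> \<zeta> - \<alpha> x\<bar> * (2 * (1 + M')\<^sup>2 * (sqrt y / t))" by (intro mult_left_mono) auto
          also have "\<dots> = 2 * (1 + M')\<^sup>2 * sqrt y * g \<zeta>" by (simp add: g_def t_def)
          finally have "\<bar>\<alpha> \<zeta> - \<alpha> x\<bar> * P \<zeta> \<le> 2 * (1 + M')\<^sup>2 * sqrt y * g \<zeta>" .
          moreover have "0 \<le> 2 * s / L * P \<zeta>" using Pnn s L by simp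
          ultimately show ?thesis using Pnn by (simp only: abs_mult abs_of_nonneg)
        qed
      qed
    qed
    also have "\<dots> = 2 * s / L + Cc * sqrt y"
      by (simp only: Bochner_Integration.integral_add[OF integrable_mult_right[OF iP] integrable_mult_right[OF ig]]
          integral_mult_right_zero P1 D_def[symmetric]) (simp add: Cc_def)
    finally have "\<bar>Re (schwarz \<alpha> z) - \<alpha> x\<bar> * L \<le> (2 * s / L + Cc * sqrt y) * L" using L by (intro mult_right_mono) auto
    also have "\<dots> = 2 * s + Cc * (sqrt y * L)" using L by (simp add: field_simps)
    also have "\<dots> < e" using elim(1) e by (simp add: s_def y_def L_def)
    finally show ?case using L by (simp add: dist_real_def abs_mult L_def y_def)
  qed
qed

lemma alpha_continuous:
  assumes x: "cmod x = 1" and d: "\<And>s. 0 < s \<Longrightarrow> \<exists>\<delta>. dini_tail \<alpha> x \<delta> s"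
  shows "(\<alpha> \<longlongrightarrow> \<alpha> x) (at x within sphere 0 1)"
proof (rule tendstoI)
  fix e :: real assume e: "0 < e"
  \<comment> \<open>Distances up to \<open>exp (- 1)\<close> have logarithm at least 1, so the
    weighted bound controls the difference itself.\<close>
  obtain \<delta> where \<delta>: "dini_tail \<alpha> x \<delta> (e / 2)" using d[of "e / 2"] e by auto
  have "\<forall>\<^sub>F z in at x within sphere 0 1. z \<in> sphere 0 1 \<and> z \<noteq> x \<and> dist z x < min \<delta> (exp (- 1))"
    using \<delta> by (auto simp: eventually_at dini_tail_def intro!: exI[of _ "min \<delta> (exp (- 1))"])
  then show "\<forall>\<^sub>F z in at x within sphere 0 1. dist (\<alpha> z) (\<alpha> x) < e"
  proof eventually_elim
    case (elim z)
    have t: "0 < cmod (z - x)" "cmod (z - x) < \<delta>" "cmod (z - x) \<le> exp (- 1)" using elim by (auto simp: dist_norm)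
    have "ln (cmod (z - x)) \<le> - 1" using ln_mono[OF t(3)] t(1) by simp
    then have "1 \<le> ln (1 / cmod (z - x))" using t(1) by (simp add: ln_div)
    then have "\<bar>\<alpha> z - \<alpha> x\<bar> * 1 \<le> \<bar>\<alpha> z - \<alpha> x\<bar> * ln (1 / cmod (z - x))" by (intro mult_left_mono) auto
    also have "\<dots> \<le> e / 2" using \<delta> elim t(2) by (auto simp: dini_tail_def)
    finally show ?case using e by (simp add: dist_real_def)
  qed
qed

text \<open>With one radius \<open>\<delta>\<close> for all points near \<open>x0\<close>, the
  singularity can be cut off at a uniform cost \<open>2 s\<close>. What is left has a bounded
  integrand that depends continuously on the base point.\<close>

lemma schwarz_bdry_continuous_on:
  assumes F: "F \<subseteq> sphere 0 1"
    and u: "\<And>x0 s. x0 \<in> F \<Longrightarrow> 0 < s \<Longrightarrow> \<exists>r>0. \<exists>\<delta>. \<forall>x\<in>F. cmod (x - x0) < r \<longrightarrow> dini_tail \<alpha> x \<delta> s"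
  shows "continuous_on F (schwarz_bdry \<alpha>)"
  unfolding continuous_on_sequentially
proof (intro allI ballI impI)
  fix X x0 assume x0: "x0 \<in> F" and X: "(\<forall>n. X n \<in> F) \<and> X \<longlonglongrightarrow> x0"
  have x01: "cmod x0 = 1" and X1: "cmod (X n) = 1" for n using x0 X F by auto
  have Xl: "X \<longlonglongrightarrow> x0" using X by simp
  have "\<exists>\<delta>. dini_tail \<alpha> x0 \<delta> s" if "0 < s" for s using u[OF x0 that] x0 by fastforce
  from alpha_continuous[OF x01 this] have "isCont \<alpha> x0 \<or> True" by simp
  have aX: "(\<lambda>n. \<alpha> (X n)) \<longlonglongrightarrow> \<alpha> x0"
  proof -
    have "continuous (at x0 within sphere 0 1) \<alpha>"
      using alpha_continuous[OF x01 \<open>\<And>s. 0 < s \<Longrightarrow> \<exists>\<delta>. dini_tail \<alpha> x0 \<delta> s\<close>] by (simp add: continuous_within)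
    then show ?thesis using X1 Xl unfolding continuous_within_sequentially by (auto simp: o_def)
  qed
  show "(schwarz_bdry \<alpha> \<circ> X) \<longlonglongrightarrow> schwarz_bdry \<alpha> x0"
  proof (rule tendstoI)
    fix e :: real assume e: "0 < e"
    \<comment> \<open>The cut-off costs \<open>2 s\<close> at each of the two points and the regular
      part \<open>e / 2\<close>, which adds up to \<open>3 e / 4\<close>.\<close>
    define s where "s = e / 16"
    have s: "0 < s" using e by (simp add: s_def)
    obtain r \<delta> where r: "0 < r" and \<delta>: "\<And>x. x \<in> F \<Longrightarrow> cmod (x - x0) < r \<Longrightarrow> dini_tail \<alpha> x \<delta> s" using u[OF x0 s] by blast
    have \<delta>0: "0 < \<delta>" using \<delta>[OF x0] r by (simp add: dini_tail_def)
    \<comment> \<open>A continuous cut-off, 0 below \<open>\<delta> / 2\<close> and 1 from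
      \<open>\<delta>\<close> on; an indicator would destroy continuity in the base point.\<close>
    define c where "c = (\<lambda>u::real. min 1 (max 0 (2 * u / \<delta> - 1)))"
    have c: "0 \<le> c u" "c u \<le> 1" "u < \<delta> / 2 \<Longrightarrow> c u = 0" "\<delta> \<le> u \<Longrightarrow> c u = 1" for u
      using \<delta>0 by (auto simp: c_def field_simps min_def max_def)
    have cc: "isCont c u" for u unfolding c_def using \<delta>0 by (intro continuous_intros) auto
    define f where "f = (\<lambda>x \<zeta>. of_real (\<alpha> \<zeta> - \<alpha> x) * ((\<zeta> + x) / (\<zeta> - x)))"
    define I where "I = (\<lambda>x. \<integral>\<zeta>. of_real (c (cmod (\<zeta> - x))) * f x \<zeta> \<partial>circ)"
    have cm [measurable]: "c \<in> borel_measurable borel" unfolding c_def by measurable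
    have fm [measurable]: "f x \<in> borel_measurable borel" for x unfolding f_def by measurable
    have cfb: "norm (of_real (c (cmod (\<zeta> - x))) * f x \<zeta>) \<le> 8 * B / \<delta>" if "cmod \<zeta> = 1" "cmod x = 1" for \<zeta> x
    proof (cases "cmod (\<zeta> - x) < \<delta> / 2")
      case True
      have "0 \<le> B" using aB[OF that(1)] by simp
      then show ?thesis using c(3)[OF True] \<delta>0 by simp
    next
      case False
      have "norm (f x \<zeta>) \<le> 2 * (\<bar>\<alpha> \<zeta> - \<alpha> x\<bar> / cmod (\<zeta> - x))" unfolding f_def by (rule bdry_kernel_bound[OF that])
      also have "\<dots> \<le> 2 * (2 * B / (\<delta> / 2))"
        using aB[OF that(1)] aB[OF that(2)] False \<delta>0 by (intro mult_left_mono frac_le) auto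
      finally have "norm (f x \<zeta>) \<le> 8 * B / \<delta>" by simp
      moreover have "c (cmod (\<zeta> - x)) * norm (f x \<zeta>) \<le> 1 * norm (f x \<zeta>)" using c by (intro mult_right_mono) auto
      ultimately show ?thesis using c(1)[of "cmod (\<zeta> - x)"] by (simp add: norm_mult)
    qed
    have near: "cmod (schwarz_bdry \<alpha> x - (of_real (\<alpha> x) + I x)) \<le> 2 * s" if x: "x \<in> F" "cmod (x - x0) < r" for x
    proof -
      have x1: "cmod x = 1" using x F by auto
      note dt = \<delta>[OF x]
      have icf: "integrable circ (\<lambda>\<zeta>. of_real (c (cmod (\<zeta> - x))) * f x \<zeta>)"
        by (rule circ_bounded(1)[OF _ cfb[OF _ x1]]) measurable
      have i_f: "integrable circ (f x)"
      proof (rule Bochner_Integration.integrable_bound[of _ "\<lambda>\<zeta>. 2 * (\<bar>\<alpha> \<zeta> - \<alpha> x\<bar> / cmod (\<zeta> - x))"])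
        show "integrable circ (\<lambda>\<zeta>. 2 * (\<bar>\<alpha> \<zeta> - \<alpha> x\<bar> / cmod (\<zeta> - x)))" by (intro integrable_mult_right dini_integrable(1)[OF x1 dt])
        show "AE \<zeta> in circ. norm (f x \<zeta>) \<le> norm (2 * (\<bar>\<alpha> \<zeta> - \<alpha> x\<bar> / cmod (\<zeta> - x)))"
          using AE_circ
        proof eventually_elim
          case (elim \<zeta>)
          show ?case using bdry_kernel_bound[OF elim x1] by (simp add: f_def)
        qed
      qed measurable
      have "schwarz_bdry \<alpha> x - (of_real (\<alpha> x) + I x) = (\<integral>\<zeta>. f x \<zeta> - of_real (c (cmod (\<zeta> - x))) * f x \<zeta> \<partial>circ)"
        unfolding Bochner_Integration.integral_diff[OF i_f icf] by (simp add: schwarz_bdry_def I_def f_def)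
      also have "cmod \<dots> \<le> (\<integral>\<zeta>. norm (f x \<zeta> - of_real (c (cmod (\<zeta> - x))) * f x \<zeta>) \<partial>circ)" by (rule integral_norm_bound)
      also have "\<dots> \<le> (\<integral>\<zeta>. 2 * (\<bar>\<alpha> \<zeta> - \<alpha> x\<bar> / cmod (\<zeta> - x) * indicator (ball x \<delta>) \<zeta>) \<partial>circ)"
      proof (rule circ_mono)
        show "integrable circ (\<lambda>\<zeta>. norm (f x \<zeta> - of_real (c (cmod (\<zeta> - x))) * f x \<zeta>))"
          by (intro integrable_norm Bochner_Integration.integrable_diff i_f icf)
        show "integrable circ (\<lambda>\<zeta>. 2 * (\<bar>\<alpha> \<zeta> - \<alpha> x\<bar> / cmod (\<zeta> - x) * indicator (ball x \<delta>) \<zeta>))"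
          by (intro integrable_mult_right dini_integrable(2)[OF x1 dt])
        fix \<zeta> assume \<zeta>: "cmod \<zeta> = 1"
        have "f x \<zeta> - of_real (c (cmod (\<zeta> - x))) * f x \<zeta> = of_real (1 - c (cmod (\<zeta> - x))) * f x \<zeta>"
          by (simp add: algebra_simps)
        then have n: "norm (f x \<zeta> - of_real (c (cmod (\<zeta> - x))) * f x \<zeta>) = \<bar>1 - c (cmod (\<zeta> - x))\<bar> * norm (f x \<zeta>)"
          by (simp only: norm_mult norm_of_real)
        show "norm (f x \<zeta> - of_real (c (cmod (\<zeta> - x))) * f x \<zeta>) \<le> 2 * (\<bar>\<alpha> \<zeta> - \<alpha> x\<bar> / cmod (\<zeta> - x) * indicator (ball x \<delta>) \<zeta>)"
        proof (cases "\<delta> \<le> cmod (\<zeta> - x)")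
          case True
          then show ?thesis unfolding n using c(4)[OF True] by (simp add: indicator_def)
        next
          case False
          have "\<bar>1 - c (cmod (\<zeta> - x))\<bar> * norm (f x \<zeta>) \<le> 1 * norm (f x \<zeta>)"
            using c(1,2)[of "cmod (\<zeta> - x)"] by (intro mult_right_mono) auto
          then show ?thesis unfolding n using bdry_kernel_bound[OF \<zeta> x1] False
            by (simp add: f_def dist_norm norm_minus_commute)
        qed
      qed
      also have "\<dots> = 2 * (\<integral>\<zeta>. \<bar>\<alpha> \<zeta> - \<alpha> x\<bar> / cmod (\<zeta> - x) * indicator (ball x \<delta>) \<zeta> \<partial>circ)" by (rule integral_mult_right_zero)
      also have "\<dots> \<le> 2 * s" using dini_integrable(3)[OF x1 dt] s by simp
      finally show ?thesis .
    qed
    have "(\<lambda>n. I (X n)) \<longlonglongrightarrow> I x0"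
      unfolding I_def
    proof (rule integral_dominated_convergence[where w = "\<lambda>_. 8 * B / \<delta>"])
      show "AE \<zeta> in circ. (\<lambda>n. of_real (c (cmod (\<zeta> - X n))) * f (X n) \<zeta>) \<longlonglongrightarrow> of_real (c (cmod (\<zeta> - x0))) * f x0 \<zeta>"
      proof (rule AE_I2)
        fix \<zeta>
        have n: "(\<lambda>n. cmod (\<zeta> - X n)) \<longlonglongrightarrow> cmod (\<zeta> - x0)" by (intro tendsto_intros Xl)
        show "(\<lambda>n. of_real (c (cmod (\<zeta> - X n))) * f (X n) \<zeta>) \<longlonglongrightarrow> of_real (c (cmod (\<zeta> - x0))) * f x0 \<zeta>"
        proof (cases "\<zeta> = x0")
          case True
          then have "\<forall>\<^sub>F n in sequentially. cmod (\<zeta> - X n) < \<delta> / 2" using order_tendstoD(2)[OF n, of "\<delta> / 2"] \<delta>0 by simp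
          then have "\<forall>\<^sub>F n in sequentially. of_real (c (cmod (\<zeta> - X n))) * f (X n) \<zeta> = of_real (c (cmod (\<zeta> - x0))) * f x0 \<zeta>"
            by eventually_elim (use c(3) True \<delta>0 in simp)
          then show ?thesis by (rule tendsto_eventually)
        next
          case False
          then show ?thesis unfolding f_def
            by (intro tendsto_intros isCont_tendsto_compose[OF cc n] Xl aX) auto
        qed
      qed
      show "AE \<zeta> in circ. norm (of_real (c (cmod (\<zeta> - X n))) * f (X n) \<zeta>) \<le> 8 * B / \<delta>" for n
        using AE_circ by eventually_elim (rule cfb[OF _ X1])
    qed (simp_all, measurable)
    then have "(\<lambda>n. of_real (\<alpha> (X n)) + I (X n)) \<longlonglongrightarrow> of_real (\<alpha> x0) + I x0" by (intro tendsto_intros aX)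
    then have "\<forall>\<^sub>F n in sequentially. dist (of_real (\<alpha> (X n)) + I (X n)) (of_real (\<alpha> x0) + I x0) < e / 2"
      using e by (intro tendstoD) auto
    moreover have "\<forall>\<^sub>F n in sequentially. dist (X n) x0 < r" using Xl r by (rule tendstoD)
    ultimately show "\<forall>\<^sub>F n in sequentially. dist ((schwarz_bdry \<alpha> \<circ> X) n) (schwarz_bdry \<alpha> x0) < e"
    proof eventually_elim
      case (elim n)
      have 1: "dist (schwarz_bdry \<alpha> (X n)) (of_real (\<alpha> (X n)) + I (X n)) \<le> 2 * s"
        using near[of "X n"] X elim(2) by (simp add: dist_norm)
      have 2: "dist (schwarz_bdry \<alpha> x0) (of_real (\<alpha> x0) + I x0) \<le> 2 * s"
        using near[OF x0] r by (simp add: dist_norm)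
      have "dist (schwarz_bdry \<alpha> (X n)) (schwarz_bdry \<alpha> x0) \<le> 2 * s + e / 2 + 2 * s"
        using 1 2 elim(1) dist_triangle[of "schwarz_bdry \<alpha> (X n)" "schwarz_bdry \<alpha> x0" "of_real (\<alpha> (X n)) + I (X n)"]
          dist_triangle[of "of_real (\<alpha> (X n)) + I (X n)" "schwarz_bdry \<alpha> x0" "of_real (\<alpha> x0) + I x0"]
        by (simp add: dist_commute)
      then show ?case using e by (simp add: s_def)
    qed
  qed
qed

end

text \<open>All exceptional sets are removed in advance: for every measure \<open>\<mu> i\<close>
  and every accuracy \<open>(1/2) ^ k\<close>, an open thin set outside which the tail is uniformly
  that small, and a thin neighbourhood of the countably many points not covered by the
  \<open>Q i\<close>. On the remaining set the Dini condition is locally uniform, which is what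
  continuity requires.\<close>

lemma BV_argument_boundary:
  fixes \<alpha> :: "complex \<Rightarrow> real" and \<mu> :: "nat \<Rightarrow> complex measure" and Q :: "nat \<Rightarrow> complex set"
  assumes am: "\<alpha> \<in> borel_measurable borel" and aB: "\<And>\<zeta>. cmod \<zeta> = 1 \<Longrightarrow> \<bar>\<alpha> \<zeta>\<bar> \<le> B"
    and \<mu>: "\<And>i. sets (\<mu> i) = sets borel" "\<And>i. finite_measure (\<mu> i)"
    and Q: "\<And>i. open (Q i)" "countable (sphere 0 1 - (\<Union>i. Q i))"
    and loc: "\<And>i x \<zeta>. x \<in> Q i \<Longrightarrow> \<zeta> \<in> Q i \<Longrightarrow> cmod x = 1 \<Longrightarrow> cmod \<zeta> = 1 \<Longrightarrow>
       \<bar>\<alpha> \<zeta> - \<alpha> x\<bar> \<le> measure (\<mu> i) (cball x (cmod (\<zeta> - x)))"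
    and V: "0 \<le> V"
  obtains W where "open W" "thin V W" "continuous_on (sphere 0 1 - W) (schwarz_bdry \<alpha>)"
    "\<And>x M. x \<in> sphere 0 1 - W \<Longrightarrow> (schwarz \<alpha> \<longlongrightarrow> schwarz_bdry \<alpha> x) (at x within stolz M x)"
    "\<And>x. x \<in> sphere 0 1 - W \<Longrightarrow> Re (schwarz_bdry \<alpha> x) = \<alpha> x"
    "\<And>x M. x \<in> sphere 0 1 - W \<Longrightarrow>
      ((\<lambda>z. (Re (schwarz \<alpha> z) - \<alpha> x) * ln (1 / (1 - cmod z))) \<longlongrightarrow> 0) (at x within stolz M x)"
proof -
  \<comment> \<open>The index \<open>n\<close> encodes the pair of a measure and an accuracy. The
    extra 64 is spent when the neighbourhood \<open>N\<close> is joined to the union.\<close>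
  have "\<exists>T G. 0 \<le> T \<and> open G \<and> thin (4 ^ (n + 2) * (64 * V)) G \<and>
     (\<forall>x. x \<notin> G \<longrightarrow> tail_pot T (\<mu> (fst (prod_decode n))) x \<le> ennreal ((1/2) ^ snd (prod_decode n)))" for n
  proof -
    obtain T G where "0 \<le> T" "open G" "thin (4 ^ (n + 2) * (64 * V)) G"
      "\<And>x. x \<notin> G \<Longrightarrow> tail_pot T (\<mu> (fst (prod_decode n))) x \<le> ennreal ((1/2) ^ snd (prod_decode n))"
      using tail_pot_quasi_small[OF \<mu>, of "(1/2) ^ snd (prod_decode n)" "4 ^ (n + 2) * (64 * V)" "fst (prod_decode n)"] V
      by auto
    then show ?thesis by blast
  qed
  then obtain T G where TG: "\<And>n. 0 \<le> T n" "\<And>n. open (G n)" "\<And>n. thin (4 ^ (n + 2) * (64 * V)) (G n)"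
    "\<And>n x. x \<notin> G n \<Longrightarrow> tail_pot (T n) (\<mu> (fst (prod_decode n))) x \<le> ennreal ((1/2) ^ snd (prod_decode n))"
    by metis
  obtain N where N: "open N" "sphere 0 1 - (\<Union>i. Q i) \<subseteq> N" "thin (64 * V) N"
    using thin_open_superset[OF thin_countable[OF Q(2), of "64 * V"]] .
  define W where "W = (\<Union>n. G n) \<union> N"
  have "thin (64 * V) (\<Union>n. G n)" using TG(3) V by (intro thin_UN) auto
  then have W: "open W" "thin V W" unfolding W_def using TG(2) N V by (auto intro: thin_Un)
  have uni: "\<exists>r>0. \<exists>\<delta>. \<forall>x\<in>sphere 0 1 - W. cmod (x - x0) < r \<longrightarrow> dini_tail \<alpha> x \<delta> s"
    if x0: "x0 \<in> sphere 0 1 - W" and s: "0 < s" for x0 s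
  proof -
    obtain i where i: "x0 \<in> Q i" using x0 N(2) unfolding W_def by blast
    obtain r where r: "0 < r" "ball x0 (2 * r) \<subseteq> Q i"
      using Q(1)[of i] i openE[of "Q i" x0] by (metis field_sum_of_halves half_gt_zero mult_2)
    obtain k where k: "(1/2::real) ^ k < s / 8" using real_arch_pow_inv[of "s / 8" "1/2::real"] s by auto
    define n where "n = prod_encode (i, k)"
    have n: "fst (prod_decode n) = i" "snd (prod_decode n) = k" by (auto simp: n_def)
    obtain m1 :: nat where m1: "T n / ln 2 < real m1" using reals_Archimedean2 by blast
    obtain m2 where m2: "(1/2::real) ^ m2 < r" using real_arch_pow_inv[of r "1/2::real"] r by auto
    \<comment> \<open>\<open>m1\<close> pushes the kernel at distance \<open>1 / 2 ^ n0\<close>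
      beyond the level \<open>T n\<close>. \<open>m2\<close> makes this distance at most
      \<open>r\<close>, so points that close to some \<open>x\<close> near \<open>x0\<close> stay in
      \<open>ball x0 (2 * r)\<close>, where the local bound holds.\<close>
    define n0 where "n0 = Suc (m1 + m2)"
    have n0: "1 \<le> n0" "T n < real n0 * ln 2" "1 / 2 ^ n0 \<le> r"
    proof -
      show "1 \<le> n0" by (simp add: n0_def)
      have "T n / ln 2 < real n0" using m1 by (simp add: n0_def)
      then show "T n < real n0 * ln 2" by (simp add: pos_divide_less_eq)
      have "(1/2::real) ^ n0 \<le> (1/2) ^ m2" by (intro power_decreasing) (auto simp: n0_def)
      then show "1 / 2 ^ n0 \<le> r" using m2 by (simp add: power_one_over)
    qed
    have dt: "dini_tail \<alpha> x (1 / 2 ^ n0) (8 * (1/2) ^ k)" if x: "x \<in> sphere 0 1 - W" "cmod (x - x0) < r" for x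
    proof (rule dini_tail_of_tail_pot[OF am \<mu>(1)[of i] \<mu>(2)[of i] _ _ n0(1) TG(1)[of n] n0(2)])
      show "cmod x = 1" using x by simp
      show "tail_pot (T n) (\<mu> i) x \<le> ennreal ((1/2) ^ k)" using TG(4)[of x n] x n by (auto simp: W_def)
      fix \<zeta> assume \<zeta>: "cmod \<zeta> = 1" "cmod (\<zeta> - x) < 1 / 2 ^ n0"
      have "dist x0 x < 2 * r" using x(2) r by (simp add: dist_norm norm_minus_commute)
      moreover have "dist x0 \<zeta> < 2 * r"
        using norm_triangle_ineq[of "\<zeta> - x" "x - x0"] \<zeta>(2) n0(3) x(2) by (simp add: dist_norm norm_minus_commute)
      ultimately show "\<bar>\<alpha> \<zeta> - \<alpha> x\<bar> \<le> measure (\<mu> i) (cball x (cmod (\<zeta> - x)))"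
        using r(2) x(1) \<zeta>(1) by (intro loc) auto
    qed simp
    then have "dini_tail \<alpha> x (1 / 2 ^ n0) s" if "x \<in> sphere 0 1 - W" "cmod (x - x0) < r" for x
      using dini_tail_mono[OF dt[OF that], of s] k by simp
    then show ?thesis using r(1) by blast
  qed
  have pt: "\<exists>\<delta>. dini_tail \<alpha> x \<delta> s" if x: "x \<in> sphere 0 1 - W" and s: "0 < s" for x s
  proof -
    obtain r \<delta> where "0 < r" "\<And>x'. x' \<in> sphere 0 1 - W \<Longrightarrow> cmod (x' - x) < r \<Longrightarrow> dini_tail \<alpha> x' \<delta> s"
      using uni[OF x s] by blast
    then have "dini_tail \<alpha> x \<delta> s" using x by simp
    then show ?thesis ..
  qed
  show ?thesis
  proof (rule that[OF W])
    show "continuous_on (sphere 0 1 - W) (schwarz_bdry \<alpha>)"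
      using uni by (intro schwarz_bdry_continuous_on[OF am aB]) auto
    fix x assume x: "x \<in> sphere 0 1 - W"
    then have x1: "cmod x = 1" by simp
    obtain \<delta> where \<delta>: "dini_tail \<alpha> x \<delta> 1" using pt[OF x, of 1] by auto
    show "Re (schwarz_bdry \<alpha> x) = \<alpha> x" by (rule schwarz_tendsto_bdry(2)[OF am aB x1 \<delta>])
    show "(schwarz \<alpha> \<longlongrightarrow> schwarz_bdry \<alpha> x) (at x within stolz M x)" for M by (rule schwarz_tendsto_bdry(1)[OF am aB x1 \<delta>])
    show "((\<lambda>z. (Re (schwarz \<alpha> z) - \<alpha> x) * ln (1 / (1 - cmod z))) \<longlongrightarrow> 0) (at x within stolz M x)" for M
      by (rule Re_schwarz_log_tendsto[OF am aB x1 pt[OF x]])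
  qed
qed

section \<open>The argument of a coefficient of countably bounded variation\<close>

text \<open>\<open>V\<close> is twice the variation function. The factor 2 anticipates that an angle
  is at most twice its chord, so that \<open>V\<close> will also dominate increments of the
  argument.\<close>

lemma bv_variation:
  assumes bv: "bv_on_arc lam 0 1 a b"
  obtains V :: "real \<Rightarrow> real" and M :: real where
    "\<And>s t. a < s \<Longrightarrow> s \<le> t \<Longrightarrow> t < b \<Longrightarrow> 2 * cmod (lam (cis t) - lam (cis s)) \<le> V t - V s"
    "\<And>t. a < t \<Longrightarrow> t < b \<Longrightarrow> 0 \<le> V t \<and> V t < M"
proof -
  obtain M where M: "\<And>(n::nat) (\<theta>::nat \<Rightarrow> real).
      (\<forall>j\<le>n. a < \<theta> j \<and> \<theta> j < b) \<Longrightarrow> (\<forall>j<n. \<theta> j \<le> \<theta> (Suc j)) \<Longrightarrow>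
      (\<Sum>j<n. cmod (lam (cis (\<theta> (Suc j))) - lam (cis (\<theta> j)))) \<le> M"
    using bv unfolding bv_on_arc_def by (simp, blast)
  define P where "P = (\<lambda>t v. \<exists>(n::nat) (\<theta>::nat \<Rightarrow> real). (\<forall>j\<le>n. a < \<theta> j \<and> \<theta> j \<le> t) \<and> (\<forall>j<n. \<theta> j \<le> \<theta> (Suc j)) \<and>
      v = (\<Sum>j<n. cmod (lam (cis (\<theta> (Suc j))) - lam (cis (\<theta> j)))))"
  define U where "U = (\<lambda>t. Sup {v. P t v})"
  have bdd: "v \<le> M" if v: "P t v" and t: "t < b" for t v
  proof -
    obtain n :: nat and \<theta> where \<theta>: "\<forall>j\<le>n. a < \<theta> j \<and> \<theta> j \<le> t" "\<forall>j<n. \<theta> j \<le> \<theta> (Suc j)"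
      "v = (\<Sum>j<n. cmod (lam (cis (\<theta> (Suc j))) - lam (cis (\<theta> j))))"
      using v unfolding P_def by blast
    show ?thesis unfolding \<theta>(3) by (rule M) (use \<theta>(1,2) t in \<open>auto intro: le_less_trans\<close>)
  qed
  have bA: "bdd_above {v. P t v}" if "t < b" for t using bdd that by (intro bdd_aboveI[of _ M]) auto
  have P0: "P t 0" if "a < t" for t
  proof -
    have "(\<forall>j\<le>0::nat. a < t \<and> t \<le> t) \<and> (\<forall>j<0::nat. t \<le> t) \<and> (0::real) = (\<Sum>j<0. cmod (lam (cis t) - lam (cis t)))"
      using that by simp
    then show ?thesis unfolding P_def by (intro exI[of _ "0::nat"] exI[of _ "\<lambda>_. t"])
  qed
  have step: "\<exists>v'. P t v' \<and> v + cmod (lam (cis t) - lam (cis s)) \<le> v'" if v: "P s v" and st: "a < s" "s \<le> t" for s t v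
  proof -
    obtain n :: nat and \<theta> where \<theta>: "\<forall>j\<le>n. a < \<theta> j \<and> \<theta> j \<le> s" "\<forall>j<n. \<theta> j \<le> \<theta> (Suc j)"
      "v = (\<Sum>j<n. cmod (lam (cis (\<theta> (Suc j))) - lam (cis (\<theta> j))))"
      using v unfolding P_def by blast
    \<comment> \<open>The partition is continued by \<open>s\<close> and then \<open>t\<close>.
      Keeping both makes the last summand exactly the increment from \<open>s\<close> to
      \<open>t\<close>.\<close>
    define \<theta>' where "\<theta>' = (\<lambda>j. if j \<le> n then \<theta> j else if j = Suc n then s else t)"
    define v' where "v' = (\<Sum>j<Suc (Suc n). cmod (lam (cis (\<theta>' (Suc j))) - lam (cis (\<theta>' j))))"
    have "P t v'" unfolding P_def
    proof (intro exI[of _ "Suc (Suc n)"] exI[of _ \<theta>'] conjI)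
      show "\<forall>j\<le>Suc (Suc n). a < \<theta>' j \<and> \<theta>' j \<le> t" using \<theta>(1) st by (auto simp: \<theta>'_def intro: order_trans)
      show "\<forall>j<Suc (Suc n). \<theta>' j \<le> \<theta>' (Suc j)"
        using \<theta>(1,2) st by (auto simp: \<theta>'_def less_Suc_eq)
    qed (simp add: v'_def)
    moreover have "v + cmod (lam (cis t) - lam (cis s)) \<le> v'"
    proof -
      have "(\<Sum>j<n. cmod (lam (cis (\<theta>' (Suc j))) - lam (cis (\<theta>' j)))) = v"
        unfolding \<theta>(3) by (intro sum.cong) (auto simp: \<theta>'_def)
      then show ?thesis unfolding v'_def by (simp add: \<theta>'_def)
    qed
    ultimately show ?thesis by blast
  qed
  have mono: "U s + cmod (lam (cis t) - lam (cis s)) \<le> U t" if st: "a < s" "s \<le> t" "t < b" for s t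
  proof -
    have "U s \<le> U t - cmod (lam (cis t) - lam (cis s))"
      unfolding U_def
    proof (rule cSup_least)
      show "{v. P s v} \<noteq> {}" using P0[OF st(1)] by blast
      fix v assume "v \<in> {v. P s v}"
      then obtain v' where v': "P t v'" "v + cmod (lam (cis t) - lam (cis s)) \<le> v'" using step[OF _ st(1,2)] by blast
      have "v' \<le> Sup {v. P t v}" using v'(1) bA[OF st(3)] by (intro cSup_upper) auto
      then show "v \<le> Sup {v. P t v} - cmod (lam (cis t) - lam (cis s))" using v'(2) by simp
    qed
    then show ?thesis by simp
  qed
  have U: "0 \<le> U t" "U t \<le> M" if t: "a < t" "t < b" for t
  proof -
    show "0 \<le> U t" unfolding U_def using P0[OF t(1)] bA[OF t(2)] by (intro cSup_upper) auto
    show "U t \<le> M" unfolding U_def using P0[OF t(1)] bdd[OF _ t(2)] by (intro cSup_least) auto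
  qed
  show ?thesis
  proof (rule that[of "\<lambda>t. 2 * U t" "2 * M + 1"])
    show "2 * cmod (lam (cis t) - lam (cis s)) \<le> 2 * U t - 2 * U s" if "a < s" "s \<le> t" "t < b" for s t
      using mono[OF that] by simp
    show "0 \<le> 2 * U t \<and> 2 * U t < 2 * M + 1" if "a < t" "t < b" for t
      using U[OF that] by simp
  qed
qed

text \<open>The variation measure is the image of Lebesgue measure under the quantile function of \<open>V\<close>.\<close>

lemma variation_measure:
  fixes V :: "real \<Rightarrow> real"
  assumes ab: "a < b" and mono: "\<And>s t. a < s \<Longrightarrow> s \<le> t \<Longrightarrow> t < b \<Longrightarrow> V s \<le> V t"
    and M: "\<And>t. a < t \<Longrightarrow> t < b \<Longrightarrow> 0 \<le> V t \<and> V t < M"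
  obtains \<mu> :: "complex measure" where "sets \<mu> = sets borel" "finite_measure \<mu>"
    "\<And>s t. a < s \<Longrightarrow> s \<le> t \<Longrightarrow> t < b \<Longrightarrow> V t - V s \<le> measure \<mu> (cis ` {s..t})"
proof -
  \<comment> \<open>The left endpoint is inserted so that the supremum is over a nonempty set even
    at levels below all values of \<open>V\<close>.\<close>
  define T where "T = (\<lambda>u. Sup (insert a {\<theta>. a < \<theta> \<and> \<theta> < b \<and> V \<theta> \<le> u}))"
  have bdd: "bdd_above (insert a {\<theta>. a < \<theta> \<and> \<theta> < b \<and> V \<theta> \<le> u})" for u
    using ab by (intro bdd_aboveI[of _ b]) auto
  have "mono T" unfolding T_def by (intro monoI cSup_subset_mono bdd) auto
  then have Tm: "T \<in> borel_measurable borel" by (rule borel_measurable_mono)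
  define L where "L = restrict_space lborel {0..M}"
  have sL: "space L = {0..M}" by (simp add: L_def)
  have eL: "emeasure L A = emeasure lborel A" if "A \<in> sets borel" "A \<subseteq> {0..M}" for A
    unfolding L_def using that by (intro emeasure_restrict_space) auto
  have cT: "(\<lambda>u. cis (T u)) \<in> borel_measurable L"
    unfolding L_def using measurable_compose[OF Tm cis_measurable] by (intro measurable_restrict_space1) auto
  define \<mu> where "\<mu> = distr L borel (\<lambda>u. cis (T u))"
  have fL: "finite_measure L"
    by (rule finite_measureI) (simp add: sL eL emeasure_lborel_Icc_eq)
  interpret L: finite_measure L by fact
  have s: "sets \<mu> = sets borel" by (simp add: \<mu>_def)
  have f: "finite_measure \<mu>" unfolding \<mu>_def by (rule L.finite_measure_distr[OF cT])
  interpret M: finite_measure \<mu> by fact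
  have "V t - V s \<le> measure \<mu> (cis ` {s..t})" if st: "a < s" "s \<le> t" "t < b" for s t
  proof -
    have "compact (cis ` {s..t})" by (intro compact_continuous_image continuous_intros) auto
    then have cl: "cis ` {s..t} \<in> sets borel" by (simp add: compact_imp_closed)
    have Vst: "V s \<le> V t" by (rule mono[OF st])
    \<comment> \<open>All levels between \<open>V s\<close> and \<open>V t\<close> are sent into the
      arc from \<open>s\<close> to \<open>t\<close>. A jump of \<open>V\<close> is a whole interval
      of levels sent to one point, so it becomes an atom and the inequality survives at
      discontinuities.\<close>
    have Tst: "T u \<in> {s..t}" if u: "V s \<le> u" "u < V t" for u
    proof -
      have "s \<le> T u" unfolding T_def using st u by (intro cSup_upper bdd) auto
      moreover have "T u \<le> t" unfolding T_def
      proof (rule cSup_least)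
        fix \<theta> assume "\<theta> \<in> insert a {\<theta>. a < \<theta> \<and> \<theta> < b \<and> V \<theta> \<le> u}"
        then consider "\<theta> = a" | "a < \<theta>" "\<theta> < b" "V \<theta> \<le> u" by auto
        then show "\<theta> \<le> t"
        proof cases
          case 2
          show ?thesis
          proof (rule ccontr)
            assume "\<not> \<theta> \<le> t"
            then have "V t \<le> V \<theta>" using st 2 by (intro mono) auto
            then show False using 2 u by simp
          qed
        qed (use st in simp)
      qed simp
      ultimately show ?thesis by simp
    qed
    have sub: "{V s..<V t} \<subseteq> (\<lambda>u. cis (T u)) -` (cis ` {s..t}) \<inter> space L"
    proof
      fix u assume u: "u \<in> {V s..<V t}"
      have "0 \<le> V s" "V t < M" using M[of s] M[of t] st by auto
      then have "u \<in> {0..M}" using u by auto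
      then show "u \<in> (\<lambda>u. cis (T u)) -` (cis ` {s..t}) \<inter> space L"
        using Tst[of u] u by (auto simp: sL)
    qed
    have "ennreal (V t - V s) = emeasure lborel {V s..<V t}" using Vst by simp
    also have "\<dots> = emeasure L {V s..<V t}" using sub sL by (intro eL[symmetric]) auto
    also have "\<dots> \<le> emeasure L ((\<lambda>u. cis (T u)) -` (cis ` {s..t}) \<inter> space L)"
      using cT cl by (intro emeasure_mono sub) (auto intro: measurable_sets)
    also have "\<dots> = emeasure \<mu> (cis ` {s..t})" unfolding \<mu>_def by (rule emeasure_distr[OF cT cl, symmetric])
    finally show ?thesis using Vst by (simp add: M.emeasure_eq_measure)
  qed
  then show ?thesis using that[OF s f] by blast
qed

section \<open>Parametrising the circle and choosing the argument\<close>

lemma cis_inj: assumes "cis s = cis t" "\<bar>s - t\<bar> < 2 * pi" shows "s = t"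
proof -
  define u where "u = (s - t) / 2"
  have "0 = 2 * \<bar>sin u\<bar>" using cmod_cis_diff[of s t] unfolding assms(1) u_def by simp
  then have "sin u = 0" by linarith
  moreover have "- pi < u" "u < pi" using assms(2) by (auto simp: u_def abs_less_iff field_simps)
  ultimately have "u = 0" using sin_eq_0_pi by blast
  then show ?thesis by (simp add: u_def)
qed

lemma cis_dist_mono:
  assumes "\<bar>v - s\<bar> \<le> \<bar>t - s\<bar>" "\<bar>t - s\<bar> \<le> pi"
  shows "cmod (cis v - cis s) \<le> cmod (cis t - cis s)"
proof -
  have e: "\<bar>sin (w / 2)\<bar> = sin (\<bar>w\<bar> / 2)" if "\<bar>w\<bar> \<le> pi" for w :: real
  proof (cases "0 \<le> w")
    case True then show ?thesis using that by (simp add: sin_ge_zero)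
  next
    case False
    then have "sin (\<bar>w\<bar> / 2) = - sin (w / 2)" by (metis abs_of_neg minus_divide_left not_le sin_minus)
    moreover have "0 \<le> sin (\<bar>w\<bar> / 2)" using that by (intro sin_ge_zero) auto
    ultimately show ?thesis by simp
  qed
  have "sin (\<bar>v - s\<bar> / 2) \<le> sin (\<bar>t - s\<bar> / 2)" using assms by (intro sin_monotone_2pi_le) auto
  then show ?thesis using assms by (simp add: cmod_cis_diff e)
qed

lemma unit_circle_param:
  assumes "cmod x = 1" obtains t where "x = cis t" "q \<le> t" "t < q + 2 * pi"
proof -
  define k where "k = \<lfloor>(Arg x - q) / (2 * pi)\<rfloor>"
  have "cis (Arg x) = x" using assms by (metis cis_Arg div_by_1 norm_zero of_real_1 sgn_eq zero_neq_one)
  moreover have "cis (2 * pi * of_int k) = 1" by (intro cis_multiple_2pi) auto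
  ultimately have "x = cis (Arg x - 2 * pi * of_int k)" by (simp flip: cis_divide)
  moreover have "of_int k \<le> (Arg x - q) / (2 * pi)" "(Arg x - q) / (2 * pi) < of_int k + 1" unfolding k_def by linarith+
  then have "q \<le> Arg x - 2 * pi * of_int k" "Arg x - 2 * pi * of_int k < q + 2 * pi"
    by (simp_all add: field_simps)
  ultimately show ?thesis using that by blast
qed

lemma borel_measurable_countable_discont:
  fixes f :: "complex \<Rightarrow> real"
  assumes "countable D" "closed S" "continuous_on (S - D) f" "\<And>x. x \<notin> S \<Longrightarrow> f x = 0"
  shows "f \<in> borel_measurable borel"
proof -
  have D: "D \<in> sets borel"
    by (rule sets.countable[OF _ assms(1)]) (simp add: borel_closed)
  have "(\<lambda>x. indicator (S - D) x *\<^sub>R f x) \<in> borel_measurable borel"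
    using D assms(2,3) by (intro borel_measurable_continuous_on_indicator) auto
  then show ?thesis
    by (rule measurable_discrete_difference[OF _ assms(1)]) (use assms(4) in \<open>auto simp: indicator_def\<close>)
qed

text \<open>No continuous argument exists in general, since \<open>lam\<close> may jump. On an arc
  the range of \<open>V\<close> is cut at the integers: where \<open>\<lfloor>V\<rfloor>\<close> is
  constant, \<open>lam\<close> stays within \<open>1/2\<close> of a fixed value, and the principal
  argument relative to it has increments at most those of \<open>V\<close>. As \<open>V\<close> is
  monotone, only countably many points are lost at the cuts.\<close>

lemma CBV_argument:
  assumes cbv: "CBV {(0, 1)} lam" and lam: "\<And>x. cmod x = 1 \<Longrightarrow> cmod (lam x) = 1"
  obtains \<alpha> :: "complex \<Rightarrow> real" and \<mu> :: "nat \<Rightarrow> complex measure" and Q :: "nat \<Rightarrow> complex set" and N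
  where "\<alpha> \<in> borel_measurable borel" "\<And>\<zeta>. \<bar>\<alpha> \<zeta>\<bar> \<le> 2 * pi"
    "\<And>i. sets (\<mu> i) = sets borel" "\<And>i. finite_measure (\<mu> i)"
    "\<And>i. open (Q i)" "countable (sphere 0 1 - (\<Union>i. Q i))"
    "\<And>i x \<zeta>. x \<in> Q i \<Longrightarrow> \<zeta> \<in> Q i \<Longrightarrow> cmod x = 1 \<Longrightarrow> cmod \<zeta> = 1 \<Longrightarrow>
       \<bar>\<alpha> \<zeta> - \<alpha> x\<bar> \<le> measure (\<mu> i) (cball x (cmod (\<zeta> - x)))"
    "countable N" "\<And>x. x \<in> sphere 0 1 - N \<Longrightarrow> lam x = cis (\<alpha> x)"
proof -
  obtain A :: "(complex \<times> real \<times> real \<times> real) set" where A: "countable A"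
    "\<forall>(c, r, a, b) \<in> A. (c, r) \<in> {(0, 1)} \<and> a < b \<and> b \<le> a + 2 * pi \<and> bv_on_arc lam c r a b"
    "\<forall>x\<in>A. \<forall>y\<in>A. x \<noteq> y \<longrightarrow>
            (case x of (c, r, a, b) \<Rightarrow> circ_arc c r a b) \<inter>
            (case y of (c, r, a, b) \<Rightarrow> circ_arc c r a b) = {}"
    "countable ((\<Union>(c, r) \<in> {(0, 1)}. sphere c r) - (\<Union>(c, r, a, b) \<in> A. circ_arc c r a b))"
    using cbv unfolding CBV_def by auto
  define A' where "A' = {p. (0, 1, fst p, snd p) \<in> A}"
  have "A' \<subseteq> (snd \<circ> snd) ` A"
  proof
    fix p assume "p \<in> A'"
    then have "(0::complex, 1::real, fst p, snd p) \<in> A" by (simp add: A'_def)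
    then have "(snd \<circ> snd) (0::complex, 1::real, fst p, snd p) \<in> (snd \<circ> snd) ` A" by (rule imageI)
    then show "p \<in> (snd \<circ> snd) ` A" by simp
  qed
  then have A'c: "countable A'" by (rule countable_subset) (rule countable_image[OF A(1)])
  define arc where "arc = (\<lambda>p::real \<times> real. cis ` {fst p<..<snd p})"
  have arc: "circ_arc 0 1 a b = cis ` {a<..<b}" for a b by (auto simp: circ_arc_def)
  have A'1: "fst p < snd p" "snd p \<le> fst p + 2 * pi" "bv_on_arc lam 0 1 (fst p) (snd p)" if "p \<in> A'" for p
    using that A(2) by (auto simp: A'_def)
  have disj: "p = q" if "p \<in> A'" "q \<in> A'" "x \<in> arc p" "x \<in> arc q" for p q x
  proof (rule ccontr)
    assume "p \<noteq> q"
    then have "(0::complex, 1::real, fst p, snd p) \<noteq> (0, 1, fst q, snd q)" by (simp add: prod_eq_iff)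
    then have "circ_arc 0 1 (fst p) (snd p) \<inter> circ_arc 0 1 (fst q) (snd q) = {}"
      using A(3) that(1,2) by (force simp: A'_def)
    then show False using that(3,4) by (auto simp: arc arc_def)
  qed
  have cover: "countable (sphere 0 1 - (\<Union>p\<in>A'. arc p))"
  proof -
    have "(\<Union>(c, r, a, b) \<in> A. circ_arc c r a b) = (\<Union>p\<in>A'. arc p)"
    proof (intro equalityI subsetI)
      fix x assume "x \<in> (\<Union>(c, r, a, b) \<in> A. circ_arc c r a b)"
      then obtain c r a b where "(c, r, a, b) \<in> A" "x \<in> circ_arc c r a b" by auto
      moreover from this have "c = 0" "r = 1" using A(2) by auto
      ultimately have "(a, b) \<in> A'" "x \<in> arc (a, b)" by (auto simp: A'_def arc arc_def)
      then show "x \<in> (\<Union>p\<in>A'. arc p)" by blast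
    next
      fix x assume "x \<in> (\<Union>p\<in>A'. arc p)"
      then obtain p where p: "p \<in> A'" "x \<in> arc p" by blast
      then have "(0, 1, fst p, snd p) \<in> A" "x \<in> circ_arc 0 1 (fst p) (snd p)" by (auto simp: A'_def arc arc_def)
      then show "x \<in> (\<Union>(c, r, a, b) \<in> A. circ_arc c r a b)" by force
    qed
    then show ?thesis using A(4) by simp
  qed
  define R where "R = (\<lambda>(p::real \<times> real) (V::real \<Rightarrow> real) (\<mu>::complex measure).
      (\<forall>s t. fst p < s \<longrightarrow> s \<le> t \<longrightarrow> t < snd p \<longrightarrow> 2 * cmod (lam (cis t) - lam (cis s)) \<le> V t - V s)
      \<and> sets \<mu> = sets borel \<and> finite_measure \<mu>
      \<and> (\<forall>s t. fst p < s \<longrightarrow> s \<le> t \<longrightarrow> t < snd p \<longrightarrow> V t - V s \<le> measure \<mu> (cis ` {s..t})))"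
  have "\<exists>Vm. R p (fst Vm) (snd Vm)" if p: "p \<in> A'" for p
  proof -
    obtain V M where V: "\<And>s t. fst p < s \<Longrightarrow> s \<le> t \<Longrightarrow> t < snd p \<Longrightarrow> 2 * cmod (lam (cis t) - lam (cis s)) \<le> V t - V s"
      "\<And>t. fst p < t \<Longrightarrow> t < snd p \<Longrightarrow> 0 \<le> V t \<and> V t < M"
      by (rule bv_variation[OF A'1(3)[OF p]]) blast
    have mono: "V s \<le> V t" if "fst p < s" "s \<le> t" "t < snd p" for s t
      using V(1)[OF that] norm_ge_zero[of "lam (cis t) - lam (cis s)"] by linarith
    obtain \<mu> :: "complex measure" where "sets \<mu> = sets borel" "finite_measure \<mu>"
      "\<And>s t. fst p < s \<Longrightarrow> s \<le> t \<Longrightarrow> t < snd p \<Longrightarrow> V t - V s \<le> measure \<mu> (cis ` {s..t})"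
      by (rule variation_measure[OF A'1(1)[OF p] mono V(2)]) (assumption | blast)+
    then have "R p (fst (V, \<mu>)) (snd (V, \<mu>))" using V(1) unfolding R_def fst_conv snd_conv by blast
    then show ?thesis ..
  qed
  then obtain Vm where Vm: "\<And>p. p \<in> A' \<Longrightarrow> R p (fst (Vm p)) (snd (Vm p))" by metis
  define V where "V = (\<lambda>p. fst (Vm p))"
  define \<mu> where "\<mu> = (\<lambda>p. snd (Vm p))"
  have V: "2 * cmod (lam (cis t) - lam (cis s)) \<le> V p t - V p s" if "p \<in> A'" "fst p < s" "s \<le> t" "t < snd p" for p s t
    using Vm[OF that(1)] that unfolding R_def V_def by blast
  have \<mu>: "sets (\<mu> p) = sets borel" "finite_measure (\<mu> p)" if "p \<in> A'" for p
    using Vm[OF that(1)] unfolding R_def \<mu>_def by blast+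
  have V\<mu>: "V p t - V p s \<le> measure (\<mu> p) (cis ` {s..t})" if "p \<in> A'" "fst p < s" "s \<le> t" "t < snd p" for p s t
    using Vm[OF that(1)] that unfolding R_def V_def \<mu>_def by blast
  have Vlip: "2 * cmod (lam (cis t) - lam (cis s)) \<le> \<bar>V p t - V p s\<bar>"
    if "p \<in> A'" "fst p < s" "s < snd p" "fst p < t" "t < snd p" for p s t
    using V[of p s t] V[of p t s] that by (cases "s \<le> t") (auto simp: norm_minus_commute)
  define pp where "pp = (\<lambda>x. SOME p. p \<in> A' \<and> x \<in> arc p)"
  define th where "th = (\<lambda>x. SOME \<theta>. fst (pp x) < \<theta> \<and> \<theta> < snd (pp x) \<and> x = cis \<theta>)"
  have pp: "pp (cis \<theta>) = p" "th (cis \<theta>) = \<theta>" if p: "p \<in> A'" "fst p < \<theta>" "\<theta> < snd p" for p \<theta>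
  proof -
    have ex: "p \<in> A' \<and> cis \<theta> \<in> arc p" using p by (auto simp: arc_def)
    then have "pp (cis \<theta>) \<in> A' \<and> cis \<theta> \<in> arc (pp (cis \<theta>))" unfolding pp_def by (rule someI)
    then show 1: "pp (cis \<theta>) = p" using ex disj by blast
    have "fst (pp (cis \<theta>)) < \<theta> \<and> \<theta> < snd (pp (cis \<theta>)) \<and> cis \<theta> = cis \<theta>" using p 1 by simp
    then have "fst (pp (cis \<theta>)) < th (cis \<theta>) \<and> th (cis \<theta>) < snd (pp (cis \<theta>)) \<and> cis \<theta> = cis (th (cis \<theta>))"
      unfolding th_def by (rule someI)
    then show "th (cis \<theta>) = \<theta>" using p A'1(2)[OF p(1)] unfolding 1 by (intro cis_inj[symmetric]) auto
  qed
  \<comment> \<open>One value of \<open>lam\<close> for each arc and each integer level. At a level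
    that is not attained the choice is arbitrary, but still of modulus 1.\<close>
  define anchor where "anchor = (\<lambda>p l. lam (cis (SOME \<theta>. fst p < \<theta> \<and> \<theta> < snd p \<and> \<lfloor>V p \<theta>\<rfloor> = l)))"
  have anchor: "cmod (anchor p l) = 1" for p l unfolding anchor_def by (rule lam) simp
  have anc: "0 < Re (lam (cis \<theta>) * cnj (anchor p \<lfloor>V p \<theta>\<rfloor>))" if p: "p \<in> A'" "fst p < \<theta>" "\<theta> < snd p" for p \<theta>
  proof -
    define \<theta>' where "\<theta>' = (SOME \<theta>'. fst p < \<theta>' \<and> \<theta>' < snd p \<and> \<lfloor>V p \<theta>'\<rfloor> = \<lfloor>V p \<theta>\<rfloor>)"
    have \<theta>': "fst p < \<theta>' \<and> \<theta>' < snd p \<and> \<lfloor>V p \<theta>'\<rfloor> = \<lfloor>V p \<theta>\<rfloor>"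
      unfolding \<theta>'_def by (rule someI[of _ \<theta>]) (use p in simp)
    have "2 * cmod (lam (cis \<theta>) - lam (cis \<theta>')) \<le> \<bar>V p \<theta> - V p \<theta>'\<bar>" using Vlip[OF p(1)] p \<theta>' by blast
    also have "\<dots> < 1" using \<theta>' by linarith
    finally have d: "cmod (lam (cis \<theta>) - anchor p \<lfloor>V p \<theta>\<rfloor>) < 1/2" by (simp add: anchor_def \<theta>'_def)
    define u where "u = anchor p \<lfloor>V p \<theta>\<rfloor>"
    have u: "u * cnj u = 1" using anchor[of p "\<lfloor>V p \<theta>\<rfloor>"] by (simp add: u_def complex_norm_square[symmetric])
    have "lam (cis \<theta>) * cnj u - 1 = (lam (cis \<theta>) - u) * cnj u" by (simp add: left_diff_distrib u)
    then have "cmod (lam (cis \<theta>) * cnj u - 1) < 1/2" using d anchor by (simp add: norm_mult u_def)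
    then have "\<bar>Re (lam (cis \<theta>) * cnj u - 1)\<bar> < 1/2" using abs_Re_le_cmod le_less_trans by blast
    then show ?thesis unfolding u_def[symmetric] by (simp only: minus_complex.sel one_complex.sel)
  qed
  define \<alpha> where "\<alpha> = (\<lambda>x. if x \<in> (\<Union>p\<in>A'. arc p) then
      Arg (anchor (pp x) \<lfloor>V (pp x) (th x)\<rfloor>) + Arg (lam x * cnj (anchor (pp x) \<lfloor>V (pp x) (th x)\<rfloor>)) else 0)"
  have \<alpha>: "\<alpha> (cis \<theta>) = Arg (anchor p \<lfloor>V p \<theta>\<rfloor>) + Arg (lam (cis \<theta>) * cnj (anchor p \<lfloor>V p \<theta>\<rfloor>))"
    if p: "p \<in> A'" "fst p < \<theta>" "\<theta> < snd p" for p \<theta>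
  proof -
    have "cis \<theta> \<in> (\<Union>p\<in>A'. arc p)" unfolding arc_def using p by (intro UN_I[OF p(1)] imageI) auto
    then show ?thesis by (simp add: \<alpha>_def pp[OF p])
  qed
  have cA: "cis (Arg u) = u" if "cmod u = 1" for u
    using that by (metis cis_Arg div_by_1 norm_zero of_real_1 sgn_eq zero_neq_one)
  have lamA: "lam x = cis (\<alpha> x)" if x: "x \<in> (\<Union>p\<in>A'. arc p)" for x
  proof -
    obtain p \<theta> where p: "p \<in> A'" "fst p < \<theta>" "\<theta> < snd p" "x = cis \<theta>" using x by (auto simp: arc_def)
    define u where "u = anchor p \<lfloor>V p \<theta>\<rfloor>"
    have u: "cmod u = 1" "cnj u * u = 1"
      using anchor[of p "\<lfloor>V p \<theta>\<rfloor>"] by (auto simp: u_def mult.commute complex_norm_square[symmetric])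
    have "cmod (lam x * cnj u) = 1" using lam[of x] p(4) u(1) by (simp add: norm_mult)
    then have "cis (\<alpha> x) = u * (lam x * cnj u)"
      unfolding p(4) \<alpha>[OF p(1-3)] u_def[symmetric] by (simp add: cis_mult[symmetric] cA u(1))
    also have "\<dots> = lam x * (cnj u * u)" by (simp add: mult_ac)
    finally show ?thesis using u(2) by simp
  qed
  have \<alpha>B: "\<bar>\<alpha> x\<bar> \<le> 2 * pi" for x
    using Arg_bounded[of "anchor (pp x) \<lfloor>V (pp x) (th x)\<rfloor>"] Arg_bounded[of "lam x * cnj (anchor (pp x) \<lfloor>V (pp x) (th x)\<rfloor>)"]
    by (auto simp: \<alpha>_def abs_le_iff)
  have \<alpha>lip: "\<bar>\<alpha> (cis t) - \<alpha> (cis s)\<bar> \<le> \<bar>V p t - V p s\<bar>"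
    if p: "p \<in> A'" "fst p < s" "s < snd p" "fst p < t" "t < snd p" and fl: "\<lfloor>V p s\<rfloor> = \<lfloor>V p t\<rfloor>" for p s t
  proof -
    define u where "u = anchor p \<lfloor>V p t\<rfloor>"
    have u: "cmod u = 1" using anchor by (simp add: u_def)
    define a b where "a = Arg (lam (cis t) * cnj u)" and "b = Arg (lam (cis s) * cnj u)"
    have cab: "cis a = lam (cis t) * cnj u" "cis b = lam (cis s) * cnj u"
      unfolding a_def b_def by (rule cA; simp add: norm_mult lam u)+
    have "\<bar>a\<bar> < pi / 2" "\<bar>b\<bar> < pi / 2"
      using anc[OF p(1,4,5)] anc[OF p(1-3)] unfolding a_def b_def Arg_Re_pos u_def fl by auto
    then have "\<bar>a - b\<bar> \<le> pi" by linarith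
    from cmod_cis_diff_ge[OF this] have "\<bar>a - b\<bar> \<le> 2 * cmod (lam (cis t) * cnj u - lam (cis s) * cnj u)"
      unfolding cab by simp
    also have "lam (cis t) * cnj u - lam (cis s) * cnj u = (lam (cis t) - lam (cis s)) * cnj u" by (simp add: algebra_simps)
    also have "2 * cmod \<dots> = 2 * cmod (lam (cis t) - lam (cis s))" by (simp add: norm_mult u)
    also have "\<dots> \<le> \<bar>V p t - V p s\<bar>" using Vlip p by blast
    finally show ?thesis unfolding \<alpha>[OF p(1,4,5)] \<alpha>[OF p(1-3)] fl a_def b_def u_def by simp
  qed
  \<comment> \<open>Rational endpoints keep the family countable. Lengths below 3, hence below
    \<open>pi\<close>, make chords increase with the angle, so the subarc between two points lies in
    the disk spanned by their distance.\<close>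
  define J where "J = {(p, q1, q2). p \<in> A' \<and> q1 \<in> \<rat> \<and> q2 \<in> \<rat> \<and> fst p \<le> q1 \<and> q1 < q2 \<and> q2 \<le> snd p \<and> q2 - q1 < 3 \<and>
     (\<forall>s t. q1 < s \<and> s < q2 \<and> q1 < t \<and> t < q2 \<longrightarrow> \<lfloor>V p s\<rfloor> = \<lfloor>V p t\<rfloor>)}"
  have "J \<subseteq> A' \<times> \<rat> \<times> \<rat>" by (auto simp: J_def)
  then have J: "countable J" using A'c countable_rat by (meson countable_SIGMA countable_subset)
  \<comment> \<open>The complement of the closed complementary arc: an open set of the plane that
    meets the circle exactly in the open arc.\<close>
  define C where "C = (\<lambda>j::(real \<times> real) \<times> real \<times> real. - cis ` {snd (snd j)..fst (snd j) + 2 * pi})"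
  have Copen: "open (C j)" for j
  proof -
    have "compact (cis ` {snd (snd j)..fst (snd j) + 2 * pi})" by (intro compact_continuous_image continuous_intros) auto
    then show ?thesis by (simp add: C_def compact_imp_closed open_Compl)
  qed
  have Cin: "\<exists>s. q1 < s \<and> s < q2 \<and> x = cis s" if x: "x \<in> C (p, q1, q2)" "cmod x = 1" and q: "q2 - q1 < 3" for p q1 q2 x
  proof -
    obtain t where t: "x = cis t" "q1 \<le> t" "t < q1 + 2 * pi" using unit_circle_param[OF x(2), of q1] .
    have "t < q2" using x(1) t by (force simp: C_def)
    moreover have "t \<noteq> q1"
    proof
      assume "t = q1"
      then have "x = cis (q1 + 2 * pi)" using t(1) by (simp add: cis_mult[symmetric])
      moreover have "q2 \<le> q1 + 2 * pi" using q pi_gt3 by linarith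
      ultimately show False using x(1) by (auto simp: C_def)
    qed
    ultimately show ?thesis using t by (intro exI[of _ t]) auto
  qed
  have Cin': "cis s \<in> C (p, q1, q2)" if "q1 < s" "s < q2" for p q1 q2 s
  proof (rule ccontr)
    assume "cis s \<notin> C (p, q1, q2)"
    then obtain t where t: "q2 \<le> t" "t \<le> q1 + 2 * pi" "cis s = cis t" by (auto simp: C_def)
    then have "s = t" using that by (intro cis_inj) auto
    then show False using that t by simp
  qed
  have Jloc: "\<bar>\<alpha> \<zeta> - \<alpha> x\<bar> \<le> measure (\<mu> (fst j)) (cball x (cmod (\<zeta> - x)))"
    if j: "j \<in> J" and x: "x \<in> C j" "\<zeta> \<in> C j" "cmod x = 1" "cmod \<zeta> = 1" for j x \<zeta>
  proof -
    obtain p q1 q2 where jj: "j = (p, q1, q2)" by (cases j)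
    have p: "p \<in> A'" "fst p \<le> q1" "q2 \<le> snd p" "q2 - q1 < 3"
      "\<And>s t. q1 < s \<Longrightarrow> s < q2 \<Longrightarrow> q1 < t \<Longrightarrow> t < q2 \<Longrightarrow> \<lfloor>V p s\<rfloor> = \<lfloor>V p t\<rfloor>"
      using j unfolding jj J_def mem_Collect_eq prod.case by blast+
    obtain s t where s: "q1 < s" "s < q2" "x = cis s" and t: "q1 < t" "t < q2" "\<zeta> = cis t"
      using Cin[of x p q1 q2] Cin[of \<zeta> p q1 q2] x p(4) unfolding jj by blast
    interpret M: finite_measure "\<mu> p" by (rule \<mu>(2)[OF p(1)])
    have ord: "\<bar>V p t - V p s\<bar> \<le> measure (\<mu> p) (cis ` {min s t..max s t})"
    proof (cases "s \<le> t")
      case True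
      then have "V p t - V p s \<le> measure (\<mu> p) (cis ` {s..t})" "2 * cmod (lam (cis t) - lam (cis s)) \<le> V p t - V p s"
        using V\<mu>[OF p(1), of s t] V[OF p(1), of s t] s t p(2,3) by auto
      moreover from this have "0 \<le> V p t - V p s" using norm_ge_zero[of "lam (cis t) - lam (cis s)"] by linarith
      ultimately show ?thesis using True by (simp add: min_absorb1 max_absorb2)
    next
      case False
      then have "V p s - V p t \<le> measure (\<mu> p) (cis ` {t..s})" "2 * cmod (lam (cis s) - lam (cis t)) \<le> V p s - V p t"
        using V\<mu>[OF p(1), of t s] V[OF p(1), of t s] s t p(2,3) by auto
      moreover from this have "0 \<le> V p s - V p t" using norm_ge_zero[of "lam (cis s) - lam (cis t)"] by linarith
      ultimately show ?thesis using False by (simp add: min_absorb2 max_absorb1)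
    qed
    have "\<bar>\<alpha> \<zeta> - \<alpha> x\<bar> \<le> \<bar>V p t - V p s\<bar>"
      unfolding s(3) t(3)
      by (rule \<alpha>lip[OF p(1) _ _ _ _ p(5)[OF s(1,2) t(1,2)]]) (use s(1,2) t(1,2) p(2,3) in auto)
    also note ord
    also have "measure (\<mu> p) (cis ` {min s t..max s t}) \<le> measure (\<mu> p) (cball x (cmod (\<zeta> - x)))"
    proof (rule M.finite_measure_mono)
      show "cis ` {min s t..max s t} \<subseteq> cball x (cmod (\<zeta> - x))"
      proof
        fix y assume "y \<in> cis ` {min s t..max s t}"
        then obtain v where v: "min s t \<le> v" "v \<le> max s t" "y = cis v" by auto
        have "cmod (cis v - cis s) \<le> cmod (cis t - cis s)"
          using v(1,2) s(1,2) t(1,2) p(4) pi_gt3 by (intro cis_dist_mono) (auto simp: min_def max_def split: if_splits)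
        then show "y \<in> cball x (cmod (\<zeta> - x))" by (simp add: v(3) s(3) t(3) dist_norm norm_minus_commute)
      qed
    qed (simp add: \<mu>(1)[OF p(1)])
    finally show ?thesis by (simp add: jj)
  qed
  \<comment> \<open>Discontinuities of \<open>V\<close> matter for the measurability of
    \<open>\<alpha>\<close>, those of \<open>\<lfloor>V\<rfloor>\<close> for the existence of a
    subarc with a single level. Both functions are monotone, so both sets are countable.\<close>
  define bad where "bad = (\<lambda>p. {\<theta> \<in> {fst p<..<snd p}. \<not> isCont (V p) \<theta>} \<union>
      {\<theta> \<in> {fst p<..<snd p}. \<not> isCont (\<lambda>\<theta>. real_of_int \<lfloor>V p \<theta>\<rfloor>) \<theta>})"
  have badc: "countable (bad p)" if p: "p \<in> A'" for p
  proof -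
    have m: "V p s \<le> V p t" if "fst p < s" "s \<le> t" "t < snd p" for s t
      using V[OF p that] norm_ge_zero[of "lam (cis t) - lam (cis s)"] by linarith
    have "mono_on {fst p<..<snd p} (V p)" using m by (auto simp: mono_on_def)
    moreover have "mono_on {fst p<..<snd p} (\<lambda>\<theta>. real_of_int \<lfloor>V p \<theta>\<rfloor>)"
      using m by (auto simp: mono_on_def intro!: floor_mono)
    ultimately show ?thesis unfolding bad_def
      by (intro countable_Un mono_on_ctble_discont_open) auto
  qed
  define D where "D = (sphere 0 1 - (\<Union>p\<in>A'. arc p)) \<union> (\<Union>p\<in>A'. cis ` bad p)"
  have Dc: "countable D" unfolding D_def using cover A'c badc by (intro countable_Un countable_UN countable_image)
  have good: "\<exists>p \<theta> q1 q2. x = cis \<theta> \<and> (p, q1, q2) \<in> J \<and> q1 < \<theta> \<and> \<theta> < q2 \<and> isCont (V p) \<theta>"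
    if x: "x \<in> sphere 0 1 - D" for x
  proof -
    obtain p \<theta> where p: "p \<in> A'" "fst p < \<theta>" "\<theta> < snd p" "x = cis \<theta>" using x by (auto simp: D_def arc_def)
    have nb: "\<theta> \<notin> bad p" using x p by (auto simp: D_def)
    then have c: "isCont (V p) \<theta>" "isCont (\<lambda>\<theta>. real_of_int \<lfloor>V p \<theta>\<rfloor>) \<theta>" using p by (auto simp: bad_def)
    obtain d where d: "0 < d" "\<And>t. \<bar>t - \<theta>\<bar> < d \<Longrightarrow> \<bar>real_of_int \<lfloor>V p t\<rfloor> - real_of_int \<lfloor>V p \<theta>\<rfloor>\<bar> < 1"
      using c(2)[unfolded continuous_at_eps_delta, rule_format, of 1] by (auto simp: dist_real_def)
    have fl: "\<lfloor>V p t\<rfloor> = \<lfloor>V p \<theta>\<rfloor>" if "\<bar>t - \<theta>\<bar> < d" for t using d(2)[OF that] by linarith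
    define e where "e = min 1 d"
    have e: "0 < e" "e \<le> 1" "e \<le> d" using d(1) by (auto simp: e_def)
    obtain q1 where q1: "q1 \<in> \<rat>" "max (fst p) (\<theta> - e) < q1" "q1 < \<theta>" using Rats_dense_in_real[of "max (fst p) (\<theta> - e)" \<theta>] p e by auto
    obtain q2 where q2: "q2 \<in> \<rat>" "\<theta> < q2" "q2 < min (snd p) (\<theta> + e)" using Rats_dense_in_real[of \<theta> "min (snd p) (\<theta> + e)"] p e by auto
    have c1: "p \<in> A' \<and> q1 \<in> \<rat> \<and> q2 \<in> \<rat> \<and> fst p \<le> q1 \<and> q1 < q2 \<and> q2 \<le> snd p \<and> q2 - q1 < 3"
      using p(1) q1 q2 e by auto
    have c2: "\<lfloor>V p s\<rfloor> = \<lfloor>V p t\<rfloor>" if "q1 < s" "s < q2" "q1 < t" "t < q2" for s t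
    proof -
      have "\<bar>s - \<theta>\<bar> < d" "\<bar>t - \<theta>\<bar> < d" using that q1 q2 e by auto
      from fl[OF this(1)] fl[OF this(2)] show ?thesis by (rule trans[OF _ sym])
    qed
    have "(p, q1, q2) \<in> J" unfolding J_def mem_Collect_eq prod.case using c1 c2 by blast
    then show ?thesis using p(4) q1 q2 c(1) by blast
  qed
  have "continuous_on (sphere 0 1 - D) \<alpha>"
    unfolding continuous_on_iff
  proof (intro ballI allI impI)
    fix x and e :: real assume x: "x \<in> sphere 0 1 - D" and e: "0 < e"
    obtain p \<theta> q1 q2 where p: "x = cis \<theta>" "(p, q1, q2) \<in> J" "q1 < \<theta>" "\<theta> < q2" "isCont (V p) \<theta>" using good[OF x] by blast
    have J': "p \<in> A'" "fst p \<le> q1" "q2 \<le> snd p" "q2 - q1 < 3"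
      "\<And>s t. q1 < s \<Longrightarrow> s < q2 \<Longrightarrow> q1 < t \<Longrightarrow> t < q2 \<Longrightarrow> \<lfloor>V p s\<rfloor> = \<lfloor>V p t\<rfloor>"
      using p(2) unfolding J_def mem_Collect_eq prod.case by blast+
    obtain d where d: "0 < d" "\<And>t. \<bar>t - \<theta>\<bar> < d \<Longrightarrow> \<bar>V p t - V p \<theta>\<bar> < e"
      using p(5)[unfolded continuous_at_eps_delta, rule_format, OF e] by (auto simp: dist_real_def)
    obtain r where r: "0 < r" "ball x r \<subseteq> C (p, q1, q2)"
      using Copen[of "(p, q1, q2)"] Cin'[OF p(3,4), of p] p(1) openE by blast
    show "\<exists>d>0. \<forall>x'\<in>sphere 0 1 - D. dist x' x < d \<longrightarrow> dist (\<alpha> x') (\<alpha> x) < e"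
    proof (intro exI[of _ "min r (d / 2)"] conjI ballI impI)
      show "0 < min r (d / 2)" using r d by simp
      fix x' assume x': "x' \<in> sphere 0 1 - D" "dist x' x < min r (d / 2)"
      have "x' \<in> C (p, q1, q2)" using r x' by (auto simp: dist_commute)
      then obtain t where t: "q1 < t" "t < q2" "x' = cis t" using Cin[of x' p q1 q2] x' J'(4) by auto
      have "\<bar>t - \<theta>\<bar> / 2 \<le> cmod (cis t - cis \<theta>)" using t(1,2) p(3,4) J'(4) pi_gt3 by (intro cmod_cis_diff_ge) auto
      then have "\<bar>t - \<theta>\<bar> < d" using x'(2) t(3) p(1) by (simp add: dist_norm)
      then have "\<bar>V p t - V p \<theta>\<bar> < e" by (rule d(2))
      moreover have "\<bar>\<alpha> (cis t) - \<alpha> (cis \<theta>)\<bar> \<le> \<bar>V p t - V p \<theta>\<bar>" 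
        by (rule \<alpha>lip[OF J'(1) _ _ _ _ J'(5)[OF p(3,4) t(1,2)]]) (use t(1,2) p(3,4) J'(2,3) in auto)
      ultimately show "dist (\<alpha> x') (\<alpha> x) < e" by (simp add: t(3) p(1) dist_real_def)
    qed
  qed
  then have \<alpha>m: "\<alpha> \<in> borel_measurable borel"
    by (rule borel_measurable_countable_discont[OF Dc closed_sphere]) (auto simp: \<alpha>_def arc_def)
  \<comment> \<open>If there is no subarc at all, empty sets and null measures serve as default
    values of the sequences.\<close>
  define Q where "Q = (\<lambda>i. if J = {} then {} else C (from_nat_into J i))"
  define \<mu>' where "\<mu>' = (\<lambda>i. if J = {} then null_measure borel else \<mu> (fst (from_nat_into J i)))"
  have inJ: "from_nat_into J i \<in> J" if "J \<noteq> {}" for i using that by (rule from_nat_into)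
  have inA: "fst (from_nat_into J i) \<in> A'" if "J \<noteq> {}" for i using inJ[OF that, of i] by (auto simp: J_def)
  show ?thesis
  proof (rule that[OF \<alpha>m \<alpha>B, of \<mu>' Q "sphere 0 1 - (\<Union>p\<in>A'. arc p)"])
    show "sets (\<mu>' i) = sets borel" for i using \<mu>(1) inA by (simp add: \<mu>'_def)
    show "finite_measure (\<mu>' i)" for i using \<mu>(2) inA by (auto simp: \<mu>'_def intro!: finite_measureI)
    show "open (Q i)" for i using Copen by (simp add: Q_def)
    have "sphere 0 1 - (\<Union>i. Q i) \<subseteq> D"
    proof (rule subsetI, rule ccontr)
      fix x assume x: "x \<in> sphere 0 1 - (\<Union>i. Q i)" "x \<notin> D"
      then have xD: "x \<in> sphere 0 1 - D" by blast
      obtain p \<theta> q1 q2 where p: "x = cis \<theta>" "(p, q1, q2) \<in> J" "q1 < \<theta>" "\<theta> < q2" using good[OF xD] by blast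
      from p(2) obtain i where i: "from_nat_into J i = (p, q1, q2)" using from_nat_into_surj[OF J] by blast
      have "x \<in> Q i" using p Cin' i by (auto simp: Q_def)
      then show False using x by blast
    qed
    then show "countable (sphere 0 1 - (\<Union>i. Q i))" using Dc countable_subset by blast
    show "\<bar>\<alpha> \<zeta> - \<alpha> x\<bar> \<le> measure (\<mu>' i) (cball x (cmod (\<zeta> - x)))"
      if "x \<in> Q i" "\<zeta> \<in> Q i" "cmod x = 1" "cmod \<zeta> = 1" for i x \<zeta>
      using that Jloc[OF inJ] by (auto simp: Q_def \<mu>'_def split: if_splits)
    show "countable (sphere 0 1 - (\<Union>p\<in>A'. arc p))" by (rule cover)
    show "lam x = cis (\<alpha> x)" if "x \<in> sphere 0 1 - (sphere 0 1 - (\<Union>p\<in>A'. arc p))" for x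
      using that by (intro lamA) auto
  qed
qed

section \<open>Interaction between boundary circles\<close>

definition circle_cauchy :: "real \<Rightarrow> (complex \<Rightarrow> complex) \<Rightarrow> complex \<Rightarrow> complex" where
  "circle_cauchy r q w = contour_integral (circlepath 0 r) (\<lambda>u. q u / (u - w)) / (2 * pi * \<i>)"

lemma circle_cauchy:
  fixes q :: "complex \<Rightarrow> complex"
  assumes r: "0 < r" and q: "continuous_on (sphere 0 r) q" and B: "\<And>u. cmod u = r \<Longrightarrow> cmod (q u) \<le> B"
  defines "I \<equiv> circle_cauchy r q"
  shows "I holomorphic_on - sphere 0 r"
    and "cmod w \<noteq> r \<Longrightarrow> cmod (I w) \<le> B * r / \<bar>cmod w - r\<bar>"
    and "cmod w \<noteq> r \<Longrightarrow> ((\<lambda>u. q u / (u - w)) has_contour_integral (2 * pi * \<i> * I w)) (circlepath 0 r)"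
proof -
  have pi: "path_image (circlepath 0 r) = sphere 0 r" using r by simp
  have int: "((\<lambda>u. q u / (u - w)) has_contour_integral (2 * pi * \<i> * I w)) (circlepath 0 r)" if "cmod w \<noteq> r" for w
  proof -
    have "continuous_on (path_image (circlepath 0 r)) (\<lambda>u. q u / (u - w))"
      unfolding pi using that by (intro continuous_intros q) auto
    then have "(\<lambda>u. q u / (u - w)) contour_integrable_on circlepath 0 r"
      by (rule contour_integrable_continuous_circlepath)
    then show ?thesis by (simp add: I_def circle_cauchy_def has_contour_integral_integral)
  qed
  then show "cmod w \<noteq> r \<Longrightarrow> ((\<lambda>u. q u / (u - w)) has_contour_integral (2 * pi * \<i> * I w)) (circlepath 0 r)" .
  have "\<exists>D. (I has_field_derivative D) (at w)" if w: "w \<in> - sphere 0 r" for w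
  proof -
    have "((\<lambda>w. 2 * pi * \<i> * I w) has_field_derivative
        (of_nat 1 * contour_integral (circlepath 0 r) (\<lambda>u. q u / (u - w) ^ Suc 1))) (at w)"
    proof (rule Cauchy_next_derivative(2)[where S = UNIV and B = "2 * pi * r" and \<gamma> = "circlepath 0 r"])
      show "continuous_on (path_image (circlepath 0 r)) q" unfolding pi by (rule q)
      show "norm (vector_derivative (circlepath 0 r) (at t)) \<le> 2 * pi * r" for t
        using r by (simp add: vector_derivative_circlepath norm_mult)
      show "((\<lambda>u. q u / (u - w) ^ 1) has_contour_integral 2 * pi * \<i> * I w) (circlepath 0 r)"
        if "w \<in> UNIV - path_image (circlepath 0 r)" for w using int[of w] that unfolding pi by simp
    qed (use w r in \<open>simp_all add: pi\<close>)
    from DERIV_cmult[OF this, of "1 / (2 * pi * \<i>)"]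
    show ?thesis by auto
  qed
  moreover have "open (- sphere (0::complex) r)" by (simp add: open_Compl)
  ultimately show "I holomorphic_on - sphere 0 r" by (simp add: holomorphic_on_open)
  assume w: "cmod w \<noteq> r"
  have B0: "0 \<le> B" using order_trans[OF norm_ge_zero B[of "of_real r"]] r by simp
  have "cmod (2 * pi * \<i> * I w) \<le> B / \<bar>cmod w - r\<bar> * (2 * pi * r)"
  proof (rule has_contour_integral_bound_circlepath[OF int[OF w]])
    show "0 \<le> B / \<bar>cmod w - r\<bar>" using B0 by simp
    show "cmod (q u / (u - w)) \<le> B / \<bar>cmod w - r\<bar>" if "cmod (u - 0) = r" for u
    proof -
      have "\<bar>cmod w - r\<bar> \<le> cmod (u - w)" using norm_triangle_ineq3[of w u] that by (simp add: norm_minus_commute)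
      then show ?thesis unfolding norm_divide using B[of u] B0 w that by (intro frac_le) auto
    qed
  qed (rule r)
  then have "2 * pi * cmod (I w) \<le> 2 * pi * (B * r / \<bar>cmod w - r\<bar>)" by (simp add: norm_mult mult_ac)
  then show "cmod (I w) \<le> B * r / \<bar>cmod w - r\<bar>" by (rule mult_left_le_imp_le) simp
qed

lemma compact_cmod_bound:
  assumes "compact S" "continuous_on S (f :: complex \<Rightarrow> complex)"
  obtains a where "\<And>x. x \<in> S \<Longrightarrow> cmod (f x) \<le> a"
  using compact_imp_bounded[OF compact_continuous_image[OF assms(2,1)]] unfolding bounded_iff by blast

lemma open_annulus: "open {w::complex. a < cmod w \<and> cmod w < b}"
  by (intro open_Collect_conj open_Collect_less continuous_intros)

text \<open>Laurent splitting with bounds: the two parts are Cauchy integrals over the outer and the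
  inner circle, and each is controlled by the supremum of \<open>q\<close> on its circle divided by
  the distance to it.\<close>

lemma annulus_split:
  assumes r: "0 < r1" "r1 < r2" "a < r1" "r2 < b"
    and q: "q holomorphic_on {w. a < cmod w \<and> cmod w < b}"
    and B: "\<And>u. cmod u = r1 \<Longrightarrow> cmod (q u) \<le> B" "\<And>u. cmod u = r2 \<Longrightarrow> cmod (q u) \<le> B"
  obtains P N where "P holomorphic_on ball 0 r2" "N holomorphic_on {w. r1 < cmod w}"
    "\<And>w. r1 < cmod w \<Longrightarrow> cmod w < r2 \<Longrightarrow> q w = P w + N w"
    "\<And>w. cmod w < r2 \<Longrightarrow> cmod (P w) \<le> B * r2 / (r2 - cmod w)"
    "\<And>w. r1 < cmod w \<Longrightarrow> cmod (N w) \<le> B * r1 / (cmod w - r1)"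
proof -
  let ?A = "{w. a < cmod w \<and> cmod w < b}"
  have r2: "0 < r2" using r by simp
  have qc: "continuous_on (sphere 0 r1) q" "continuous_on (sphere 0 r2) q"
    by (rule continuous_on_subset[OF holomorphic_on_imp_continuous_on[OF q]]; use r in auto)+
  note I1 = circle_cauchy[OF r(1) qc(1) B(1)]
  note I2 = circle_cauchy[OF r2 qc(2) B(2)]
  have "q w = circle_cauchy r2 q w + - circle_cauchy r1 q w" if w: "r1 < cmod w" "cmod w < r2" for w
  proof -
    \<comment> \<open>The difference quotient is holomorphic across \<open>w\<close>, so its
      integrals over the two circles agree although \<open>w\<close> lies between them. Evaluating
      both sides gives Cauchy's formula for the annulus.\<close>
    define g where "g = (\<lambda>u. if u = w then deriv q w else (q u - q w) / (u - w))"
    have g: "g holomorphic_on ?A" unfolding g_def by (rule pole_lemma_open[OF q open_annulus])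
    have "contour_integral (circlepath 0 r1) g = contour_integral (circlepath 0 r2) g"
    proof (rule Cauchy_theorem_homotopic_loops[OF _ open_annulus g])
      show "homotopic_loops ?A (circlepath 0 r1) (circlepath 0 r2)"
      proof (rule homotopic_loops_linear)
        show "closed_segment (circlepath 0 r1 t) (circlepath 0 r2 t) \<subseteq> ?A" for t
        proof
          fix x assume "x \<in> closed_segment (circlepath 0 r1 t) (circlepath 0 r2 t)"
          then obtain u where u: "0 \<le> u" "u \<le> 1" "x = (1 - u) *\<^sub>R circlepath 0 r1 t + u *\<^sub>R circlepath 0 r2 t"
            by (auto simp: in_segment)
          define v where "v = (1 - u) * r1 + u * r2"
          have "r1 * (1 - u) + r1 * u \<le> r1 * (1 - u) + r2 * u" "r1 * (1 - u) + r2 * u \<le> r2 * (1 - u) + r2 * u"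
            using r u by (intro add_mono mult_right_mono; simp)+
          then have v: "r1 \<le> v" "v \<le> r2" by (simp_all add: v_def algebra_simps)
          have "x = of_real v * exp (2 * of_real pi * \<i> * of_real t)"
            by (simp add: u(3) circlepath scaleR_conv_of_real v_def algebra_simps)
          then have "cmod x = v" using v r by (simp add: norm_mult)
          then show "x \<in> ?A" using v r by simp
        qed
      qed (use r in \<open>simp_all add: valid_path_imp_path\<close>)
    qed simp_all
    moreover have "contour_integral (circlepath 0 r2) g = 2 * pi * \<i> * circle_cauchy r2 q w - q w * (2 * pi * \<i>)"
    proof (rule contour_integral_unique, rule has_contour_integral_eq)
      have "((\<lambda>u. 1 / (u - w)) has_contour_integral (2 * of_real pi * \<i> * 1)) (circlepath 0 r2)"
        using w by (intro Cauchy_integral_circlepath_simple) auto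
      then show "((\<lambda>u. q u / (u - w) - q w * (1 / (u - w))) has_contour_integral 2 * pi * \<i> * circle_cauchy r2 q w - q w * (2 * pi * \<i>)) (circlepath 0 r2)"
        using w by (intro has_contour_integral_diff has_contour_integral_lmul I2(3)) auto
      show "q u / (u - w) - q w * (1 / (u - w)) = g u" if "u \<in> path_image (circlepath 0 r2)" for u
        using that w r by (auto simp: g_def diff_divide_distrib)
    qed
    moreover have "contour_integral (circlepath 0 r1) g = 2 * pi * \<i> * circle_cauchy r1 q w - q w * 0"
    proof (rule contour_integral_unique, rule has_contour_integral_eq)
      have "((\<lambda>u. 1 / (u - w)) has_contour_integral 0) (circlepath 0 r1)"
        using w r by (intro Cauchy_theorem_disc_simple[where a = 0 and e = "cmod w"]) (auto intro!: holomorphic_intros)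
      then show "((\<lambda>u. q u / (u - w) - q w * (1 / (u - w))) has_contour_integral 2 * pi * \<i> * circle_cauchy r1 q w - q w * 0) (circlepath 0 r1)"
        using w by (intro has_contour_integral_diff has_contour_integral_lmul I1(3)) auto
      show "q u / (u - w) - q w * (1 / (u - w)) = g u" if "u \<in> path_image (circlepath 0 r1)" for u
        using that w r by (auto simp: g_def diff_divide_distrib)
    qed
    ultimately have "2 * pi * \<i> * circle_cauchy r2 q w - q w * (2 * pi * \<i>) = 2 * pi * \<i> * circle_cauchy r1 q w" by simp
    then have "(2 * pi * \<i>) * q w = (2 * pi * \<i>) * (circle_cauchy r2 q w - circle_cauchy r1 q w)" by (simp add: algebra_simps)
    then show ?thesis by simp
  qed
  moreover have "circle_cauchy r2 q holomorphic_on ball 0 r2" by (rule holomorphic_on_subset[OF I2(1)]) auto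
  moreover have "(\<lambda>w. - circle_cauchy r1 q w) holomorphic_on {w. r1 < cmod w}"
    by (intro holomorphic_intros holomorphic_on_subset[OF I1(1)]) auto
  moreover have "cmod (circle_cauchy r2 q w) \<le> B * r2 / (r2 - cmod w)" if "cmod w < r2" for w
    using I2(2)[of w] that by simp
  moreover have "cmod (- circle_cauchy r1 q w) \<le> B * r1 / (cmod w - r1)" if "r1 < cmod w" for w
    using I1(2)[of w] that by simp
  ultimately show ?thesis using that[of "circle_cauchy r2 q" "\<lambda>w. - circle_cauchy r1 q w"] by blast
qed

text \<open>Schwarz reflection in the unit circle. The assumed bound makes \<open>N\<close> vanish
  at infinity, so the reflected function tends to 0 at the origin and the singularity is
  removable.\<close>

lemma reflection_holomorphic:
  assumes N: "N holomorphic_on {w. r < cmod w}" and r: "0 < r"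
    and B: "\<And>w. r < cmod w \<Longrightarrow> cmod (N w) \<le> B * r / (cmod w - r)"
  defines "Ns \<equiv> \<lambda>w. if w = 0 then 0 else cnj (N (1 / cnj w))"
  shows "Ns holomorphic_on ball 0 (1 / r)"
proof -
  have inv: "r < cmod (1 / w)" if "cmod w < 1 / r" "w \<noteq> 0" for w
    using that r by (simp add: norm_divide field_simps)
  have 1: "(cnj \<circ> (\<lambda>w. N (1 / w)) \<circ> cnj) holomorphic_on ball 0 (1 / r) - {0}"
  proof (rule holomorphic_on_compose_cnj_cnj)
    have "(N \<circ> (\<lambda>w. 1 / w)) holomorphic_on cnj ` (ball 0 (1 / r) - {0})"
      by (rule holomorphic_on_compose_gen[OF _ N]) (use inv in \<open>auto intro!: holomorphic_intros\<close>)
    then show "(\<lambda>w. N (1 / w)) holomorphic_on cnj ` (ball 0 (1 / r) - {0})" by (simp add: o_def)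
  qed auto
  show ?thesis
  proof (rule no_isolated_singularity'[where K = "{0}"])
    show "Ns holomorphic_on ball 0 (1 / r) - {0}"
      by (rule holomorphic_transform[OF 1]) (simp add: Ns_def)
    have "(Ns \<longlongrightarrow> 0) (at 0 within ball 0 (1 / r))"
    proof (rule Lim_null_comparison)
      have "cmod (Ns w) \<le> B * r * cmod w / (1 - r * cmod w)" if "w \<in> ball 0 (1 / r)" "w \<noteq> 0" for w
      proof -
        have "cmod (Ns w) \<le> B * r / (cmod (1 / cnj w) - r)"
          using B[of "1 / cnj w"] inv[of "cnj w"] that by (simp add: Ns_def)
        also have "\<dots> = B * r * cmod w / (1 - r * cmod w)"
          using that r by (simp add: norm_divide field_simps)
        finally show ?thesis .
      qed
      then show "\<forall>\<^sub>F w in at 0 within ball 0 (1 / r). cmod (Ns w) \<le> B * r * cmod w / (1 - r * cmod w)"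
        by (auto simp: eventually_at_filter)
      show "((\<lambda>w. B * r * cmod w / (1 - r * cmod w)) \<longlongrightarrow> 0) (at 0 within ball 0 (1 / r))"
        by (rule tendsto_eq_intros refl | simp)+
    qed
    then show "(Ns \<longlongrightarrow> Ns z) (at z within ball 0 (1 / r))" if "z \<in> {0}" for z using that by (simp add: Ns_def)
  qed auto
qed

text \<open>The Laurent part of \<open>h / (E \<kappa>)\<close> living outside the disk is reflected into the disk. The
  gain \<open>\<eta>\<close> comes from \<open>\<kappa> = w\<^sup>n / (1 + w\<^sup>2\<^sup>n)\<close>, which is real on the circle and of size
  \<open>\<bar>w\<bar>\<^sup>n\<close> inside.\<close>

lemma reflection_correction:
  assumes E: "E holomorphic_on ball 0 1" "\<And>w. w \<in> ball 0 1 \<Longrightarrow> E w \<noteq> 0"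
    and \<rho>: "0 < \<rho>" "\<rho> < 1" and \<eta>: "0 < \<eta>"
  obtains \<kappa> :: "complex \<Rightarrow> complex" and P C \<rho>' B where "\<rho> < \<rho>'" "\<rho>' < 1" "finite P"
    "\<And>x. cmod x = 1 \<Longrightarrow> x \<notin> P \<Longrightarrow> isCont \<kappa> x \<and> Im (\<kappa> x) = 0"
    "\<And>\<epsilon> h. h holomorphic_on {w. \<rho> < cmod w \<and> cmod w < 1} \<Longrightarrow>
       (\<And>w. \<rho> < cmod w \<Longrightarrow> cmod w < 1 \<Longrightarrow> cmod (h w) \<le> \<epsilon>) \<Longrightarrow>
       \<exists>F k. F holomorphic_on ball 0 1 \<and> (\<forall>w. cmod w \<le> \<rho> \<longrightarrow> cmod (F w) \<le> \<eta> * \<epsilon>) \<and>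
         (\<forall>s<1. \<forall>w. cmod w \<le> s \<longrightarrow> cmod (F w) \<le> B s * \<epsilon>) \<and>
         (\<forall>w. \<rho>' < cmod w \<longrightarrow> cmod w < 1 \<longrightarrow> F w + h w = E w * \<kappa> w * k w) \<and>
         continuous_on {w. \<rho>' < cmod w \<and> cmod w \<le> 1} k \<and>
         (\<forall>w. \<rho>' < cmod w \<longrightarrow> cmod w \<le> 1 \<longrightarrow> cmod (k w) \<le> C * \<epsilon>) \<and>
         (\<forall>w. cmod w = 1 \<longrightarrow> Re (k w) = 0)"
proof -
  \<comment> \<open>Four equally spaced radii: \<open>\<rho>2\<close> and \<open>\<rho>4\<close>
    carry the Laurent splitting, \<open>\<rho>3\<close> is the collar radius that is returned, and
    the gaps keep all denominators away from 0.\<close>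
  define d where "d = (1 - \<rho>) / 4"
  define \<rho>2 where "\<rho>2 = \<rho> + d"
  define \<rho>3 where "\<rho>3 = \<rho> + 2 * d"
  define \<rho>4 where "\<rho>4 = \<rho> + 3 * d"
  have d: "0 < d" "\<rho> < \<rho>2" "\<rho>2 < \<rho>3" "\<rho>3 < \<rho>4" "\<rho>4 < 1" using \<rho> by (simp_all add: d_def \<rho>2_def \<rho>3_def \<rho>4_def field_simps)
  have cE: "continuous_on (ball 0 1) E" by (rule holomorphic_on_imp_continuous_on[OF E(1)])
  have "compact (E ` cball 0 \<rho>4)"
    by (intro compact_continuous_image continuous_on_subset[OF cE] compact_cball) (use d in auto)
  then have "bounded (E ` cball 0 \<rho>4)" by (rule compact_imp_bounded)
  then obtain K where K: "0 < K" "\<And>w. cmod w \<le> \<rho>4 \<Longrightarrow> cmod (E w) \<le> K" unfolding bounded_pos by auto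
  have "compact ((\<lambda>w. inverse (E w)) ` cball 0 \<rho>4)"
    by (intro compact_continuous_image continuous_intros continuous_on_subset[OF cE] compact_cball) (use d E in auto)
  then have "bounded ((\<lambda>w. inverse (E w)) ` cball 0 \<rho>4)" by (rule compact_imp_bounded)
  then obtain m where m: "0 < m" "\<And>w. cmod w \<le> \<rho>4 \<Longrightarrow> cmod (inverse (E w)) \<le> m" unfolding bounded_pos by auto
  \<comment> \<open>\<open>D\<close> collects every factor of the final estimate that does not
    depend on \<open>n\<close>. Inside, \<open>\<kappa>\<close> is of size
    \<open>\<rho> ^ n\<close>, while dividing by it on the annulus costs at most
    \<open>2 / \<rho>2 ^ n\<close>; the quotient \<open>\<rho> / \<rho>2 < 1\<close> produces the
    gain.\<close>
  define D where "D = K / (1 - \<rho>) * (2 * m) * (\<rho>4 / (\<rho>4 - \<rho>) + \<rho>2 / (1 - \<rho>2))"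
  have D: "0 < D" unfolding D_def using K m d \<rho>
    by (intro mult_pos_pos add_pos_pos divide_pos_pos) auto
  have "0 \<le> \<rho> / \<rho>2" "\<rho> / \<rho>2 < 1" using d \<rho> by auto
  then have "(\<lambda>n. D * (\<rho> / \<rho>2) ^ n) \<longlonglongrightarrow> D * 0" by (intro tendsto_intros LIMSEQ_power_zero) auto
  then have "\<forall>\<^sub>F n in sequentially. D * (\<rho> / \<rho>2) ^ n < \<eta>" using \<eta> by (intro order_tendstoD(2)[of _ "D * 0"]) auto
  then have "\<forall>\<^sub>F n in sequentially. 0 < n \<and> D * (\<rho> / \<rho>2) ^ n < \<eta>" using eventually_gt_at_top[of 0] by eventually_elim auto
  then obtain n :: nat where n: "0 < n" "D * (\<rho> / \<rho>2) ^ n < \<eta>"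
    using eventually_happens'[OF sequentially_bot] by blast
  define \<kappa> :: "complex \<Rightarrow> complex" where "\<kappa> = (\<lambda>w. w ^ n / (1 + w ^ (2 * n)))"
  define P where "P = {w::complex. w ^ (2 * n) = - 1}"
  have den: "1 + w ^ (2 * n) \<noteq> 0" if "cmod w < 1" for w :: complex
  proof
    assume "1 + w ^ (2 * n) = 0"
    then have "w ^ (2 * n) = - 1" by (simp add: eq_neg_iff_add_eq_0 add.commute)
    then have "cmod w ^ (2 * n) = 1" by (metis norm_minus_cancel norm_one norm_power)
    then show False using that n power_less_one_iff[of "cmod w" "2 * n"] by simp
  qed
  have \<kappa>hol: "\<kappa> holomorphic_on ball 0 1" unfolding \<kappa>_def using den by (intro holomorphic_intros) auto
  have "isCont \<kappa> x \<and> Im (\<kappa> x) = 0" if x: "cmod x = 1" "x \<notin> P" for x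
  proof
    have nz: "1 + x ^ (2 * n) \<noteq> 0" using x(2) by (auto simp: P_def eq_neg_iff_add_eq_0 add.commute)
    then show "isCont \<kappa> x" unfolding \<kappa>_def by (intro continuous_intros)
    \<comment> \<open>On the circle \<open>\<kappa>\<close> is the reciprocal of
      \<open>x ^ n + cnj x ^ n = 2 Re (x ^ n)\<close>, hence real off its poles.\<close>
    have xx: "cnj x ^ n * x ^ n = 1" using x(1) by (metis complex_norm_square mult.commute of_real_1 power_mult_distrib power_one)
    have "x ^ n * (cnj x ^ n + x ^ n) = 1 + x ^ (2 * n)" using xx by (simp add: distrib_left mult.commute mult_2_right power_add)
    then have "\<kappa> x * (cnj x ^ n + x ^ n) = 1" using nz unfolding \<kappa>_def by (metis divide_self times_divide_eq_left)
    moreover have "cnj x ^ n + x ^ n = of_real (2 * Re (x ^ n))"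
      using complex_add_cnj[of "x ^ n"] by (simp add: add.commute)
    ultimately have "\<kappa> x * of_real (2 * Re (x ^ n)) = 1" by simp
    then have "\<kappa> x = of_real (inverse (2 * Re (x ^ n)))" by (metis inverse_unique mult.commute of_real_inverse)
    then show "Im (\<kappa> x) = 0" by (simp only: Im_complex_of_real)
  qed
  \<comment> \<open>This bound involves only \<open>E\<close> and \<open>\<kappa>\<close>. The
    resulting \<open>B\<close> is thus fixed before \<open>h\<close> is given, as an iteration over
    many \<open>h\<close> requires.\<close>
  define K' where "K' = (\<lambda>s. SOME K. \<forall>w. cmod w = s \<longrightarrow> cmod (E w * \<kappa> w) \<le> K)"
  have K': "cmod (E w * \<kappa> w) \<le> K' s" if "s < 1" "cmod w = s" for s w
  proof -
    have "continuous_on (sphere 0 s) (\<lambda>w. E w * \<kappa> w)"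
      by (rule continuous_on_subset[OF continuous_on_mult[OF cE holomorphic_on_imp_continuous_on[OF \<kappa>hol]]]) (use that in auto)
    then obtain a where a: "\<And>x. x \<in> sphere 0 s \<Longrightarrow> cmod (E x * \<kappa> x) \<le> a"
      using compact_cmod_bound[OF compact_sphere] by blast
    have "\<forall>w. cmod w = s \<longrightarrow> cmod (E w * \<kappa> w) \<le> a" by (auto intro: a)
    then have "\<exists>K. \<forall>w. cmod w = s \<longrightarrow> cmod (E w * \<kappa> w) \<le> K" ..
    from someI_ex[OF this] show ?thesis using that unfolding K'_def by blast
  qed
  define b where "b = m * (2 / \<rho>2 ^ n)"
  have b: "0 < b" using m d \<rho> by (simp add: b_def)
  define C where "C = 2 * (b * \<rho>2 / (\<rho>3 - \<rho>2))"
  have C: "0 < C" unfolding C_def using b d \<rho> by simp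
  define B where "B = (\<lambda>s. 1 + K' (max s \<rho>4) * C)"
  show ?thesis
  proof (rule that[of \<rho>3 P \<kappa> B C])
    show "\<rho> < \<rho>3" "\<rho>3 < 1" using d by auto
    show "finite P" unfolding P_def using n by (intro finite_nth_roots) auto
    show "isCont \<kappa> x \<and> Im (\<kappa> x) = 0" if "cmod x = 1" "x \<notin> P" for x
      using that \<open>\<And>x. cmod x = 1 \<Longrightarrow> x \<notin> P \<Longrightarrow> isCont \<kappa> x \<and> Im (\<kappa> x) = 0\<close> by blast
    fix \<epsilon> :: real and h assume h: "h holomorphic_on {w. \<rho> < cmod w \<and> cmod w < 1}"
      and h\<epsilon>: "\<And>w. \<rho> < cmod w \<Longrightarrow> cmod w < 1 \<Longrightarrow> cmod (h w) \<le> \<epsilon>"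
    have \<epsilon>: "0 \<le> \<epsilon>" using order_trans[OF norm_ge_zero h\<epsilon>[of "of_real \<rho>2"]] d \<rho> by simp
    define q where "q = (\<lambda>w. h w * inverse (E w) * ((1 + w ^ (2 * n)) / w ^ n))"
    have q: "q holomorphic_on {w. \<rho> < cmod w \<and> cmod w < 1}"
      unfolding q_def using E \<rho> by (intro holomorphic_intros h holomorphic_on_subset[OF E(1)]) auto
    have qB: "cmod (q w) \<le> b * \<epsilon>" if w: "\<rho>2 \<le> cmod w" "cmod w \<le> \<rho>4" for w
    proof -
      have "cmod (1 + w ^ (2 * n)) \<le> 1 + cmod w ^ (2 * n)"
        using norm_triangle_ineq[of 1 "w ^ (2 * n)"] by (simp add: norm_power)
      also have "\<dots> \<le> 2" using w d power_le_one[of "cmod w" "2 * n"] by simp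
      finally have "cmod ((1 + w ^ (2 * n)) / w ^ n) \<le> 2 / \<rho>2 ^ n"
        unfolding norm_divide norm_power using w d \<rho> by (intro frac_le power_mono zero_less_power) auto
      moreover have "cmod (h w) \<le> \<epsilon>" using h\<epsilon> w d by simp
      ultimately have "cmod (q w) \<le> \<epsilon> * m * (2 / \<rho>2 ^ n)"
        unfolding q_def norm_mult using m w \<epsilon> by (intro mult_mono) auto
      then show ?thesis by (simp add: b_def mult_ac)
    qed
    obtain P N where PN: "P holomorphic_on ball 0 \<rho>4" "N holomorphic_on {w. \<rho>2 < cmod w}"
      "\<And>w. \<rho>2 < cmod w \<Longrightarrow> cmod w < \<rho>4 \<Longrightarrow> q w = P w + N w"
      "\<And>w. cmod w < \<rho>4 \<Longrightarrow> cmod (P w) \<le> (b * \<epsilon>) * \<rho>4 / (\<rho>4 - cmod w)"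
      "\<And>w. \<rho>2 < cmod w \<Longrightarrow> cmod (N w) \<le> (b * \<epsilon>) * \<rho>2 / (cmod w - \<rho>2)"
    proof (rule annulus_split[of \<rho>2 \<rho>4 \<rho> 1 q "b * \<epsilon>"])
      show "0 < \<rho>2" "\<rho>2 < \<rho>4" "\<rho> < \<rho>2" "\<rho>4 < 1" using d \<rho> by auto
      show "cmod (q u) \<le> b * \<epsilon>" if "cmod u = \<rho>2" for u using qB that d by auto
      show "cmod (q u) \<le> b * \<epsilon>" if "cmod u = \<rho>4" for u using qB that d by auto
    qed (rule q, blast)
    define Ns where "Ns = (\<lambda>w. if w = 0 then 0 else cnj (N (1 / cnj w)))"
    have \<rho>2: "0 < \<rho>2" "1 < 1 / \<rho>2" using d \<rho> by auto
    have \<rho>2': "x < 1 / \<rho>2" if "x \<le> 1" for x using \<rho>2(2) that by linarith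
    have Ns: "Ns holomorphic_on ball 0 (1 / \<rho>2)"
      unfolding Ns_def by (rule reflection_holomorphic[OF PN(2) \<rho>2(1) PN(5)])
    have Nb: "cmod (N w) \<le> (b * \<epsilon>) * \<rho>2 / (t - \<rho>2)" if "t \<le> cmod w" "\<rho>2 < t" for w t
    proof -
      have "cmod (N w) \<le> (b * \<epsilon>) * \<rho>2 / (cmod w - \<rho>2)" using that by (intro PN(5)) auto
      also have "\<dots> \<le> (b * \<epsilon>) * \<rho>2 / (t - \<rho>2)" using that b \<epsilon> \<rho>2 by (intro divide_left_mono) auto
      finally show ?thesis .
    qed
    have Nsb: "cmod (Ns w) \<le> (b * \<epsilon>) * \<rho>2 / (t - \<rho>2)" if "cmod w \<le> 1" "\<rho>2 < t" "t \<le> 1" for w t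
    proof (cases "w = 0")
      case True then show ?thesis using that b \<epsilon> \<rho>2 by (simp add: Ns_def)
    next
      case False
      then have "t \<le> cmod (1 / cnj w)" using that by (simp add: norm_divide field_simps order_trans[of _ 1])
      then show ?thesis using Nb[of t "1 / cnj w"] that False by (simp add: Ns_def)
    qed
    \<comment> \<open>On the circle reflection is conjugation of the value, so \<open>k\<close> is a
      number minus its conjugate and its real part vanishes.\<close>
    define k where "k = (\<lambda>w. N w - Ns w)"
    \<comment> \<open>The two formulas agree on the overlap because
      \<open>E \<kappa> (P + N) = h\<close> there. The first shows smallness inside, the second the
      required form near the circle.\<close>
    define F where "F = (\<lambda>w. if cmod w < \<rho>4 then - (E w * \<kappa> w * (P w + Ns w)) else E w * \<kappa> w * k w - h w)"
    have F2: "F w = E w * \<kappa> w * k w - h w" if "\<rho>2 < cmod w" "cmod w < 1" for w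
    proof (cases "cmod w < \<rho>4")
      case True
      have "w \<noteq> 0" using that \<rho>2 by auto
      then have "E w * \<kappa> w * q w = h w"
        unfolding q_def \<kappa>_def using E(2)[of w] den[of w] that by simp
      then have "E w * \<kappa> w * (P w + N w) = h w" using PN(3)[OF that(1) True] by simp
      then show ?thesis using True by (simp add: F_def k_def algebra_simps)
    qed (simp add: F_def)
    have kb: "cmod (k w) \<le> C * \<epsilon>" if "\<rho>3 \<le> cmod w" "cmod w \<le> 1" for w
    proof -
      have "cmod (k w) \<le> cmod (N w) + cmod (Ns w)" unfolding k_def by (rule norm_triangle_ineq4)
      also have "\<dots> \<le> (b * \<epsilon>) * \<rho>2 / (\<rho>3 - \<rho>2) + (b * \<epsilon>) * \<rho>2 / (\<rho>3 - \<rho>2)"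
        using that d by (intro add_mono Nb Nsb) auto
      also have "\<dots> = C * \<epsilon>" by (simp add: C_def mult_ac)
      finally show ?thesis .
    qed
    have kc: "k holomorphic_on {w. \<rho>2 < cmod w \<and> cmod w < 1 / \<rho>2}"
      unfolding k_def by (intro holomorphic_intros holomorphic_on_subset[OF PN(2)] holomorphic_on_subset[OF Ns]) auto
    have Fhol: "F holomorphic_on ball 0 1"
    proof -
      have "(\<lambda>w. - (E w * \<kappa> w * (P w + Ns w))) holomorphic_on ball 0 \<rho>4"
        by (intro holomorphic_intros holomorphic_on_subset[OF E(1)] holomorphic_on_subset[OF \<kappa>hol] PN(1) holomorphic_on_subset[OF Ns])
          (use d in \<open>auto intro!: \<rho>2'\<close>)
      then have 1: "F holomorphic_on ball 0 \<rho>4" by (rule holomorphic_transform) (simp add: F_def)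
      have "(\<lambda>w. E w * \<kappa> w * k w - h w) holomorphic_on {w. \<rho>2 < cmod w \<and> cmod w < 1}"
        by (intro holomorphic_intros holomorphic_on_subset[OF E(1)] holomorphic_on_subset[OF \<kappa>hol]
            holomorphic_on_subset[OF kc] holomorphic_on_subset[OF h]) (use d in \<open>auto intro!: \<rho>2'\<close>)
      then have 2: "F holomorphic_on {w. \<rho>2 < cmod w \<and> cmod w < 1}" by (rule holomorphic_transform) (simp add: F2)
      have "F holomorphic_on ball 0 \<rho>4 \<union> {w. \<rho>2 < cmod w \<and> cmod w < 1}"
        using 1 2 by (intro holomorphic_on_Un open_annulus open_ball)
      moreover have "ball 0 \<rho>4 \<union> {w. \<rho>2 < cmod w \<and> cmod w < 1} = ball 0 1" using d by auto
      ultimately show ?thesis by simp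
    qed
    have Fsmall: "cmod (F w) \<le> \<eta> * \<epsilon>" if w: "cmod w \<le> \<rho>" for w
    proof -
      have "cmod (P w) \<le> (b * \<epsilon>) * \<rho>4 / (\<rho>4 - cmod w)" using w d by (intro PN(4)) auto
      also have "\<dots> \<le> (b * \<epsilon>) * \<rho>4 / (\<rho>4 - \<rho>)" using w d b \<epsilon> \<rho> by (intro divide_left_mono) auto
      finally have "cmod (P w) \<le> (b * \<epsilon>) * \<rho>4 / (\<rho>4 - \<rho>)" .
      moreover have "cmod (Ns w) \<le> (b * \<epsilon>) * \<rho>2 / (1 - \<rho>2)" using w d by (intro Nsb) auto
      ultimately have PNs: "cmod (P w + Ns w) \<le> (b * \<epsilon>) * (\<rho>4 / (\<rho>4 - \<rho>) + \<rho>2 / (1 - \<rho>2))"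
        using norm_triangle_ineq[of "P w" "Ns w"] by (simp add: algebra_simps)
      have "1 - \<rho> \<le> 1 - cmod w ^ (2 * n)"
      proof -
        have "cmod w ^ (2 * n) \<le> \<rho> ^ (2 * n)" using w by (intro power_mono) auto
        also have "\<dots> \<le> \<rho> ^ 1" using \<rho> n by (intro power_decreasing) auto
        finally show ?thesis by simp
      qed
      also have "1 - cmod w ^ (2 * n) \<le> cmod (1 + w ^ (2 * n))"
        using norm_diff_ineq[of 1 "w ^ (2 * n)"] by (simp add: norm_power)
      finally have "cmod (\<kappa> w) \<le> \<rho> ^ n / (1 - \<rho>)"
        unfolding \<kappa>_def norm_divide norm_power using w \<rho> by (intro frac_le power_mono) auto
      then have "cmod (E w * \<kappa> w * (P w + Ns w)) \<le> K * (\<rho> ^ n / (1 - \<rho>)) * ((b * \<epsilon>) * (\<rho>4 / (\<rho>4 - \<rho>) + \<rho>2 / (1 - \<rho>2)))"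
        unfolding norm_mult using K(1) K(2)[of w] w d \<rho> PNs by (intro mult_mono) auto
      also have "\<dots> = D * (\<rho> / \<rho>2) ^ n * \<epsilon>" by (simp add: D_def b_def power_divide mult_ac)
      also have "\<dots> \<le> \<eta> * \<epsilon>" using n \<epsilon> by (intro mult_right_mono) auto
      finally show ?thesis using w d by (simp add: F_def)
    qed
    \<comment> \<open>On the circle of radius \<open>max s \<rho>4\<close> the formula with
      \<open>k\<close> and \<open>h\<close> applies, and the maximum principle carries the bound
      inwards.\<close>
    have Fb: "cmod (F w) \<le> B s * \<epsilon>" if s: "s < 1" "cmod w \<le> s" for s w
    proof (rule maximum_modulus_frontier[of F "cball 0 (max s \<rho>4)"])
      have s1: "max s \<rho>4 < 1" "0 < max s \<rho>4" using s d \<rho> by auto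
      show "F holomorphic_on interior (cball 0 (max s \<rho>4))" by (rule holomorphic_on_subset[OF Fhol]) (use s1 in auto)
      show "continuous_on (closure (cball 0 (max s \<rho>4))) F"
        by (rule continuous_on_subset[OF holomorphic_on_imp_continuous_on[OF Fhol]]) (use s1 in auto)
      show "w \<in> cball 0 (max s \<rho>4)" using s by auto
      fix z :: complex assume "z \<in> frontier (cball 0 (max s \<rho>4))"
      then have z: "cmod z = max s \<rho>4" using s1 by simp
      have "cmod (F z) \<le> cmod (E z * \<kappa> z) * cmod (k z) + cmod (h z)"
        using F2[of z] z s1 d norm_triangle_ineq4[of "E z * \<kappa> z * k z" "h z"] by (simp add: norm_mult)
      also have "\<dots> \<le> K' (max s \<rho>4) * (C * \<epsilon>) + \<epsilon>"
        using z s1 d by (intro add_mono mult_mono' K' kb h\<epsilon>) auto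
      finally show "cmod (F z) \<le> B s * \<epsilon>" by (simp add: B_def algebra_simps)
    qed simp
    show "\<exists>F k. F holomorphic_on ball 0 1 \<and> (\<forall>w. cmod w \<le> \<rho> \<longrightarrow> cmod (F w) \<le> \<eta> * \<epsilon>) \<and>
         (\<forall>s<1. \<forall>w. cmod w \<le> s \<longrightarrow> cmod (F w) \<le> B s * \<epsilon>) \<and>
         (\<forall>w. \<rho>3 < cmod w \<longrightarrow> cmod w < 1 \<longrightarrow> F w + h w = E w * \<kappa> w * k w) \<and>
         continuous_on {w. \<rho>3 < cmod w \<and> cmod w \<le> 1} k \<and>
         (\<forall>w. \<rho>3 < cmod w \<longrightarrow> cmod w \<le> 1 \<longrightarrow> cmod (k w) \<le> C * \<epsilon>) \<and>
         (\<forall>w. cmod w = 1 \<longrightarrow> Re (k w) = 0)"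
    proof (rule exI[of _ F], rule exI[of _ k], intro conjI allI impI)
      show "F w + h w = E w * \<kappa> w * k w" if "\<rho>3 < cmod w" "cmod w < 1" for w using F2[of w] that d by simp
      show "continuous_on {w. \<rho>3 < cmod w \<and> cmod w \<le> 1} k"
        by (rule continuous_on_subset[OF holomorphic_on_imp_continuous_on[OF kc]]) (use d in \<open>auto intro!: \<rho>2'\<close>)
      fix w :: complex assume w: "cmod w = 1"
      then have "w * cnj w = 1" by (simp add: complex_norm_square[symmetric])
      then have "1 / cnj w = w" by (metis div_by_1 divide_divide_eq_right mult_1 nonzero_mult_div_cancel_right zero_neq_one mult_zero_right)
      moreover have "w \<noteq> 0" using w by auto
      ultimately show "Re (k w) = 0" by (simp add: k_def Ns_def)
    qed (use Fhol Fsmall Fb kb in auto)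
  qed
qed

section \<open>Iterated removal of the interaction\<close>

lemma geometric_series_holomorphic:
  fixes f :: "nat \<Rightarrow> complex \<Rightarrow> complex"
  assumes S: "open S" and f: "\<And>m. f m holomorphic_on S"
    and b: "\<And>x. x \<in> S \<Longrightarrow> \<exists>d>0. \<exists>K. cball x d \<subseteq> S \<and> (\<forall>m. \<forall>y\<in>cball x d. cmod (f m y) \<le> K / 2 ^ m)"
  shows "(\<lambda>x. \<Sum>m. f m x) holomorphic_on S" and "\<And>x. x \<in> S \<Longrightarrow> summable (\<lambda>m. f m x)"
proof -
  have g: "summable (\<lambda>m. K / 2 ^ m)" for K :: real
    using summable_mult[OF summable_geometric[of "1 / 2 :: real"], of K] by (simp add: power_one_over)
  show "(\<lambda>x. \<Sum>m. f m x) holomorphic_on S"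
  proof (rule holomorphic_uniform_sequence[OF S])
    show "(\<lambda>x. \<Sum>m<n. f m x) holomorphic_on S" for n by (intro holomorphic_intros f)
    fix x assume "x \<in> S"
    then obtain d K where d: "0 < d" "cball x d \<subseteq> S" "\<forall>m. \<forall>y\<in>cball x d. cmod (f m y) \<le> K / 2 ^ m" using b by meson
    have "uniform_limit (cball x d) (\<lambda>n y. \<Sum>m<n. f m y) (\<lambda>y. \<Sum>m. f m y) sequentially"
      by (rule Weierstrass_m_test[OF _ g]) (use d(3) in blast)
    then show "\<exists>d>0. cball x d \<subseteq> S \<and> uniform_limit (cball x d) (\<lambda>n y. \<Sum>m<n. f m y) (\<lambda>y. \<Sum>m. f m y) sequentially"
      using d by blast
  qed
  fix x assume "x \<in> S"
  then obtain d K where d: "0 < d" "cball x d \<subseteq> S" "\<forall>m. \<forall>y\<in>cball x d. cmod (f m y) \<le> K / 2 ^ m" using b by meson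
  show "summable (\<lambda>m. f m x)" by (rule summable_comparison_test'[OF g[of K], of 0]) (use d in auto)
qed

text \<open>The transition maps send a collar of one circle into the disk
  \<open>\<bar>w\<bar> \<le> \<rho>\<close> of another, where corrections are smaller by
  \<open>\<eta>\<close>. Each stage cancels the disturbance left by the preceding one up to
  \<open>E \<kappa> k\<close> and causes a disturbance of half the size. Adding the identities
  \<open>G (m + 1) + H (G m) = E \<kappa> k m\<close> over \<open>m\<close> gives the claim with
  \<open>L = \<kappa> K\<close>, where \<open>K\<close> is the sum of the
  \<open>k m\<close>.\<close>

theorem crosstalk_removal:
  fixes \<tau> :: "'i \<Rightarrow> 'i \<Rightarrow> complex \<Rightarrow> complex"
  assumes I: "finite I" and \<rho>: "0 < \<rho>" "\<rho> < 1"
    and E: "\<And>j. j \<in> I \<Longrightarrow> E j holomorphic_on ball 0 1" "\<And>j w. j \<in> I \<Longrightarrow> w \<in> ball 0 1 \<Longrightarrow> E j w \<noteq> 0"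
    and \<tau>: "\<And>i j. i \<in> I \<Longrightarrow> j \<in> I \<Longrightarrow> i \<noteq> j \<Longrightarrow> \<tau> i j holomorphic_on {w. \<rho> < cmod w \<and> cmod w < 1}"
      "\<And>i j w. i \<in> I \<Longrightarrow> j \<in> I \<Longrightarrow> i \<noteq> j \<Longrightarrow> \<rho> < cmod w \<Longrightarrow> cmod w < 1 \<Longrightarrow> cmod (\<tau> i j w) \<le> \<rho>"
  obtains P \<rho>' where "\<rho> \<le> \<rho>'" "\<rho>' < 1" "\<And>j. j \<in> I \<Longrightarrow> finite (P j)"
    "\<And>F0. (\<And>j. j \<in> I \<Longrightarrow> F0 j holomorphic_on ball 0 1) \<Longrightarrow>
       \<exists>F L. (\<forall>j\<in>I. F j holomorphic_on ball 0 1) \<and>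
         (\<forall>j\<in>I. \<forall>w. \<rho>' < cmod w \<longrightarrow> cmod w < 1 \<longrightarrow>
           F j w + (\<Sum>i\<in>I - {j}. F i (\<tau> i j w)) = F0 j w + E j w * L j w) \<and>
         (\<forall>j\<in>I. \<forall>x. cmod x = 1 \<longrightarrow> x \<notin> P j \<longrightarrow> (\<exists>t::real. (L j \<longlongrightarrow> \<i> * of_real t) (at x within ball 0 1)))"
proof -
  define N where "N = real (card I)"
  have N: "0 \<le> N" by (simp add: N_def)
  \<comment> \<open>At stage \<open>m\<close> a circle receives at most \<open>N\<close> terms of
    size \<open>M / 2 ^ m\<close>, so \<open>\<eta> N \<le> 1/2\<close> is what halves the bound;
    \<open>N + 1\<close> covers an empty index set.\<close>
  define \<eta> where "\<eta> = 1 / (2 * (N + 1))"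
  have \<eta>: "0 < \<eta>" "\<eta> * N \<le> 1 / 2" using N by (auto simp: \<eta>_def field_simps)
  define good where "good = (\<lambda>j \<kappa> C \<rho>' B \<epsilon> h F k. F holomorphic_on ball 0 1 \<and>
         (\<forall>w. cmod w \<le> \<rho> \<longrightarrow> cmod (F w) \<le> \<eta> * \<epsilon>) \<and>
         (\<forall>s<1. \<forall>w. cmod w \<le> s \<longrightarrow> cmod (F w) \<le> B s * \<epsilon>) \<and>
         (\<forall>w. \<rho>' < cmod w \<longrightarrow> cmod w < 1 \<longrightarrow> F w + h w = E j w * \<kappa> w * k w) \<and>
         continuous_on {w. \<rho>' < cmod w \<and> cmod w \<le> 1} k \<and>
         (\<forall>w. \<rho>' < cmod w \<longrightarrow> cmod w \<le> 1 \<longrightarrow> cmod (k w) \<le> C * \<epsilon>) \<and>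
         (\<forall>w. cmod w = 1 \<longrightarrow> Re (k w) = 0))"
  define reg where "reg = (\<lambda>(\<kappa>::complex \<Rightarrow> complex) P. finite P \<and> (\<forall>x. cmod x = 1 \<longrightarrow> x \<notin> P \<longrightarrow> isCont \<kappa> x \<and> Im (\<kappa> x) = 0))"
  define corr where "corr = (\<lambda>j \<kappa> C \<rho>' B. \<forall>\<epsilon> h. h holomorphic_on {w. \<rho> < cmod w \<and> cmod w < 1} \<longrightarrow>
       (\<forall>w. \<rho> < cmod w \<longrightarrow> cmod w < 1 \<longrightarrow> cmod (h w) \<le> \<epsilon>) \<longrightarrow> (\<exists>F k. good j \<kappa> C \<rho>' B \<epsilon> h F k))"
  have "\<forall>j\<in>I. \<exists>\<kappa> P C \<rho>' B. \<rho>' < 1 \<and> reg \<kappa> P \<and> corr j \<kappa> C \<rho>' B"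
  proof
    fix j assume j: "j \<in> I"
    show "\<exists>\<kappa> P C \<rho>' B. \<rho>' < 1 \<and> reg \<kappa> P \<and> corr j \<kappa> C \<rho>' B"
    proof (rule reflection_correction[OF E(1)[OF j] E(2)[OF j] \<rho> \<eta>(1)], assumption)
      fix \<kappa> :: "complex \<Rightarrow> complex" and P C \<rho>' B
      assume a: "\<rho>' < 1" "finite P" "\<And>x. cmod x = 1 \<Longrightarrow> x \<notin> P \<Longrightarrow> isCont \<kappa> x \<and> Im (\<kappa> x) = 0"
        and b: "\<And>\<epsilon> h. h holomorphic_on {w. \<rho> < cmod w \<and> cmod w < 1} \<Longrightarrow>
          (\<And>w. \<rho> < cmod w \<Longrightarrow> cmod w < 1 \<Longrightarrow> cmod (h w) \<le> \<epsilon>) \<Longrightarrow>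
          \<exists>F k. F holomorphic_on ball 0 1 \<and> (\<forall>w. cmod w \<le> \<rho> \<longrightarrow> cmod (F w) \<le> \<eta> * \<epsilon>) \<and>
            (\<forall>s<1. \<forall>w. cmod w \<le> s \<longrightarrow> cmod (F w) \<le> B s * \<epsilon>) \<and>
            (\<forall>w. \<rho>' < cmod w \<longrightarrow> cmod w < 1 \<longrightarrow> F w + h w = E j w * \<kappa> w * k w) \<and>
            continuous_on {w. \<rho>' < cmod w \<and> cmod w \<le> 1} k \<and>
            (\<forall>w. \<rho>' < cmod w \<longrightarrow> cmod w \<le> 1 \<longrightarrow> cmod (k w) \<le> C * \<epsilon>) \<and>
            (\<forall>w. cmod w = 1 \<longrightarrow> Re (k w) = 0)"
      have "reg \<kappa> P" unfolding reg_def using a by blast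
      moreover have "corr j \<kappa> C \<rho>' B" unfolding corr_def good_def using b by blast
      ultimately show ?thesis using a(1) by blast
    qed
  qed
  then obtain \<kappa> P C \<rho>' B where T: "\<And>j. j \<in> I \<Longrightarrow> \<rho>' j < 1 \<and> reg (\<kappa> j) (P j) \<and> corr j (\<kappa> j) (C j) (\<rho>' j) (B j)"
    by metis
  define r where "r = Max (insert \<rho> (\<rho>' ` I))"
  have r: "\<rho> \<le> r" "r < 1" "\<And>j. j \<in> I \<Longrightarrow> \<rho>' j \<le> r" using I T \<rho> by (auto simp: r_def)
  show ?thesis
  proof (rule that[of r P])
    show "\<rho> \<le> r" "r < 1" by (rule r)+
    show "finite (P j)" if "j \<in> I" for j using T[OF that] unfolding reg_def by blast
  next
    fix F0 :: "'i \<Rightarrow> complex \<Rightarrow> complex" assume F0: "\<And>j. j \<in> I \<Longrightarrow> F0 j holomorphic_on ball 0 1"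
    have "\<exists>M. \<forall>w. cmod w \<le> \<rho> \<longrightarrow> cmod (F0 j w) \<le> M" if "j \<in> I" for j
    proof -
      have "continuous_on (cball 0 \<rho>) (F0 j)"
        by (rule continuous_on_subset[OF holomorphic_on_imp_continuous_on[OF F0[OF that]]]) (use \<rho> in auto)
      then obtain a where a: "\<And>x. x \<in> cball 0 \<rho> \<Longrightarrow> cmod (F0 j x) \<le> a"
        using compact_cmod_bound[OF compact_cball] by blast
      have "\<forall>w. cmod w \<le> \<rho> \<longrightarrow> cmod (F0 j w) \<le> a" by (auto intro: a)
      then show ?thesis ..
    qed
    then obtain M0 where M0: "\<And>j w. j \<in> I \<Longrightarrow> cmod w \<le> \<rho> \<Longrightarrow> cmod (F0 j w) \<le> M0 j" by metis
    define M where "M = (\<Sum>j\<in>I. \<bar>M0 j\<bar>)"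
    have M: "0 \<le> M" by (simp add: M_def sum_nonneg)
    have M1: "cmod (F0 j w) \<le> M" if "j \<in> I" "cmod w \<le> \<rho>" for j w
    proof -
      have "\<bar>M0 j\<bar> \<le> M" unfolding M_def using I that(1) by (intro member_le_sum) auto
      then show ?thesis using M0[OF that] by linarith
    qed
    define inv where "inv = (\<lambda>(m::nat) F. \<forall>j\<in>I. F j holomorphic_on ball 0 1 \<and> (\<forall>w. cmod w \<le> \<rho> \<longrightarrow> cmod (F j w) \<le> M / 2 ^ m))"
    define H where "H = (\<lambda>F j w. \<Sum>i\<in>I - {j}. F i (\<tau> i j w) :: complex)"
    define step where "step = (\<lambda>(m::nat) F F' k'. \<forall>j\<in>I. good j (\<kappa> j) (C j) (\<rho>' j) (B j) (N * (M / 2 ^ m)) (H F j) (F' j) (k' j))"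
    have ex: "\<exists>F' k'. inv (Suc m) F' \<and> step m F F' k'" if F: "inv m F" for m F
    proof -
      have "\<exists>F' k'. good j (\<kappa> j) (C j) (\<rho>' j) (B j) (N * (M / 2 ^ m)) (H F j) F' k'" if j: "j \<in> I" for j
      proof -
        have "H F j holomorphic_on {w. \<rho> < cmod w \<and> cmod w < 1}" unfolding H_def
        proof (intro holomorphic_intros)
          fix i assume i: "i \<in> I - {j}"
          have "F i \<circ> \<tau> i j holomorphic_on {w. \<rho> < cmod w \<and> cmod w < 1}"
          proof (rule holomorphic_on_compose_gen)
            show "\<tau> i j holomorphic_on {w. \<rho> < cmod w \<and> cmod w < 1}" using \<tau>(1) i j by blast
            show "F i holomorphic_on ball 0 1" using F i unfolding inv_def by blast
            show "\<tau> i j ` {w. \<rho> < cmod w \<and> cmod w < 1} \<subseteq> ball 0 1"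
            proof
              fix y assume "y \<in> \<tau> i j ` {w. \<rho> < cmod w \<and> cmod w < 1}"
              then have "cmod y \<le> \<rho>" using \<tau>(2)[of i j] i j by auto
              then show "y \<in> ball 0 1" using \<rho> by simp
            qed
          qed
          then show "(\<lambda>w. F i (\<tau> i j w)) holomorphic_on {w. \<rho> < cmod w \<and> cmod w < 1}" by (simp add: o_def)
        qed
        moreover have "cmod (H F j w) \<le> N * (M / 2 ^ m)" if w: "\<rho> < cmod w" "cmod w < 1" for w
        proof -
          have "cmod (H F j w) \<le> (\<Sum>i\<in>I - {j}. M / 2 ^ m)" unfolding H_def
          proof (rule sum_norm_le)
            fix i assume i: "i \<in> I - {j}"
            then have "cmod (\<tau> i j w) \<le> \<rho>" using \<tau>(2) j w by auto
            then show "cmod (F i (\<tau> i j w)) \<le> M / 2 ^ m" using F i unfolding inv_def by blast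
          qed
          also have "\<dots> \<le> (\<Sum>i\<in>I. M / 2 ^ m)" using I M by (intro sum_mono2) auto
          finally show ?thesis by (simp add: N_def)
        qed
        ultimately show ?thesis using T[OF j] unfolding corr_def by blast
      qed
      then obtain F' k' where F': "\<And>j. j \<in> I \<Longrightarrow> good j (\<kappa> j) (C j) (\<rho>' j) (B j) (N * (M / 2 ^ m)) (H F j) (F' j) (k' j)"
        by metis
      have "\<eta> * (N * (M / 2 ^ m)) \<le> 1 / 2 * (M / 2 ^ m)"
        using mult_right_mono[OF \<eta>(2), of "M / 2 ^ m"] M by (simp add: mult.assoc)
      then have le: "\<eta> * (N * (M / 2 ^ m)) \<le> M / 2 ^ Suc m" by simp
      have "inv (Suc m) F'" unfolding inv_def
      proof (intro ballI conjI allI impI)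
        fix j assume j: "j \<in> I"
        show "F' j holomorphic_on ball 0 1" using F'[OF j] unfolding good_def by blast
        fix w assume "cmod w \<le> \<rho>"
        then have "cmod (F' j w) \<le> \<eta> * (N * (M / 2 ^ m))" using F'[OF j] unfolding good_def by blast
        then show "cmod (F' j w) \<le> M / 2 ^ Suc m" using le by linarith
      qed
      then show ?thesis using F' unfolding step_def by blast
    qed
    \<comment> \<open>Each stage is a pair of functions and kernels. The clause for
      \<open>m = 0\<close> pins the start to \<open>F0\<close>; its kernel component is never
      referred to and may be arbitrary.\<close>
    have "\<exists>f. \<forall>m. (inv m (fst (f m)) \<and> (m = 0 \<longrightarrow> fst (f m) = F0)) \<and> step m (fst (f m)) (fst (f (Suc m))) (snd (f (Suc m)))"
    proof (rule dependent_nat_choice)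
      have "inv 0 F0" unfolding inv_def using F0 M1 by simp
      then show "\<exists>x. inv 0 (fst x) \<and> (0 = (0::nat) \<longrightarrow> fst x = F0)" by (intro exI[of _ "(F0, undefined)"]) simp
      fix x m assume "inv m (fst x) \<and> (m = 0 \<longrightarrow> fst x = F0)"
      then obtain F' k' where "inv (Suc m) F'" "step m (fst x) F' k'" using ex by blast
      then show "\<exists>y. (inv (Suc m) (fst y) \<and> (Suc m = 0 \<longrightarrow> fst y = F0)) \<and> step m (fst x) (fst y) (snd y)"
        by (intro exI[of _ "(F', k')"]) simp
    qed
    then obtain f where f: "\<And>m. inv m (fst (f m))" "fst (f 0) = F0" "\<And>m. step m (fst (f m)) (fst (f (Suc m))) (snd (f (Suc m)))"
      by blast
    define G where "G = (\<lambda>m. fst (f m))"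
    define k where "k = (\<lambda>m. snd (f (Suc m)))"
    have G0: "G 0 = F0" using f(2) by (simp add: G_def)
    have st: "good j (\<kappa> j) (C j) (\<rho>' j) (B j) (N * (M / 2 ^ m)) (H (G m) j) (G (Suc m) j) (k m j)" if "j \<in> I" for m j
      using f(3) that unfolding step_def G_def k_def by blast
    have Ghol: "G m j holomorphic_on ball 0 1" if "j \<in> I" for m j using f(1) that unfolding inv_def G_def by blast
    have Gb: "cmod (G (Suc m) j w) \<le> B j s * N * M / 2 ^ m" if "j \<in> I" "s < 1" "cmod w \<le> s" for m j s w
      using st[OF that(1), of m] that(2,3) unfolding good_def by (simp add: mult.assoc)
    have geo: "(\<lambda>w. \<Sum>m. G (Suc m) j w) holomorphic_on ball 0 1" "\<And>w. w \<in> ball 0 1 \<Longrightarrow> summable (\<lambda>m. G (Suc m) j w)" if j: "j \<in> I" for j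
    proof -
      have b: "\<exists>d>0. \<exists>K. cball x d \<subseteq> ball 0 1 \<and> (\<forall>m. \<forall>y\<in>cball x d. cmod (G (Suc m) j y) \<le> K / 2 ^ m)" if x: "x \<in> ball 0 1" for x
      proof (intro exI conjI allI ballI)
        define d where "d = (1 - cmod x) / 2"
        show "0 < d" using x by (simp add: d_def)
        have le: "cmod y \<le> (1 + cmod x) / 2" if "y \<in> cball x d" for y
          using that norm_triangle_ineq2[of y x] by (simp add: d_def dist_norm norm_minus_commute field_simps)
        show "cball x d \<subseteq> ball 0 1"
        proof
          fix y assume "y \<in> cball x d" from le[OF this] show "y \<in> ball 0 1" using x by simp
        qed
        show "cmod (G (Suc m) j y) \<le> B j ((1 + cmod x) / 2) * N * M / 2 ^ m" if "y \<in> cball x d" for m y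
          using le[OF that] x by (intro Gb[OF j]) auto
      qed
      show "(\<lambda>w. \<Sum>m. G (Suc m) j w) holomorphic_on ball 0 1" "\<And>w. w \<in> ball 0 1 \<Longrightarrow> summable (\<lambda>m. G (Suc m) j w)"
        by (rule geometric_series_holomorphic[OF open_ball Ghol[OF j] b]; assumption)+
    qed
    define F where "F = (\<lambda>j w. F0 j w + (\<Sum>m. G (Suc m) j w))"
    have Fsum: "(\<lambda>m. G m j w) sums F j w" if "j \<in> I" "w \<in> ball 0 1" for j w
      using sums_Suc[OF summable_sums[OF geo(2)[OF that]]] G0 by (simp add: F_def add.commute)
    define K where "K = (\<lambda>j w. \<Sum>m. k m j w)"
    define A where "A = {w::complex. r < cmod w \<and> cmod w \<le> 1}"
    have gs: "summable (\<lambda>m. D / 2 ^ m)" for D :: real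
      using summable_mult[OF summable_geometric[of "1 / 2 :: real"], of D] by (simp add: power_one_over)
    have kb: "cmod (k m j w) \<le> (C j * N * M) / 2 ^ m" if "j \<in> I" "w \<in> A" for m j w
    proof -
      have "\<rho>' j < cmod w" "cmod w \<le> 1" using that r(3)[OF that(1)] by (auto simp: A_def)
      then show ?thesis using st[OF that(1), of m] unfolding good_def by (simp add: mult.assoc)
    qed
    have ksum: "(\<lambda>m. k m j w) sums K j w" if "j \<in> I" "w \<in> A" for j w
      unfolding K_def by (rule summable_sums, rule summable_comparison_test'[OF gs[of "C j * N * M"], of 0]) (use kb[OF that] in auto)
    have Kc: "continuous_on A (K j)" if j: "j \<in> I" for j
    proof -
      have "uniform_limit A (\<lambda>n w. \<Sum>m<n. k m j w) (\<lambda>w. \<Sum>m. k m j w) sequentially"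
        by (rule Weierstrass_m_test[OF kb[OF j] gs])
      moreover have "continuous_on A (\<lambda>w. \<Sum>m<n. k m j w)" for n
      proof (intro continuous_intros)
        fix m
        have "continuous_on {w. \<rho>' j < cmod w \<and> cmod w \<le> 1} (k m j)" using st[OF j, of m] unfolding good_def by blast
        then show "continuous_on A (k m j)" by (rule continuous_on_subset) (use r(3)[OF j] in \<open>auto simp: A_def\<close>)
      qed
      ultimately show ?thesis unfolding K_def by (intro uniform_limit_theorem) auto
    qed
    show "\<exists>F L. (\<forall>j\<in>I. F j holomorphic_on ball 0 1) \<and>
           (\<forall>j\<in>I. \<forall>w. r < cmod w \<longrightarrow> cmod w < 1 \<longrightarrow>
             F j w + (\<Sum>i\<in>I - {j}. F i (\<tau> i j w)) = F0 j w + E j w * L j w) \<and>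
           (\<forall>j\<in>I. \<forall>x. cmod x = 1 \<longrightarrow> x \<notin> P j \<longrightarrow> (\<exists>t::real. (L j \<longlongrightarrow> \<i> * of_real t) (at x within ball 0 1)))"
    proof (rule exI[of _ F], rule exI[of _ "\<lambda>j w. \<kappa> j w * K j w"], intro conjI ballI allI impI)
      show "F j holomorphic_on ball 0 1" if "j \<in> I" for j unfolding F_def by (intro holomorphic_intros F0 geo that)
      show "F j w + (\<Sum>i\<in>I - {j}. F i (\<tau> i j w)) = F0 j w + E j w * (\<kappa> j w * K j w)"
        if j: "j \<in> I" and w: "r < cmod w" "cmod w < 1" for j w
      proof -
        have "(\<lambda>m. G m i (\<tau> i j w)) sums F i (\<tau> i j w)" if i: "i \<in> I - {j}" for i
        proof (rule Fsum)
          have "cmod (\<tau> i j w) \<le> \<rho>" using \<tau>(2)[of i j w] i j w r(1) by auto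
          then show "\<tau> i j w \<in> ball 0 1" using \<rho> by simp
        qed (use i in blast)
        then have "(\<lambda>m. H (G m) j w) sums (\<Sum>i\<in>I - {j}. F i (\<tau> i j w))" unfolding H_def by (rule sums_sum)
        moreover have "(\<lambda>m. G (Suc m) j w) sums (F j w - F0 j w)"
          using Fsum[OF j, of w] w(2) G0 sums_Suc_iff[of "\<lambda>m. G m j w" "F j w - F0 j w"] by simp
        ultimately have "(\<lambda>m. G (Suc m) j w + H (G m) j w) sums (F j w - F0 j w + (\<Sum>i\<in>I - {j}. F i (\<tau> i j w)))"
          by (intro sums_add)
        moreover have "G (Suc m) j w + H (G m) j w = E j w * \<kappa> j w * k m j w" for m
        proof -
          have "\<rho>' j < cmod w" using r(3)[OF j] w by linarith
          then show ?thesis using st[OF j, of m] w(2) unfolding good_def by blast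
        qed
        moreover have "(\<lambda>m. E j w * \<kappa> j w * k m j w) sums (E j w * \<kappa> j w * K j w)"
          using w by (intro sums_mult ksum[OF j]) (auto simp: A_def)
        ultimately have "F j w - F0 j w + (\<Sum>i\<in>I - {j}. F i (\<tau> i j w)) = E j w * \<kappa> j w * K j w"
          using sums_unique2 by fastforce
        then show ?thesis by (simp add: algebra_simps)
      qed
      show "\<exists>t::real. ((\<lambda>w. \<kappa> j w * K j w) \<longlongrightarrow> \<i> * of_real t) (at x within ball 0 1)"
        if j: "j \<in> I" and x: "cmod x = 1" "x \<notin> P j" for j x
      proof -
        have xA: "x \<in> A" using x r by (simp add: A_def)
        have c: "isCont (\<kappa> j) x" "Im (\<kappa> j x) = 0" using T[OF j] x unfolding reg_def by blast+
        have "(K j \<longlongrightarrow> K j x) (at x within A)" using Kc[OF j] xA by (simp add: continuous_on_def)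
        then have "(K j \<longlongrightarrow> K j x) (at x within ball 0 1 \<inter> {w. r < cmod w})" by (rule tendsto_within_subset) (auto simp: A_def)
        \<comment> \<open>Near \<open>x\<close> the collar and the disk coincide, so a limit along
          the collar is a limit within the disk.\<close>
        moreover have "at x within ball 0 1 \<inter> {w. r < cmod w} = at x within ball 0 1"
        proof (rule at_within_nhd)
          show "open {w::complex. r < cmod w}" by (intro open_Collect_less continuous_intros)
        qed (use xA in \<open>auto simp: A_def\<close>)
        ultimately have "(K j \<longlongrightarrow> K j x) (at x within ball 0 1)" by simp
        moreover have "(\<kappa> j \<longlongrightarrow> \<kappa> j x) (at x within ball 0 1)"
          using c(1) by (meson at_le isCont_def subset_UNIV tendsto_mono)
        ultimately have "((\<lambda>w. \<kappa> j w * K j w) \<longlongrightarrow> \<kappa> j x * K j x) (at x within ball 0 1)" by (intro tendsto_mult)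
        moreover have "Re (K j x) = 0"
        proof -
          have "Re (k m j x) = 0" for m using st[OF j, of m] x(1) unfolding good_def by blast
          then have "(\<lambda>m. 0) sums Re (K j x)" using sums_Re[OF ksum[OF j xA]] by simp
          then show ?thesis using sums_unique2 sums_zero by blast
        qed
        then have "\<kappa> j x * K j x = \<i> * of_real (Re (\<kappa> j x) * Im (K j x))" using c(2) by (simp add: complex_eq_iff)
        ultimately show ?thesis by metis
      qed
    qed
  qed
qed

section \<open>The boundary value problem on one circle\<close>

definition polar :: "complex set \<Rightarrow> bool" where
  "polar E \<longleftrightarrow> (\<forall>V. thin V E)"

lemma polarD: "polar E \<Longrightarrow> thin V E"
  by (simp add: polar_def)

lemma polarI: assumes "\<And>V. 0 \<le> V \<Longrightarrow> thin V E" shows "polar E"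
  unfolding polar_def
proof
  fix V show "thin V E" using assms[of "max 0 V"] by (auto intro: thin_mono)
qed

lemma polar_subset: "polar E \<Longrightarrow> E' \<subseteq> E \<Longrightarrow> polar E'"
  unfolding polar_def by (blast intro: thin_mono)

lemma polar_countable: "countable N \<Longrightarrow> polar N"
  by (simp add: polar_def thin_countable)

lemma polar_Un: "polar A \<Longrightarrow> polar B \<Longrightarrow> polar (A \<union> B)"
  by (rule polarI) (auto intro: thin_Un polarD)

lemma polar_finite_UN: "finite I \<Longrightarrow> (\<And>i. i \<in> I \<Longrightarrow> polar (E i)) \<Longrightarrow> polar (\<Union>i\<in>I. E i)"
  by (induction I rule: finite_induct) (auto intro: polar_Un polar_countable)

text \<open>The flag \<open>b\<close> distinguishes the outer boundary circle from the circles around the holes. On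
  the latter the coordinate \<open>r / (z - c)\<close> maps the domain into the unit disk, hence the conjugate.\<close>

definition circ_map :: "bool \<Rightarrow> complex \<Rightarrow> real \<Rightarrow> complex \<Rightarrow> complex" where
  "circ_map b c r x = c + of_real r * (if b then x else cnj x)"

definition circ_inv :: "bool \<Rightarrow> complex \<Rightarrow> real \<Rightarrow> complex \<Rightarrow> complex" where
  "circ_inv b c r z = (if b then (z - c) / of_real r else cnj ((z - c) / of_real r))"

lemma circ_map_inv [simp]:
  assumes "0 < r" shows "circ_map b c r (circ_inv b c r z) = z" "circ_inv b c r (circ_map b c r x) = x"
  using assms by (auto simp: circ_map_def circ_inv_def)

lemma circ_map_dist:
  assumes "0 < r" shows "cmod (circ_map b c r x - circ_map b c r y) = r * cmod (x - y)"
    "cmod (circ_inv b c r x - circ_inv b c r y) = cmod (x - y) / r"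
proof -
  have "circ_map b c r x - circ_map b c r y = of_real r * (if b then x - y else cnj (x - y))"
    by (simp add: circ_map_def algebra_simps)
  then show "cmod (circ_map b c r x - circ_map b c r y) = r * cmod (x - y)"
    using assms by (simp add: norm_mult del: complex_cnj_diff)
  have "circ_inv b c r x - circ_inv b c r y = (if b then (x - y) / of_real r else cnj ((x - y) / of_real r))"
    by (simp add: circ_inv_def diff_divide_distrib)
  then show "cmod (circ_inv b c r x - circ_inv b c r y) = cmod (x - y) / r"
    using assms by (simp add: norm_divide del: complex_cnj_diff complex_cnj_divide)
qed

lemma continuous_on_circ_map: "continuous_on A (circ_map b c r)"
  by (cases b) (auto simp: circ_map_def[abs_def] intro!: continuous_intros)

lemma continuous_on_circ_inv: "continuous_on A (circ_inv b c r)"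
  by (cases b) (auto simp: circ_inv_def[abs_def] divide_inverse intro!: continuous_intros)

lemma circ_map_in_sphere: "0 < r \<Longrightarrow> circ_map b c r x \<in> sphere c r \<longleftrightarrow> cmod x = 1"
  by (auto simp: circ_map_def dist_norm norm_mult)

lemma polar_circ_map: assumes "polar E" "0 < r" shows "polar (circ_map b c r ` E)"
  unfolding polar_def
proof
  fix V
  have "thin (V + ln (max 1 r) - ln (max 1 r)) (circ_map b c r ` E)"
  proof (rule thin_image[where S = "circ_inv b c r"])
    show "cmod (circ_map b c r x - circ_map b c r y) \<le> max 1 r * cmod (x - y)" for x y
      unfolding circ_map_dist(1)[OF assms(2)] by (intro mult_right_mono) auto
  qed (use assms polarD continuous_on_circ_inv in auto)
  then show "thin V (circ_map b c r ` E)" by simp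
qed

definition quasicont :: "complex set \<Rightarrow> (complex \<Rightarrow> 'a::topological_space) \<Rightarrow> bool" where
  "quasicont S f \<longleftrightarrow> (\<forall>V\<ge>0. \<exists>G. open G \<and> thin V G \<and> continuous_on (S - G) f)"

text \<open>The exceptional set is pulled back by a similarity. The summand \<open>ln L\<close> in
  the requested thinness pays for the dilation.\<close>

lemma quasicont_circ_map:
  assumes f: "quasicont S f" and r: "0 < r" and S: "sphere c r \<subseteq> S"
  shows "quasicont (sphere 0 1) (\<lambda>x. f (circ_map b c r x))"
  unfolding quasicont_def
proof (intro allI impI)
  fix V :: real assume V: "0 \<le> V"
  define L where "L = max 1 (1 / r)"
  have L: "1 \<le> L" "1 / r \<le> L" by (auto simp: L_def)
  then have "0 \<le> V + ln L" using V by (simp add: ln_ge_zero)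
  then obtain G where G: "open G" "thin (V + ln L) G" "continuous_on (S - G) f"
    using f unfolding quasicont_def by meson
  have "thin (V + ln L - ln L) (circ_inv b c r ` G)"
  proof (rule thin_image[where S = "circ_map b c r"])
    show "cmod (circ_inv b c r x - circ_inv b c r y) \<le> L * cmod (x - y)" for x y
      unfolding circ_map_dist(2)[OF r] using mult_right_mono[OF L(2), of "cmod (x - y)"] by simp
  qed (use G r L continuous_on_circ_map in auto)
  moreover have eq: "circ_inv b c r ` G = circ_map b c r -` G"
    using r by (auto simp: image_iff) (metis circ_map_inv(2))
  moreover have "open (circ_map b c r -` G)" using G(1) continuous_on_circ_map[of UNIV] by (intro open_vimage) auto
  moreover have "continuous_on (sphere 0 1 - circ_map b c r -` G) (\<lambda>x. f (circ_map b c r x))"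
    by (rule continuous_on_compose2[OF G(3) continuous_on_circ_map])
      (use S circ_map_in_sphere[OF r] in auto)
  ultimately show "\<exists>G. open G \<and> thin V G \<and> continuous_on (sphere 0 1 - G) (\<lambda>x. f (circ_map b c r x))" by auto
qed

text \<open>The countable set on which \<open>cis \<alpha>\<close> may differ from
  \<open>lam\<close> is thin and is absorbed into \<open>W\<close>, so the argument can be forgotten
  in favour of \<open>A\<close> and its boundary function.\<close>

lemma CBV_multiplier:
  assumes "CBV {(0, 1)} lam" and "\<And>x. cmod x = 1 \<Longrightarrow> cmod (lam x) = 1"
  obtains A \<beta> where "A holomorphic_on ball 0 1"
    "\<And>V. 0 \<le> V \<Longrightarrow> \<exists>W. open W \<and> thin V W \<and> continuous_on (sphere 0 1 - W) \<beta> \<and>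
       (\<forall>x\<in>sphere 0 1 - W. lam x = cis (Re (\<beta> x)) \<and> (\<forall>M. (A \<longlongrightarrow> \<beta> x) (at x within stolz M x) \<and>
         ((\<lambda>z. (Re (A z) - Re (\<beta> x)) * ln (1 / (1 - cmod z))) \<longlongrightarrow> 0) (at x within stolz M x)))"
proof (rule CBV_argument[OF assms], assumption)
  fix \<alpha> :: "complex \<Rightarrow> real" and \<mu> :: "nat \<Rightarrow> complex measure" and Q :: "nat \<Rightarrow> complex set" and N
  assume \<alpha>: "\<alpha> \<in> borel_measurable borel" "\<And>\<zeta>. \<bar>\<alpha> \<zeta>\<bar> \<le> 2 * pi"
    "\<And>i. sets (\<mu> i) = sets borel" "\<And>i. finite_measure (\<mu> i)"
    "\<And>i. open (Q i)" "countable (sphere 0 1 - (\<Union>i. Q i))"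
    "\<And>i x \<zeta>. x \<in> Q i \<Longrightarrow> \<zeta> \<in> Q i \<Longrightarrow> cmod x = 1 \<Longrightarrow> cmod \<zeta> = 1 \<Longrightarrow>
       \<bar>\<alpha> \<zeta> - \<alpha> x\<bar> \<le> measure (\<mu> i) (cball x (cmod (\<zeta> - x)))"
    and N: "countable N" "\<And>x. x \<in> sphere 0 1 - N \<Longrightarrow> lam x = cis (\<alpha> x)"
  show ?thesis
  proof (rule that[of "schwarz \<alpha>" "schwarz_bdry \<alpha>"])
    show "schwarz \<alpha> holomorphic_on ball 0 1" by (rule schwarz_holomorphic[OF \<alpha>(1) \<alpha>(2)])
    fix V :: real assume V: "0 \<le> V"
    obtain W where W: "open W" "thin (64 * V) W" "continuous_on (sphere 0 1 - W) (schwarz_bdry \<alpha>)"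
      "\<And>x M. x \<in> sphere 0 1 - W \<Longrightarrow> (schwarz \<alpha> \<longlongrightarrow> schwarz_bdry \<alpha> x) (at x within stolz M x)"
      "\<And>x. x \<in> sphere 0 1 - W \<Longrightarrow> Re (schwarz_bdry \<alpha> x) = \<alpha> x"
      "\<And>x M. x \<in> sphere 0 1 - W \<Longrightarrow>
        ((\<lambda>z. (Re (schwarz \<alpha> z) - \<alpha> x) * ln (1 / (1 - cmod z))) \<longlongrightarrow> 0) (at x within stolz M x)"
      by (rule BV_argument_boundary[OF \<alpha>(1) \<alpha>(2) \<alpha>(3-6), where V = "64 * V"], rule \<alpha>(7), assumption+, (use V in simp), blast)
    obtain U where U: "open U" "N \<subseteq> U" "thin (64 * V) U" using thin_open_superset[OF thin_countable[OF N(1)]] .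
    show "\<exists>W. open W \<and> thin V W \<and> continuous_on (sphere 0 1 - W) (schwarz_bdry \<alpha>) \<and>
       (\<forall>x\<in>sphere 0 1 - W. lam x = cis (Re (schwarz_bdry \<alpha> x)) \<and> (\<forall>M. (schwarz \<alpha> \<longlongrightarrow> schwarz_bdry \<alpha> x) (at x within stolz M x) \<and>
         ((\<lambda>z. (Re (schwarz \<alpha> z) - Re (schwarz_bdry \<alpha> x)) * ln (1 / (1 - cmod z))) \<longlongrightarrow> 0) (at x within stolz M x)))"
    proof (intro exI[of _ "W \<union> U"] conjI ballI allI)
      show "open (W \<union> U)" "thin V (W \<union> U)" using W U V by (auto intro: thin_Un)
      show "continuous_on (sphere 0 1 - (W \<union> U)) (schwarz_bdry \<alpha>)" by (rule continuous_on_subset[OF W(3)]) auto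
      fix x assume x: "x \<in> sphere 0 1 - (W \<union> U)"
      then have x': "x \<in> sphere 0 1 - W" "x \<in> sphere 0 1 - N" using U(2) by auto
      show "lam x = cis (Re (schwarz_bdry \<alpha> x))" using N(2)[OF x'(2)] W(5)[OF x'(1)] by simp
      fix M
      show "(schwarz \<alpha> \<longlongrightarrow> schwarz_bdry \<alpha> x) (at x within stolz M x)" by (rule W(4)[OF x'(1)])
      show "((\<lambda>z. (Re (schwarz \<alpha> z) - Re (schwarz_bdry \<alpha> x)) * ln (1 / (1 - cmod z))) \<longlongrightarrow> 0) (at x within stolz M x)"
        using W(6)[OF x'(1)] W(5)[OF x'(1)] by simp
    qed
  qed
qed

text \<open>Multiplying by \<open>exp (\<i> A)\<close> turns the condition on \<open>Re (cnj \<lambda> f)\<close> into one on \<open>Re G\<close>; the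
  logarithmic growth of \<open>Im G\<close> is compensated by \<open>Re A - arg \<lambda> = o(1 / ln (1 / (1 - \<bar>z\<bar>)))\<close>.\<close>

theorem circle_solution:
  fixes \<phi> :: "complex \<Rightarrow> real"
  assumes lam: "CBV {(0, 1)} lam" "\<And>x. cmod x = 1 \<Longrightarrow> cmod (lam x) = 1" and \<phi>: "quasicont (sphere 0 1) \<phi>"
  obtains E G Z where "E holomorphic_on ball 0 1" "\<And>w. E w \<noteq> 0" "G holomorphic_on ball 0 1" "polar Z"
    "\<And>x M \<kappa> t. cmod x = 1 \<Longrightarrow> x \<notin> Z \<Longrightarrow> (\<kappa> \<longlongrightarrow> \<i> * of_real t) (at x within ball 0 1) \<Longrightarrow>
       ((\<lambda>z. Re (cnj (lam x) * (E z * (G z + \<kappa> z)))) \<longlongrightarrow> \<phi> x) (at x within stolz M x)"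
proof (rule CBV_multiplier[OF lam], assumption)
  fix A \<beta> assume A: "A holomorphic_on ball 0 1"
    and \<beta>: "\<And>V. 0 \<le> V \<Longrightarrow> \<exists>W. open W \<and> thin V W \<and> continuous_on (sphere 0 1 - W) \<beta> \<and>
       (\<forall>x\<in>sphere 0 1 - W. lam x = cis (Re (\<beta> x)) \<and> (\<forall>M. (A \<longlongrightarrow> \<beta> x) (at x within stolz M x) \<and>
         ((\<lambda>z. (Re (A z) - Re (\<beta> x)) * ln (1 / (1 - cmod z))) \<longlongrightarrow> 0) (at x within stolz M x)))"
  \<comment> \<open>The modulus of \<open>exp (\<i> A)\<close> tends to
    \<open>exp (- Im (\<beta> x))\<close>; the inverse factor compensates for it.\<close>
  define \<psi> where "\<psi> = (\<lambda>x. \<phi> x * exp (Im (\<beta> x)))"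
  define R where "R = (\<lambda>x. lam x = cis (Re (\<beta> x)) \<and> (\<forall>M. (A \<longlongrightarrow> \<beta> x) (at x within stolz M x) \<and>
         ((\<lambda>z. (Re (A z) - Re (\<beta> x)) * ln (1 / (1 - cmod z))) \<longlongrightarrow> 0) (at x within stolz M x)))"
  \<comment> \<open>With these weights the union of the \<open>W k\<close> for
    \<open>k \<ge> n\<close> is thin of order \<open>n\<close>, so the points lying in infinitely
    many \<open>W k\<close> form a polar set.\<close>
  have "\<exists>W. open W \<and> thin (4 ^ (n + 2) * real n) W \<and> continuous_on (sphere 0 1 - W) \<psi> \<and> (\<forall>x\<in>sphere 0 1 - W. R x)" for n
  proof -
    define V where "V = 4 ^ (n + 2) * real n"
    have V: "0 \<le> V" "0 \<le> 64 * V" by (simp_all add: V_def)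
    obtain W where W: "open W" "thin (64 * V) W" "continuous_on (sphere 0 1 - W) \<beta>" "\<forall>x\<in>sphere 0 1 - W. R x"
      using \<beta>[OF V(2)] unfolding R_def by blast
    obtain U where U: "open U" "thin (64 * V) U" "continuous_on (sphere 0 1 - U) \<phi>"
      using \<phi> V(2) unfolding quasicont_def by blast
    have "continuous_on (sphere 0 1 - (W \<union> U)) \<psi>" unfolding \<psi>_def
      by (intro continuous_intros continuous_on_subset[OF W(3)] continuous_on_subset[OF U(3)]) auto
    moreover have "open (W \<union> U)" "thin V (W \<union> U)" using W U V by (auto intro: thin_Un)
    moreover have "\<forall>x\<in>sphere 0 1 - (W \<union> U). R x" using W(4) by blast
    ultimately show ?thesis unfolding V_def by blast
  qed
  then obtain W where W: "\<And>n. open (W n)" "\<And>n. thin (4 ^ (n + 2) * real n) (W n)"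
    "\<And>n. continuous_on (sphere 0 1 - W n) \<psi>" "\<And>n x. x \<in> sphere 0 1 - W n \<Longrightarrow> R x" by metis
  \<comment> \<open>Removing all later exceptional sets at once makes the closed sets increase with
    \<open>n\<close>, as \<open>gehring\<close> demands.\<close>
  define F where "F = (\<lambda>n. sphere 0 1 - (\<Union>k. W (n + k)))"
  have FW: "F n \<subseteq> sphere 0 1 - W n" for n unfolding F_def by (metis Diff_mono UN_upper UNIV_I add_0_right order_refl)
  have "closed (F n)" for n unfolding F_def using W(1) by (intro closed_Diff closed_sphere open_UN) auto
  moreover have "F n \<subseteq> sphere 0 1" for n unfolding F_def by blast
  moreover have "incseq F"
  proof (rule incseq_SucI)
    fix n
    have "W (Suc n + k) \<subseteq> (\<Union>k. W (n + k))" for k using UN_upper[of "Suc k" UNIV "\<lambda>k. W (n + k)"] by simp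
    then have "(\<Union>k. W (Suc n + k)) \<subseteq> (\<Union>k. W (n + k))" by (intro UN_least)
    then show "F n \<subseteq> F (Suc n)" unfolding F_def by blast
  qed
  moreover have "continuous_on (F n) \<psi>" for n by (rule continuous_on_subset[OF W(3) FW])
  ultimately obtain G N where G: "G holomorphic_on ball 0 1" "countable N"
    "\<And>n x M. x \<in> F n \<Longrightarrow> x \<notin> N \<Longrightarrow> ((\<lambda>z. Re (G z)) \<longlongrightarrow> \<psi> x) (at x within stolz M x)"
    "\<And>n x M. x \<in> F n \<Longrightarrow> x \<notin> N \<Longrightarrow>
       \<exists>C. \<forall>\<^sub>F z in at x within stolz M x. cmod (G z) \<le> C * (1 + ln (1 / (1 - cmod z)))"
    by (rule gehring) blast
  define Z where "Z = (\<Inter>n. \<Union>k. W (n + k)) \<union> N"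
  have "polar (\<Inter>n. \<Union>k. W (n + k))"
  proof (rule polarI)
    fix V :: real assume V: "0 \<le> V"
    obtain n where n: "V \<le> real n" using real_arch_simple by blast
    have "thin V (\<Union>k. W (n + k))"
    proof (rule thin_UN[OF _ V])
      fix k
      have "4 ^ (k + 2) * V \<le> 4 ^ (n + k + 2) * real (n + k)"
        using n V by (intro mult_mono power_increasing) auto
      then show "thin (4 ^ (k + 2) * V) (W (n + k))" using W(2)[of "n + k"] by (auto intro: thin_mono)
    qed
    then show "thin V (\<Inter>n. \<Union>k. W (n + k))" by (rule thin_mono) auto
  qed
  then have Z: "polar Z" unfolding Z_def by (rule polar_Un[OF _ polar_countable[OF G(2)]])
  show ?thesis
  proof (rule that[of "\<lambda>z. exp (\<i> * A z)" G Z])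
    show "(\<lambda>z. exp (\<i> * A z)) holomorphic_on ball 0 1" by (intro holomorphic_intros A)
    show "exp (\<i> * A w) \<noteq> 0" for w by simp
    show "G holomorphic_on ball 0 1" "polar Z" by (rule G(1), rule Z)
    fix x M \<kappa> and t :: real assume x: "cmod x = 1" "x \<notin> Z" and \<kappa>': "(\<kappa> \<longlongrightarrow> \<i> * of_real t) (at x within ball 0 1)"
    obtain n where xF: "x \<in> F n" using x by (auto simp: Z_def F_def)
    have xN: "x \<notin> N" using x by (simp add: Z_def)
    have Rx: "R x" using W(4) FW xF by blast
    let ?F = "at x within stolz M x"
    define \<delta> where "\<delta> = (\<lambda>z. Re (A z) - Re (\<beta> x))"
    have Al: "(A \<longlongrightarrow> \<beta> x) ?F" and dl: "((\<lambda>z. \<delta> z * ln (1 / (1 - cmod z))) \<longlongrightarrow> 0) ?F" and lx: "lam x = cis (Re (\<beta> x))"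
      using Rx unfolding R_def \<delta>_def by blast+
    have \<kappa>: "(\<kappa> \<longlongrightarrow> \<i> * of_real t) ?F" by (rule tendsto_within_subset[OF \<kappa>' stolz_subset])
    have d0: "(\<delta> \<longlongrightarrow> 0) ?F" unfolding \<delta>_def using tendsto_diff[OF tendsto_Re[OF Al] tendsto_const[of "Re (\<beta> x)"]] by simp
    obtain C where C: "\<forall>\<^sub>F z in ?F. cmod (G z) \<le> C * (1 + ln (1 / (1 - cmod z)))" using G(4)[OF xF xN] by blast
    have "((\<lambda>z. sin (\<delta> z) * Im (G z)) \<longlongrightarrow> 0) ?F"
    proof (rule Lim_null_comparison)
      show "\<forall>\<^sub>F z in ?F. norm (sin (\<delta> z) * Im (G z)) \<le> \<bar>C * (\<delta> z + \<delta> z * ln (1 / (1 - cmod z)))\<bar>"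
        using C
      proof eventually_elim
        case (elim z)
        have "\<bar>sin (\<delta> z)\<bar> * \<bar>Im (G z)\<bar> \<le> \<bar>\<delta> z\<bar> * (C * (1 + ln (1 / (1 - cmod z))))"
          using abs_sin_x_le_abs_x[of "\<delta> z"] abs_Im_le_cmod[of "G z"] elim by (intro mult_mono) auto
        also have "\<dots> \<le> \<bar>\<delta> z * (C * (1 + ln (1 / (1 - cmod z))))\<bar>" by (simp only: abs_mult) (intro mult_left_mono; simp flip: abs_mult)
        finally show ?case by (simp add: abs_mult algebra_simps)
      qed
      have "((\<lambda>z. \<bar>C * (\<delta> z + \<delta> z * ln (1 / (1 - cmod z)))\<bar>) \<longlongrightarrow> \<bar>C * (0 + 0)\<bar>) ?F"
        by (intro tendsto_intros d0 dl)
      then show "((\<lambda>z. \<bar>C * (\<delta> z + \<delta> z * ln (1 / (1 - cmod z)))\<bar>) \<longlongrightarrow> 0) ?F" by simp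
    qed
    \<comment> \<open>The perturbation \<open>\<kappa>\<close> drops out: its finite imaginary limit
      is multiplied by a sine that tends to 0, and its real part vanishes in the limit.\<close>
    then have s: "((\<lambda>z. sin (\<delta> z) * Im (G z) + sin (\<delta> z) * Im (\<kappa> z)) \<longlongrightarrow> 0 + sin 0 * Im (\<i> * of_real t)) ?F"
      by (intro tendsto_intros d0 \<kappa>)
    have c: "((\<lambda>z. cos (\<delta> z) * (Re (G z) + Re (\<kappa> z))) \<longlongrightarrow> cos 0 * (\<psi> x + Re (\<i> * of_real t))) ?F"
      by (intro tendsto_intros d0 \<kappa> G(3)[OF xF xN])
    have e: "((\<lambda>z. exp (- Im (A z))) \<longlongrightarrow> exp (- Im (\<beta> x))) ?F" by (intro tendsto_intros Al)
    have "((\<lambda>z. exp (- Im (A z)) * (cos (\<delta> z) * (Re (G z) + Re (\<kappa> z)) - (sin (\<delta> z) * Im (G z) + sin (\<delta> z) * Im (\<kappa> z))))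
        \<longlongrightarrow> exp (- Im (\<beta> x)) * (cos 0 * (\<psi> x + Re (\<i> * of_real t)) - (0 + sin 0 * Im (\<i> * of_real t)))) ?F"
      by (intro tendsto_mult tendsto_diff e c s)
    moreover have "exp (- Im (\<beta> x)) * (cos 0 * (\<psi> x + Re (\<i> * of_real t)) - (0 + sin 0 * Im (\<i> * of_real t))) = \<phi> x"
      by (simp add: \<psi>_def mult.left_commute flip: exp_add)
    moreover have "exp (- Im (A z)) * (cos (\<delta> z) * (Re (G z) + Re (\<kappa> z)) - (sin (\<delta> z) * Im (G z) + sin (\<delta> z) * Im (\<kappa> z)))
        = Re (cnj (lam x) * (exp (\<i> * A z) * (G z + \<kappa> z)))" for z
    proof -
      have "\<i> * A z = of_real (- Im (A z)) + \<i> * of_real (Re (A z))" by (simp add: complex_eq_iff)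
      then have "exp (\<i> * A z) = of_real (exp (- Im (A z))) * cis (Re (A z))"
        by (simp only: exp_add exp_of_real cis_conv_exp)
      then have "cnj (lam x) * exp (\<i> * A z) = of_real (exp (- Im (A z))) * (cis (- Re (\<beta> x)) * cis (Re (A z)))"
        by (simp add: lx cis_cnj)
      also have "cis (- Re (\<beta> x)) * cis (Re (A z)) = cis (\<delta> z)" by (simp add: cis_mult \<delta>_def)
      finally have "cnj (lam x) * (exp (\<i> * A z) * (G z + \<kappa> z)) = of_real (exp (- Im (A z))) * (cis (\<delta> z) * (G z + \<kappa> z))"
        by (simp only: mult.assoc[symmetric])
      then show ?thesis by (simp add: algebra_simps)
    qed
    ultimately show "((\<lambda>z. Re (cnj (lam x) * (exp (\<i> * A z) * (G z + \<kappa> z)))) \<longlongrightarrow> \<phi> x) ?F" by simp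
  qed
qed

section \<open>Circular domains\<close>

text \<open>For a hole the conjugate traverses the circle backwards, so endpoints change sign and a
  monotone partition has to be reversed.\<close>

lemma bv_on_arc_circ_map:
  assumes "bv_on_arc lam c r a d"
  shows "bv_on_arc (\<lambda>x. lam (circ_map b c r x)) 0 1 (if b then a else - d) (if b then d else - a)"
proof -
  obtain M where M: "\<And>(n::nat) (\<theta>::nat \<Rightarrow> real). (\<forall>j\<le>n. a < \<theta> j \<and> \<theta> j < d) \<Longrightarrow> (\<forall>j<n. \<theta> j \<le> \<theta> (Suc j)) \<Longrightarrow>
      (\<Sum>j<n. cmod (lam (c + of_real r * cis (\<theta> (Suc j))) - lam (c + of_real r * cis (\<theta> j)))) \<le> M"
    using assms unfolding bv_on_arc_def by blast
  show ?thesis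
  proof (cases b)
    case True
    then show ?thesis using assms by (simp add: bv_on_arc_def circ_map_def)
  next
    case False
    have "(\<Sum>j<n. cmod (lam (c + of_real r * cis (- \<theta> (Suc j))) - lam (c + of_real r * cis (- \<theta> j)))) \<le> M"
      if \<theta>: "\<forall>j\<le>n. - d < \<theta> j \<and> \<theta> j < - a" "\<forall>j<n. \<theta> j \<le> \<theta> (Suc j)" for n :: nat and \<theta>
    proof -
      define \<theta>' where "\<theta>' = (\<lambda>j. - \<theta> (n - j))"
      have "a < \<theta>' j \<and> \<theta>' j < d" if "j \<le> n" for j
      proof -
        have "- d < \<theta> (n - j) \<and> \<theta> (n - j) < - a" using \<theta>(1) by simp
        then show ?thesis unfolding \<theta>'_def by linarith
      qed
      moreover have "\<theta>' j \<le> \<theta>' (Suc j)" if "j < n" for j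
        using \<theta>(2)[rule_format, of "n - Suc j"] that by (simp add: \<theta>'_def Suc_diff_Suc)
      ultimately have "(\<Sum>j<n. cmod (lam (c + of_real r * cis (\<theta>' (Suc j))) - lam (c + of_real r * cis (\<theta>' j)))) \<le> M"
        by (intro M) auto
      also have "(\<Sum>j<n. cmod (lam (c + of_real r * cis (\<theta>' (Suc j))) - lam (c + of_real r * cis (\<theta>' j)))) =
          (\<Sum>j<n. cmod (lam (c + of_real r * cis (\<theta>' (Suc (n - Suc j)))) - lam (c + of_real r * cis (\<theta>' (n - Suc j)))))"
        by (rule sum.nat_diff_reindex[symmetric])
      also have "\<dots> = (\<Sum>j<n. cmod (lam (c + of_real r * cis (- \<theta> (Suc j))) - lam (c + of_real r * cis (- \<theta> j))))"
      proof (rule sum.cong[OF refl])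
        fix j assume "j \<in> {..<n}"
        then have "Suc (n - Suc j) = n - j" "n - (n - j) = j" "n - (n - Suc j) = Suc j" by auto
        then show "cmod (lam (c + of_real r * cis (\<theta>' (Suc (n - Suc j)))) - lam (c + of_real r * cis (\<theta>' (n - Suc j)))) =
            cmod (lam (c + of_real r * cis (- \<theta> (Suc j))) - lam (c + of_real r * cis (- \<theta> j)))"
          by (simp only: \<theta>'_def norm_minus_commute)
      qed
      finally show ?thesis .
    qed
    then show ?thesis using False unfolding bv_on_arc_def circ_map_def
      by (intro exI[of _ M]) (simp add: cis_cnj)
  qed
qed

lemma circ_map_circ_arc:
  assumes "0 < r"
  shows "circ_map b c r x \<in> circ_arc c r a d \<longleftrightarrow> x \<in> circ_arc 0 1 (if b then a else - d) (if b then d else - a)"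
proof (cases b)
  case True
  then show ?thesis using assms by (auto simp: circ_arc_def circ_map_def)
next
  case False
  have "cnj x = cis \<theta> \<longleftrightarrow> x = cis (- \<theta>)" for \<theta> by (metis cis_cnj complex_cnj_cnj)
  then have "circ_map b c r x \<in> circ_arc c r a d \<longleftrightarrow> (\<exists>\<theta>. x = cis (- \<theta>) \<and> a < \<theta> \<and> \<theta> < d)"
    using False assms by (auto simp: circ_arc_def circ_map_def)
  also have "\<dots> \<longleftrightarrow> (\<exists>\<theta>. x = cis \<theta> \<and> - d < \<theta> \<and> \<theta> < - a)"
    by (metis add.inverse_inverse neg_less_iff_less)
  finally show ?thesis using False by (auto simp: circ_arc_def)
qed

text \<open>Since the circles are disjoint, arcs of the others cannot help to cover this one. The
  arcs on it therefore still cover all but countably many points, and injectivity of the map pulls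
  countability back.\<close>

lemma CBV_circ_map:
  assumes cbv: "CBV Cs lam" and cr: "(c, r) \<in> Cs" and pos: "\<And>c r. (c, r) \<in> Cs \<Longrightarrow> 0 < r"
    and disj: "\<And>x y. x \<in> Cs \<Longrightarrow> y \<in> Cs \<Longrightarrow> x \<noteq> y \<Longrightarrow> sphere (fst x) (snd x) \<inter> sphere (fst y) (snd y) = {}"
  shows "CBV {(0, 1)} (\<lambda>x. lam (circ_map b c r x))"
proof -
  have r: "0 < r" by (rule pos[OF cr])
  obtain A :: "(complex \<times> real \<times> real \<times> real) set" where A: "countable A"
    "\<forall>(c, r, a, b) \<in> A. (c, r) \<in> Cs \<and> a < b \<and> b \<le> a + 2 * pi \<and> bv_on_arc lam c r a b"
    "\<forall>x\<in>A. \<forall>y\<in>A. x \<noteq> y \<longrightarrow> (case x of (c, r, a, b) \<Rightarrow> circ_arc c r a b) \<inter> (case y of (c, r, a, b) \<Rightarrow> circ_arc c r a b) = {}"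
    "countable ((\<Union>(c, r) \<in> Cs. sphere c r) - (\<Union>(c, r, a, b) \<in> A. circ_arc c r a b))"
    using cbv unfolding CBV_def by blast
  define T :: "complex \<times> real \<times> real \<times> real \<Rightarrow> complex \<times> real \<times> real \<times> real" where
    "T = (\<lambda>(_, _, a, d). (0, 1, if b then a else - d, if b then d else - a))"
  define A0 where "A0 = {p \<in> A. fst p = c \<and> fst (snd p) = r}"
  have A0: "\<exists>a d. p = (c, r, a, d) \<and> (c, r, a, d) \<in> A" if "p \<in> A0" for p
    using that by (cases p) (auto simp: A0_def)
  have arc: "circ_map b c r x \<in> circ_arc c r a d \<longleftrightarrow> x \<in> (case T (c, r, a, d) of (c, r, a, b) \<Rightarrow> circ_arc c r a b)" for x a d
    by (simp add: T_def circ_map_circ_arc[OF r])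
  show ?thesis unfolding CBV_def
  proof (intro exI[of _ "T ` A0"] conjI)
    show "countable (T ` A0)" using A(1) by (intro countable_image) (auto simp: A0_def)
    show "\<forall>(c', r', a, d)\<in>T ` A0. (c', r') \<in> {(0, 1)} \<and> a < d \<and> d \<le> a + 2 * pi \<and> bv_on_arc (\<lambda>x. lam (circ_map b c r x)) c' r' a d"
    proof
      fix q assume "q \<in> T ` A0"
      then obtain a d where q: "q = T (c, r, a, d)" "(c, r, a, d) \<in> A" using A0 by blast
      then have "a < d" "d \<le> a + 2 * pi" "bv_on_arc lam c r a d" using A(2) by auto
      then show "case q of (c', r', a, d) \<Rightarrow> (c', r') \<in> {(0, 1)} \<and> a < d \<and> d \<le> a + 2 * pi \<and> bv_on_arc (\<lambda>x. lam (circ_map b c r x)) c' r' a d"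
        using bv_on_arc_circ_map[of lam c r a d b] by (cases b) (auto simp: q(1) T_def)
    qed
    show "\<forall>x\<in>T ` A0. \<forall>y\<in>T ` A0. x \<noteq> y \<longrightarrow> (case x of (c, r, a, b) \<Rightarrow> circ_arc c r a b) \<inter> (case y of (c, r, a, b) \<Rightarrow> circ_arc c r a b) = {}"
    proof (intro ballI impI)
      fix x y assume xy: "x \<in> T ` A0" "y \<in> T ` A0" "x \<noteq> y"
      obtain a d where x: "x = T (c, r, a, d)" "(c, r, a, d) \<in> A" using A0 xy(1) by blast
      obtain a' d' where y: "y = T (c, r, a', d')" "(c, r, a', d') \<in> A" using A0 xy(2) by blast
      have "(c, r, a, d) \<noteq> (c, r, a', d')" using x y xy(3) by blast
      then have "circ_arc c r a d \<inter> circ_arc c r a' d' = {}" using A(3) x(2) y(2) by fastforce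
      then show "(case x of (c, r, a, b) \<Rightarrow> circ_arc c r a b) \<inter> (case y of (c, r, a, b) \<Rightarrow> circ_arc c r a b) = {}"
        unfolding x(1) y(1)
      proof (intro equals0I)
        fix u assume "u \<in> (case T (c, r, a, d) of (c, r, a, b) \<Rightarrow> circ_arc c r a b) \<inter> (case T (c, r, a', d') of (c, r, a, b) \<Rightarrow> circ_arc c r a b)"
        then have "circ_map b c r u \<in> circ_arc c r a d \<inter> circ_arc c r a' d'" unfolding Int_iff arc .
        then show False using \<open>circ_arc c r a d \<inter> circ_arc c r a' d' = {}\<close> by blast
      qed
    qed
    have "circ_map b c r ` ((\<Union>(c, r)\<in>{(0, 1)}. sphere c r) - (\<Union>(c, r, a, b)\<in>T ` A0. circ_arc c r a b)) \<subseteq>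
       (\<Union>(c, r) \<in> Cs. sphere c r) - (\<Union>(c, r, a, b) \<in> A. circ_arc c r a b)"
    proof (rule image_subsetI, rule DiffI)
      fix x assume x: "x \<in> (\<Union>(c, r)\<in>{(0, 1)}. sphere c r) - (\<Union>(c, r, a, b)\<in>T ` A0. circ_arc c r a b)"
      then have s: "circ_map b c r x \<in> sphere c r" using circ_map_in_sphere[OF r] by auto
      then show "circ_map b c r x \<in> (\<Union>(c, r) \<in> Cs. sphere c r)" using cr by blast
      show "circ_map b c r x \<notin> (\<Union>(c, r, a, b) \<in> A. circ_arc c r a b)"
      proof
        assume "circ_map b c r x \<in> (\<Union>(c, r, a, b) \<in> A. circ_arc c r a b)"
        then obtain c' r' a d where p: "(c', r', a, d) \<in> A" "circ_map b c r x \<in> circ_arc c' r' a d" by auto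
        have cr': "(c', r') \<in> Cs" using A(2) p(1) by auto
        have "circ_map b c r x \<in> sphere c' r'" using p(2) pos[OF cr'] by (auto simp: circ_arc_def dist_norm norm_mult)
        then have "sphere c' r' \<inter> sphere c r \<noteq> {}" using s by blast
        then have eq: "(c', r') = (c, r)" using disj[OF cr' cr] by (metis fst_conv snd_conv)
        then have "(c, r, a, d) \<in> A0" using p(1) by (simp add: A0_def)
        then have "T (c, r, a, d) \<in> T ` A0" by (rule imageI)
        moreover have "x \<in> (case T (c, r, a, d) of (c, r, a, b) \<Rightarrow> circ_arc c r a b)"
        proof (rule iffD1[OF arc])
          show "circ_map b c r x \<in> circ_arc c r a d" using p(2) eq by simp
        qed
        ultimately have "x \<in> (\<Union>(c, r, a, b)\<in>T ` A0. circ_arc c r a b)" by (rule UN_I)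
        then show False by (rule DiffD2[OF x])
      qed
    qed
    then have "countable (circ_map b c r ` ((\<Union>(c, r)\<in>{(0, 1)}. sphere c r) - (\<Union>(c, r, a, b)\<in>T ` A0. circ_arc c r a b)))"
      by (rule countable_subset) (rule A(4))
    moreover have "inj (circ_map b c r)" by (rule inj_on_inverseI[of _ "circ_inv b c r"]) (simp add: r)
    ultimately show "countable ((\<Union>(c, r)\<in>{(0, 1)}. sphere c r) - (\<Union>(c, r, a, b)\<in>T ` A0. circ_arc c r a b))"
      by (metis countable_image_inj_eq inj_on_subset subset_UNIV)
  qed
qed

section \<open>Holomorphic coordinates at the boundary circles\<close>

definition circ_coord :: "bool \<Rightarrow> complex \<Rightarrow> real \<Rightarrow> complex \<Rightarrow> complex" where
  "circ_coord b c r z = (if b then (z - c) / of_real r else of_real r / (z - c))"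

definition circ_pt :: "bool \<Rightarrow> complex \<Rightarrow> real \<Rightarrow> complex \<Rightarrow> complex" where
  "circ_pt b c r w = (if b then c + of_real r * w else c + of_real r / w)"

definition circ_side :: "bool \<Rightarrow> complex \<Rightarrow> real \<Rightarrow> complex set" where
  "circ_side b c r = (if b then ball c r else - cball c r)"

lemma circ_coord_norm: "0 < r \<Longrightarrow> cmod (circ_coord b c r z) = (if b then cmod (z - c) / r else r / cmod (z - c))"
  by (simp add: circ_coord_def norm_divide)

lemma circ_coord_less_1: "0 < r \<Longrightarrow> z \<in> circ_side b c r \<Longrightarrow> cmod (circ_coord b c r z) < 1"
  by (auto simp: circ_coord_norm circ_side_def dist_norm norm_minus_commute not_le divide_less_eq_1)

lemma circ_pt_coord: "0 < r \<Longrightarrow> z \<in> circ_side b c r \<Longrightarrow> circ_pt b c r (circ_coord b c r z) = z"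
  by (auto simp: circ_coord_def circ_pt_def circ_side_def)

lemma holomorphic_circ_coord: "0 < r \<Longrightarrow> circ_coord b c r holomorphic_on circ_side b c r"
  by (cases b) (auto simp: circ_coord_def[abs_def] circ_side_def intro!: holomorphic_intros)

lemma circ_coord_sphere:
  assumes "0 < r" "\<zeta> \<in> sphere c r"
  shows "cmod (circ_coord b c r \<zeta>) = 1" "circ_map b c r (circ_coord b c r \<zeta>) = \<zeta>" "isCont (circ_coord b c r) \<zeta>"
proof -
  have d: "cmod (\<zeta> - c) = r" using assms(2) by (simp add: dist_norm norm_minus_commute)
  then show "cmod (circ_coord b c r \<zeta>) = 1" using assms(1) by (simp add: circ_coord_norm)
  have nz: "\<zeta> - c \<noteq> 0" using d assms(1) by auto
  then show "isCont (circ_coord b c r) \<zeta>" using assms(1)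
    by (cases b) (auto simp: circ_coord_def[abs_def] intro!: continuous_intros)
  have "cnj (\<zeta> - c) * (\<zeta> - c) = of_real r * of_real r"
    using d by (metis complex_norm_square mult.commute of_real_mult power2_eq_square)
  then have "of_real r * cnj (of_real r / (\<zeta> - c)) = \<zeta> - c" using nz by (simp add: field_simps)
  then show "circ_map b c r (circ_coord b c r \<zeta>) = \<zeta>"
    using assms(1) by (simp add: circ_map_def circ_coord_def)
qed

text \<open>Both \<open>\<bar>w z - w \<zeta>\<bar>\<close> and \<open>1 - \<bar>w z\<bar>\<close>
  for the coordinate \<open>w\<close> arise from \<open>\<bar>z - \<zeta>\<bar>\<close> and the
  distance of \<open>z\<close> to the circle by division by the same number, \<open>r\<close> inside
  and \<open>\<bar>z - c\<bar>\<close> outside. The aperture \<open>M\<close> is thus preserved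
  exactly.\<close>

lemma circ_coord_stolz:
  assumes r: "0 < r" and \<zeta>: "\<zeta> \<in> sphere c r" and z: "z \<in> circ_side b c r"
    and M: "cmod (z - \<zeta>) \<le> M * \<bar>cmod (z - c) - r\<bar>"
  shows "circ_coord b c r z \<in> stolz M (circ_coord b c r \<zeta>)"
proof (cases b)
  case True
  then have "cmod (z - c) < r" using z by (simp add: circ_side_def dist_norm norm_minus_commute)
  then have "cmod (z - \<zeta>) / r \<le> M * (1 - cmod (z - c) / r)" using M r by (simp add: field_simps)
  moreover have "circ_coord b c r z - circ_coord b c r \<zeta> = (z - \<zeta>) / of_real r"
    using True by (simp add: circ_coord_def diff_divide_distrib)
  ultimately show ?thesis
    using circ_coord_less_1[OF r z] True r by (simp add: stolz_def circ_coord_norm norm_divide)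
next
  case False
  then have l: "r < cmod (z - c)" using z by (simp add: circ_side_def dist_norm norm_minus_commute)
  have d: "cmod (\<zeta> - c) = r" using \<zeta> by (simp add: dist_norm norm_minus_commute)
  have nz: "z - c \<noteq> 0" "\<zeta> - c \<noteq> 0" using l r d by auto
  have "circ_coord b c r z - circ_coord b c r \<zeta> = of_real r * (\<zeta> - z) / ((z - c) * (\<zeta> - c))"
    using False nz by (simp add: circ_coord_def diff_frac_eq algebra_simps)
  then have "cmod (circ_coord b c r z - circ_coord b c r \<zeta>) = cmod (z - \<zeta>) / cmod (z - c)"
    using r by (simp add: norm_mult norm_divide d norm_minus_commute)
  moreover have "cmod (z - \<zeta>) / cmod (z - c) \<le> M * (1 - r / cmod (z - c))"
  proof -
    have "cmod (z - \<zeta>) / cmod (z - c) \<le> M * (cmod (z - c) - r) / cmod (z - c)"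
      using M l by (intro divide_right_mono) auto
    also have "\<dots> = M * (1 - r / cmod (z - c))" using nz by (simp add: diff_divide_distrib right_diff_distrib)
    finally show ?thesis .
  qed
  ultimately show ?thesis
    using circ_coord_less_1[OF r z] False r by (simp add: stolz_def circ_coord_norm)
qed

text \<open>On the compact circle the modulus of the other coordinate attains a maximum below 1. It
  stays below some \<open>s < 1\<close> in a neighbourhood of width \<open>e\<close>, and a thin
  collar is mapped into this neighbourhood.\<close>

lemma circle_pair_separation:
  assumes r: "0 < r" and r': "0 < r'" and sub: "sphere c r \<subseteq> circ_side b' c' r'"
  obtains \<rho> where "\<rho> < 1"
    "\<And>v. \<rho> < cmod v \<Longrightarrow> cmod v < 1 \<Longrightarrow> circ_pt b c r v \<in> circ_side b' c' r' \<and> cmod (circ_coord b' c' r' (circ_pt b c r v)) \<le> \<rho>"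
proof -
  have op: "open (circ_side b' c' r')" by (auto simp: circ_side_def open_Compl)
  have cc: "continuous_on (circ_side b' c' r') (\<lambda>z. cmod (circ_coord b' c' r' z))"
    using r' by (intro continuous_intros holomorphic_on_imp_continuous_on holomorphic_circ_coord)
  have ne: "sphere c r \<noteq> {}" using r by simp
  obtain z0 where z0: "z0 \<in> sphere c r" "\<And>z. z \<in> sphere c r \<Longrightarrow> cmod (circ_coord b' c' r' z) \<le> cmod (circ_coord b' c' r' z0)"
    using continuous_attains_sup[OF compact_sphere ne continuous_on_subset[OF cc sub]] by blast
  define s where "s = (1 + cmod (circ_coord b' c' r' z0)) / 2"
  have z01: "cmod (circ_coord b' c' r' z0) < 1" using circ_coord_less_1[OF r'] z0(1) sub by blast
  then have s: "s < 1" "cmod (circ_coord b' c' r' z0) < s" by (simp_all add: s_def)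
  define U where "U = {z \<in> circ_side b' c' r'. cmod (circ_coord b' c' r' z) < s}"
  have "open U"
  proof -
    have "U = circ_side b' c' r' \<inter> (\<lambda>z. cmod (circ_coord b' c' r' z)) -` {..<s}" by (auto simp: U_def)
    then show ?thesis using continuous_on_open_vimage[OF op] cc by (metis inf_commute open_lessThan)
  qed
  moreover have "sphere c r \<subseteq> U" using z0(2) s(2) sub unfolding U_def by fastforce
  ultimately obtain e where e: "0 < e" "{x. infdist x (sphere c r) \<le> e} \<subseteq> U"
    using compact_in_open_separated[OF ne compact_sphere] by blast
  \<comment> \<open>The last entry places the collar within \<open>e / 2\<close> of the circle, up
    to the factor \<open>1 / \<bar>v\<bar>\<close> that the inversion produces; the entry
    \<open>1 / 2\<close> bounds this factor by 2.\<close>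
  define \<rho> where "\<rho> = max s (max (1 / 2) (1 - e / (2 * r)))"
  show ?thesis
  proof (rule that[of \<rho>])
    show "\<rho> < 1" using s e(1) r by (simp add: \<rho>_def)
    fix v :: complex assume v: "\<rho> < cmod v" "cmod v < 1"
    have v2: "1 / 2 < cmod v" "1 - e / (2 * r) < cmod v" using v(1) by (simp_all add: \<rho>_def)
    define u where "u = v / of_real (cmod v)"
    have nz: "v \<noteq> 0" using v2 by auto
    then have u: "cmod u = 1" by (simp add: u_def norm_divide)
    have le: "r * (1 - cmod v) \<le> e / 2" using v2(2) r by (simp add: field_simps)
    have "circ_pt b c r u \<in> sphere c r" using u r by (auto simp: circ_pt_def dist_norm norm_mult norm_divide)
    then have "infdist (circ_pt b c r v) (sphere c r) \<le> dist (circ_pt b c r v) (circ_pt b c r u)" by (rule infdist_le)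
    also have "\<dots> \<le> e"
    proof (cases b)
      case True
      have "v - u = u * of_real (cmod v - 1)" using nz by (simp add: u_def field_simps)
      then have "cmod (v - u) = 1 - cmod v" using u v(2) by (simp add: norm_mult del: of_real_diff)
      moreover have "circ_pt b c r v - circ_pt b c r u = of_real r * (v - u)" using True by (simp add: circ_pt_def algebra_simps)
      ultimately show ?thesis using le r e(1) by (simp add: dist_norm norm_mult)
    next
      case False
      have "circ_pt b c r v - circ_pt b c r u = of_real (r * (1 - cmod v)) / v"
        using False nz by (simp add: circ_pt_def u_def field_simps)
      then have "dist (circ_pt b c r v) (circ_pt b c r u) = r * (1 - cmod v) / cmod v"
        using v(2) r by (simp only: dist_norm norm_divide norm_of_real) simp
      also have "\<dots> \<le> (e / 2) / (1 / 2)" using le v2 e(1) by (intro frac_le) auto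
      finally show ?thesis by simp
    qed
    finally have "circ_pt b c r v \<in> U" using e(2) by blast
    then show "circ_pt b c r v \<in> circ_side b' c' r' \<and> cmod (circ_coord b' c' r' (circ_pt b c r v)) \<le> \<rho>"
      by (auto simp: U_def \<rho>_def)
  qed
qed

lemma holomorphic_circ_pt: "circ_pt b c r holomorphic_on - {0}"
  by (cases b) (auto simp: circ_pt_def[abs_def] intro!: holomorphic_intros)

text \<open>The open set \<Omega> is disjoint from its frontier circles, so by connectedness it lies
  on one side of each. The other circles belong to the closure of \<Omega> and avoid this circle,
  hence lie strictly on the same side.\<close>

lemma nondeg_circular_domain_sides:
  assumes \<Omega>: "nondeg_circular_domain \<Omega> Cs"
  obtains b where "\<And>c r. (c, r) \<in> Cs \<Longrightarrow> \<Omega> \<subseteq> circ_side (b (c, r)) c r"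
    "\<And>c r c' r'. (c, r) \<in> Cs \<Longrightarrow> (c', r') \<in> Cs \<Longrightarrow> (c, r) \<noteq> (c', r') \<Longrightarrow> sphere c r \<subseteq> circ_side (b (c', r')) c' r'"
proof -
  define b where "b = (\<lambda>(c, r). \<Omega> \<subseteq> ball c r)"
  have \<Omega>': "open \<Omega>" "connected \<Omega>" "\<And>c r. (c, r) \<in> Cs \<Longrightarrow> 0 < r" "frontier \<Omega> = (\<Union>(c, r) \<in> Cs. sphere c r)"
    "\<And>x y. x \<in> Cs \<Longrightarrow> y \<in> Cs \<Longrightarrow> x \<noteq> y \<Longrightarrow> sphere (fst x) (snd x) \<inter> sphere (fst y) (snd y) = {}"
    using \<Omega> unfolding nondeg_circular_domain_def by blast+
  have side: "\<Omega> \<subseteq> circ_side (b (c, r)) c r" if cr: "(c, r) \<in> Cs" for c r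
  proof (cases "\<Omega> \<subseteq> ball c r")
    case False
    have dj: "\<Omega> \<inter> sphere c r = {}"
      using \<Omega>'(1,4) cr frontier_disjoint_eq[of \<Omega>] by blast
    have "\<Omega> \<inter> ball c r = {}"
    proof (rule ccontr)
      assume "\<Omega> \<inter> ball c r \<noteq> {}"
      moreover have "\<Omega> - ball c r \<noteq> {}" using False by blast
      ultimately have "\<Omega> \<inter> frontier (ball c r) \<noteq> {}" by (rule connected_Int_frontier[OF \<Omega>'(2)])
      then show False using dj \<Omega>'(3)[OF cr] by simp
    qed
    moreover have "cball c r = ball c r \<union> sphere c r" by auto
    ultimately have "\<Omega> \<subseteq> - cball c r" using dj by blast
    then show ?thesis using False by (simp add: b_def circ_side_def)
  qed (simp add: b_def circ_side_def)
  have "sphere c r \<subseteq> circ_side (b (c', r')) c' r'" if cr: "(c, r) \<in> Cs" "(c', r') \<in> Cs" "(c, r) \<noteq> (c', r')" for c r c' r'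
  proof
    fix z assume z: "z \<in> sphere c r"
    then have "z \<in> frontier \<Omega>" unfolding \<Omega>'(4) using cr(1) by blast
    then have zc: "z \<in> closure \<Omega>" by (simp add: frontier_def)
    have ns: "dist c' z \<noteq> r'" using \<Omega>'(5)[OF cr] z by auto
    show "z \<in> circ_side (b (c', r')) c' r'"
    proof (cases "b (c', r')")
      case True
      then have "\<Omega> \<subseteq> cball c' r'" using side[OF cr(2)] by (auto simp: circ_side_def)
      then have "closure \<Omega> \<subseteq> cball c' r'" by (intro closure_minimal closed_cball)
      then show ?thesis using True zc ns by (auto simp: circ_side_def)
    next
      case False
      then have "\<Omega> \<subseteq> - ball c' r'" using side[OF cr(2)] by (auto simp: circ_side_def)
      then have "closure \<Omega> \<subseteq> - ball c' r'" by (intro closure_minimal) auto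
      then show ?thesis using False zc ns by (auto simp: circ_side_def)
    qed
  qed
  with side show ?thesis using that by blast
qed

text \<open>The solutions differ by the choice of a pole \<open>x k\<close> on one of the circles: the function
  \<open>(x k + w) / (x k - w)\<close> is purely imaginary on the rest of the circle.\<close>

theorem solution_family:
  fixes \<phi> :: "complex \<Rightarrow> real"
  assumes \<Omega>: "nondeg_circular_domain \<Omega> Cs"
    and lam: "\<And>\<zeta>. \<zeta> \<in> frontier \<Omega> \<Longrightarrow> cmod (lam \<zeta>) = 1" "CBV Cs lam" and \<phi>: "quasicont (frontier \<Omega>) \<phi>"
  obtains Z and f :: "nat \<Rightarrow> complex \<Rightarrow> complex" where "polar Z" "\<And>n. f n holomorphic_on \<Omega>"
    "\<And>n c r \<zeta> M. (c, r) \<in> Cs \<Longrightarrow> \<zeta> \<in> sphere c r \<Longrightarrow> \<zeta> \<notin> Z \<Longrightarrow>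
       ((\<lambda>z. Re (cnj (lam \<zeta>) * f n z)) \<longlongrightarrow> \<phi> \<zeta>) (at \<zeta> within {z \<in> \<Omega>. cmod (z - \<zeta>) \<le> M * \<bar>cmod (z - c) - r\<bar>})"
    "\<And>K a k. finite K \<Longrightarrow> (\<And>z. z \<in> \<Omega> \<Longrightarrow> (\<Sum>k\<in>K. a k * (f (Suc k) z - f 0 z)) = 0) \<Longrightarrow> k \<in> K \<Longrightarrow> a k = 0"
proof (rule nondeg_circular_domain_sides[OF \<Omega>])
  fix b assume side: "\<And>c r. (c, r) \<in> Cs \<Longrightarrow> \<Omega> \<subseteq> circ_side (b (c, r)) c r"
    and sphere_side: "\<And>c r c' r'. (c, r) \<in> Cs \<Longrightarrow> (c', r') \<in> Cs \<Longrightarrow> (c, r) \<noteq> (c', r') \<Longrightarrow> sphere c r \<subseteq> circ_side (b (c', r')) c' r'"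
  have \<Omega>': "open \<Omega>" "\<Omega> \<noteq> {}" "bounded \<Omega>" "finite Cs" "\<And>c r. (c, r) \<in> Cs \<Longrightarrow> 0 < r" "frontier \<Omega> = (\<Union>(c, r) \<in> Cs. sphere c r)"
    "\<And>x y. x \<in> Cs \<Longrightarrow> y \<in> Cs \<Longrightarrow> x \<noteq> y \<Longrightarrow> sphere (fst x) (snd x) \<inter> sphere (fst y) (snd y) = {}"
    using \<Omega> unfolding nondeg_circular_domain_def by blast+
  have fr: "sphere c r \<subseteq> frontier \<Omega>" if "(c, r) \<in> Cs" for c r unfolding \<Omega>'(6) using that by blast
  have "frontier \<Omega> \<noteq> {}" using \<Omega>'(2,3) frontier_eq_empty[of \<Omega>] not_bounded_UNIV by auto
  then have "Cs \<noteq> {}" unfolding \<Omega>'(6) by auto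
  then obtain j0 where j0: "j0 \<in> Cs" by blast
  define w where "w = (\<lambda>j. circ_coord (b j) (fst j) (snd j))"
  define p where "p = (\<lambda>j. circ_pt (b j) (fst j) (snd j))"
  define T where "T = (\<lambda>j. circ_map (b j) (fst j) (snd j))"
  define side where "side = (\<lambda>j. circ_side (b j) (fst j) (snd j))"
  have rj: "0 < snd j" if "j \<in> Cs" for j using \<Omega>'(5)[of "fst j" "snd j"] that by simp
  have \<Omega>s: "z \<in> side j" if "j \<in> Cs" "z \<in> \<Omega>" for j z using side[of "fst j" "snd j"] that by (auto simp: side_def)
  have wlt: "cmod (w j z) < 1" if "j \<in> Cs" "z \<in> \<Omega>" for j z
    using circ_coord_less_1[OF rj] \<Omega>s that unfolding w_def side_def by blast
  have whol: "w j holomorphic_on side j" if "j \<in> Cs" for j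
    unfolding w_def side_def by (rule holomorphic_circ_coord[OF rj[OF that]])
  have pw: "p j (w j z) = z" if "j \<in> Cs" "z \<in> \<Omega>" for j z
    using circ_pt_coord[OF rj] \<Omega>s that unfolding w_def p_def side_def by blast
  define S where "S = (\<lambda>j E G Z. E holomorphic_on ball 0 1 \<and> (\<forall>w. E w \<noteq> 0) \<and> G holomorphic_on ball 0 1 \<and> polar Z \<and>
    (\<forall>x M \<kappa> t. cmod x = 1 \<longrightarrow> x \<notin> Z \<longrightarrow> (\<kappa> \<longlongrightarrow> \<i> * of_real t) (at x within ball 0 1) \<longrightarrow>
       ((\<lambda>z. Re (cnj (lam (T j x)) * (E z * (G z + \<kappa> z)))) \<longlongrightarrow> \<phi> (T j x)) (at x within stolz M x)))"
  have "\<exists>E G Z. S j E G Z" if j: "j \<in> Cs" for j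
  proof -
    have j': "(fst j, snd j) \<in> Cs" using j by simp
    have c: "CBV {(0, 1)} (\<lambda>x. lam (T j x))" unfolding T_def by (rule CBV_circ_map[OF lam(2) j' \<Omega>'(5,7)])
    have l: "cmod (lam (T j x)) = 1" if "cmod x = 1" for x
      using lam(1) fr[OF j'] circ_map_in_sphere[OF rj[OF j]] that unfolding T_def by blast
    have q: "quasicont (sphere 0 1) (\<lambda>x. \<phi> (T j x))" unfolding T_def by (rule quasicont_circ_map[OF \<phi> rj[OF j] fr[OF j']])
    show ?thesis unfolding S_def by (rule circle_solution[OF c l q], assumption) blast
  qed
  then obtain E G Z where S: "\<And>j. j \<in> Cs \<Longrightarrow> S j (E j) (G j) (Z j)" by metis
  have E: "E j holomorphic_on ball 0 1" "\<And>w. E j w \<noteq> 0" and G: "G j holomorphic_on ball 0 1" and Z: "polar (Z j)"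
    if "j \<in> Cs" for j using S[OF that] unfolding S_def by blast+
  have lim: "((\<lambda>z. Re (cnj (lam (T j x)) * (E j z * (G j z + \<kappa> z)))) \<longlongrightarrow> \<phi> (T j x)) (at x within stolz M x)"
    if "j \<in> Cs" "cmod x = 1" "x \<notin> Z j" "(\<kappa> \<longlongrightarrow> \<i> * of_real t) (at x within ball 0 1)" for j x M \<kappa> t
    using S[OF that(1)] that(2-4) unfolding S_def by blast
  define \<tau> where "\<tau> = (\<lambda>i j v. w i (p j v))"
  have "\<exists>\<rho><1. \<forall>v. \<rho> < cmod v \<longrightarrow> cmod v < 1 \<longrightarrow> p j v \<in> side i \<and> cmod (\<tau> i j v) \<le> \<rho>"
    if ij: "i \<in> Cs" "j \<in> Cs" "i \<noteq> j" for i j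
  proof -
    have "sphere (fst j) (snd j) \<subseteq> circ_side (b i) (fst i) (snd i)"
    proof -
      have "(fst j, snd j) \<noteq> (fst i, snd i)" using ij(3) by simp
      then show ?thesis using sphere_side[of "fst j" "snd j" "fst i" "snd i"] ij(1,2) by simp
    qed
    then show ?thesis unfolding \<tau>_def w_def p_def side_def
      by (rule circle_pair_separation[OF rj[OF ij(2)] rj[OF ij(1)]]) blast
  qed
  then obtain \<rho>0 where \<rho>0: "\<And>i j. i \<in> Cs \<Longrightarrow> j \<in> Cs \<Longrightarrow> i \<noteq> j \<Longrightarrow> \<rho>0 i j < 1"
    "\<And>i j v. i \<in> Cs \<Longrightarrow> j \<in> Cs \<Longrightarrow> i \<noteq> j \<Longrightarrow> \<rho>0 i j < cmod v \<Longrightarrow> cmod v < 1 \<Longrightarrow> p j v \<in> side i \<and> cmod (\<tau> i j v) \<le> \<rho>0 i j"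
    by metis
  define D where "D = {(i, j). i \<in> Cs \<and> j \<in> Cs \<and> i \<noteq> j}"
  have D: "finite D" by (rule finite_subset[of _ "Cs \<times> Cs"]) (use \<Omega>'(4) in \<open>auto simp: D_def\<close>)
  \<comment> \<open>A single radius for all ordered pairs of circles; the entry \<open>1 / 2\<close>
    keeps it positive and the set nonempty when there is only one circle.\<close>
  define \<rho> where "\<rho> = Max (insert (1 / 2) ((\<lambda>(i, j). \<rho>0 i j) ` D))"
  have \<rho>: "0 < \<rho>" "\<rho> < 1"
  proof -
    have "1 / 2 \<le> \<rho>" unfolding \<rho>_def using D by (intro Max_ge) auto
    then show "0 < \<rho>" by linarith
    show "\<rho> < 1" unfolding \<rho>_def using D \<rho>0(1) by (subst Max_less_iff) (auto simp: D_def)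
  qed
  have \<rho>\<rho>: "\<rho>0 i j \<le> \<rho>" if "i \<in> Cs" "j \<in> Cs" "i \<noteq> j" for i j
  proof -
    have "(i, j) \<in> D" using that by (simp add: D_def)
    then have "\<rho>0 i j \<in> (\<lambda>(i, j). \<rho>0 i j) ` D" by force
    then show ?thesis unfolding \<rho>_def using D by (intro Max_ge) auto
  qed
  have sep: "p j v \<in> side i" "cmod (\<tau> i j v) \<le> \<rho>" if "i \<in> Cs" "j \<in> Cs" "i \<noteq> j" "\<rho> < cmod v" "cmod v < 1" for i j v
    using \<rho>0(2)[OF that(1-3), of v] \<rho>\<rho>[OF that(1-3)] that(4,5) by auto
  have \<tau>hol: "\<tau> i j holomorphic_on {v. \<rho> < cmod v \<and> cmod v < 1}" if ij: "i \<in> Cs" "j \<in> Cs" "i \<noteq> j" for i j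
  proof -
    have "w i \<circ> p j holomorphic_on {v. \<rho> < cmod v \<and> cmod v < 1}"
    proof (rule holomorphic_on_compose_gen[OF _ whol[OF ij(1)]])
      show "p j holomorphic_on {v. \<rho> < cmod v \<and> cmod v < 1}"
        unfolding p_def by (rule holomorphic_on_subset[OF holomorphic_circ_pt]) (use \<rho> in auto)
      show "p j ` {v. \<rho> < cmod v \<and> cmod v < 1} \<subseteq> side i" using sep(1)[OF ij] by blast
    qed
    then show ?thesis by (simp add: \<tau>_def o_def)
  qed
  obtain P \<rho>' where P: "\<rho> \<le> \<rho>'" "\<rho>' < 1" "\<And>j. j \<in> Cs \<Longrightarrow> finite (P j)"
    "\<And>F0. (\<And>j. j \<in> Cs \<Longrightarrow> F0 j holomorphic_on ball 0 1) \<Longrightarrow>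
       \<exists>F L. (\<forall>j\<in>Cs. F j holomorphic_on ball 0 1) \<and>
         (\<forall>j\<in>Cs. \<forall>w. \<rho>' < cmod w \<longrightarrow> cmod w < 1 \<longrightarrow>
           F j w + (\<Sum>i\<in>Cs - {j}. F i (\<tau> i j w)) = F0 j w + E j w * L j w) \<and>
         (\<forall>j\<in>Cs. \<forall>x. cmod x = 1 \<longrightarrow> x \<notin> P j \<longrightarrow> (\<exists>t::real. (L j \<longlongrightarrow> \<i> * of_real t) (at x within ball 0 1)))"
    by (rule crosstalk_removal[OF \<Omega>'(4) \<rho> E(1) E(2) \<tau>hol sep(2)]) (assumption | blast)+
  \<comment> \<open>The poles must avoid \<open>P j0\<close>, so that the interaction term still has
    a finite limit at each of them.\<close>
  have "infinite (sphere (0::complex) 1 - P j0)"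
  proof (rule Diff_infinite_finite[OF P(3)[OF j0]])
    have "inj_on cis {0<..<1::real}"
    proof (rule inj_onI)
      fix s t :: real assume st: "s \<in> {0<..<1}" "t \<in> {0<..<1}" "cis s = cis t"
      have "\<bar>s - t\<bar> < 1" using st(1,2) by auto
      then have "\<bar>s - t\<bar> < 2 * pi" using pi_gt3 by linarith
      then show "s = t" using cis_inj st(3) by blast
    qed
    then have "infinite (cis ` {0<..<1::real})" by (simp add: finite_image_iff infinite_Ioo)
    moreover have "cis ` {0<..<1::real} \<subseteq> sphere 0 1" by auto
    ultimately show "infinite (sphere (0::complex) 1)" using finite_subset by blast
  qed
  then obtain x :: "nat \<Rightarrow> complex" where x: "inj x" "range x \<subseteq> sphere 0 1 - P j0"
    using infinite_countable_subset by blast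
  have x1: "cmod (x k) = 1" "x k \<notin> P j0" for k
  proof -
    have "x k \<in> sphere 0 1 - P j0" using x(2) by blast
    then show "cmod (x k) = 1" "x k \<notin> P j0" by auto
  qed
  have xinj: "x k = x m \<longleftrightarrow> k = m" for k m using x(1) by (simp add: inj_eq)
  \<comment> \<open>Solution 0 has no pole, and solution \<open>Suc k\<close> has one at
    \<open>x k\<close> in the coordinate of \<open>j0\<close>. The index shift makes solution 0 the
    reference point of the affine family.\<close>
  define K where "K = (\<lambda>n j v. if j = j0 then case n of 0 \<Rightarrow> 0 | Suc k \<Rightarrow> (x k + v) / (x k - v) else 0)"
  define F0 where "F0 = (\<lambda>n j v. E j v * (G j v + K n j v))"
  have Khol: "K n j holomorphic_on ball 0 1" for n j
    unfolding K_def using x1 by (cases "j = j0"; cases n) (auto intro!: holomorphic_intros)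
  define Q where "Q = (\<lambda>n F L. (\<forall>j\<in>Cs. F j holomorphic_on ball 0 1) \<and>
         (\<forall>j\<in>Cs. \<forall>w. \<rho>' < cmod w \<longrightarrow> cmod w < 1 \<longrightarrow>
           F j w + (\<Sum>i\<in>Cs - {j}. F i (\<tau> i j w)) = F0 n j w + E j w * L j w) \<and>
         (\<forall>j\<in>Cs. \<forall>x. cmod x = 1 \<longrightarrow> x \<notin> P j \<longrightarrow> (\<exists>t::real. (L j \<longlongrightarrow> \<i> * of_real t) (at x within ball 0 1))))"
  have "\<exists>F L. Q n F L" for n unfolding Q_def
    by (rule P(4)) (unfold F0_def, intro holomorphic_intros E G Khol)
  then obtain F L where Q: "\<And>n. Q n (F n) (L n)" by metis
  have F: "F n j holomorphic_on ball 0 1" if "j \<in> Cs" for n j using Q[of n] that unfolding Q_def by blast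
  have FL: "F n j v + (\<Sum>i\<in>Cs - {j}. F n i (\<tau> i j v)) = F0 n j v + E j v * L n j v"
    if "j \<in> Cs" "\<rho>' < cmod v" "cmod v < 1" for n j v using Q[of n] that unfolding Q_def by blast
  have L: "\<exists>t::real. (L n j \<longlongrightarrow> \<i> * of_real t) (at x within ball 0 1)"
    if "j \<in> Cs" "cmod x = 1" "x \<notin> P j" for n j x using Q[of n] that unfolding Q_def by blast
  define f where "f = (\<lambda>n z. \<Sum>j\<in>Cs. F n j (w j z))"
  \<comment> \<open>In the collar of circle \<open>j\<close> the other summands are functions of
    \<open>w j z\<close> through the transition maps, and the removal theorem turns the whole sum
    into one product for which the one-circle result applies.\<close>
  have near: "f n z = E j (w j z) * (G j (w j z) + (K n j (w j z) + L n j (w j z)))"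
    if j: "j \<in> Cs" and z: "z \<in> \<Omega>" "\<rho>' < cmod (w j z)" for n j z
  proof -
    have "f n z = F n j (w j z) + (\<Sum>i\<in>Cs - {j}. F n i (w i z))"
      unfolding f_def by (rule sum.remove[OF \<Omega>'(4) j])
    also have "(\<Sum>i\<in>Cs - {j}. F n i (w i z)) = (\<Sum>i\<in>Cs - {j}. F n i (\<tau> i j (w j z)))"
      by (simp add: \<tau>_def pw[OF j z(1)])
    also have "F n j (w j z) + \<dots> = F0 n j (w j z) + E j (w j z) * L n j (w j z)"
      by (rule FL[OF j z(2) wlt[OF j z(1)]])
    finally show ?thesis by (simp add: F0_def algebra_simps)
  qed
  have bd: "cmod (w j \<zeta>) = 1" "T j (w j \<zeta>) = \<zeta>" "isCont (w j) \<zeta>" if "j \<in> Cs" "\<zeta> \<in> sphere (fst j) (snd j)" for j \<zeta>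
    using circ_coord_sphere[OF rj[OF that(1)] that(2), of "b j"] unfolding w_def T_def by auto
  have ev: "\<forall>\<^sub>F z in at \<zeta> within S. z \<in> \<Omega> \<and> \<rho>' < cmod (w j z)"
    if j: "j \<in> Cs" "\<zeta> \<in> sphere (fst j) (snd j)" and S: "S \<subseteq> \<Omega>" for j \<zeta> S
  proof -
    have "((\<lambda>z. cmod (w j z)) \<longlongrightarrow> cmod (w j \<zeta>)) (at \<zeta> within S)"
      using bd(3)[OF j] by (intro tendsto_norm) (meson at_le isCont_def subset_UNIV tendsto_mono)
    then have "\<forall>\<^sub>F z in at \<zeta> within S. \<rho>' < cmod (w j z)"
      using P(2) bd(1)[OF j] by (intro order_tendstoD(1)[of _ "cmod (w j \<zeta>)"]) auto
    moreover have "\<forall>\<^sub>F z in at \<zeta> within S. z \<in> \<Omega>"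
      unfolding eventually_at_filter using S by (intro always_eventually) auto
    ultimately show ?thesis by eventually_elim simp
  qed
  have wlim: "filterlim (w j) (at (w j \<zeta>) within A) (at \<zeta> within S)"
    if j: "j \<in> Cs" "\<zeta> \<in> sphere (fst j) (snd j)" and S: "S \<subseteq> \<Omega>" "\<And>z. z \<in> S \<Longrightarrow> w j z \<in> A" for j \<zeta> S A
    unfolding filterlim_at
  proof
    show "\<forall>\<^sub>F z in at \<zeta> within S. w j z \<in> A \<and> w j z \<noteq> w j \<zeta>"
      unfolding eventually_at_filter
    proof (intro always_eventually allI impI)
      fix z assume "z \<in> S"
      then show "w j z \<in> A \<and> w j z \<noteq> w j \<zeta>" using S wlt[OF j(1), of z] bd(1)[OF j] by force
    qed
    show "(w j \<longlongrightarrow> w j \<zeta>) (at \<zeta> within S)"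
      using bd(3)[OF j] by (meson at_le isCont_def subset_UNIV tendsto_mono)
  qed
  define Z' where "Z' = (\<Union>j\<in>Cs. T j ` (Z j \<union> (P j \<union> range x)))"
  have Kt: "\<exists>t::real. (K n j \<longlongrightarrow> \<i> * of_real t) (at y within ball 0 1)" if y: "cmod y = 1" "y \<notin> range x" for n j y
  proof (cases "j = j0 \<and> n \<noteq> 0")
    case True
    then obtain k where k: "n = Suc k" by (cases n) auto
    have ne: "x k - y \<noteq> 0" using y by auto
    have "(K n j \<longlongrightarrow> (x k + y) / (x k - y)) (at y within ball 0 1)"
      unfolding K_def k using True ne by (auto intro!: tendsto_intros)
    moreover have "Re ((x k + y) / (x k - y)) = 0"
      using x1(1)[of k] y(1) ne by (simp add: Re_divide cmod_def real_sqrt_eq_1_iff) (simp add: field_simps power2_eq_square)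
    then have "(x k + y) / (x k - y) = \<i> * of_real (Im ((x k + y) / (x k - y)))" by (simp add: complex_eq_iff)
    ultimately show ?thesis by metis
  next
    case False
    then have "K n j = (\<lambda>v. 0)" by (cases n) (auto simp: K_def)
    then show ?thesis by (intro exI[of _ 0]) simp
  qed
  show ?thesis
  proof (rule that[of Z' f])
    show "polar Z'" unfolding Z'_def T_def
      by (intro polar_finite_UN \<Omega>'(4) polar_circ_map polar_Un Z polar_countable[OF countable_finite[OF P(3)]] polar_countable rj) auto
    show "f n holomorphic_on \<Omega>" for n unfolding f_def
    proof (intro holomorphic_intros)
      fix j assume j: "j \<in> Cs"
      have "F n j \<circ> w j holomorphic_on \<Omega>"
        by (rule holomorphic_on_compose_gen[OF holomorphic_on_subset[OF whol[OF j]] F[OF j]]) (use \<Omega>s[OF j] wlt[OF j] in auto)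
      then show "(\<lambda>z. F n j (w j z)) holomorphic_on \<Omega>" by (simp add: o_def)
    qed
  next
    fix n c r \<zeta> M assume cr: "(c, r) \<in> Cs" and \<zeta>: "\<zeta> \<in> sphere c r" "\<zeta> \<notin> Z'"
    define j where "j = (c, r)"
    define S where "S = {z \<in> \<Omega>. cmod (z - \<zeta>) \<le> M * \<bar>cmod (z - c) - r\<bar>}"
    have j: "j \<in> Cs" "\<zeta> \<in> sphere (fst j) (snd j)" using cr \<zeta> by (simp_all add: j_def)
    have y: "w j \<zeta> \<notin> Z j" "w j \<zeta> \<notin> P j" "w j \<zeta> \<notin> range x"
    proof -
      have "\<zeta> \<in> Z'" if "w j \<zeta> \<in> Z j \<union> (P j \<union> range x)"
        unfolding Z'_def by (rule UN_I[OF j(1)]) (use imageI[OF that, of "T j"] bd(2)[OF j] in simp)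
      then show "w j \<zeta> \<notin> Z j" "w j \<zeta> \<notin> P j" "w j \<zeta> \<notin> range x" using \<zeta>(2) by blast+
    qed
    obtain t where t: "(L n j \<longlongrightarrow> \<i> * of_real t) (at (w j \<zeta>) within ball 0 1)" using L[OF j(1) bd(1)[OF j] y(2)] by blast
    obtain t' where t': "(K n j \<longlongrightarrow> \<i> * of_real t') (at (w j \<zeta>) within ball 0 1)" using Kt[OF bd(1)[OF j] y(3)] by blast
    have "((\<lambda>v. K n j v + L n j v) \<longlongrightarrow> \<i> * of_real (t' + t)) (at (w j \<zeta>) within ball 0 1)"
      using tendsto_add[OF t' t] by (simp add: distrib_left)
    from lim[OF j(1) bd(1)[OF j] y(1) this, of M]
    have "((\<lambda>v. Re (cnj (lam \<zeta>) * (E j v * (G j v + (K n j v + L n j v))))) \<longlongrightarrow> \<phi> \<zeta>) (at (w j \<zeta>) within stolz M (w j \<zeta>))"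
      by (simp only: bd(2)[OF j])
    moreover have "filterlim (w j) (at (w j \<zeta>) within stolz M (w j \<zeta>)) (at \<zeta> within S)"
    proof (rule wlim[OF j])
      show "S \<subseteq> \<Omega>" by (auto simp: S_def)
      show "w j z \<in> stolz M (w j \<zeta>)" if "z \<in> S" for z
        using that circ_coord_stolz[OF rj[OF j(1)] j(2), of z "b j" M] \<Omega>s[OF j(1), of z]
        by (simp add: S_def w_def side_def j_def)
    qed
    ultimately have "((\<lambda>z. Re (cnj (lam \<zeta>) * (E j (w j z) * (G j (w j z) + (K n j (w j z) + L n j (w j z)))))) \<longlongrightarrow> \<phi> \<zeta>) (at \<zeta> within S)"
      by (rule filterlim_compose)
    moreover have "\<forall>\<^sub>F z in at \<zeta> within S. Re (cnj (lam \<zeta>) * (E j (w j z) * (G j (w j z) + (K n j (w j z) + L n j (w j z))))) = Re (cnj (lam \<zeta>) * f n z)"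
      using ev[OF j, of S] near[OF j(1)] by (auto simp: S_def elim!: eventually_mono)
    ultimately show "((\<lambda>z. Re (cnj (lam \<zeta>) * f n z)) \<longlongrightarrow> \<phi> \<zeta>) (at \<zeta> within {z \<in> \<Omega>. cmod (z - \<zeta>) \<le> M * \<bar>cmod (z - c) - r\<bar>})"
      unfolding S_def by (rule Lim_transform_eventually)
  next
    fix I :: "nat set" and a :: "nat \<Rightarrow> complex" and m
    assume I: "finite I" "m \<in> I" and zero: "\<And>z. z \<in> \<Omega> \<Longrightarrow> (\<Sum>k\<in>I. a k * (f (Suc k) z - f 0 z)) = 0"
    define \<zeta> where "\<zeta> = T j0 (x m)"
    have \<zeta>s: "\<zeta> \<in> sphere (fst j0) (snd j0)"
      unfolding \<zeta>_def T_def using circ_map_in_sphere[OF rj[OF j0]] x1 by blast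
    have w\<zeta>: "w j0 \<zeta> = x m"
      using bd(2)[OF j0 \<zeta>s] circ_map_inv(2)[OF rj[OF j0]] unfolding \<zeta>_def T_def by metis
    have "\<zeta> \<in> frontier \<Omega>" using fr[of "fst j0" "snd j0"] j0 \<zeta>s by auto
    then have "\<zeta> \<in> closure \<Omega>" "\<zeta> \<notin> \<Omega>" using \<Omega>'(1) by (auto simp: frontier_def interior_open)
    then have ntriv: "at \<zeta> within \<Omega> \<noteq> bot" by (simp add: trivial_limit_within closure_def)
    have wf: "filterlim (w j0) (at (x m) within ball 0 1) (at \<zeta> within \<Omega>)"
      using wlim[OF j0 \<zeta>s, of \<Omega> "ball 0 1"] wlt[OF j0] unfolding w\<zeta> by auto
    \<comment> \<open>In differences with solution 0 the term \<open>G\<close> cancels. After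
      division by \<open>E\<close> the relation is multiplied by \<open>x m - v\<close>: as
      \<open>v\<close> tends to \<open>x m\<close>, the other poles and the interaction terms vanish
      and only \<open>2 x m * a m\<close> is left.\<close>
    define H where "H = (\<lambda>v. \<Sum>k\<in>I. a k * ((x m - v) * ((x k + v) / (x k - v)) + (x m - v) * (L (Suc k) j0 v - L 0 j0 v)))"
    have "(H \<longlongrightarrow> (\<Sum>k\<in>I. a k * ((if k = m then 2 * x m else 0) + 0))) (at (x m) within ball 0 1)"
      unfolding H_def
    proof (intro tendsto_sum tendsto_mult tendsto_const tendsto_add)
      fix k
      have id: "((\<lambda>v. x m - v) \<longlongrightarrow> 0) (at (x m) within ball 0 1)"
        by (rule tendsto_eq_intros refl | simp)+
      show "((\<lambda>v. (x m - v) * ((x k + v) / (x k - v))) \<longlongrightarrow> (if k = m then 2 * x m else 0)) (at (x m) within ball 0 1)"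
      proof (cases "k = m")
        case True
        have "((\<lambda>v. x m + v) \<longlongrightarrow> 2 * x m) (at (x m) within ball 0 1)" by (rule tendsto_eq_intros refl | simp)+
        moreover have "\<forall>\<^sub>F v in at (x m) within ball 0 1. x m + v = (x m - v) * ((x k + v) / (x k - v))"
          using True by (auto simp: eventually_at_filter)
        ultimately show ?thesis using True by (auto intro: Lim_transform_eventually)
      next
        case False
        then have "x k - x m \<noteq> 0" by (simp add: xinj)
        then have "((\<lambda>v. (x m - v) * ((x k + v) / (x k - v))) \<longlongrightarrow> 0 * ((x k + x m) / (x k - x m))) (at (x m) within ball 0 1)"
          by (intro tendsto_intros id)
        then show ?thesis using False by simp
      qed
      obtain t t' :: real where "(L (Suc k) j0 \<longlongrightarrow> \<i> * of_real t) (at (x m) within ball 0 1)"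
        "(L 0 j0 \<longlongrightarrow> \<i> * of_real t') (at (x m) within ball 0 1)" using L[OF j0 x1] by meson
      then have "((\<lambda>v. (x m - v) * (L (Suc k) j0 v - L 0 j0 v)) \<longlongrightarrow> 0 * (\<i> * of_real t - \<i> * of_real t')) (at (x m) within ball 0 1)"
        by (intro tendsto_intros id)
      then show "((\<lambda>v. (x m - v) * (L (Suc k) j0 v - L 0 j0 v)) \<longlongrightarrow> 0) (at (x m) within ball 0 1)" by simp
    qed
    from filterlim_compose[OF this wf] have "((\<lambda>z. H (w j0 z)) \<longlongrightarrow> (\<Sum>k\<in>I. a k * ((if k = m then 2 * x m else 0) + 0))) (at \<zeta> within \<Omega>)" .
    then have "((\<lambda>z. H (w j0 z)) \<longlongrightarrow> a m * (2 * x m)) (at \<zeta> within \<Omega>)"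
    proof -
      have "(\<Sum>k\<in>I. a k * ((if k = m then 2 * x m else 0) + 0)) = (\<Sum>k\<in>I. if k = m then a k * (2 * x m) else 0)"
        by (rule sum.cong) auto
      also have "\<dots> = a m * (2 * x m)" using I by (simp add: sum.delta')
      finally show ?thesis using \<open>((\<lambda>z. H (w j0 z)) \<longlongrightarrow> (\<Sum>k\<in>I. a k * ((if k = m then 2 * x m else 0) + 0))) (at \<zeta> within \<Omega>)\<close> by (simp only:)
    qed
    moreover have "\<forall>\<^sub>F z in at \<zeta> within \<Omega>. H (w j0 z) = 0"
      using ev[OF j0 \<zeta>s order_refl]
    proof eventually_elim
      case (elim z)
      have "a k * (f (Suc k) z - f 0 z) = E j0 (w j0 z) * (a k * ((x k + w j0 z) / (x k - w j0 z) + (L (Suc k) j0 (w j0 z) - L 0 j0 (w j0 z))))" for k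
        using elim by (simp add: near[OF j0] K_def algebra_simps)
      then have "E j0 (w j0 z) * (\<Sum>k\<in>I. a k * ((x k + w j0 z) / (x k - w j0 z) + (L (Suc k) j0 (w j0 z) - L 0 j0 (w j0 z)))) = 0"
        using zero[of z] elim by (simp only: sum_distrib_left)
      then have "(\<Sum>k\<in>I. a k * ((x k + w j0 z) / (x k - w j0 z) + (L (Suc k) j0 (w j0 z) - L 0 j0 (w j0 z)))) = 0"
        using E(2)[OF j0] by simp
      moreover have "H (w j0 z) = (x m - w j0 z) * (\<Sum>k\<in>I. a k * ((x k + w j0 z) / (x k - w j0 z) + (L (Suc k) j0 (w j0 z) - L 0 j0 (w j0 z))))"
        unfolding H_def sum_distrib_left by (rule sum.cong) (simp_all add: distrib_left mult.left_commute)
      ultimately show ?case by simp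
    qed
    then have "((\<lambda>z. H (w j0 z)) \<longlongrightarrow> 0) (at \<zeta> within \<Omega>)" by (rule tendsto_eventually)
    ultimately have "a m * (2 * x m) = 0" using tendsto_unique[OF ntriv] by blast
    moreover have "x m \<noteq> 0" using x1(1)[of m] by auto
    ultimately show "a m = 0" by simp
  qed
qed

section \<open>Infinite dimension\<close>

text \<open>Gaussian elimination: a pivot \<open>k0\<close> removes the equation \<open>b0\<close>,
  the smaller system is solved by induction, and the coefficient of \<open>k0\<close> is then
  determined.\<close>

lemma exists_linear_relation:
  fixes a :: "'k \<Rightarrow> 'b \<Rightarrow> complex"
  assumes "finite B" "finite K" "card B < card K"
  shows "\<exists>c. (\<exists>k\<in>K. c k \<noteq> 0) \<and> (\<forall>b\<in>B. (\<Sum>k\<in>K. c k * a k b) = 0)"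
  using assms
proof (induction B arbitrary: K a rule: finite_induct)
  case empty
  then have "K \<noteq> {}" by auto
  then show ?case by (intro exI[of _ "\<lambda>_. 1"]) auto
next
  case (insert b0 B)
  show ?case
  proof (cases "\<forall>k\<in>K. a k b0 = 0")
    case True
    have "card B < card K" using insert by simp
    then obtain c where "\<exists>k\<in>K. c k \<noteq> 0" "\<forall>b\<in>B. (\<Sum>k\<in>K. c k * a k b) = 0" using insert.IH[OF insert.prems(1)] by blast
    then show ?thesis using True by (intro exI[of _ c]) auto
  next
    case False
    then obtain k0 where k0: "k0 \<in> K" "a k0 b0 \<noteq> 0" by blast
    have K: "finite (K - {k0})" "card B < card (K - {k0})" using insert k0 by auto
    define q where "q = (\<lambda>k. a k b0 / a k0 b0)"
    obtain c where c: "\<exists>k\<in>K - {k0}. c k \<noteq> 0" "\<And>b. b \<in> B \<Longrightarrow> (\<Sum>k\<in>K - {k0}. c k * (a k b - q k * a k0 b)) = 0"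
      using insert.IH[OF K, of "\<lambda>k b. a k b - q k * a k0 b"] by blast
    define d where "d = c(k0 := - (\<Sum>k\<in>K - {k0}. c k * q k))"
    have "(\<Sum>k\<in>K. d k * a k b) = (\<Sum>k\<in>K - {k0}. c k * (a k b - q k * a k0 b))" for b
    proof -
      have "(\<Sum>k\<in>K. d k * a k b) = d k0 * a k0 b + (\<Sum>k\<in>K - {k0}. d k * a k b)"
        by (rule sum.remove[OF insert.prems(1) k0(1)])
      also have "(\<Sum>k\<in>K - {k0}. d k * a k b) = (\<Sum>k\<in>K - {k0}. c k * a k b)"
        by (rule sum.cong) (auto simp: d_def)
      also have "d k0 * a k0 b = - (\<Sum>k\<in>K - {k0}. c k * q k * a k0 b)" by (simp add: d_def sum_distrib_right)
      finally show ?thesis by (simp add: right_diff_distrib sum_subtractf mult.assoc)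
    qed
    moreover have "a k b0 - q k * a k0 b0 = 0" for k using k0 by (simp add: q_def)
    ultimately have "(\<Sum>k\<in>K. d k * a k b) = 0" if "b \<in> insert b0 B" for b
      using that c(2)[of b] by (cases "b = b0") (simp_all only: insert_iff mult_zero_right sum.neutral_const HOL.simp_thms)
    then have "\<forall>b\<in>insert b0 B. (\<Sum>k\<in>K. d k * a k b) = 0" by blast
    moreover have "\<exists>k\<in>K. d k \<noteq> 0" using c(1) by (auto simp: d_def)
    ultimately show ?thesis by blast
  qed
qed

lemma infinite_dimensional_onI:
  fixes h :: "nat \<Rightarrow> complex \<Rightarrow> complex"
  assumes h: "\<And>n. h n \<in> S"
    and indep: "\<And>K a k. finite K \<Longrightarrow> (\<And>z. z \<in> D \<Longrightarrow> (\<Sum>k\<in>K. a k * (h (Suc k) z - h 0 z)) = 0) \<Longrightarrow> k \<in> K \<Longrightarrow> a k = 0"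
  shows "infinite_dimensional_on D S"
  unfolding infinite_dimensional_on_def
proof
  assume "\<exists>f0 B. finite B \<and> S \<subseteq> {f. \<exists>a. \<forall>z\<in>D. f z = f0 z + (\<Sum>b\<in>B. a b * b z)}"
  then obtain f0 B where B: "finite B" "S \<subseteq> {f. \<exists>a. \<forall>z\<in>D. f z = f0 z + (\<Sum>b\<in>B. a b * b z)}" by blast
  have "\<exists>a. \<forall>z\<in>D. h n z = f0 z + (\<Sum>b\<in>B. a b * b z)" for n using B(2) h by blast
  then obtain a where a: "\<And>n z. z \<in> D \<Longrightarrow> h n z = f0 z + (\<Sum>b\<in>B. a n b * b z)" by metis
  obtain c where c: "\<exists>k\<in>{..card B}. c k \<noteq> 0" "\<forall>b\<in>B. (\<Sum>k\<in>{..card B}. c k * (a (Suc k) b - a 0 b)) = 0"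
    \<comment> \<open>There are \<open>card B + 1\<close> differences, one more than the equations.
      Taking differences with \<open>h 0\<close> has removed the unknown \<open>f0\<close>.\<close>
    using exists_linear_relation[OF B(1), of "{..card B}" "\<lambda>k b. a (Suc k) b - a 0 b"] by auto
  have "(\<Sum>k\<in>{..card B}. c k * (h (Suc k) z - h 0 z)) = 0" if z: "z \<in> D" for z
  proof -
    have "c k * (h (Suc k) z - h 0 z) = (\<Sum>b\<in>B. c k * (a (Suc k) b - a 0 b) * b z)" for k
      by (simp add: a[OF z] sum_subtractf[symmetric] sum_distrib_left algebra_simps)
    then have "(\<Sum>k\<in>{..card B}. c k * (h (Suc k) z - h 0 z)) = (\<Sum>k\<in>{..card B}. \<Sum>b\<in>B. c k * (a (Suc k) b - a 0 b) * b z)"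
      by simp
    also have "\<dots> = (\<Sum>b\<in>B. (\<Sum>k\<in>{..card B}. c k * (a (Suc k) b - a 0 b)) * b z)"
      by (subst sum.swap) (simp only: sum_distrib_right)
    also have "\<dots> = 0" using c(2) by (intro sum.neutral) simp
    finally show ?thesis .
  qed
  then show False using indep[of "{..card B}" c] c(1) by blast
qed

section \<open>Nontangential paths and the final assembly\<close>

lemma nontangential_path_region:
  assumes \<gamma>: "nontangential_path \<Omega> Cs \<zeta> \<gamma>" and pos: "\<And>c r. (c, r) \<in> Cs \<Longrightarrow> 0 < r"
  obtains c r M where "(c, r) \<in> Cs" "\<zeta> \<in> sphere c r"
    "filterlim \<gamma> (at \<zeta> within {z \<in> \<Omega>. cmod (z - \<zeta>) \<le> M * \<bar>cmod (z - c) - r\<bar>}) (at_left 1)"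
proof -
  obtain c r n \<alpha> where cr: "(c, r) \<in> Cs" "\<zeta> \<in> sphere c r" "n = (\<zeta> - c) / of_real r \<or> n = (c - \<zeta>) / of_real r"
    and \<alpha>: "0 < \<alpha>" "\<alpha> < pi / 2" and sec: "\<forall>\<^sub>F t in at_left 1. \<gamma> t \<in> sector \<zeta> n \<alpha>"
    and \<Omega>: "\<gamma> ` {0..<1} \<subseteq> \<Omega>" and lim: "(\<gamma> \<longlongrightarrow> \<zeta>) (at_left 1)"
    using \<gamma> unfolding nontangential_path_def by blast
  have r: "0 < r" by (rule pos[OF cr(1)])
  define k where "k = cos \<alpha>"
  have k: "0 < k" "k \<le> 1" using \<alpha> by (auto simp: k_def intro: cos_gt_zero)
  \<comment> \<open>With \<open>d = \<bar>z - \<zeta>\<bar>\<close> and \<open>s\<close> the scalar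
    product of \<open>z - \<zeta>\<close> and \<open>\<zeta> - c\<close>, the identity
    \<open>\<bar>z - c\<bar>^2 - r^2 = d^2 + 2 s\<close> holds. The sector gives
    \<open>\<bar>s\<bar> \<ge> r k d\<close>, and \<open>d < r k\<close> keeps \<open>d^2\<close>
    below this, so the left side is at least \<open>r k d\<close> in modulus. Division by
    \<open>\<bar>z - c\<bar> + r \<le> 3 r\<close> yields the aperture \<open>3 / k\<close>. Using
    \<open>\<bar>s\<bar>\<close> treats both normals at once.\<close>
  have reg: "cmod (z - \<zeta>) \<le> 3 / k * \<bar>cmod (z - c) - r\<bar>" if z: "z \<in> sector \<zeta> n \<alpha>" "cmod (z - \<zeta>) < r * k" for z
  proof -
    define d where "d = cmod (z - \<zeta>)"
    define s where "s = Re ((z - \<zeta>) * cnj (\<zeta> - c))"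
    have rk: "r * k \<le> r" using r k by (simp add: mult_left_le)
    have d: "0 \<le> d" "d < r * k" "d \<le> r" using z(2) rk by (auto simp: d_def)
    have "k * d \<le> \<bar>s\<bar> / r"
    proof -
      have "k * d < Re ((z - \<zeta>) * cnj n)" using z(1) by (simp add: sector_def k_def d_def)
      also have "Re ((z - \<zeta>) * cnj n) = s / r \<or> Re ((z - \<zeta>) * cnj n) = - s / r"
        using cr(3)
      proof
        assume "n = (\<zeta> - c) / of_real r"
        then have "(z - \<zeta>) * cnj n = (z - \<zeta>) * cnj (\<zeta> - c) / of_real r" by simp
        then show ?thesis unfolding s_def by (simp only: Re_divide_of_real simp_thms)
      next
        assume "n = (c - \<zeta>) / of_real r"
        then have "n = - ((\<zeta> - c) / of_real r)" by (simp add: minus_divide_left)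
        then have "(z - \<zeta>) * cnj n = - ((z - \<zeta>) * cnj (\<zeta> - c) / of_real r)" by simp
        then have "Re ((z - \<zeta>) * cnj n) = - (s / r)" unfolding s_def by (simp only: uminus_complex.sel Re_divide_of_real)
        then show ?thesis by simp
      qed
      then have "Re ((z - \<zeta>) * cnj n) \<le> \<bar>s\<bar> / r"
        using divide_right_mono[OF abs_ge_self[of s], of r] divide_right_mono[OF abs_ge_minus_self[of s], of r] r by fastforce
      finally show ?thesis by simp
    qed
    then have s: "r * (k * d) \<le> \<bar>s\<bar>" using r by (simp add: pos_le_divide_eq mult.commute)
    have dc: "cmod (\<zeta> - c) = r" using cr(2) by (simp add: dist_norm norm_minus_commute)
    have "(cmod (z - c))\<^sup>2 = d\<^sup>2 + 2 * s + r\<^sup>2"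
    proof -
      have "(cmod (z - c))\<^sup>2 = (cmod ((z - \<zeta>) + (\<zeta> - c)))\<^sup>2" by simp
      also have "\<dots> = (cmod (z - \<zeta>))\<^sup>2 + (cmod (\<zeta> - c))\<^sup>2 + 2 * Re ((z - \<zeta>) * cnj (\<zeta> - c))" by (simp only: cmod_power2 plus_complex.sel) (simp add: power2_eq_square algebra_simps)
      finally show ?thesis unfolding dc d_def s_def by simp
    qed
    then have "(cmod (z - c) - r) * (cmod (z - c) + r) = d * d + 2 * s" by (simp add: algebra_simps power2_eq_square)
    then have e: "\<bar>cmod (z - c) - r\<bar> * (cmod (z - c) + r) = \<bar>d * d + 2 * s\<bar>"
      using r by (metis abs_mult abs_of_nonneg add_nonneg_nonneg less_imp_le norm_ge_zero)
    have "d * d \<le> d * (r * k)" using d by (intro mult_left_mono) auto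
    also have "d * (r * k) = r * (k * d)" by (simp only: mult_ac)
    finally have "r * (k * d) \<le> \<bar>d * d + 2 * s\<bar>" using s zero_le_square[of d] by arith
    also have "\<dots> \<le> \<bar>cmod (z - c) - r\<bar> * (3 * r)"
    proof -
      have "cmod (z - c) \<le> d + r" using norm_triangle_ineq[of "z - \<zeta>" "\<zeta> - c"] dc by (simp add: d_def)
      then show ?thesis unfolding e[symmetric] using d by (intro mult_left_mono) auto
    qed
    finally have "r * (k * d) \<le> r * (3 * \<bar>cmod (z - c) - r\<bar>)" by (simp add: mult_ac)
    then have "k * d \<le> 3 * \<bar>cmod (z - c) - r\<bar>" using r by simp
    then show ?thesis using k by (simp add: d_def field_simps)
  qed
  have "((\<lambda>t. cmod (\<gamma> t - \<zeta>)) \<longlongrightarrow> 0) (at_left 1)" using tendsto_norm[OF LIM_zero[OF lim]] by simp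
  then have "\<forall>\<^sub>F t in at_left 1. cmod (\<gamma> t - \<zeta>) < r * k" using r k by (intro order_tendstoD(2)[of _ 0]) auto
  moreover have "\<forall>\<^sub>F t in at_left (1::real). 0 < t \<and> t < 1"
    using eventually_at_left_real[of 0 "1::real"] by simp
  ultimately have "\<forall>\<^sub>F t in at_left 1. \<gamma> t \<in> {z \<in> \<Omega>. cmod (z - \<zeta>) \<le> 3 / k * \<bar>cmod (z - c) - r\<bar>} \<and> \<gamma> t \<noteq> \<zeta>"
    using sec
  proof eventually_elim
    case (elim t)
    then have "\<gamma> t \<in> \<Omega>" using \<Omega> by auto
    moreover have "\<gamma> t \<noteq> \<zeta>" using elim(3) by (simp add: sector_def)
    ultimately show ?case using reg[OF elim(3,1)] by simp
  qed
  then have "filterlim \<gamma> (at \<zeta> within {z \<in> \<Omega>. cmod (z - \<zeta>) \<le> 3 / k * \<bar>cmod (z - c) - r\<bar>}) (at_left 1)"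
    using lim by (simp add: filterlim_at)
  with cr(1,2) show ?thesis by (rule that)
qed

lemma solution_family_paths:
  assumes \<Omega>: "nondeg_circular_domain \<Omega> Cs" and lam: "\<forall>\<zeta>\<in>frontier \<Omega>. lam \<zeta> \<in> sphere 0 1" "CBV Cs lam"
    and \<phi>: "cap_measurable_fun (frontier \<Omega>) \<phi>"
  obtains E and f :: "nat \<Rightarrow> complex \<Rightarrow> complex" where "log_cap_zero E" "\<And>n. f n holomorphic_on \<Omega>"
    "\<And>n \<zeta> \<gamma>. \<zeta> \<in> frontier \<Omega> - E \<Longrightarrow> nontangential_path \<Omega> Cs \<zeta> \<gamma> \<Longrightarrow>
       ((\<lambda>t. Re (cnj (lam \<zeta>) * f n (\<gamma> t))) \<longlongrightarrow> \<phi> \<zeta>) (at_left 1)"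
    "\<And>K a k. finite K \<Longrightarrow> (\<And>z. z \<in> \<Omega> \<Longrightarrow> (\<Sum>k\<in>K. a k * (f (Suc k) z - f 0 z)) = 0) \<Longrightarrow> k \<in> K \<Longrightarrow> a k = 0"
proof -
  have l: "cmod (lam \<zeta>) = 1" if "\<zeta> \<in> frontier \<Omega>" for \<zeta> using lam(1) that by auto
  have q: "quasicont (frontier \<Omega>) \<phi>" unfolding quasicont_def
    using cap_measurable_quasicontinuous[OF \<phi>] by blast
  have pos: "\<And>c r. (c, r) \<in> Cs \<Longrightarrow> 0 < r" and bd: "bounded \<Omega>" using \<Omega> unfolding nondeg_circular_domain_def by blast+
  show ?thesis
  proof (rule solution_family[OF \<Omega> l lam(2) q], assumption)
    fix Z and f :: "nat \<Rightarrow> complex \<Rightarrow> complex"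
    assume Z: "polar Z" and f: "\<And>n. f n holomorphic_on \<Omega>"
      "\<And>n c r \<zeta> M. (c, r) \<in> Cs \<Longrightarrow> \<zeta> \<in> sphere c r \<Longrightarrow> \<zeta> \<notin> Z \<Longrightarrow>
       ((\<lambda>z. Re (cnj (lam \<zeta>) * f n z)) \<longlongrightarrow> \<phi> \<zeta>) (at \<zeta> within {z \<in> \<Omega>. cmod (z - \<zeta>) \<le> M * \<bar>cmod (z - c) - r\<bar>})"
      "\<And>K a k. finite K \<Longrightarrow> (\<And>z. z \<in> \<Omega> \<Longrightarrow> (\<Sum>k\<in>K. a k * (f (Suc k) z - f 0 z)) = 0) \<Longrightarrow> k \<in> K \<Longrightarrow> a k = 0"
    show ?thesis
    \<comment> \<open>Only boundary points matter, and the intersection is bounded, as the passage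
      from thinness to capacity zero requires.\<close>
    proof (rule that[of "Z \<inter> frontier \<Omega>" f])
      show "log_cap_zero (Z \<inter> frontier \<Omega>)"
      proof (rule log_cap_zero_of_thin)
        show "bounded (Z \<inter> frontier \<Omega>)" by (rule bounded_subset[OF bounded_closure[OF bd]]) (auto simp: frontier_def)
        show "thin V (Z \<inter> frontier \<Omega>)" for V by (rule polarD[OF polar_subset[OF Z]]) blast
      qed
      show "((\<lambda>t. Re (cnj (lam \<zeta>) * f n (\<gamma> t))) \<longlongrightarrow> \<phi> \<zeta>) (at_left 1)"
        if \<zeta>: "\<zeta> \<in> frontier \<Omega> - Z \<inter> frontier \<Omega>" and \<gamma>: "nontangential_path \<Omega> Cs \<zeta> \<gamma>" for n \<zeta> \<gamma>
      proof (rule nontangential_path_region[OF \<gamma> pos], assumption)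
        fix c r M assume "(c, r) \<in> Cs" "\<zeta> \<in> sphere c r"
          "filterlim \<gamma> (at \<zeta> within {z \<in> \<Omega>. cmod (z - \<zeta>) \<le> M * \<bar>cmod (z - c) - r\<bar>}) (at_left 1)"
        then show ?thesis using filterlim_compose[OF f(2)] \<zeta> by blast
      qed
    qed (use f in blast)+
  qed
qed

theorem theorem3:
  shows
  "(\<forall>(lam::complex \<Rightarrow> complex) (\<phi>::complex \<Rightarrow> real).
      (\<forall>\<zeta>\<in>sphere 0 1. lam \<zeta> \<in> sphere 0 1) \<and> CBV {(0, 1)} lam \<and>
      cap_measurable_fun (sphere 0 1) \<phi> \<longrightarrow>
      infinite_dimensional_on (ball 0 1)
        {f. f holomorphic_on ball 0 1 \<and>
            (\<exists>E. log_cap_zero E \<and>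
               (\<forall>\<zeta>\<in>sphere 0 1 - E. \<forall>\<gamma>. nontangential_path (ball 0 1) {(0, 1)} \<zeta> \<gamma> \<longrightarrow>
                  ((\<lambda>t. Re (cnj (lam \<zeta>) * f (\<gamma> t))) \<longlongrightarrow> \<phi> \<zeta>) (at_left 1)))})
   \<and>
   (\<forall>(\<Omega>::complex set) Cs (g::complex \<Rightarrow> complex) (lam::complex \<Rightarrow> complex) (\<phi>::complex \<Rightarrow> real).
      nondeg_circular_domain \<Omega> Cs \<and>
      g holomorphic_on ball 0 1 \<and> covering_space (ball 0 1) g \<Omega> \<and>
      (\<forall>\<zeta>\<in>frontier \<Omega>. lam \<zeta> \<in> sphere 0 1) \<and> CBV Cs lam \<and>
      cap_measurable_fun (frontier \<Omega>) \<phi> \<longrightarrow>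
      infinite_dimensional_on (ball 0 1)
        {F. F holomorphic_on ball 0 1 \<and>
            (\<exists>E. log_cap_zero E \<and>
               (\<forall>\<zeta>\<in>frontier \<Omega> - E. \<forall>\<gamma> \<gamma>'.
                  nontangential_path \<Omega> Cs \<zeta> \<gamma> \<and>
                  continuous_on {0..<1} \<gamma>' \<and> \<gamma>' ` {0..<1} \<subseteq> ball 0 1 \<and>
                  (\<forall>t\<in>{0..<1}. g (\<gamma>' t) = \<gamma> t) \<longrightarrow>
                  ((\<lambda>t. Re (cnj (lam \<zeta>) * F (\<gamma>' t))) \<longlongrightarrow> \<phi> \<zeta>) (at_left 1)))})"
proof (intro conjI allI impI, goal_cases)
  case (1 lam \<phi>)
  have \<Omega>: "nondeg_circular_domain (ball 0 1) {(0, 1)}"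
    by (simp add: nondeg_circular_domain_def frontier_ball)
  have h: "\<forall>\<zeta>\<in>frontier (ball 0 1). lam \<zeta> \<in> sphere 0 1" "CBV {(0, 1)} lam" "cap_measurable_fun (frontier (ball 0 1)) \<phi>"
    using 1 by (auto simp: frontier_ball)
  show ?case
  proof (rule solution_family_paths[OF \<Omega> h])
    fix E and f :: "nat \<Rightarrow> complex \<Rightarrow> complex"
    assume f: "log_cap_zero E" "\<And>n. f n holomorphic_on ball 0 1"
      "\<And>n \<zeta> \<gamma>. \<zeta> \<in> frontier (ball 0 1) - E \<Longrightarrow> nontangential_path (ball 0 1) {(0, 1)} \<zeta> \<gamma> \<Longrightarrow>
       ((\<lambda>t. Re (cnj (lam \<zeta>) * f n (\<gamma> t))) \<longlongrightarrow> \<phi> \<zeta>) (at_left 1)"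
      and ind: "\<And>K a k. finite K \<Longrightarrow> (\<And>z. z \<in> ball 0 1 \<Longrightarrow> (\<Sum>k\<in>K. a k * (f (Suc k) z - f 0 z)) = 0) \<Longrightarrow> k \<in> K \<Longrightarrow> a k = 0"
    have "frontier (ball 0 1) = sphere (0::complex) 1" by (simp add: frontier_ball)
    note f3 = f(3)[unfolded this]
    show ?case
    proof (rule infinite_dimensional_onI[of f], intro CollectI conjI exI[of _ E] ballI allI impI)
      show "((\<lambda>t. Re (cnj (lam \<zeta>) * f n (\<gamma> t))) \<longlongrightarrow> \<phi> \<zeta>) (at_left 1)"
        if "\<zeta> \<in> sphere 0 1 - E" "nontangential_path (ball 0 1) {(0, 1)} \<zeta> \<gamma>" for n \<zeta> \<gamma> by (rule f3[OF that])
      show "a k = 0" if "finite K" "\<And>z. z \<in> ball 0 1 \<Longrightarrow> (\<Sum>k\<in>K. a k * (f (Suc k) z - f 0 z)) = 0" "k \<in> K" for K a k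
        using ind[OF that] .
    qed (use f in blast)+
  qed
next
  case (2 \<Omega> Cs g lam \<phi>)
  then have \<Omega>: "nondeg_circular_domain \<Omega> Cs" and g: "g holomorphic_on ball 0 1" "covering_space (ball 0 1) g \<Omega>"
    and h: "\<forall>\<zeta>\<in>frontier \<Omega>. lam \<zeta> \<in> sphere 0 1" "CBV Cs lam" "cap_measurable_fun (frontier \<Omega>) \<phi>" by blast+
  have gim: "g ` ball 0 1 = \<Omega>" by (rule covering_space_imp_surjective[OF g(2)])
  show ?case
  proof (rule solution_family_paths[OF \<Omega> h])
    fix E and f :: "nat \<Rightarrow> complex \<Rightarrow> complex"
    assume E: "log_cap_zero E" and f: "\<And>n. f n holomorphic_on \<Omega>"
      "\<And>n \<zeta> \<gamma>. \<zeta> \<in> frontier \<Omega> - E \<Longrightarrow> nontangential_path \<Omega> Cs \<zeta> \<gamma> \<Longrightarrow>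
       ((\<lambda>t. Re (cnj (lam \<zeta>) * f n (\<gamma> t))) \<longlongrightarrow> \<phi> \<zeta>) (at_left 1)"
      and ind: "\<And>K a k. finite K \<Longrightarrow> (\<And>z. z \<in> \<Omega> \<Longrightarrow> (\<Sum>k\<in>K. a k * (f (Suc k) z - f 0 z)) = 0) \<Longrightarrow> k \<in> K \<Longrightarrow> a k = 0"
    show ?case
    \<comment> \<open>Along a lift \<open>\<gamma>'\<close> of \<open>\<gamma>\<close> the
      composition takes the values of the single-valued \<open>f n\<close> on
      \<open>\<gamma>\<close> itself, whichever branch the lift represents. Since \<open>g\<close>
      maps onto \<Omega>, a linear relation in the disk descends to \<Omega>.\<close>
    proof (rule infinite_dimensional_onI[of "\<lambda>n z. f n (g z)"])
      fix n
      have "f n \<circ> g holomorphic_on ball 0 1"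
        by (rule holomorphic_on_compose_gen[OF g(1) f(1)]) (simp add: gim)
      moreover have "((\<lambda>t. Re (cnj (lam \<zeta>) * f n (g (\<gamma>' t)))) \<longlongrightarrow> \<phi> \<zeta>) (at_left 1)"
        if \<zeta>: "\<zeta> \<in> frontier \<Omega> - E" and \<gamma>: "nontangential_path \<Omega> Cs \<zeta> \<gamma>" and \<gamma>': "\<forall>t\<in>{0..<1}. g (\<gamma>' t) = \<gamma> t" for \<zeta> \<gamma> \<gamma>'
      proof (rule Lim_transform_eventually[OF f(2)[OF \<zeta> \<gamma>]])
        have "\<forall>\<^sub>F t in at_left (1::real). t \<in> {0<..<1}" by (rule eventually_at_left_real) simp
        then show "\<forall>\<^sub>F t in at_left 1. Re (cnj (lam \<zeta>) * f n (\<gamma> t)) = Re (cnj (lam \<zeta>) * f n (g (\<gamma>' t)))"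
          by eventually_elim (use \<gamma>' in simp)
      qed
      ultimately show "(\<lambda>z. f n (g z)) \<in> {F. F holomorphic_on ball 0 1 \<and>
            (\<exists>E. log_cap_zero E \<and>
               (\<forall>\<zeta>\<in>frontier \<Omega> - E. \<forall>\<gamma> \<gamma>'.
                  nontangential_path \<Omega> Cs \<zeta> \<gamma> \<and>
                  continuous_on {0..<1} \<gamma>' \<and> \<gamma>' ` {0..<1} \<subseteq> ball 0 1 \<and>
                  (\<forall>t\<in>{0..<1}. g (\<gamma>' t) = \<gamma> t) \<longrightarrow>
                  ((\<lambda>t. Re (cnj (lam \<zeta>) * F (\<gamma>' t))) \<longlongrightarrow> \<phi> \<zeta>) (at_left 1)))}"
        using E by (auto simp: o_def)
    next
      fix K a k assume K: "finite K" "k \<in> K"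
        and zero: "\<And>z. z \<in> ball 0 1 \<Longrightarrow> (\<Sum>k\<in>K. a k * (f (Suc k) (g z) - f 0 (g z))) = 0"
      have "(\<Sum>k\<in>K. a k * (f (Suc k) z - f 0 z)) = 0" if "z \<in> \<Omega>" for z
        using that zero unfolding gim[symmetric] by blast
      then show "a k = 0" using ind K by blast
    qed
  qed
qed

end
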